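(* Let $a_n(t)>0$, $b_n(t)\in\mathbb{R}$ ($n\in\mathbb{Z}$, $t\in[0,\infty)$) be a solution of the Toda lattice $$\dot a_n=\frac{a_n}{2}\,(b_{n+1}-b_n),\qquad \dot b_n=a_n^2-a_{n-1}^2,\qquad n\in\mathbb{Z},\qquad \cdot=\frac{d}{dt},$$ whose initial data satisfy $$a_n(0)\to 0,\quad b_n(0)\to 0\quad (n\to+\infty),\qquad \sum_{n<0}|n|\bigl\{|a_n(0)-1|+|b_n(0)|\bigr\}<\infty,$$ and which belongs to the following class: for every $T>0$, $$\|a_n(t)\|_{C[0,T]}\to 0,\quad \|b_n(t)\|_{C[0,T]}\to 0\quad (n\to+\infty),\qquad \|Q(t)\|_{C[0,T]}<\infty,$$ where $Q(t)=\sum_{n<0}|n|\bigl(|a_n(t)-1|+|b_n(t)|\bigr)$. Let $\{R(\lambda,t);\ \mu_k(t);\ M_k(t),\ k=1,\dots,p\}$ be the scattering data (defined in the context) of the Jacobi operator $L(t)$ with coefficients $a_n(t),b_n(t)$. Then for all $t\ge 0$ the scattering data evolve according to $$R(\lambda,t)=R(\lambda,0)\,e^{(z^{-1}-z)t},\qquad \lambda\in\partial\Gamma,\quad z=z(\lambda),$$ $$\mu_k(t)=\mu_k(0),\qquad k=1,\dots,p,$$ $$M_k^{-2}(t)=M_k^{-2}(0)\,e^{(z_k^{-1}-z_k)t},\qquad z_k=z(\mu_k),\quad k=1,\dots,p.$$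
   Context: For a function $g$ on $[0,T]$, $\|g\|_{C[0,T]}=\sup_{0\le t\le T}|g(t)|$. Fix $t\ge 0$ and write $a_n=a_n(t)$, $b_n=b_n(t)$; all objects below depend on $t$ through these coefficients. $L=L(t)$ is the Jacobi operator in $\ell^2(-\infty,\infty)$ given by $(Ly)_n=a_{n-1}y_{n-1}+b_ny_n+a_ny_{n+1}$. Consider the equation $$a_{n-1}y_{n-1}+b_ny_n+a_ny_{n+1}=\lambda y_n,\qquad n\in\mathbb{Z},\ \lambda\in\mathbb{C}. \qquad ( * )$$ The function $z(\lambda)$: $\Gamma$ is the complex $\lambda$-plane cut along $[-2,2]$, and $\partial\Gamma$ denotes the boundary of the cut plane (the upper and lower sides of the cut). On $\Gamma$ put $z(\lambda)=\frac{\lambda}{2}+\sqrt{\frac{\lambda^2}{4}-1}$, with the regular branch of the root satisfying $\sqrt{\lambda^2/4-1}<0$ for $\lambda>2$ (so $|z|<1$ on $\Gamma$), extended by boundary values to $\partial\Gamma$, where $|z|=1$. Jost solution: $f_n(\lambda)=f_n(\lambda,t)$ is the solution of $( * )$ with $f_n(\lambda)z^{n}\to1$ as $n\to-\infty$; it has the form $f_n(\lambda)=\alpha_nz^{-n}\bigl(1+\sum_{m<0}A_{nm}z^{-m}\bigr)$. Weyl solution: $P_n(\lambda)$ and $Q_n(\lambda)$ are the solutions of $( * )$ with $P_{-1}=0$, $P_0=1$ and $Q_0=0$, $Q_1=1/a_0$. $L_0$ is the semi-infinite Jacobi operator in $\ell^2[0,\infty)$ defined by the left-hand side of $( * )$ for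 $n\ge0$ with boundary condition $y_{-1}=0$; it is compact and self-adjoint, with eigenvalues $\lambda_1,\lambda_2,\dots$, $\lambda_n\to0$. Let $\beta_j$ be the $\ell^2[0,\infty)$-norm of the eigenvector $(P_n(\lambda_j))_{n\ge0}$, let $\rho(\lambda)=\sum_{\lambda_j<\lambda}\beta_j^{-2}$ be the spectral function of $L_0$, and let $m(\lambda)=\int_{-\infty}^{\infty}\frac{d\rho(\tau)}{\tau-\lambda}$ be the right Weyl function. The Weyl solution is $\psi_n(\lambda)=Q_n(\lambda)+m(\lambda)P_n(\lambda)$ (it is square summable as $n\to+\infty$). Reflection coefficient: for $\lambda\in\partial\Gamma$, $\lambda^2\ne4$, $\lambda\neq\lambda_j$ for all $j$, the function $a(\lambda)=a(\lambda,t)$ is defined by the identity $\psi_n(\lambda)=a(\lambda)\overline{f_n(\lambda)}+\overline{a(\lambda)}f_n(\lambda)$, $n\in\mathbb{Z}$, and $R(\lambda)=R(\lambda,t)=\overline{a(\lambda)}/a(\lambda)$. This function is continuous on $\partial\Gamma$ (it is extended to the excluded points by continuity). Discrete data: the interval $[-2,2]$ is the continuous spectrum of $L(t)$, of multiplicity one, and outside it $L(t)$ has finitely many simple eigenvalues, denoted $\mu_k=\mu_k(t)$, $k=1,\dots,p$ (numbered, say, in increasing order). The norming constants $M_k=M_k(t)>0$ are defined by $M_k^{2}(t)=\sum_{n=-\infty}^{\infty}f_n^2(\mu_k,t)$.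
   Formalization: At λ = 0 the law for R is stated only when R(0,·) is defined at times 0 and t (0 is no eigenvalue λ_j and ∫dρ(τ)/τ converges), since the λ_j accumulate at 0 and R has no continuous extension there, contrary to the claimed continuity on ∂Γ. *)

theory Defs
  imports "HOL-Analysis.Analysis"
begin

subsection \<open>Toda lattice\<close>

text \<open>At \<open>t = 0\<close> the derivative is one-sided.\<close>

definition toda_solution :: "(real \<Rightarrow> int \<Rightarrow> real) \<Rightarrow> (real \<Rightarrow> int \<Rightarrow> real) \<Rightarrow> bool" where
  "toda_solution a b \<longleftrightarrow>
     (\<forall>t\<ge>0. \<forall>n.
        ((\<lambda>s. a s n) has_real_derivative a t n / 2 * (b t (n + 1) - b t n)) (at t within {0..}) \<and>
        ((\<lambda>s. b s n) has_real_derivative (a t n)\<^sup>2 - (a t (n - 1))\<^sup>2) (at t within {0..}))"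

definition left_moment_term :: "(int \<Rightarrow> real) \<Rightarrow> (int \<Rightarrow> real) \<Rightarrow> int \<Rightarrow> real" where
  "left_moment_term a b n = \<bar>of_int n\<bar> * (\<bar>a n - 1\<bar> + \<bar>b n\<bar>)"

definition left_moment :: "(int \<Rightarrow> real) \<Rightarrow> (int \<Rightarrow> real) \<Rightarrow> real" where
  "left_moment a b = (\<Sum>\<^sub>\<infinity>n\<in>{..<0}. left_moment_term a b n)"

definition initial_class :: "(int \<Rightarrow> real) \<Rightarrow> (int \<Rightarrow> real) \<Rightarrow> bool" where
  "initial_class a b \<longleftrightarrow>
     (a \<longlongrightarrow> 0) at_top \<and> (b \<longlongrightarrow> 0) at_top \<and> left_moment_term a b summable_on {..<0}"

text \<open>For the coefficients of a Toda solution the suprema over \<open>{0..T}\<close> of \<open>\<bar>a t n\<bar>\<close> and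
  \<open>\<bar>b t n\<bar>\<close> are finite by continuity in \<open>t\<close>; for the moment this has to be required.\<close>

definition solution_class :: "(real \<Rightarrow> int \<Rightarrow> real) \<Rightarrow> (real \<Rightarrow> int \<Rightarrow> real) \<Rightarrow> bool" where
  "solution_class a b \<longleftrightarrow>
     (\<forall>T>0.
        ((\<lambda>n. SUP t\<in>{0..T}. \<bar>a t n\<bar>) \<longlongrightarrow> 0) at_top \<and>
        ((\<lambda>n. SUP t\<in>{0..T}. \<bar>b t n\<bar>) \<longlongrightarrow> 0) at_top \<and>
        (\<forall>t\<in>{0..T}. left_moment_term (a t) (b t) summable_on {..<0}) \<and>
        bdd_above ((\<lambda>t. left_moment (a t) (b t)) ` {0..T}))"


subsection \<open>Jacobi operator\<close>

definition jacobi :: "(int \<Rightarrow> real) \<Rightarrow> (int \<Rightarrow> real) \<Rightarrow> (int \<Rightarrow> complex) \<Rightarrow> int \<Rightarrow> complex" where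
  "jacobi a b y n =
     complex_of_real (a (n - 1)) * y (n - 1) + complex_of_real (b n) * y n
       + complex_of_real (a n) * y (n + 1)"

definition jacobi_solution ::
    "(int \<Rightarrow> real) \<Rightarrow> (int \<Rightarrow> real) \<Rightarrow> complex \<Rightarrow> (int \<Rightarrow> complex) \<Rightarrow> bool" where
  "jacobi_solution a b l y \<longleftrightarrow> (\<forall>n. jacobi a b y n = l * y n)"

definition square_summable_on :: "(int \<Rightarrow> complex) \<Rightarrow> int set \<Rightarrow> bool" where
  "square_summable_on y A \<longleftrightarrow> (\<lambda>n. (cmod (y n))\<^sup>2) summable_on A"

text \<open>The operator is self-adjoint, so only real eigenvalues need to be considered.\<close>

definition discrete_eigenvalues :: "(int \<Rightarrow> real) \<Rightarrow> (int \<Rightarrow> real) \<Rightarrow> real set" where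
  "discrete_eigenvalues a b =
     {\<mu>. \<mu> \<notin> {-2..2} \<and>
         (\<exists>y. square_summable_on y UNIV \<and> (\<exists>n. y n \<noteq> 0) \<and>
              jacobi_solution a b (complex_of_real \<mu>) y)}"

definition num_eigenvalues :: "(int \<Rightarrow> real) \<Rightarrow> (int \<Rightarrow> real) \<Rightarrow> nat" where
  "num_eigenvalues a b = card (discrete_eigenvalues a b)"

text \<open>The eigenvalues in increasing order, numbered from 1 to \<open>num_eigenvalues a b\<close>.\<close>

definition eigenvalue :: "(int \<Rightarrow> real) \<Rightarrow> (int \<Rightarrow> real) \<Rightarrow> nat \<Rightarrow> real" where
  "eigenvalue a b k = sorted_list_of_set (discrete_eigenvalues a b) ! (k - 1)"


subsection \<open>The function z and the boundary of the cut plane\<close>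

text \<open>\<open>csqrt\<close> is the principal branch. The product \<open>csqrt (l/2 - 1) * csqrt (l/2 + 1)\<close> is a
  holomorphic root of \<open>l\<^sup>2/4 - 1\<close> off \<open>[-2,2]\<close> (the jumps of the factors cancel for \<open>l < -2\<close>)
  and is positive for \<open>l > 2\<close>; the branch that is negative there is its negative.\<close>

definition z_fun :: "complex \<Rightarrow> complex" where
  "z_fun l = l / 2 - csqrt (l / 2 - 1) * csqrt (l / 2 + 1)"

datatype side = Upper | Lower

type_synonym cut_point = "side \<times> real"

definition cut_boundary :: "cut_point set" where
  "cut_boundary = UNIV \<times> {-2..2}"

fun side_sign :: "side \<Rightarrow> real" where
  "side_sign Upper = 1"
| "side_sign Lower = -1"

definition z_bdry :: "cut_point \<Rightarrow> complex" where
  "z_bdry \<xi> = Lim (at_right 0) (\<lambda>\<epsilon>. z_fun (Complex (snd \<xi>) (side_sign (fst \<xi>) * \<epsilon>)))"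


subsection \<open>Jost solution and norming constants\<close>

text \<open>The value \<open>z\<close> is an argument because on the cut it depends on the side. It is \<open>z_fun l\<close>
  off the cut and \<open>z_bdry (s, l)\<close> on the side \<open>s\<close> of the cut.\<close>

definition jost :: "(int \<Rightarrow> real) \<Rightarrow> (int \<Rightarrow> real) \<Rightarrow> complex \<Rightarrow> complex \<Rightarrow> int \<Rightarrow> complex" where
  "jost a b l z =
     (THE f. jacobi_solution a b l f \<and> ((\<lambda>n. f n * z powi n) \<longlongrightarrow> 1) at_bot)"

definition norming_const :: "(int \<Rightarrow> real) \<Rightarrow> (int \<Rightarrow> real) \<Rightarrow> real \<Rightarrow> real" where
  "norming_const a b \<mu> =
     sqrt (Re (\<Sum>\<^sub>\<infinity>n\<in>UNIV. (jost a b (complex_of_real \<mu>) (z_fun (complex_of_real \<mu>)) n)\<^sup>2))"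


subsection \<open>Weyl solution\<close>

definition P_sol :: "(int \<Rightarrow> real) \<Rightarrow> (int \<Rightarrow> real) \<Rightarrow> complex \<Rightarrow> int \<Rightarrow> complex" where
  "P_sol a b l = (THE y. jacobi_solution a b l y \<and> y (-1) = 0 \<and> y 0 = 1)"

definition Q_sol :: "(int \<Rightarrow> real) \<Rightarrow> (int \<Rightarrow> real) \<Rightarrow> complex \<Rightarrow> int \<Rightarrow> complex" where
  "Q_sol a b l = (THE y. jacobi_solution a b l y \<and> y 0 = 0 \<and> y 1 = 1 / complex_of_real (a 0))"

text \<open>Eigenvalues of the semi-infinite operator on \<open>n \<ge> 0\<close> with boundary condition \<open>y (-1) = 0\<close>
  (real because that operator is self-adjoint).\<close>

definition half_eigenvalues :: "(int \<Rightarrow> real) \<Rightarrow> (int \<Rightarrow> real) \<Rightarrow> real set" where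
  "half_eigenvalues a b =
     {x. \<exists>y. square_summable_on y {0..} \<and> (\<exists>n\<ge>0. y n \<noteq> 0) \<and> y (-1) = 0 \<and>
            (\<forall>n\<ge>0. jacobi a b y n = complex_of_real x * y n)}"

definition half_norm :: "(int \<Rightarrow> real) \<Rightarrow> (int \<Rightarrow> real) \<Rightarrow> real \<Rightarrow> real" where
  "half_norm a b x = sqrt (\<Sum>\<^sub>\<infinity>n\<in>{0..}. (cmod (P_sol a b (complex_of_real x) n))\<^sup>2)"

definition spectral_function :: "(int \<Rightarrow> real) \<Rightarrow> (int \<Rightarrow> real) \<Rightarrow> real \<Rightarrow> real" where
  "spectral_function a b x =
     (\<Sum>\<^sub>\<infinity>\<nu> \<in> {\<nu> \<in> half_eigenvalues a b. \<nu> < x}. 1 / (half_norm a b \<nu>)\<^sup>2)"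

text \<open>\<open>spectral_function\<close> is left-continuous while \<open>interval_measure\<close> expects a right-continuous
  function; passing to right limits does not change the Lebesgue-Stieltjes measure.\<close>

definition spectral_measure :: "(int \<Rightarrow> real) \<Rightarrow> (int \<Rightarrow> real) \<Rightarrow> real measure" where
  "spectral_measure a b = interval_measure (\<lambda>x. Lim (at_right x) (spectral_function a b))"

definition weyl_m :: "(int \<Rightarrow> real) \<Rightarrow> (int \<Rightarrow> real) \<Rightarrow> complex \<Rightarrow> complex" where
  "weyl_m a b l = (\<integral>\<tau>. 1 / (complex_of_real \<tau> - l) \<partial>spectral_measure a b)"

definition weyl_sol :: "(int \<Rightarrow> real) \<Rightarrow> (int \<Rightarrow> real) \<Rightarrow> complex \<Rightarrow> int \<Rightarrow> complex" where
  "weyl_sol a b l n = Q_sol a b l n + weyl_m a b l * P_sol a b l n"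


subsection \<open>Reflection coefficient\<close>

definition a_coeff :: "(int \<Rightarrow> real) \<Rightarrow> (int \<Rightarrow> real) \<Rightarrow> cut_point \<Rightarrow> complex" where
  "a_coeff a b \<xi> =
     (let l = complex_of_real (snd \<xi>); f = jost a b l (z_bdry \<xi>)
      in THE c. \<forall>n. weyl_sol a b l n = c * cnj (f n) + cnj c * f n)"

definition regular_points :: "(int \<Rightarrow> real) \<Rightarrow> (int \<Rightarrow> real) \<Rightarrow> real set" where
  "regular_points a b = {x \<in> {-2..2}. x\<^sup>2 \<noteq> 4 \<and> x \<notin> half_eigenvalues a b}"

text \<open>At the excluded points the value is the limit along the same side of the cut.\<close>

definition reflection :: "(int \<Rightarrow> real) \<Rightarrow> (int \<Rightarrow> real) \<Rightarrow> cut_point \<Rightarrow> complex" where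
  "reflection a b \<xi> =
     (let R = (\<lambda>x. cnj (a_coeff a b (fst \<xi>, x)) / a_coeff a b (fst \<xi>, x))
      in if snd \<xi> \<in> regular_points a b then R (snd \<xi>)
         else Lim (at (snd \<xi>) within regular_points a b) R)"

text \<open>The reflection coefficient is defined on the whole boundary except possibly over
  \<open>0\<close>. The eigenvalues of the semi-infinite operator accumulate there and the
  coefficient winds around the unit circle infinitely often, so it has no continuous extension;
  its value at 0 exists only if 0 is not an eigenvalue and the Stieltjes integral for the
  Weyl function converges.\<close>

definition reflection_domain :: "(int \<Rightarrow> real) \<Rightarrow> (int \<Rightarrow> real) \<Rightarrow> cut_point set" where
  "reflection_domain a b =
     {\<xi> \<in> cut_boundary. snd \<xi> = 0 \<longrightarrow>
        0 \<notin> half_eigenvalues a b \<and>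
        integrable (spectral_measure a b) (\<lambda>\<tau>. 1 / complex_of_real \<tau>)}"

end

theory Submission
  imports Defs "HOL-Probability.Distribution_Functions" "HOL-Complex_Analysis.Great_Picard"
begin

text \<open>The lattice is a Lax equation: with \<open>(A y)\<^sub>n = (a\<^sub>n y\<^sub>n\<^sub>+\<^sub>1 - a\<^sub>n\<^sub>-\<^sub>1 y\<^sub>n\<^sub>-\<^sub>1) / 2\<close>, a
  solution of \<open>L(0) y = \<lambda> y\<close> that is transported by \<open>y' = A y\<close> solves \<open>L(t) y = \<lambda> y\<close> at every later
  time (\<open>toda_flow_exists\<close>). The scattering data are then read off from the effect of this transport
  on three kinds of solutions.

  The transport is controlled because the eigenvalue equation removes one neighbour from \<open>A y\<close>
  (\<open>flow_forms\<close>): on each half-line the infinite system becomes a chain in which every site is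
  driven only by its neighbour nearer to the origin, and Gronwall estimates run along that chain
  (\<open>chain_sum_bound\<close>, \<open>chain_tendsto_zero\<close>).

  \<^item> Jost solutions. At \<open>-\<infinity>\<close> the coefficients tend to 1 and 0, and the chain for \<open>y\<^sub>n z\<^sup>n\<close> becomes
    \<open>u' = \<theta> u\<close> with \<open>\<theta> = 1/z - (z + 1/z)/2 = (1/z - z)/2\<close>. Hence the transport of the Jost solution
    \<open>f(0)\<close> is \<open>exp (\<theta> t) f(t)\<close> (\<open>jost_flow\<close>).

  \<^item> Eigenvectors. The operator \<open>A\<close> is skew-symmetric, and the transport preserves the norm of
    square summable solutions (\<open>toda_flow_norm\<close>). So eigenvalues persist, in both directions of time
    (\<open>discrete_eigenvalues_const\<close>). At an eigenvalue the Jost solution is an eigenvector, which makes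
    \<open>M\<^sup>2\<close> change by \<open>exp (- 2 \<theta> t)\<close> (\<open>norming_const_evolution\<close>). The eigenvalues can be numbered
    because there are finitely many: the quadratic form of \<open>2 - L\<close> is nonnegative on sequences
    that vanish on a large finite set (\<open>quadratic_form_nonneg\<close>), by the first moment condition.

  \<^item> Weyl solutions. For nonreal \<open>\<lambda>\<close> the Weyl solution \<open>\<psi>\<close> spans the solutions that are square
    summable at \<open>+\<infinity>\<close>, and this property is transported; so the transport of \<open>\<psi>(0)\<close> is a multiple
    of \<open>\<psi>(t)\<close>. Real \<open>\<lambda>\<close> are reached as limits of \<open>\<lambda> + \<i>/j\<close> (\<open>weyl_sol_flow\<close>). That \<open>\<psi>\<close> is square
    summable has to be derived from the definition of the Weyl function by the spectral data of
    the half-line operator; this is where the completeness of the eigenvectors of that compact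
    operator is needed (\<open>residual_trivial\<close>, \<open>weyl_sol_right_l2\<close>).

  On the cut, the definition of the coefficient \<open>a(\<lambda>)\<close> gives \<open>R = - cnj D / D\<close> for the
  Wronskian \<open>D\<close> of \<open>\<psi>\<close> and \<open>f\<close> (\<open>reflection_quotient\<close>). Wronskians are preserved by the
  transport, which multiplies \<open>\<psi>\<close> by a real number and \<open>f\<close> by \<open>E = exp (\<theta> t)\<close> with \<open>\<bar>E\<bar> = 1\<close>.
  Therefore \<open>D(0) = \<rho> E D(t)\<close> with a real \<open>\<rho>\<close>, and the quotient acquires the factor \<open>E\<^sup>2\<close>. The points
  where \<open>R\<close> is a limit follow by continuity (\<open>reflection_evolution\<close>): at the eigenvalues of the
  half-line operator the poles of \<open>D\<close> cancel in the quotient, and at the ends of the cut the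
  factor tends to 1.\<close>

section \<open>Three-term recurrences\<close>

lemma jacobi_up:
  assumes "jacobi_solution a b l y" "a n > 0"
  shows "y (n + 1) = ((l - complex_of_real (b n)) * y n - complex_of_real (a (n - 1)) * y (n - 1)) / complex_of_real (a n)"
proof -
  have "complex_of_real (a (n - 1)) * y (n - 1) + complex_of_real (b n) * y n
       + complex_of_real (a n) * y (n + 1) = l * y n"
    using assms(1) unfolding jacobi_solution_def jacobi_def by blast
  then show ?thesis using assms(2) by (simp add: field_simps)
qed

lemma jacobi_down:
  assumes "jacobi_solution a b l y" "a (n - 1) > 0"
  shows "y (n - 1) = ((l - complex_of_real (b n)) * y n - complex_of_real (a n) * y (n + 1)) / complex_of_real (a (n - 1))"
proof -
  have "complex_of_real (a (n - 1)) * y (n - 1) + complex_of_real (b n) * y n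
       + complex_of_real (a n) * y (n + 1) = l * y n"
    using assms(1) unfolding jacobi_solution_def jacobi_def by blast
  then show ?thesis using assms(2) by (simp add: field_simps)
qed

lemma int_pair_induct:
  fixes n m :: int
  assumes "Q m" "Q (m + 1)"
    and up: "\<And>n. Q (n - 1) \<Longrightarrow> Q n \<Longrightarrow> Q (n + 1)"
    and down: "\<And>n. Q n \<Longrightarrow> Q (n + 1) \<Longrightarrow> Q (n - 1)"
  shows "Q n"
proof -
  have "Q n \<and> Q (n + 1)"
  proof (induction n rule: int_induct[where k = m])
    case base
    then show ?case using assms by simp
  next
    case (step1 i)
    then show ?case using up[of "i + 1"] by simp
  next
    case (step2 i)
    then show ?case using down[of i] by simp
  qed
  then show ?thesis by simp
qed

lemma jacobi_solution_unique:
  assumes "jacobi_solution a b l y" "jacobi_solution a b l y'" "\<forall>n. a n > 0"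
    and "y m = y' m" "y (m + 1) = y' (m + 1)"
  shows "y = y'"
proof
  fix n
  show "y n = y' n"
  proof (rule int_pair_induct[where m = m])
    fix n assume "y (n - 1) = y' (n - 1)" "y n = y' n"
    then show "y (n + 1) = y' (n + 1)"
      using jacobi_up[OF assms(1)] jacobi_up[OF assms(2)] assms(3) by simp
  next
    fix n assume "y n = y' n" "y (n + 1) = y' (n + 1)"
    then show "y (n - 1) = y' (n - 1)"
      using jacobi_down[OF assms(1)] jacobi_down[OF assms(2)] assms(3) by simp
  qed (use assms in auto)
qed

text \<open>The recurrence solved from the values \<open>c\<close> at \<open>m\<close> and \<open>d\<close> at \<open>m + 1\<close>: to the right, counted from
  \<open>m\<close>, and to the left, counted from \<open>m + 1\<close>.\<close>

fun rec_up :: "(int \<Rightarrow> real) \<Rightarrow> (int \<Rightarrow> real) \<Rightarrow> complex \<Rightarrow> int \<Rightarrow> complex \<Rightarrow> complex \<Rightarrow> nat \<Rightarrow> complex" where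
  "rec_up a b l m c d 0 = c"
| "rec_up a b l m c d (Suc 0) = d"
| "rec_up a b l m c d (Suc (Suc k)) =
     ((l - complex_of_real (b (m + int k + 1))) * rec_up a b l m c d (Suc k)
       - complex_of_real (a (m + int k)) * rec_up a b l m c d k) / complex_of_real (a (m + int k + 1))"

fun rec_down :: "(int \<Rightarrow> real) \<Rightarrow> (int \<Rightarrow> real) \<Rightarrow> complex \<Rightarrow> int \<Rightarrow> complex \<Rightarrow> complex \<Rightarrow> nat \<Rightarrow> complex" where
  "rec_down a b l m c d 0 = d"
| "rec_down a b l m c d (Suc 0) = c"
| "rec_down a b l m c d (Suc (Suc k)) =
     ((l - complex_of_real (b (m - int k))) * rec_down a b l m c d (Suc k)
       - complex_of_real (a (m - int k)) * rec_down a b l m c d k) / complex_of_real (a (m - int k - 1))"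

lemma jacobi_solution_exists:
  assumes pos: "\<forall>n. a n > 0"
  obtains y where "jacobi_solution a b l y" "y m = c" "y (m + 1) = d"
proof -
  define y where "y n = (if n \<ge> m then rec_up a b l m c d (nat (n - m))
                          else rec_down a b l m c d (nat (m + 1 - n)))" for n
  have y0: "y m = c" and y1: "y (m + 1) = d" by (simp_all add: y_def)
  have "jacobi a b y n = l * y n" for n
  proof (cases "n \<ge> m + 1")
    case True
    define k where "k = nat (n - m - 1)"
    have n: "n = m + int k + 1" using True k_def by simp
    have "nat (n - m) = Suc k" "nat (n + 1 - m) = Suc (Suc k)" "nat (n - 1 - m) = k"
      using n by auto
    then have e: "y n = rec_up a b l m c d (Suc k)" "y (n + 1) = rec_up a b l m c d (Suc (Suc k))"
      "y (n - 1) = rec_up a b l m c d k" using True by (auto simp: y_def)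
    have e2: "a (m + int k) = a (n - 1)" "b (m + int k + 1) = b n" "a (m + int k + 1) = a n"
      using n by auto
    have "a n \<noteq> 0" using pos by (metis less_irrefl)
    then show ?thesis unfolding jacobi_def e rec_up.simps(3) e2 by (simp add: field_simps)
  next
    case False
    define k where "k = nat (m - n)"
    have n: "n = m - int k" using False k_def by simp
    have "nat (m + 1 - n) = Suc k" "nat (m + 1 - (n + 1)) = k" "nat (m + 1 - (n - 1)) = Suc (Suc k)"
      using n by auto
    moreover have yd: "y i = rec_down a b l m c d (nat (m + 1 - i))" if le: "i \<le> m + 1" for i
    proof -
      consider "i < m" | "i = m" | "i = m + 1" using le by linarith
      then show ?thesis by cases (use y0 y1 in \<open>simp_all add: y_def\<close>)
    qed
    ultimately have e: "y n = rec_down a b l m c d (Suc k)" "y (n + 1) = rec_down a b l m c d k"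
      "y (n - 1) = rec_down a b l m c d (Suc (Suc k))"
      using False yd[of n] yd[of "n + 1"] yd[of "n - 1"] by simp_all
    have e2: "m - int k = n" using n by auto
    have "a (n - 1) \<noteq> 0" using pos by (metis less_irrefl)
    then show ?thesis unfolding jacobi_def e rec_down.simps(3) e2 by (simp add: field_simps)
  qed
  then show ?thesis using that y0 y1 unfolding jacobi_solution_def by blast
qed

lemma jacobi_solution_lincomb:
  assumes "jacobi_solution a b l u" "jacobi_solution a b l v"
  shows "jacobi_solution a b l (\<lambda>n. c * u n + d * v n)"
  unfolding jacobi_solution_def jacobi_def
proof
  fix n
  have u: "complex_of_real (a (n - 1)) * u (n - 1) + complex_of_real (b n) * u n
       + complex_of_real (a n) * u (n + 1) = l * u n"
   and v: "complex_of_real (a (n - 1)) * v (n - 1) + complex_of_real (b n) * v n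
       + complex_of_real (a n) * v (n + 1) = l * v n"
    using assms unfolding jacobi_solution_def jacobi_def by blast+
  have "l * (c * u n + d * v n) = c * (l * u n) + d * (l * v n)" by (simp add: algebra_simps)
  then show "complex_of_real (a (n - 1)) * (c * u (n - 1) + d * v (n - 1)) +
         complex_of_real (b n) * (c * u n + d * v n) +
         complex_of_real (a n) * (c * u (n + 1) + d * v (n + 1)) = l * (c * u n + d * v n)"
    unfolding u[symmetric] v[symmetric] by (simp add: algebra_simps)
qed

lemma jacobi_solution_scale:
  "jacobi_solution a b l u \<Longrightarrow> jacobi_solution a b l (\<lambda>n. c * u n)"
  using jacobi_solution_lincomb[of a b l u u c 0] by simp

lemma jacobi_solution_cnj:
  assumes "jacobi_solution a b l u"
  shows "jacobi_solution a b (cnj l) (\<lambda>n. cnj (u n))"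
  unfolding jacobi_solution_def jacobi_def
proof
  fix n
  have "complex_of_real (a (n - 1)) * u (n - 1) + complex_of_real (b n) * u n
       + complex_of_real (a n) * u (n + 1) = l * u n"
    using assms unfolding jacobi_solution_def jacobi_def by blast
  from arg_cong[OF this, of cnj]
  show "complex_of_real (a (n - 1)) * cnj (u (n - 1)) + complex_of_real (b n) * cnj (u n)
       + complex_of_real (a n) * cnj (u (n + 1)) = cnj l * cnj (u n)"
    by simp
qed

text \<open>Every value of a solution is a polynomial in \<open>l\<close> that is linear in two neighbouring values, so
  convergence spreads from these two sites.\<close>

lemma jacobi_solution_tendsto:
  fixes y :: "'c \<Rightarrow> int \<Rightarrow> complex"
  assumes sol: "\<forall>\<^sub>F s in F. jacobi_solution a b (l s) (y s)" and sol0: "jacobi_solution a b l0 y0"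
    and pos: "\<forall>n. a n > 0"
    and l: "(l \<longlongrightarrow> l0) F"
    and m: "((\<lambda>s. y s m) \<longlongrightarrow> y0 m) F" "((\<lambda>s. y s (m + 1)) \<longlongrightarrow> y0 (m + 1)) F"
  shows "((\<lambda>s. y s n) \<longlongrightarrow> y0 n) F"
proof (rule int_pair_induct[where m = m and Q = "\<lambda>n. ((\<lambda>s. y s n) \<longlongrightarrow> y0 n) F"])
  fix n assume h: "((\<lambda>s. y s (n - 1)) \<longlongrightarrow> y0 (n - 1)) F" "((\<lambda>s. y s n) \<longlongrightarrow> y0 n) F"
  have an: "complex_of_real (a n) \<noteq> 0" using pos by (metis less_irrefl of_real_eq_0_iff)
  have "((\<lambda>s. ((l s - complex_of_real (b n)) * y s n - complex_of_real (a (n - 1)) * y s (n - 1)) / complex_of_real (a n))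
     \<longlongrightarrow> ((l0 - complex_of_real (b n)) * y0 n - complex_of_real (a (n - 1)) * y0 (n - 1)) / complex_of_real (a n)) F"
    using an by (intro tendsto_intros l h)
  then have "((\<lambda>s. ((l s - complex_of_real (b n)) * y s n - complex_of_real (a (n - 1)) * y s (n - 1)) / complex_of_real (a n))
     \<longlongrightarrow> y0 (n + 1)) F"
    using jacobi_up[OF sol0] pos by simp
  then show "((\<lambda>s. y s (n + 1)) \<longlongrightarrow> y0 (n + 1)) F"
  proof (rule Lim_transform_eventually)
    show "\<forall>\<^sub>F s in F. ((l s - complex_of_real (b n)) * y s n - complex_of_real (a (n - 1)) * y s (n - 1)) / complex_of_real (a n) = y s (n + 1)"
      using sol by eventually_elim (use jacobi_up pos in metis)
  qed
next
  fix n assume h: "((\<lambda>s. y s n) \<longlongrightarrow> y0 n) F" "((\<lambda>s. y s (n + 1)) \<longlongrightarrow> y0 (n + 1)) F"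
  have an: "complex_of_real (a (n - 1)) \<noteq> 0" using pos by (metis less_irrefl of_real_eq_0_iff)
  have "((\<lambda>s. ((l s - complex_of_real (b n)) * y s n - complex_of_real (a n) * y s (n + 1)) / complex_of_real (a (n - 1)))
     \<longlongrightarrow> ((l0 - complex_of_real (b n)) * y0 n - complex_of_real (a n) * y0 (n + 1)) / complex_of_real (a (n - 1))) F"
    using an by (intro tendsto_intros l h)
  then have "((\<lambda>s. ((l s - complex_of_real (b n)) * y s n - complex_of_real (a n) * y s (n + 1)) / complex_of_real (a (n - 1)))
     \<longlongrightarrow> y0 (n - 1)) F"
    using jacobi_down[OF sol0] pos by simp
  then show "((\<lambda>s. y s (n - 1)) \<longlongrightarrow> y0 (n - 1)) F"
  proof (rule Lim_transform_eventually)
    show "\<forall>\<^sub>F s in F. ((l s - complex_of_real (b n)) * y s n - complex_of_real (a n) * y s (n + 1)) / complex_of_real (a (n - 1)) = y s (n - 1)"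
      using sol by eventually_elim (use jacobi_down pos in metis)
  qed
qed (use m in auto)

text \<open>The weight \<open>a n\<close> makes this independent of \<open>n\<close> when \<open>u\<close> and \<open>v\<close> solve the same equation.\<close>

definition wronskian :: "(int \<Rightarrow> real) \<Rightarrow> (int \<Rightarrow> complex) \<Rightarrow> (int \<Rightarrow> complex) \<Rightarrow> int \<Rightarrow> complex" where
  "wronskian a u v n = complex_of_real (a n) * (u n * v (n + 1) - u (n + 1) * v n)"

lemma wronskian_const:
  assumes "jacobi_solution a b l u" "jacobi_solution a b l v"
  shows "wronskian a u v n = wronskian a u v m"
proof -
  have step: "wronskian a u v n = wronskian a u v (n - 1)" for n
  proof -
    have u: "complex_of_real (a n) * u (n + 1) = l * u n - complex_of_real (a (n - 1)) * u (n - 1) - complex_of_real (b n) * u n"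
     and v: "complex_of_real (a n) * v (n + 1) = l * v n - complex_of_real (a (n - 1)) * v (n - 1) - complex_of_real (b n) * v n"
      using assms unfolding jacobi_solution_def jacobi_def by (metis add_diff_cancel_left' diff_diff_eq)+
    have "wronskian a u v n = u n * (complex_of_real (a n) * v (n + 1)) - (complex_of_real (a n) * u (n + 1)) * v n"
      by (simp add: wronskian_def algebra_simps)
    also have "\<dots> = wronskian a u v (n - 1)"
      unfolding u v by (simp add: wronskian_def algebra_simps)
    finally show ?thesis .
  qed
  show ?thesis
  proof (induction n rule: int_induct[where k = m])
    case (step1 i)
    then show ?case using step[of "i + 1"] by simp
  next
    case (step2 i)
    then show ?case using step[of i] by simp
  qed simp
qed

lemma wronskian_zero_proportional:
  assumes u: "jacobi_solution a b l u" and v: "jacobi_solution a b l v" and pos: "\<forall>n. a n > 0"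
    and w: "wronskian a u v m = 0" and nz: "u k \<noteq> 0"
  obtains c where "v = (\<lambda>n. c * u n)"
proof -
  have an: "complex_of_real (a m) \<noteq> 0" using pos by (metis less_irrefl of_real_eq_0_iff)
  have x: "u m * v (m + 1) = u (m + 1) * v m" using w an by (simp add: wronskian_def)
  have ne: "u m \<noteq> 0 \<or> u (m + 1) \<noteq> 0"
  proof (rule ccontr)
    assume "\<not> ?thesis"
    moreover have "jacobi_solution a b l (\<lambda>n. 0)" by (simp add: jacobi_solution_def jacobi_def)
    ultimately have "u = (\<lambda>n. 0)"
      using jacobi_solution_unique[OF u _ pos, of "\<lambda>n. 0" m] by simp
    then show False using nz by simp
  qed
  define c where "c = (if u m \<noteq> 0 then v m / u m else v (m + 1) / u (m + 1))"
  have "v m = c * u m" "v (m + 1) = c * u (m + 1)"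
    using x ne by (auto simp: c_def field_simps)
  then have "v = (\<lambda>n. c * u n)"
    using jacobi_solution_unique[OF v jacobi_solution_scale[OF u] pos] by blast
  then show ?thesis using that by blast
qed

lemma P_sol:
  assumes pos: "\<forall>n. a n > 0"
  shows "jacobi_solution a b l (P_sol a b l)" "P_sol a b l (-1) = 0" "P_sol a b l 0 = 1"
proof -
  obtain y where y: "jacobi_solution a b l y" "y (-1) = 0" "y (-1 + 1) = 1"
    using jacobi_solution_exists[OF pos] by metis
  have "\<exists>!y. jacobi_solution a b l y \<and> y (-1) = 0 \<and> y 0 = 1"
    using y jacobi_solution_unique[OF _ _ pos, of b l _ _ "-1"] by (intro ex1I[of _ y]) auto
  from theI'[OF this] show "jacobi_solution a b l (P_sol a b l)" "P_sol a b l (-1) = 0" "P_sol a b l 0 = 1"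
    unfolding P_sol_def by auto
qed

lemma Q_sol:
  assumes pos: "\<forall>n. a n > 0"
  shows "jacobi_solution a b l (Q_sol a b l)" "Q_sol a b l (-1) = - 1 / complex_of_real (a (-1))"
    "Q_sol a b l 0 = 0"
proof -
  obtain y where y: "jacobi_solution a b l y" "y 0 = 0" "y (0 + 1) = 1 / complex_of_real (a 0)"
    using jacobi_solution_exists[OF pos] by metis
  have "\<exists>!y. jacobi_solution a b l y \<and> y 0 = 0 \<and> y 1 = 1 / complex_of_real (a 0)"
    using y jacobi_solution_unique[OF _ _ pos, of b l _ _ "0"] by (intro ex1I[of _ y]) auto
  from theI'[OF this] have *: "jacobi_solution a b l (Q_sol a b l)" "Q_sol a b l 0 = 0" "Q_sol a b l 1 = 1 / complex_of_real (a 0)"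
    unfolding Q_sol_def by auto
  then show "jacobi_solution a b l (Q_sol a b l)" "Q_sol a b l 0 = 0" by auto
  have "complex_of_real (a 0) \<noteq> 0" using pos by (metis less_irrefl of_real_eq_0_iff)
  then show "Q_sol a b l (-1) = - 1 / complex_of_real (a (-1))"
    using jacobi_down[OF *(1), of 0] * pos by simp
qed

text \<open>The value at \<open>-1\<close> depends neither on \<open>l\<close> nor on the Weyl function, so proportionality of a
  solution to the Weyl solution is a statement about the Weyl function alone.\<close>

lemma weyl_sol:
  assumes pos: "\<forall>n. a n > 0"
  shows "jacobi_solution a b l (weyl_sol a b l)" "weyl_sol a b l (-1) = - 1 / complex_of_real (a (-1))"
    "weyl_sol a b l 0 = weyl_m a b l"
  using jacobi_solution_lincomb[OF Q_sol(1)[OF pos] P_sol(1)[OF pos], of b l 1 "weyl_m a b l"]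
    P_sol[OF pos, of b l] Q_sol[OF pos, of b l]
  by (simp_all add: weyl_sol_def[abs_def])

lemma sol_real:
  assumes "jacobi_solution a b (complex_of_real x) y" and pos: "\<forall>n. a n > 0"
    and "y m \<in> \<real>" "y (m + 1) \<in> \<real>"
  shows "y n \<in> \<real>"
proof -
  have "(\<lambda>n. cnj (y n)) = y"
    using jacobi_solution_cnj[OF assms(1)] assms Reals_cnj_iff
    by (intro jacobi_solution_unique[where m = m]) auto
  then show ?thesis using Reals_cnj_iff by metis
qed

section \<open>The uniformising variable z\<close>

lemma z_fun_real:
  assumes "\<mu> \<notin> {-2..2::real}"
  obtains \<zeta> where "z_fun (complex_of_real \<mu>) = complex_of_real \<zeta>" "\<zeta> \<noteq> 0" "\<bar>\<zeta>\<bar> < 1" "\<zeta> + 1 / \<zeta> = \<mu>"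
proof (cases "\<mu> > 2")
  case True
  define s where "s = sqrt (\<mu> / 2 - 1) * sqrt (\<mu> / 2 + 1)"
  have s: "s > 0" "s\<^sup>2 = \<mu>\<^sup>2 / 4 - 1"
    using True by (auto simp: s_def power_mult_distrib field_simps power2_eq_square)
  have e: "csqrt (complex_of_real \<mu> / 2 - 1) = complex_of_real (sqrt (\<mu> / 2 - 1))"
     "csqrt (complex_of_real \<mu> / 2 + 1) = complex_of_real (sqrt (\<mu> / 2 + 1))"
    using True csqrt_of_real_nonneg[of "complex_of_real \<mu> / 2 - 1"]
      csqrt_of_real_nonneg[of "complex_of_real \<mu> / 2 + 1"] by auto
  have z: "z_fun (complex_of_real \<mu>) = complex_of_real (\<mu> / 2 - s)"
    unfolding z_fun_def e s_def by simp
  have pr: "(\<mu> / 2 - s) * (\<mu> / 2 + s) = 1" using s(2) by (simp add: field_simps power2_eq_square)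
  have big: "\<mu> / 2 + s > 1" using True s by simp
  have inv: "\<mu> / 2 - s = 1 / (\<mu> / 2 + s)" using pr big by (simp add: field_simps)
  show ?thesis
  proof (rule that[OF z])
    show "\<mu> / 2 - s \<noteq> 0" using pr by auto
    show "\<bar>\<mu> / 2 - s\<bar> < 1" unfolding inv using big by simp
    have "1 / (\<mu> / 2 - s) = \<mu> / 2 + s" unfolding inv using big by simp
    then show "\<mu> / 2 - s + 1 / (\<mu> / 2 - s) = \<mu>" by simp
  qed
next
  case False
  then have neg: "\<mu> < -2" using assms by auto
  define s where "s = sqrt (1 - \<mu> / 2) * sqrt (- \<mu> / 2 - 1)"
  have s: "s > 0" "s\<^sup>2 = \<mu>\<^sup>2 / 4 - 1"
    using neg by (auto simp: s_def power_mult_distrib field_simps power2_eq_square)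
  have e: "csqrt (complex_of_real \<mu> / 2 - 1) = \<i> * complex_of_real (sqrt (1 - \<mu> / 2))"
     "csqrt (complex_of_real \<mu> / 2 + 1) = \<i> * complex_of_real (sqrt (- \<mu> / 2 - 1))"
    using neg csqrt_of_real_nonpos[of "complex_of_real \<mu> / 2 - 1"]
      csqrt_of_real_nonpos[of "complex_of_real \<mu> / 2 + 1"] by (auto simp: abs_if algebra_simps)
  have z: "z_fun (complex_of_real \<mu>) = complex_of_real (\<mu> / 2 + s)"
    unfolding z_fun_def e s_def by (simp add: algebra_simps)
  have pr: "(\<mu> / 2 + s) * (\<mu> / 2 - s) = 1" using s(2) by (simp add: field_simps power2_eq_square)
  have big: "\<mu> / 2 - s < - 1" using neg s by simp
  have inv: "\<mu> / 2 + s = 1 / (\<mu> / 2 - s)" using pr big by (simp add: field_simps)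
  show ?thesis
  proof (rule that[OF z])
    show "\<mu> / 2 + s \<noteq> 0" using pr by auto
    show "\<bar>\<mu> / 2 + s\<bar> < 1" unfolding inv using big by (simp add: field_simps)
    have "1 / (\<mu> / 2 + s) = \<mu> / 2 - s" unfolding inv using big by simp
    then show "\<mu> / 2 + s + 1 / (\<mu> / 2 + s) = \<mu>" by simp
  qed
qed

lemma side_sign_cases: "side_sign s = 1 \<or> side_sign s = -1"
  by (cases s) auto

text \<open>The two square roots converge separately along the vertical approach: for \<open>x\<close> in \<open>{-2..2}\<close> the
  limit of the first is imaginary, with the sign of the side, and that of the second is real.\<close>

lemma z_bdry_eq:
  assumes "x \<in> {-2..2::real}"
  shows "z_bdry (s, x) = Complex (x / 2) (- side_sign s * sqrt (1 - x\<^sup>2 / 4))"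
proof -
  define \<sigma> where "\<sigma> = side_sign s"
  have \<sigma>: "\<sigma> = 1 \<or> \<sigma> = -1" using side_sign_cases \<sigma>_def by auto
  have sq: "((\<lambda>\<epsilon>. csqrt (Complex u (\<sigma> * \<epsilon>))) \<longlongrightarrow> Complex (sqrt ((\<bar>u\<bar> + u) / 2)) (\<sigma> * sqrt ((\<bar>u\<bar> - u) / 2)))
      (at_right 0)" for u
  proof -
    have c: "((\<lambda>\<epsilon>. cmod (Complex u (\<sigma> * \<epsilon>))) \<longlongrightarrow> \<bar>u\<bar>) (at_right 0)"
    proof -
      have "((\<lambda>\<epsilon>. Complex u (\<sigma> * \<epsilon>)) \<longlongrightarrow> Complex u (\<sigma> * 0)) (at_right 0)"
        by (intro tendsto_intros tendsto_Complex)
      from tendsto_norm[OF this] show ?thesis by (simp add: complex_norm)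
    qed
    have "((\<lambda>\<epsilon>. Complex (sqrt ((cmod (Complex u (\<sigma> * \<epsilon>)) + u) / 2)) (\<sigma> * sqrt ((cmod (Complex u (\<sigma> * \<epsilon>)) - u) / 2)))
      \<longlongrightarrow> Complex (sqrt ((\<bar>u\<bar> + u) / 2)) (\<sigma> * sqrt ((\<bar>u\<bar> - u) / 2))) (at_right 0)"
      by (intro tendsto_intros tendsto_Complex c) auto
    then show ?thesis
    proof (rule Lim_transform_eventually)
      show "\<forall>\<^sub>F \<epsilon> in at_right 0. Complex (sqrt ((cmod (Complex u (\<sigma> * \<epsilon>)) + u) / 2))
          (\<sigma> * sqrt ((cmod (Complex u (\<sigma> * \<epsilon>)) - u) / 2)) = csqrt (Complex u (\<sigma> * \<epsilon>))"
        unfolding eventually_at_right_field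
        using \<sigma> by (intro exI[of _ 1]) (auto simp: complex_eq_iff sgn_if)
    qed
  qed
  have h: "Complex x (\<sigma> * \<epsilon>) / 2 - 1 = Complex (x / 2 - 1) (\<sigma> * (\<epsilon> / 2))"
          "Complex x (\<sigma> * \<epsilon>) / 2 + 1 = Complex (x / 2 + 1) (\<sigma> * (\<epsilon> / 2))" for \<epsilon>
    by (auto simp: complex_eq_iff)
  have fl: "filterlim (\<lambda>\<epsilon>::real. \<epsilon> / 2) (at_right 0) (at_right 0)"
  proof -
    have "((\<lambda>\<epsilon>::real. \<epsilon> / 2) \<longlongrightarrow> 0 / 2) (at_right 0)" by (intro tendsto_intros) auto
    then show ?thesis
      by (auto simp: filterlim_at eventually_at_right_field intro!: exI[of _ 1])
  qed
  have 1: "((\<lambda>\<epsilon>. csqrt (Complex (x / 2 - 1) (\<sigma> * (\<epsilon> / 2)))) \<longlongrightarrow> Complex 0 (\<sigma> * sqrt (1 - x / 2))) (at_right 0)"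
    using filterlim_compose[OF sq[of "x / 2 - 1"] fl] assms by (simp add: diff_divide_distrib)
  have 2: "((\<lambda>\<epsilon>. csqrt (Complex (x / 2 + 1) (\<sigma> * (\<epsilon> / 2)))) \<longlongrightarrow> Complex (sqrt (x / 2 + 1)) 0) (at_right 0)"
    using filterlim_compose[OF sq[of "x / 2 + 1"] fl] assms by (simp add: add_divide_distrib)
  have 3: "((\<lambda>\<epsilon>. Complex x (\<sigma> * \<epsilon>) / 2) \<longlongrightarrow> Complex x (\<sigma> * 0) / 2) (at_right 0)"
    by (intro tendsto_intros tendsto_Complex) auto
  have sp: "sqrt (1 - x / 2) * sqrt (x / 2 + 1) = sqrt (1 - x\<^sup>2 / 4)"
    unfolding real_sqrt_mult[symmetric] by (simp add: field_simps power2_eq_square)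
  have "((\<lambda>\<epsilon>. z_fun (Complex x (\<sigma> * \<epsilon>))) \<longlongrightarrow>
      Complex x (\<sigma> * 0) / 2 - Complex 0 (\<sigma> * sqrt (1 - x / 2)) * Complex (sqrt (x / 2 + 1)) 0) (at_right 0)"
    unfolding z_fun_def h by (intro tendsto_intros 1 2 3)
  moreover have "Complex x (\<sigma> * 0) / 2 - Complex 0 (\<sigma> * sqrt (1 - x / 2)) * Complex (sqrt (x / 2 + 1)) 0
      = Complex (x / 2) (- \<sigma> * sqrt (1 - x\<^sup>2 / 4))"
    unfolding sp[symmetric] by (simp add: complex_eq_iff)
  ultimately have "((\<lambda>\<epsilon>. z_fun (Complex x (\<sigma> * \<epsilon>))) \<longlongrightarrow> Complex (x / 2) (- \<sigma> * sqrt (1 - x\<^sup>2 / 4))) (at_right 0)"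
    by simp
  then show ?thesis unfolding z_bdry_def \<sigma>_def by (intro tendsto_Lim) auto
qed

lemma z_bdry_facts:
  assumes "x \<in> {-2..2::real}"
  shows "cmod (z_bdry (s, x)) = 1" "z_bdry (s, x) \<noteq> 0" "inverse (z_bdry (s, x)) = cnj (z_bdry (s, x))"
    "z_bdry (s, x) + inverse (z_bdry (s, x)) = complex_of_real x"
    "x\<^sup>2 \<noteq> 4 \<Longrightarrow> (z_bdry (s, x))\<^sup>2 \<noteq> 1"
    "x\<^sup>2 = 4 \<Longrightarrow> inverse (z_bdry (s, x)) = z_bdry (s, x)"
proof -
  define r where "r = sqrt (1 - x\<^sup>2 / 4)"
  have x4: "x\<^sup>2 \<le> 4" using assms abs_le_square_iff[of x 2] by (auto simp: abs_le_iff)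
  then have r2: "r\<^sup>2 = 1 - x\<^sup>2 / 4" by (simp add: r_def)
  have sg: "(side_sign s)\<^sup>2 = 1" using side_sign_cases[of s] by auto
  have z: "z_bdry (s, x) = Complex (x / 2) (- side_sign s * r)" using z_bdry_eq[OF assms] r_def by simp
  have n2: "(cmod (z_bdry (s, x)))\<^sup>2 = 1"
    unfolding z cmod_power2 using r2 sg by (simp add: power_mult_distrib power_divide)
  show n: "cmod (z_bdry (s, x)) = 1" using n2 by (simp add: abs_square_eq_1)
  show z0: "z_bdry (s, x) \<noteq> 0" using n by auto
  show inv: "inverse (z_bdry (s, x)) = cnj (z_bdry (s, x))"
    using n z0 complex_norm_square[of "z_bdry (s, x)"] by (simp add: field_simps)
  show "z_bdry (s, x) + inverse (z_bdry (s, x)) = complex_of_real x"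
    unfolding inv unfolding z by (simp add: complex_eq_iff)
  show "(z_bdry (s, x))\<^sup>2 \<noteq> 1" if "x\<^sup>2 \<noteq> 4"
  proof
    assume *: "(z_bdry (s, x))\<^sup>2 = 1"
    then have "z_bdry (s, x) = 1 \<or> z_bdry (s, x) = -1" by (simp add: power2_eq_1_iff)
    then have "x / 2 = 1 \<or> x / 2 = -1" unfolding z by (auto simp: complex_eq_iff)
    then show False using that by auto
  qed
  show "inverse (z_bdry (s, x)) = z_bdry (s, x)" if "x\<^sup>2 = 4"
  proof -
    have "r = 0" using that r_def by simp
    then show ?thesis unfolding inv unfolding z by (simp add: complex_eq_iff)
  qed
qed

lemma z_bdry_tendsto:
  assumes "x \<in> {-2..2::real}" "S \<subseteq> {-2..2}"
  shows "((\<lambda>y. z_bdry (s, y)) \<longlongrightarrow> z_bdry (s, x)) (at x within S)"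
proof -
  have "((\<lambda>y. Complex (y / 2) (- side_sign s * sqrt (1 - y\<^sup>2 / 4))) \<longlongrightarrow>
      Complex (x / 2) (- side_sign s * sqrt (1 - x\<^sup>2 / 4))) (at x within S)"
    by (intro tendsto_Complex tendsto_intros) auto
  then show ?thesis
    unfolding z_bdry_eq[OF assms(1)]
  proof (rule Lim_transform_eventually)
    show "\<forall>\<^sub>F y in at x within S. Complex (y / 2) (- side_sign s * sqrt (1 - y\<^sup>2 / 4)) = z_bdry (s, y)"
      using assms(2) by (auto simp: eventually_at_filter z_bdry_eq subset_iff)
  qed
qed

section \<open>Differential equations and inequalities\<close>

text \<open>Picard iteration. The successive differences are dominated by an exponential series on all of
  \<open>{0..T}\<close>, so no subdivision of the interval is needed.\<close>

lemma lipschitz_ode_exists: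
  fixes G :: "real \<Rightarrow> 'a::banach \<Rightarrow> 'a"
  assumes T: "0 \<le> T" and K: "0 \<le> K"
    and cont: "\<And>x. continuous_on {0..T} x \<Longrightarrow> continuous_on {0..T} (\<lambda>s. G s (x s))"
    and lip: "\<And>s x y. s \<in> {0..T} \<Longrightarrow> norm (G s x - G s y) \<le> K * norm (x - y)"
  obtains X where "X 0 = x0"
    "\<And>t. t \<in> {0..T} \<Longrightarrow> (X has_vector_derivative G t (X t)) (at t within {0..T})"
proof -
  define Xs where "Xs = rec_nat (\<lambda>t. x0) (\<lambda>k x t. x0 + integral {0..t} (\<lambda>s. G s (x s)))"
  have Xs0: "Xs 0 = (\<lambda>t. x0)" and XsS: "Xs (Suc k) = (\<lambda>t. x0 + integral {0..t} (\<lambda>s. G s (Xs k s)))" for k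
    by (simp_all add: Xs_def)
  have contX: "continuous_on {0..T} (Xs k)" for k
  proof (induction k)
    case (Suc k)
    then show ?case unfolding XsS
      by (intro continuous_intros indefinite_integral_continuous_1 integrable_continuous_real cont)
  qed (simp add: Xs0)
  have intG: "(\<lambda>s. G s (x s)) integrable_on {0..t}" if "continuous_on {0..T} x" "t \<in> {0..T}" for x t
    using that by (intro integrable_continuous_real continuous_on_subset[OF cont]) auto
  obtain B where B: "\<And>s. s \<in> {0..T} \<Longrightarrow> norm (G s x0) \<le> B" "B \<ge> 0"
  proof -
    have "compact ((\<lambda>s. G s x0) ` {0..T})"
      by (intro compact_continuous_image cont[of "\<lambda>_. x0", simplified] compact_Icc continuous_intros)
    then obtain B where "\<forall>x\<in>(\<lambda>s. G s x0) ` {0..T}. norm x \<le> B" using compact_imp_bounded bounded_iff by metis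
    then have "norm (G s x0) \<le> max B 0" if "s \<in> {0..T}" for s using that by (auto simp: le_max_iff_disj)
    then show ?thesis using that[of "max B 0"] by simp
  qed
  define C where "C = B * T"
  have diff: "norm (Xs (Suc k) t - Xs k t) \<le> C * (K * t) ^ k / fact k" if "t \<in> {0..T}" for k t
    using that
  proof (induction k arbitrary: t)
    case 0
    have "norm (integral {0..t} (\<lambda>s. G s x0)) \<le> B * (t - 0)"
      using 0 B by (intro integral_bound continuous_on_subset[OF cont[of "\<lambda>_. x0", simplified]]) auto
    also have "\<dots> \<le> C" unfolding C_def using 0 B by (intro mult_left_mono) auto
    finally show ?case unfolding XsS Xs0 by simp
  next
    case (Suc k)
    have "Xs (Suc (Suc k)) t - Xs (Suc k) t
       = integral {0..t} (\<lambda>s. G s (Xs (Suc k) s)) - integral {0..t} (\<lambda>s. G s (Xs k s))"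
      by (subst (1 2) XsS) simp
    also have "\<dots> = integral {0..t} (\<lambda>s. G s (Xs (Suc k) s) - G s (Xs k s))"
      using Suc.prems by (intro integral_diff[symmetric] intG contX)
    finally have e: "Xs (Suc (Suc k)) t - Xs (Suc k) t = integral {0..t} (\<lambda>s. G s (Xs (Suc k) s) - G s (Xs k s))" .
    have I: "((\<lambda>s. C * K ^ Suc k * s ^ k / fact k) has_integral
        C * K ^ Suc k * t ^ Suc k / fact (Suc k) - C * K ^ Suc k * 0 ^ Suc k / fact (Suc k)) {0..t}"
    proof (rule fundamental_theorem_of_calculus)
      fix x assume "x \<in> {0..t}"
      have "((\<lambda>s. C * K ^ Suc k * s ^ Suc k / fact (Suc k)) has_real_derivative
           C * K ^ Suc k * (real (Suc k) * x ^ k) / fact (Suc k)) (at x within {0..t})"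
        by (intro derivative_eq_intros | simp)+
      moreover have "C * K ^ Suc k * (real (Suc k) * x ^ k) / fact (Suc k) = C * K ^ Suc k * x ^ k / fact k"
        by (simp add: field_simps del: of_nat_Suc)
      ultimately show "((\<lambda>s. C * K ^ Suc k * s ^ Suc k / fact (Suc k)) has_vector_derivative
           C * K ^ Suc k * x ^ k / fact k) (at x within {0..t})"
        unfolding has_real_derivative_iff_has_vector_derivative by metis
    qed (use Suc.prems in auto)
    have "norm (integral {0..t} (\<lambda>s. G s (Xs (Suc k) s) - G s (Xs k s)))
        \<le> integral {0..t} (\<lambda>s. C * K ^ Suc k * s ^ k / fact k)"
    proof (rule integral_norm_bound_integral)
      show "(\<lambda>s. G s (Xs (Suc k) s) - G s (Xs k s)) integrable_on {0..t}"
        using Suc.prems by (intro integrable_diff intG contX)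
      show "(\<lambda>s. C * K ^ Suc k * s ^ k / fact k) integrable_on {0..t}" using I by blast
      fix s assume s: "s \<in> {0..t}"
      have "norm (G s (Xs (Suc k) s) - G s (Xs k s)) \<le> K * norm (Xs (Suc k) s - Xs k s)"
        using s Suc.prems by (intro lip) auto
      also have "\<dots> \<le> K * (C * (K * s) ^ k / fact k)"
        using s Suc.prems K by (intro mult_left_mono Suc.IH) auto
      finally show "norm (G s (Xs (Suc k) s) - G s (Xs k s)) \<le> C * K ^ Suc k * s ^ k / fact k"
        by (simp add: power_mult_distrib mult_ac)
    qed
    also have "\<dots> = C * (K * t) ^ Suc k / fact (Suc k)"
      unfolding integral_unique[OF I] by (simp add: power_mult_distrib mult_ac)
    finally show ?case unfolding e .
  qed
  define X where "X t = x0 + (\<Sum>k. Xs (Suc k) t - Xs k t)" for t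
  have C0: "C \<ge> 0" using B T by (simp add: C_def)
  have ul: "uniform_limit {0..T} (\<lambda>n t. \<Sum>k<n. Xs (Suc k) t - Xs k t) (\<lambda>t. \<Sum>k. Xs (Suc k) t - Xs k t) sequentially"
  proof (rule Weierstrass_m_test)
    fix k t assume t: "t \<in> {0..T}"
    have "norm (Xs (Suc k) t - Xs k t) \<le> C * (K * t) ^ k / fact k" using diff t by blast
    also have "\<dots> \<le> C * (K * T) ^ k / fact k"
      using t K C0 by (intro divide_right_mono mult_left_mono power_mono) auto
    finally show "norm (Xs (Suc k) t - Xs k t) \<le> C * (K * T) ^ k / fact k" .
  next
    have "summable (\<lambda>k. C * (inverse (fact k) * (K * T) ^ k))" by (intro summable_mult summable_exp)
    then show "summable (\<lambda>k. C * (K * T) ^ k / fact k)" by (simp add: field_simps)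
  qed
  have tel: "(\<Sum>k<n. Xs (Suc k) t - Xs k t) = Xs n t - x0" for n t
    using sum_lessThan_telescope[of "\<lambda>k. Xs k t" n] by (simp add: Xs0)
  have ul2: "uniform_limit {0..T} Xs X sequentially"
  proof -
    have "uniform_limit {0..T} (\<lambda>n t. x0 + (\<Sum>k<n. Xs (Suc k) t - Xs k t)) X sequentially"
      unfolding X_def by (intro uniform_limit_intros ul)
    then show ?thesis unfolding tel by simp
  qed
  have contXl: "continuous_on {0..T} X"
    by (rule uniform_limit_theorem[OF _ ul2]) (auto simp: contX)
  have eq: "X t = x0 + integral {0..t} (\<lambda>s. G s (X s))" if t: "t \<in> {0..T}" for t
  proof (rule LIMSEQ_unique)
    show "(\<lambda>n. Xs (Suc n) t) \<longlonglongrightarrow> X t"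
      by (rule LIMSEQ_Suc) (rule tendsto_uniform_limitI[OF ul2 t])
    have "(\<lambda>n. integral {0..t} (\<lambda>s. G s (Xs n s))) \<longlonglongrightarrow> integral {0..t} (\<lambda>s. G s (X s))"
    proof (rule tendstoI)
      fix e :: real assume e: "e > 0"
      define d where "d = e / (K * T + 1)"
      have KT: "K * T \<ge> 0" using K T by simp
      have d: "d > 0" unfolding d_def using e KT by (intro divide_pos_pos) auto
      from uniform_limitD[OF ul2 d]
      show "\<forall>\<^sub>F n in sequentially. dist (integral {0..t} (\<lambda>s. G s (Xs n s))) (integral {0..t} (\<lambda>s. G s (X s))) < e"
      proof eventually_elim
        case (elim n)
        have "dist (integral {0..t} (\<lambda>s. G s (Xs n s))) (integral {0..t} (\<lambda>s. G s (X s)))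
           = norm (integral {0..t} (\<lambda>s. G s (Xs n s) - G s (X s)))"
          unfolding dist_norm using t by (subst integral_diff) (auto intro: intG contX contXl)
        also have "\<dots> \<le> (K * d) * (t - 0)"
        proof (rule integral_bound)
          show "continuous_on {0..t} (\<lambda>s. G s (Xs n s) - G s (X s))"
            using t by (intro continuous_intros continuous_on_subset[OF cont] contX contXl) auto
          fix s assume s: "s \<in> {0..t}"
          have "norm (G s (Xs n s) - G s (X s)) \<le> K * norm (Xs n s - X s)" using s t by (intro lip) auto
          also have "\<dots> \<le> K * d" using elim s t K by (intro mult_left_mono) (auto simp: dist_norm less_imp_le)
          finally show "norm (G s (Xs n s) - G s (X s)) \<le> K * d" .
        qed (use t in auto)
        also have "\<dots> \<le> (K * d) * T" using t K d by (intro mult_left_mono) auto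
        also have "\<dots> < e"
        proof -
          have "K * T * d < (K * T + 1) * d" using d by simp
          also have "\<dots> = e" unfolding d_def using KT by (simp add: field_simps)
          finally show ?thesis by (simp add: mult_ac)
        qed
        finally show ?case .
      qed
    qed
    then show "(\<lambda>n. Xs (Suc n) t) \<longlonglongrightarrow> x0 + integral {0..t} (\<lambda>s. G s (X s))"
      unfolding XsS by (intro tendsto_intros)
  qed
  show ?thesis
  proof (rule that)
    show "X 0 = x0" using eq[of 0] T by simp
    fix t assume t: "t \<in> {0..T}"
    have "((\<lambda>t. integral {0..t} (\<lambda>s. G s (X s))) has_vector_derivative G t (X t)) (at t within {0..T})"
      using integral_has_vector_derivative[OF cont[OF contXl] t] .
    then have "((\<lambda>t. x0 + integral {0..t} (\<lambda>s. G s (X s))) has_vector_derivative 0 + G t (X t)) (at t within {0..T})"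
      by (intro has_vector_derivative_add has_vector_derivative_const)
    then have "((\<lambda>t. x0 + integral {0..t} (\<lambda>s. G s (X s))) has_vector_derivative G t (X t)) (at t within {0..T})"
      by simp
    then show "(X has_vector_derivative G t (X t)) (at t within {0..T})"
      by (rule has_vector_derivative_transform[OF t, rotated]) (use eq in auto)
  qed
qed

text \<open>Gronwall's inequality with an exponential forcing term: the function
  \<open>exp (- C t) \<phi>(t) - M exp ((c - C) t)\<close> has a nonpositive derivative.\<close>

lemma differential_inequality:
  fixes \<phi> \<phi>' :: "real \<Rightarrow> real"
  assumes der: "\<And>t. t \<in> {0..T} \<Longrightarrow> (\<phi> has_real_derivative \<phi>' t) (at t within {0..T})"
    and le: "\<And>t. t \<in> {0..T} \<Longrightarrow> \<phi>' t \<le> C * \<phi> t + N * exp (c * t)"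
    and init: "\<phi> 0 \<le> M" and N: "N \<le> (c - C) * M" and t: "t \<in> {0..T}"
  shows "\<phi> t \<le> M * exp (c * t)"
proof -
  define h where "h s = exp (- C * s) * \<phi> s - M * exp ((c - C) * s)" for s
  define h' where "h' s = exp (- C * s) * \<phi>' s + (- C * exp (- C * s)) * \<phi> s - M * ((c - C) * exp ((c - C) * s))" for s
  have hd: "(h has_real_derivative h' s) (at s within {0..t})" if "s \<in> {0..t}" for s
  proof -
    have "(\<phi> has_real_derivative \<phi>' s) (at s within {0..t})"
      using der[of s] that t by (auto intro: DERIV_subset)
    then show ?thesis unfolding h_def[abs_def] h'_def
      by (auto intro!: derivative_eq_intros simp: algebra_simps)
  qed
  have h'le: "h' s \<le> 0" if s: "s \<in> {0..t}" for s
  proof -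
    have "exp (- C * s) * \<phi>' s \<le> exp (- C * s) * (C * \<phi> s + N * exp (c * s))"
      using le[of s] s t by (intro mult_left_mono) auto
    moreover have "exp (- C * s) * (N * exp (c * s)) = N * exp ((c - C) * s)"
    proof -
      have "exp (- C * s) * exp (c * s) = exp ((c - C) * s)"
        by (simp only: exp_add[symmetric]) (simp add: algebra_simps)
      then show ?thesis by (metis mult.left_commute)
    qed
    moreover have "N * exp ((c - C) * s) \<le> ((c - C) * M) * exp ((c - C) * s)"
      using N by (intro mult_right_mono) auto
    ultimately have "exp (- C * s) * \<phi>' s \<le> exp (- C * s) * (C * \<phi> s) + (c - C) * M * exp ((c - C) * s)"
      unfolding distrib_left by linarith
    then show ?thesis unfolding h'_def by (simp add: mult_ac)
  qed
  have "\<exists>x\<in>{0..t}. h t - h 0 = (\<lambda>d. d * h' x) (t - 0)"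
    using t hd by (intro mvt_very_simple) (auto simp: has_field_derivative_def mult_commute_abs)
  then obtain x where "x \<in> {0..t}" "h t - h 0 = t * h' x" by auto
  moreover have "t * h' x \<le> 0" using h'le[of x] t \<open>x \<in> {0..t}\<close> by (intro mult_nonneg_nonpos) auto
  ultimately have "h t \<le> h 0" by simp
  also have "h 0 \<le> 0" using init by (simp add: h_def)
  finally have "exp (- C * t) * \<phi> t \<le> M * exp ((c - C) * t)" by (simp add: h_def)
  then have "exp (C * t) * (exp (- C * t) * \<phi> t) \<le> exp (C * t) * (M * exp ((c - C) * t))"
    by (intro mult_left_mono) auto
  moreover have "exp (C * t) * (exp (- C * t) * \<phi> t) = \<phi> t"
    by (simp add: exp_minus)
  moreover have "exp (C * t) * (M * exp ((c - C) * t)) = M * exp (c * t)"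
    by (simp add: exp_add[symmetric] algebra_simps)
  ultimately show ?thesis by (simp only:)
qed

text \<open>Each member of the chain is driven by its predecessor only. Adding up \<open>N\<close> inequalities
  therefore gives a Gronwall inequality for the partial sum whose constants do not depend on \<open>N\<close>;
  a bound in advance is needed for the first member alone. With \<open>\<phi> k t = \<bar>y\<^sub>k(t)\<bar>\<^sup>2\<close> this transports
  square summability.\<close>

lemma chain_sum_bound:
  fixes \<phi> \<phi>' :: "nat \<Rightarrow> real \<Rightarrow> real"
  assumes der: "\<And>k t. t \<in> {0..T} \<Longrightarrow> (\<phi> k has_real_derivative \<phi>' k t) (at t within {0..T})"
    and nonneg: "\<And>k t. 0 \<le> \<phi> k t" and C: "0 \<le> C"
    and le: "\<And>k t. t \<in> {0..T} \<Longrightarrow> \<phi>' (Suc k) t \<le> C * (\<phi> (Suc k) t + \<phi> k t)"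
    and B: "\<And>t. t \<in> {0..T} \<Longrightarrow> \<phi> 0 t \<le> B"
    and S: "\<And>N. (\<Sum>k<N. \<phi> (Suc k) 0) \<le> S" and t: "t \<in> {0..T}"
  shows "(\<Sum>k<N. \<phi> (Suc k) t) \<le> (S + C * B) * exp ((2 * C + 1) * t)"
proof (rule differential_inequality[where \<phi>' = "\<lambda>t. \<Sum>k<N. \<phi>' (Suc k) t" and T = T and C = "2 * C" and N = "C * B"])
  have B0: "0 \<le> B" using B[OF t] nonneg[of 0 t] by linarith
  have S0: "0 \<le> S" using S[of 0] by simp
  show "C * B \<le> (2 * C + 1 - 2 * C) * (S + C * B)" using S0 by simp
  show "(\<Sum>k<N. \<phi> (Suc k) 0) \<le> S + C * B" using S[of N] C B0 by (simp add: add_increasing2)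
  show "t \<in> {0..T}" by fact
  fix t assume t: "t \<in> {0..T}"
  show "((\<lambda>t. \<Sum>k<N. \<phi> (Suc k) t) has_real_derivative (\<Sum>k<N. \<phi>' (Suc k) t)) (at t within {0..T})"
    using der t by (intro DERIV_sum) auto
  have shift: "(\<Sum>k<N. \<phi> k t) \<le> B + (\<Sum>k<N. \<phi> (Suc k) t)"
  proof -
    have "(\<Sum>k<N. \<phi> k t) \<le> (\<Sum>k<Suc N. \<phi> k t)" by (simp add: nonneg)
    also have "\<dots> = \<phi> 0 t + (\<Sum>k<N. \<phi> (Suc k) t)" by (rule sum.lessThan_Suc_shift)
    finally show ?thesis using B[OF t] by simp
  qed
  have "(\<Sum>k<N. \<phi>' (Suc k) t) \<le> (\<Sum>k<N. C * (\<phi> (Suc k) t + \<phi> k t))"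
    using le t by (intro sum_mono) auto
  also have "\<dots> = C * ((\<Sum>k<N. \<phi> (Suc k) t) + (\<Sum>k<N. \<phi> k t))"
    by (simp add: sum_distrib_left[symmetric] sum.distrib)
  also have "\<dots> \<le> C * ((\<Sum>k<N. \<phi> (Suc k) t) + (B + (\<Sum>k<N. \<phi> (Suc k) t)))"
    using shift C by (intro mult_left_mono) auto
  also have "\<dots> = 2 * C * (\<Sum>k<N. \<phi> (Suc k) t) + C * B" by (simp add: algebra_simps)
  also have "C * B \<le> C * B * exp ((2 * C + 1) * t)"
    using mult_left_mono[of 1 "exp ((2 * C + 1) * t)" "C * B"] C B0 t by simp
  finally show "(\<Sum>k<N. \<phi>' (Suc k) t) \<le> 2 * C * (\<Sum>k<N. \<phi> (Suc k) t) + C * B * exp ((2 * C + 1) * t)" by simp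
qed

text \<open>A bound \<open>D\<close> for the member \<open>k0\<close> propagates along the chain, and it can be made to decay on the
  way: \<open>\<phi> (k0 + j)\<close> stays below \<open>(\<epsilon> + D / 2\<^sup>j) exp (c t)\<close>. Halving the bound at every step is paid
  for by the larger rate \<open>c = 3 C + 1\<close>, which does not depend on \<open>j\<close>.\<close>

lemma chain_tendsto_zero:
  fixes \<phi> \<phi>' :: "nat \<Rightarrow> real \<Rightarrow> real"
  assumes der: "\<And>k t. t \<in> {0..T} \<Longrightarrow> (\<phi> k has_real_derivative \<phi>' k t) (at t within {0..T})"
    and nonneg: "\<And>k t. 0 \<le> \<phi> k t" and C: "0 \<le> C"
    and le: "\<And>k t. t \<in> {0..T} \<Longrightarrow> \<phi>' (Suc k) t \<le> C * (\<phi> (Suc k) t + \<phi> k t) + s k"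
    and s: "s \<longlonglongrightarrow> 0"
    and init: "(\<lambda>k. \<phi> k 0) \<longlonglongrightarrow> 0" and t: "t \<in> {0..T}"
  shows "(\<lambda>k. \<phi> k t) \<longlonglongrightarrow> 0"
proof (rule LIMSEQ_I)
  fix r :: real assume r: "r > 0"
  define c where "c = 3 * C + 1"
  define \<epsilon> where "\<epsilon> = r / (3 * exp (c * T))"
  have \<epsilon>: "\<epsilon> > 0" using r by (simp add: \<epsilon>_def)
  have "\<forall>\<^sub>F k in sequentially. \<phi> k 0 < \<epsilon> \<and> s k < \<epsilon>"
    using order_tendstoD(2)[OF s \<epsilon>] order_tendstoD(2)[OF init \<epsilon>] by eventually_elim auto
  then obtain k0 where k0: "\<And>k. k \<ge> k0 \<Longrightarrow> \<phi> k 0 < \<epsilon> \<and> s k < \<epsilon>"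
    by (auto simp: eventually_sequentially)
  have "continuous_on {0..T} (\<phi> k0)"
    using der by (meson DERIV_continuous_on)
  then have "compact (\<phi> k0 ` {0..T})" by (intro compact_continuous_image) auto
  then obtain D where D: "\<And>t. t \<in> {0..T} \<Longrightarrow> \<bar>\<phi> k0 t\<bar> \<le> D"
    using compact_imp_bounded bounded_iff by (metis image_eqI real_norm_def)
  have D0: "D \<ge> 0" using D[OF t] by linarith
  define M where "M j = \<epsilon> + D * (1 / 2) ^ j" for j :: nat
  \<comment> \<open>Losing at most a factor 2 from one step to the next is what the rate c absorbs.\<close>
  have M: "M j \<ge> \<epsilon>" "M j \<le> 2 * M (Suc j)" for j using D0 \<epsilon> by (auto simp: M_def)
  have claim: "\<phi> (k0 + j) t \<le> M j * exp (c * t)" if "t \<in> {0..T}" for j t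
    using that
  proof (induction j arbitrary: t)
    case 0
    have "\<phi> k0 t \<le> M 0 * 1" using D[OF 0] \<epsilon> by (simp add: M_def)
    also have "\<dots> \<le> M 0 * exp (c * t)" using 0 C D0 \<epsilon> by (intro mult_left_mono) (auto simp: M_def c_def)
    finally show ?case by simp
  next
    case (Suc j)
    show ?case
    proof (rule differential_inequality[where \<phi>' = "\<phi>' (k0 + Suc j)" and T = T and C = C and N = "(2 * C + 1) * M (Suc j)"])
      show "\<phi> (k0 + Suc j) 0 \<le> M (Suc j)" using k0[of "k0 + Suc j"] M(1)[of "Suc j"] by simp
      show "(2 * C + 1) * M (Suc j) \<le> (c - C) * M (Suc j)" by (simp add: c_def)
      fix t assume t: "t \<in> {0..T}"
      show "(\<phi> (k0 + Suc j) has_real_derivative \<phi>' (k0 + Suc j) t) (at t within {0..T})" by (rule der[OF t])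
      have e1: "1 \<le> exp (c * t)" using t C by (auto simp: c_def)
      have "\<phi>' (k0 + Suc j) t \<le> C * (\<phi> (k0 + Suc j) t + \<phi> (k0 + j) t) + s (k0 + j)"
        using le[OF t, of "k0 + j"] by simp
      also have "\<dots> \<le> C * (\<phi> (k0 + Suc j) t + 2 * M (Suc j) * exp (c * t)) + M (Suc j) * exp (c * t)"
      proof (intro add_mono mult_left_mono)
        have "M j * exp (c * t) \<le> 2 * M (Suc j) * exp (c * t)" using M(2)[of j] by (intro mult_right_mono) auto
        then show "\<phi> (k0 + j) t \<le> 2 * M (Suc j) * exp (c * t)" using Suc.IH[OF t] by linarith
        have "s (k0 + j) \<le> M (Suc j) * 1" using k0[of "k0 + j"] M(1)[of "Suc j"] by simp
        also have "\<dots> \<le> M (Suc j) * exp (c * t)" using e1 M(1)[of "Suc j"] \<epsilon> by (intro mult_left_mono) auto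
        finally show "s (k0 + j) \<le> M (Suc j) * exp (c * t)" .
      qed (use C in auto)
      finally show "\<phi>' (k0 + Suc j) t \<le> C * \<phi> (k0 + Suc j) t + (2 * C + 1) * M (Suc j) * exp (c * t)"
        by (simp add: algebra_simps)
    qed (use Suc.prems in auto)
  qed
  have "(\<lambda>j. D * (1 / 2) ^ j) \<longlonglongrightarrow> D * 0" by (intro tendsto_intros LIMSEQ_power_zero) auto
  then have "\<forall>\<^sub>F j in sequentially. D * (1 / 2) ^ j < \<epsilon>" using \<epsilon> by (intro order_tendstoD) auto
  then obtain j0 where j0: "\<And>j. j \<ge> j0 \<Longrightarrow> D * (1 / 2) ^ j < \<epsilon>" by (auto simp: eventually_sequentially)
  have "norm (\<phi> n t - 0) < r" if n: "n \<ge> k0 + j0" for n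
  proof -
    define j where "j = n - k0"
    have j: "n = k0 + j" "j \<ge> j0" using n by (auto simp: j_def)
    have "\<phi> n t \<le> M j * exp (c * t)" using claim[OF t] j by simp
    also have "\<dots> \<le> (2 * \<epsilon>) * exp (c * T)"
      using j0[OF j(2)] t \<epsilon> D0 C by (intro mult_mono) (auto simp: M_def c_def)
    also have "\<dots> < r" using r by (simp add: \<epsilon>_def)
    finally show ?thesis using nonneg[of n t] by simp
  qed
  then show "\<exists>no. \<forall>n\<ge>no. norm (\<phi> n t - 0) < r" by blast
qed

section \<open>The isospectral flow on solutions\<close>

text \<open>The lattice on a compact time interval with one-sided derivatives at both ends, a form that is
  stable under time reversal.\<close>

definition toda_on :: "real \<Rightarrow> (real \<Rightarrow> int \<Rightarrow> real) \<Rightarrow> (real \<Rightarrow> int \<Rightarrow> real) \<Rightarrow> bool" where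
  "toda_on T a b \<longleftrightarrow> 0 \<le> T \<and>
     (\<forall>t\<in>{0..T}. \<forall>n. a t n > 0 \<and>
        ((\<lambda>s. a s n) has_real_derivative a t n / 2 * (b t (n + 1) - b t n)) (at t within {0..T}) \<and>
        ((\<lambda>s. b s n) has_real_derivative (a t n)\<^sup>2 - (a t (n - 1))\<^sup>2) (at t within {0..T}))"

text \<open>Solutions of \<open>L(t) y = l y\<close> that are transported by \<open>y' = A y\<close>, where \<open>A\<close> is the skew-symmetric
  operator of the Lax pair.\<close>

definition toda_flow :: "real \<Rightarrow> (real \<Rightarrow> int \<Rightarrow> real) \<Rightarrow> (real \<Rightarrow> int \<Rightarrow> real) \<Rightarrow> complex \<Rightarrow>
    (real \<Rightarrow> int \<Rightarrow> complex) \<Rightarrow> bool" where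
  "toda_flow T a b l y \<longleftrightarrow>
     (\<forall>t\<in>{0..T}. jacobi_solution (a t) (b t) l (y t) \<and>
        (\<forall>n. ((\<lambda>s. y s n) has_vector_derivative
           (complex_of_real (a t n) * y t (n + 1) - complex_of_real (a t (n - 1)) * y t (n - 1)) / 2)
          (at t within {0..T})))"

lemma toda_onD:
  assumes "toda_on T a b"
  shows "0 \<le> T" "t \<in> {0..T} \<Longrightarrow> a t n > 0"
    "t \<in> {0..T} \<Longrightarrow> ((\<lambda>s. a s n) has_real_derivative a t n / 2 * (b t (n + 1) - b t n)) (at t within {0..T})"
    "t \<in> {0..T} \<Longrightarrow> ((\<lambda>s. b s n) has_real_derivative (a t n)\<^sup>2 - (a t (n - 1))\<^sup>2) (at t within {0..T})"
  using assms unfolding toda_on_def by auto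

lemma toda_on_continuous:
  assumes "toda_on T a b"
  shows "continuous_on {0..T} (\<lambda>t. a t n)" "continuous_on {0..T} (\<lambda>t. b t n)"
  by (rule DERIV_continuous_on, erule toda_onD(3)[OF assms])
     (rule DERIV_continuous_on, erule toda_onD(4)[OF assms])

lemma toda_on_bounded:
  assumes "toda_on T a b"
  obtains K where "\<And>t. t \<in> {0..T} \<Longrightarrow> \<bar>a t n\<bar> \<le> K \<and> \<bar>b t n\<bar> \<le> K"
proof -
  have "bounded ((\<lambda>t. a t n) ` {0..T})" "bounded ((\<lambda>t. b t n) ` {0..T})"
    by (auto intro!: compact_imp_bounded compact_continuous_image toda_on_continuous[OF assms])
  then obtain A B where "\<forall>x\<in>(\<lambda>t. a t n) ` {0..T}. norm x \<le> A" "\<forall>x\<in>(\<lambda>t. b t n) ` {0..T}. norm x \<le> B"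
    unfolding bounded_iff by blast
  then show ?thesis using that[of "max A B"] by (auto simp: le_max_iff_disj)
qed

lemma has_vector_derivative_of_real_mult:
  fixes g :: "real \<Rightarrow> complex"
  assumes "(f has_real_derivative f') (at t within S)" "(g has_vector_derivative g') (at t within S)"
  shows "((\<lambda>s. complex_of_real (f s) * g s) has_vector_derivative
    complex_of_real f' * g t + complex_of_real (f t) * g') (at t within S)"
  using has_vector_derivative_scaleR[OF assms] by (simp add: scaleR_conv_of_real add.commute)

lemma cmod_mult_le: "cmod c \<le> p \<Longrightarrow> cmod w \<le> q \<Longrightarrow> cmod (c * w) \<le> p * q"
  unfolding norm_mult by (intro mult_mono) (auto intro: order.trans[OF norm_ge_zero])

text \<open>The eigenvalue equation removes one neighbour from \<open>A y\<close>. In the first form the site \<open>n\<close> is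
  driven from the left, in the second from the right; using the first on the right half-line and
  the second on the left one, all estimates propagate away from the origin.\<close>

lemma flow_forms:
  assumes "jacobi_solution a b l y"
  shows "(complex_of_real (a n) * y (n + 1) - complex_of_real (a (n - 1)) * y (n - 1)) / 2
      = (l - complex_of_real (b n)) / 2 * y n - complex_of_real (a (n - 1)) * y (n - 1)"
    "(complex_of_real (a n) * y (n + 1) - complex_of_real (a (n - 1)) * y (n - 1)) / 2
      = - (l - complex_of_real (b n)) / 2 * y n + complex_of_real (a n) * y (n + 1)"
proof -
  have "complex_of_real (a (n - 1)) * y (n - 1) + complex_of_real (b n) * y n
       + complex_of_real (a n) * y (n + 1) = l * y n"
    using assms unfolding jacobi_solution_def jacobi_def by blast
  then have e: "complex_of_real (a n) * y (n + 1) = l * y n - complex_of_real (a (n - 1)) * y (n - 1) - complex_of_real (b n) * y n"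
    by (simp add: algebra_simps)
  show "(complex_of_real (a n) * y (n + 1) - complex_of_real (a (n - 1)) * y (n - 1)) / 2
      = (l - complex_of_real (b n)) / 2 * y n - complex_of_real (a (n - 1)) * y (n - 1)"
    "(complex_of_real (a n) * y (n + 1) - complex_of_real (a (n - 1)) * y (n - 1)) / 2
      = - (l - complex_of_real (b n)) / 2 * y n + complex_of_real (a n) * y (n + 1)"
    unfolding e by (simp_all add: field_simps)
qed

text \<open>At the sites \<open>-1\<close> and \<open>0\<close> the two forms of the flow close up to a linear system of two
  differential equations. Its solution is extended to all sites by the recurrence, at each time
  separately. That the extension still satisfies the flow equation passes from two neighbouring
  sites to the next one; this is the Lax equation, computed site by site.\<close>

lemma toda_flow_exists:
  assumes toda: "toda_on T a b" and y0: "jacobi_solution (a 0) (b 0) l y0"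
  obtains y where "toda_flow T a b l y" "y 0 = y0"
proof -
  note T = toda_onD(1)[OF toda] and pos = toda_onD(2)[OF toda] and da = toda_onD(3)[OF toda] and db = toda_onD(4)[OF toda]
  note ca = toda_on_continuous(1)[OF toda] and cb = toda_on_continuous(2)[OF toda]
  obtain K1 where K1: "\<And>t. t \<in> {0..T} \<Longrightarrow> \<bar>a t (-1)\<bar> \<le> K1 \<and> \<bar>b t (-1)\<bar> \<le> K1"
    using toda_on_bounded[OF toda, of "-1"] by blast
  obtain K2 where K2: "\<And>t. t \<in> {0..T} \<Longrightarrow> \<bar>a t 0\<bar> \<le> K2 \<and> \<bar>b t 0\<bar> \<le> K2"
    using toda_on_bounded[OF toda, of "0"] by blast
  define G where "G s x = (- (l - complex_of_real (b s (-1))) / 2 * fst x + complex_of_real (a s (-1)) * snd x,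
       (l - complex_of_real (b s 0)) / 2 * snd x - complex_of_real (a s (-1)) * fst x)" for s and x :: "complex \<times> complex"
  define K where "K = cmod l + 3 * K1 + K2"
  have K10: "K1 \<ge> 0" "K2 \<ge> 0" using K1[of 0] K2[of 0] T by auto
  have Glip: "norm (G s x - G s y) \<le> K * norm (x - y)" if s: "s \<in> {0..T}" for s x y
  proof -
    have l1: "norm (- (l - complex_of_real (b s (-1))) / 2) \<le> cmod l / 2 + K1 / 2"
      using norm_triangle_ineq4[of l "complex_of_real (b s (-1))"] K1[OF s]
      by (simp add: norm_divide norm_minus_commute)
    have l2: "norm ((l - complex_of_real (b s 0)) / 2) \<le> cmod l / 2 + K2 / 2"
      using norm_triangle_ineq4[of l "complex_of_real (b s 0)"] K2[OF s]
      by (simp add: norm_divide)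
    have l3: "norm (complex_of_real (a s (-1))) \<le> K1" using K1[OF s] by simp
    have fs: "cmod (fst (x - y)) \<le> norm (x - y)" "cmod (snd (x - y)) \<le> norm (x - y)"
      using norm_fst_le[of "fst (x - y)" "snd (x - y)"] norm_snd_le[of "snd (x - y)" "fst (x - y)"]
      by (simp_all only: prod.collapse)
    have e: "G s x - G s y = (- (l - complex_of_real (b s (-1))) / 2 * fst (x - y) + complex_of_real (a s (-1)) * snd (x - y),
       (l - complex_of_real (b s 0)) / 2 * snd (x - y) - complex_of_real (a s (-1)) * fst (x - y))"
      by (simp add: G_def field_simps)
    have "norm (G s x - G s y) \<le> norm (- (l - complex_of_real (b s (-1))) / 2 * fst (x - y) + complex_of_real (a s (-1)) * snd (x - y))
       + norm ((l - complex_of_real (b s 0)) / 2 * snd (x - y) - complex_of_real (a s (-1)) * fst (x - y))"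
      unfolding e by (rule norm_Pair_le)
    also have "\<dots> \<le> ((cmod l / 2 + K1 / 2) * norm (x - y) + K1 * norm (x - y))
       + ((cmod l / 2 + K2 / 2) * norm (x - y) + K1 * norm (x - y))"
      by (intro add_mono order.trans[OF norm_triangle_ineq] order.trans[OF norm_triangle_ineq4]
          cmod_mult_le l1 l2 l3 fs)
    also have "\<dots> = (cmod l + 5/2 * K1 + K2 / 2) * norm (x - y)" by (simp add: algebra_simps)
    also have "\<dots> \<le> K * norm (x - y)" unfolding K_def using K10 by (intro mult_right_mono) auto
    finally show ?thesis .
  qed
  have Gcont: "continuous_on {0..T} (\<lambda>s. G s (x s))" if "continuous_on {0..T} x" for x
    unfolding G_def by (intro continuous_intros that ca cb) auto
  have K0: "0 \<le> K" using K10 by (simp add: K_def)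
  \<comment> \<open>The sites -1 and 0: the second form of the flow at -1 and the first form at 0 involve
    only these two sites.\<close>
  obtain X where X0: "X 0 = (y0 (-1), y0 0)"
    and X: "\<And>t. t \<in> {0..T} \<Longrightarrow> (X has_vector_derivative G t (X t)) (at t within {0..T})"
    using lipschitz_ode_exists[OF T K0 Gcont Glip, where ?x0.0 = "(y0 (-1), y0 0)"] by blast
  have "\<forall>t\<in>{0..T}. \<exists>y. jacobi_solution (a t) (b t) l y \<and> y (-1) = fst (X t) \<and> y (-1 + 1) = snd (X t)"
    using pos by (metis jacobi_solution_exists)
  then obtain y where y: "\<And>t. t \<in> {0..T} \<Longrightarrow> jacobi_solution (a t) (b t) l (y t) \<and> y t (-1) = fst (X t) \<and> y t (-1 + 1) = snd (X t)"
    by metis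
  have t0: "0 \<in> {0..T}" using T by simp
  have y00: "y 0 = y0"
    by (rule jacobi_solution_unique[where m = "-1"]) (use y[OF t0] y0 pos[OF t0] X0 in auto)
  define Q where "Q n \<longleftrightarrow> (\<forall>t\<in>{0..T}. ((\<lambda>s. y s n) has_vector_derivative
           (complex_of_real (a t n) * y t (n + 1) - complex_of_real (a t (n - 1)) * y t (n - 1)) / 2)
          (at t within {0..T}))" for n
  have Q1: "Q (-1)" unfolding Q_def
  proof
    fix t assume t: "t \<in> {0..T}"
    have "((\<lambda>s. fst (X s)) has_vector_derivative fst (G t (X t))) (at t within {0..T})"
      using bounded_linear.has_vector_derivative[OF bounded_linear_fst X[OF t]] .
    then have "((\<lambda>s. y s (-1)) has_vector_derivative fst (G t (X t))) (at t within {0..T})"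
      by (rule has_vector_derivative_transform[OF t, rotated]) (use y in auto)
    then show "((\<lambda>s. y s (-1)) has_vector_derivative
           (complex_of_real (a t (-1)) * y t (-1 + 1) - complex_of_real (a t (-1 - 1)) * y t (-1 - 1)) / 2)
          (at t within {0..T})"
      unfolding flow_forms(2)[OF y[OF t, THEN conjunct1]] using y[OF t] by (simp add: G_def)
  qed
  have Q0: "Q (-1 + 1)" unfolding Q_def
  proof
    fix t assume t: "t \<in> {0..T}"
    have "((\<lambda>s. snd (X s)) has_vector_derivative snd (G t (X t))) (at t within {0..T})"
      using bounded_linear.has_vector_derivative[OF bounded_linear_snd X[OF t]] .
    then have "((\<lambda>s. y s (-1 + 1)) has_vector_derivative snd (G t (X t))) (at t within {0..T})"
      by (rule has_vector_derivative_transform[OF t, rotated]) (use y in auto)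
    then show "((\<lambda>s. y s (-1 + 1)) has_vector_derivative
           (complex_of_real (a t (-1 + 1)) * y t (-1 + 1 + 1) - complex_of_real (a t (-1 + 1 - 1)) * y t (-1 + 1 - 1)) / 2)
          (at t within {0..T})"
      unfolding flow_forms(1)[OF y[OF t, THEN conjunct1]] using y[OF t] by (simp add: G_def)
  qed
  have up: "Q (n + 1)" if h: "Q (n - 1)" "Q n" for n
    unfolding Q_def
  proof
    fix t assume t: "t \<in> {0..T}"
    note sol = y[OF t, THEN conjunct1]
    define A where "A = complex_of_real (a t n)"
    define Am where "Am = complex_of_real (a t (n - 1))"
    define B where "B = complex_of_real (b t n)"
    define Bm where "Bm = complex_of_real (b t (n - 1))"
    define Bp where "Bp = complex_of_real (b t (n + 1))"
    define p where "p = y t n"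
    define q where "q = y t (n - 1)"
    define W where "W = (l - B) * p - Am * q"
    have A0: "A \<noteq> 0" using pos[OF t, of n] by (simp add: A_def)
    have dp: "((\<lambda>s. y s n) has_vector_derivative (l - B) / 2 * p - Am * q) (at t within {0..T})"
      using h(2)[unfolded Q_def, rule_format, OF t] unfolding flow_forms(1)[OF sol] by (simp add: B_def p_def Am_def q_def)
    have dq: "((\<lambda>s. y s (n - 1)) has_vector_derivative - (l - Bm) / 2 * q + Am * p) (at t within {0..T})"
      using h(1)[unfolded Q_def, rule_format, OF t] unfolding flow_forms(2)[OF sol] by (simp add: Bm_def p_def Am_def q_def)
    have dB: "((\<lambda>s. l - complex_of_real (b s n)) has_vector_derivative - (A\<^sup>2 - Am\<^sup>2)) (at t within {0..T})"
      using has_vector_derivative_diff[OF has_vector_derivative_const has_vector_derivative_of_real[OF db[OF t, of n]]]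
      by (simp add: A_def Am_def)
    have dBp: "((\<lambda>s. (l - complex_of_real (b s n)) * y s n) has_vector_derivative
        (l - B) * ((l - B) / 2 * p - Am * q) + - (A\<^sup>2 - Am\<^sup>2) * p) (at t within {0..T})"
      using has_vector_derivative_mult[OF dB dp] by (simp add: B_def p_def)
    have dAq: "((\<lambda>s. complex_of_real (a s (n - 1)) * y s (n - 1)) has_vector_derivative
        Am / 2 * (B - Bm) * q + Am * (- (l - Bm) / 2 * q + Am * p)) (at t within {0..T})"
      using has_vector_derivative_of_real_mult[OF da[OF t, of "n - 1"] dq] by (simp add: B_def Bm_def Am_def q_def)
    \<comment> \<open>The recurrence expresses a t n * y t (n + 1) as W; its derivative is computed from the sites
      n - 1 and n.\<close>
    have dW: "((\<lambda>s. (l - complex_of_real (b s n)) * y s n - complex_of_real (a s (n - 1)) * y s (n - 1))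
        has_vector_derivative (l - B) / 2 * W - A\<^sup>2 * p) (at t within {0..T})"
    proof -
      have e: "(l - B) * ((l - B) / 2 * p - Am * q) + - (A\<^sup>2 - Am\<^sup>2) * p - (Am / 2 * (B - Bm) * q + Am * (- (l - Bm) / 2 * q + Am * p))
          = (l - B) / 2 * W - A\<^sup>2 * p"
        by (simp add: W_def field_simps power2_eq_square)
      show ?thesis using has_vector_derivative_diff[OF dBp dAq] unfolding e .
    qed
    have di: "((\<lambda>s. inverse (a s n)) has_real_derivative - (inverse (a t n) * (a t n / 2 * (b t (n + 1) - b t n)) * inverse (a t n))) (at t within {0..T})"
      using pos[OF t, of n] by (intro DERIV_inverse' da t) auto
    have "((\<lambda>s. complex_of_real (inverse (a s n)) * ((l - complex_of_real (b s n)) * y s n - complex_of_real (a s (n - 1)) * y s (n - 1)))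
       has_vector_derivative
       complex_of_real (- (inverse (a t n) * (a t n / 2 * (b t (n + 1) - b t n)) * inverse (a t n))) * W + complex_of_real (inverse (a t n)) * ((l - B) / 2 * W - A\<^sup>2 * p))
      (at t within {0..T})"
      using has_vector_derivative_of_real_mult[OF di dW] by (simp add: W_def B_def p_def Am_def q_def)
    then have d1: "((\<lambda>s. y s (n + 1)) has_vector_derivative
       complex_of_real (- (inverse (a t n) * (a t n / 2 * (b t (n + 1) - b t n)) * inverse (a t n))) * W + complex_of_real (inverse (a t n)) * ((l - B) / 2 * W - A\<^sup>2 * p))
      (at t within {0..T})"
    proof (rule has_vector_derivative_transform[OF t, rotated])
      fix s assume s: "s \<in> {0..T}"
      show "y s (n + 1) = complex_of_real (inverse (a s n)) * ((l - complex_of_real (b s n)) * y s n - complex_of_real (a s (n - 1)) * y s (n - 1))"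
        using jacobi_up[OF y[OF s, THEN conjunct1] pos[OF s]] by (simp add: divide_inverse mult.commute)
    qed
    have Wy: "W = A * y t (n + 1)" using jacobi_up[OF sol pos[OF t], of n] A0 by (simp add: W_def A_def B_def Am_def p_def q_def)
    have e2: "complex_of_real (- (inverse (a t n) * (a t n / 2 * (b t (n + 1) - b t n)) * inverse (a t n))) * W + complex_of_real (inverse (a t n)) * ((l - B) / 2 * W - A\<^sup>2 * p)
       = (l - Bp) / 2 * y t (n + 1) - A * p"
    proof -
      have "complex_of_real (- (inverse (a t n) * (a t n / 2 * (b t (n + 1) - b t n)) * inverse (a t n))) * W + complex_of_real (inverse (a t n)) * ((l - B) / 2 * W - A\<^sup>2 * p)
        = - (inverse A * (A / 2 * (Bp - B)) * inverse A) * W + inverse A * ((l - B) / 2 * W - A\<^sup>2 * p)"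
        by (simp add: A_def Bp_def B_def)
      also have "\<dots> = (l - Bp) / 2 * y t (n + 1) - A * p"
        unfolding Wy using A0 by (simp add: field_simps power2_eq_square)
      finally show ?thesis .
    qed
    show "((\<lambda>s. y s (n + 1)) has_vector_derivative
           (complex_of_real (a t (n + 1)) * y t (n + 1 + 1) - complex_of_real (a t (n + 1 - 1)) * y t (n + 1 - 1)) / 2)
          (at t within {0..T})"
      using d1 unfolding flow_forms(1)[OF sol] e2 by (simp add: Bp_def A_def p_def)
  qed
  have down: "Q (n - 1)" if h: "Q n" "Q (n + 1)" for n
    unfolding Q_def
  proof
    fix t assume t: "t \<in> {0..T}"
    note sol = y[OF t, THEN conjunct1]
    define A where "A = complex_of_real (a t n)"
    define Am where "Am = complex_of_real (a t (n - 1))"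
    define B where "B = complex_of_real (b t n)"
    define Bm where "Bm = complex_of_real (b t (n - 1))"
    define Bp where "Bp = complex_of_real (b t (n + 1))"
    define p where "p = y t n"
    define q where "q = y t (n + 1)"
    define W where "W = (l - B) * p - A * q"
    have A0: "Am \<noteq> 0" using pos[OF t, of "n - 1"] by (simp add: Am_def)
    have dp: "((\<lambda>s. y s n) has_vector_derivative - (l - B) / 2 * p + A * q) (at t within {0..T})"
      using h(1)[unfolded Q_def, rule_format, OF t] unfolding flow_forms(2)[OF sol] by (simp add: B_def p_def A_def q_def)
    have dq: "((\<lambda>s. y s (n + 1)) has_vector_derivative (l - Bp) / 2 * q - A * p) (at t within {0..T})"
      using h(2)[unfolded Q_def, rule_format, OF t] unfolding flow_forms(1)[OF sol] by (simp add: Bp_def p_def A_def q_def)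
    have dB: "((\<lambda>s. l - complex_of_real (b s n)) has_vector_derivative - (A\<^sup>2 - Am\<^sup>2)) (at t within {0..T})"
      using has_vector_derivative_diff[OF has_vector_derivative_const has_vector_derivative_of_real[OF db[OF t, of n]]]
      by (simp add: A_def Am_def)
    have dBp: "((\<lambda>s. (l - complex_of_real (b s n)) * y s n) has_vector_derivative
        (l - B) * (- (l - B) / 2 * p + A * q) + - (A\<^sup>2 - Am\<^sup>2) * p) (at t within {0..T})"
      using has_vector_derivative_mult[OF dB dp] by (simp add: B_def p_def)
    have dAq: "((\<lambda>s. complex_of_real (a s n) * y s (n + 1)) has_vector_derivative
        A / 2 * (Bp - B) * q + A * ((l - Bp) / 2 * q - A * p)) (at t within {0..T})"
      using has_vector_derivative_of_real_mult[OF da[OF t, of "n"] dq] by (simp add: B_def Bp_def A_def q_def)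
    have dW: "((\<lambda>s. (l - complex_of_real (b s n)) * y s n - complex_of_real (a s n) * y s (n + 1))
        has_vector_derivative - (l - B) / 2 * W + Am\<^sup>2 * p) (at t within {0..T})"
    proof -
      have e: "(l - B) * (- (l - B) / 2 * p + A * q) + - (A\<^sup>2 - Am\<^sup>2) * p - (A / 2 * (Bp - B) * q + A * ((l - Bp) / 2 * q - A * p))
          = - (l - B) / 2 * W + Am\<^sup>2 * p"
        by (simp add: W_def field_simps power2_eq_square)
      show ?thesis using has_vector_derivative_diff[OF dBp dAq] unfolding e .
    qed
    have di: "((\<lambda>s. inverse (a s (n - 1))) has_real_derivative - (inverse (a t (n - 1)) * (a t (n - 1) / 2 * (b t n - b t (n - 1))) * inverse (a t (n - 1)))) (at t within {0..T})"
      using pos[OF t, of "n - 1"] da[OF t, of "n - 1"] by (intro DERIV_inverse') auto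
    have "((\<lambda>s. complex_of_real (inverse (a s (n - 1))) * ((l - complex_of_real (b s n)) * y s n - complex_of_real (a s n) * y s (n + 1)))
       has_vector_derivative
       complex_of_real (- (inverse (a t (n - 1)) * (a t (n - 1) / 2 * (b t n - b t (n - 1))) * inverse (a t (n - 1)))) * W + complex_of_real (inverse (a t (n - 1))) * (- (l - B) / 2 * W + Am\<^sup>2 * p))
      (at t within {0..T})"
      using has_vector_derivative_of_real_mult[OF di dW] by (simp add: W_def B_def p_def A_def q_def)
    then have d1: "((\<lambda>s. y s (n - 1)) has_vector_derivative
       complex_of_real (- (inverse (a t (n - 1)) * (a t (n - 1) / 2 * (b t n - b t (n - 1))) * inverse (a t (n - 1)))) * W + complex_of_real (inverse (a t (n - 1))) * (- (l - B) / 2 * W + Am\<^sup>2 * p))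
      (at t within {0..T})"
    proof (rule has_vector_derivative_transform[OF t, rotated])
      fix s assume s: "s \<in> {0..T}"
      show "y s (n - 1) = complex_of_real (inverse (a s (n - 1))) * ((l - complex_of_real (b s n)) * y s n - complex_of_real (a s n) * y s (n + 1))"
        using jacobi_down[OF y[OF s, THEN conjunct1] pos[OF s]] by (simp add: divide_inverse mult.commute)
    qed
    have Wy: "W = Am * y t (n - 1)" using jacobi_down[OF sol pos[OF t], of n] A0 by (simp add: W_def A_def B_def Am_def p_def q_def)
    have e2: "complex_of_real (- (inverse (a t (n - 1)) * (a t (n - 1) / 2 * (b t n - b t (n - 1))) * inverse (a t (n - 1)))) * W + complex_of_real (inverse (a t (n - 1))) * (- (l - B) / 2 * W + Am\<^sup>2 * p)
       = - (l - Bm) / 2 * y t (n - 1) + Am * p"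
    proof -
      have "complex_of_real (- (inverse (a t (n - 1)) * (a t (n - 1) / 2 * (b t n - b t (n - 1))) * inverse (a t (n - 1)))) * W + complex_of_real (inverse (a t (n - 1))) * (- (l - B) / 2 * W + Am\<^sup>2 * p)
        = - (inverse Am * (Am / 2 * (B - Bm)) * inverse Am) * W + inverse Am * (- (l - B) / 2 * W + Am\<^sup>2 * p)"
        by (simp add: Am_def Bm_def B_def)
      also have "\<dots> = - (l - Bm) / 2 * y t (n - 1) + Am * p"
        unfolding Wy using A0 by (simp add: field_simps power2_eq_square)
      finally show ?thesis .
    qed
    show "((\<lambda>s. y s (n - 1)) has_vector_derivative
           (complex_of_real (a t (n - 1)) * y t (n - 1 + 1) - complex_of_real (a t (n - 1 - 1)) * y t (n - 1 - 1)) / 2)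
          (at t within {0..T})"
      using d1 unfolding flow_forms(2)[OF sol] e2 by (simp add: Bm_def Am_def p_def)
  qed
  have "Q n" for n by (rule int_pair_induct[where m = "-1" and Q = Q]) (use Q1 Q0 up down in auto)
  then have "toda_flow T a b l y" unfolding toda_flow_def Q_def using y by blast
  then show ?thesis using that y00 by blast
qed

lemma toda_flowD:
  assumes "toda_flow T a b l y" "t \<in> {0..T}"
  shows "jacobi_solution (a t) (b t) l (y t)"
    "((\<lambda>s. y s n) has_vector_derivative
      (l - complex_of_real (b t n)) / 2 * y t n - complex_of_real (a t (n - 1)) * y t (n - 1)) (at t within {0..T})"
    "((\<lambda>s. y s n) has_vector_derivative
      - (l - complex_of_real (b t n)) / 2 * y t n + complex_of_real (a t n) * y t (n + 1)) (at t within {0..T})"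
    "((\<lambda>s. y s n) has_vector_derivative
       (complex_of_real (a t n) * y t (n + 1) - complex_of_real (a t (n - 1)) * y t (n - 1)) / 2) (at t within {0..T})"
proof -
  show s: "jacobi_solution (a t) (b t) l (y t)" using assms unfolding toda_flow_def by blast
  show d: "((\<lambda>s. y s n) has_vector_derivative
       (complex_of_real (a t n) * y t (n + 1) - complex_of_real (a t (n - 1)) * y t (n - 1)) / 2) (at t within {0..T})"
    using assms unfolding toda_flow_def by blast
  show "((\<lambda>s. y s n) has_vector_derivative
      (l - complex_of_real (b t n)) / 2 * y t n - complex_of_real (a t (n - 1)) * y t (n - 1)) (at t within {0..T})"
    using d unfolding flow_forms(1)[OF s] .
  show "((\<lambda>s. y s n) has_vector_derivative
      - (l - complex_of_real (b t n)) / 2 * y t n + complex_of_real (a t n) * y t (n + 1)) (at t within {0..T})"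
    using d unfolding flow_forms(2)[OF s] .
qed

text \<open>With the second form of the flow at \<open>n\<close> and the first at \<open>n + 1\<close> no other sites enter, and the
  contributions of \<open>b\<close> cancel the derivative of \<open>a t n\<close>.\<close>

lemma toda_flow_wronskian:
  assumes toda: "toda_on T a b" and u: "toda_flow T a b l u" and v: "toda_flow T a b l v" and t: "t \<in> {0..T}"
  shows "wronskian (a t) (u t) (v t) n = wronskian (a 0) (u 0) (v 0) n"
proof -
  have "((\<lambda>s. wronskian (a s) (u s) (v s) n) has_vector_derivative 0) (at s within {0..T})" if s: "s \<in> {0..T}" for s
  proof -
    define A where "A = complex_of_real (a s n)"
    define B where "B = complex_of_real (b s n)"
    define Bp where "Bp = complex_of_real (b s (n + 1))"
    define u0 where "u0 = u s n"
    define u1 where "u1 = u s (n + 1)"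
    define v0 where "v0 = v s n"
    define v1 where "v1 = v s (n + 1)"
    have du0: "((\<lambda>s. u s n) has_vector_derivative - (l - B) / 2 * u0 + A * u1) (at s within {0..T})"
      using toda_flowD(3)[OF u s, of n] by (simp add: B_def A_def u0_def u1_def)
    have dv0: "((\<lambda>s. v s n) has_vector_derivative - (l - B) / 2 * v0 + A * v1) (at s within {0..T})"
      using toda_flowD(3)[OF v s, of n] by (simp add: B_def A_def v0_def v1_def)
    have du1: "((\<lambda>s. u s (n + 1)) has_vector_derivative (l - Bp) / 2 * u1 - A * u0) (at s within {0..T})"
      using toda_flowD(2)[OF u s, of "n + 1"] by (simp add: Bp_def A_def u0_def u1_def)
    have dv1: "((\<lambda>s. v s (n + 1)) has_vector_derivative (l - Bp) / 2 * v1 - A * v0) (at s within {0..T})"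
      using toda_flowD(2)[OF v s, of "n + 1"] by (simp add: Bp_def A_def v0_def v1_def)
    have "((\<lambda>s. complex_of_real (a s n) * (u s n * v s (n + 1) - u s (n + 1) * v s n)) has_vector_derivative
       complex_of_real (a s n / 2 * (b s (n + 1) - b s n)) * (u0 * v1 - u1 * v0) +
       A * (u0 * ((l - Bp) / 2 * v1 - A * v0) + (- (l - B) / 2 * u0 + A * u1) * v1
         - (u1 * (- (l - B) / 2 * v0 + A * v1) + ((l - Bp) / 2 * u1 - A * u0) * v0))) (at s within {0..T})"
      using has_vector_derivative_of_real_mult[OF toda_onD(3)[OF toda s, of n]
        has_vector_derivative_diff[OF has_vector_derivative_mult[OF du0 dv1] has_vector_derivative_mult[OF du1 dv0]]]
      by (simp add: A_def u0_def u1_def v0_def v1_def)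
    moreover have "complex_of_real (a s n / 2 * (b s (n + 1) - b s n)) * (u0 * v1 - u1 * v0) +
       A * (u0 * ((l - Bp) / 2 * v1 - A * v0) + (- (l - B) / 2 * u0 + A * u1) * v1
         - (u1 * (- (l - B) / 2 * v0 + A * v1) + ((l - Bp) / 2 * u1 - A * u0) * v0)) = 0"
    proof -
      have e: "complex_of_real (a s n / 2 * (b s (n + 1) - b s n)) = A / 2 * (Bp - B)" by (simp add: A_def Bp_def B_def)
      show ?thesis unfolding e by (simp add: field_simps)
    qed
    ultimately show ?thesis unfolding wronskian_def by simp
  qed
  then obtain c where c: "\<And>s. s \<in> {0..T} \<Longrightarrow> wronskian (a s) (u s) (v s) n = c"
    using has_vector_derivative_zero_constant[of "{0..T}" "\<lambda>s. wronskian (a s) (u s) (v s) n"] by auto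
  have "0 \<in> {0..T}" using toda_onD(1)[OF toda] by simp
  then show ?thesis using c t by metis
qed

section \<open>Estimates for the flow\<close>

lemma norm_power2_has_real_derivative:
  fixes y :: "real \<Rightarrow> complex"
  assumes "(y has_vector_derivative y') (at t within S)"
  shows "((\<lambda>s. (cmod (y s))\<^sup>2) has_real_derivative 2 * Re (cnj (y t) * y')) (at t within S)"
proof -
  have d: "((\<lambda>s. Re (y s)) has_real_derivative Re y') (at t within S)"
    "((\<lambda>s. Im (y s)) has_real_derivative Im y') (at t within S)"
    using bounded_linear.has_vector_derivative[OF bounded_linear_Re assms]
      bounded_linear.has_vector_derivative[OF bounded_linear_Im assms]
    unfolding has_real_derivative_iff_has_vector_derivative by auto
  show ?thesis unfolding cmod_power2
    using DERIV_add[OF DERIV_power[OF d(1), of 2] DERIV_power[OF d(2), of 2]]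
    by (simp add: mult_ac distrib_left)
qed

lemma two_mult_le_squares: "2 * ((x::real) * y) \<le> x\<^sup>2 + y\<^sup>2"
  using zero_le_power2[of "x - y"] by (simp add: power2_diff)

text \<open>The growth of \<open>\<bar>u\<bar>\<^sup>2\<close> under \<open>u' = c u + d v + e\<close>.\<close>

lemma growth_rate_bound:
  "2 * Re (cnj u * (c * u + d * v + e)) \<le> (2 * cmod c + cmod d + 1) * ((cmod u)\<^sup>2 + (cmod v)\<^sup>2) + (cmod e)\<^sup>2"
proof -
  have "Re (cnj u * (c * u + d * v + e)) \<le> cmod (cnj u * (c * u + d * v + e))" by (rule complex_Re_le_cmod)
  also have "\<dots> \<le> cmod u * (cmod c * cmod u + cmod d * cmod v + cmod e)"
    unfolding norm_mult complex_mod_cnj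
    by (intro mult_left_mono order.trans[OF norm_triangle_ineq] add_mono)
       (auto simp: norm_mult intro: order.trans[OF norm_triangle_ineq])
  finally have "2 * Re (cnj u * (c * u + d * v + e)) \<le> 2 * (cmod u * (cmod c * cmod u + cmod d * cmod v + cmod e))" by simp
  also have "\<dots> = 2 * cmod c * (cmod u)\<^sup>2 + cmod d * (2 * (cmod u * cmod v)) + 2 * (cmod u * cmod e)"
    by (simp add: algebra_simps power2_eq_square)
  also have "\<dots> \<le> 2 * cmod c * (cmod u)\<^sup>2 + cmod d * ((cmod u)\<^sup>2 + (cmod v)\<^sup>2) + ((cmod u)\<^sup>2 + (cmod e)\<^sup>2)"
    by (intro add_mono mult_left_mono two_mult_le_squares) auto
  also have "\<dots> \<le> (2 * cmod c + cmod d + 1) * ((cmod u)\<^sup>2 + (cmod v)\<^sup>2) + (cmod e)\<^sup>2"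
    by (simp add: algebra_simps)
  finally show ?thesis .
qed

lemma toda_flow_bounded:
  assumes "toda_flow T a b l y"
  obtains B where "\<And>t. t \<in> {0..T} \<Longrightarrow> (cmod (y t n))\<^sup>2 \<le> B"
proof -
  have "continuous_on {0..T} (\<lambda>t. y t n)"
    unfolding continuous_on_eq_continuous_within
    using toda_flowD(4)[OF assms] has_vector_derivative_continuous by blast
  then have "continuous_on {0..T} (\<lambda>t. (cmod (y t n))\<^sup>2)" by (intro continuous_intros)
  then have "bounded ((\<lambda>t. (cmod (y t n))\<^sup>2) ` {0..T})"
    by (auto intro!: compact_imp_bounded compact_continuous_image)
  then obtain B where "\<forall>x\<in>(\<lambda>t. (cmod (y t n))\<^sup>2) ` {0..T}. norm x \<le> B" unfolding bounded_iff by blast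
  then show ?thesis using that[of B] by auto
qed

lemma sum_symmetric_interval:
  fixes f :: "int \<Rightarrow> real"
  shows "(\<Sum>n\<in>{- int N..int N}. f n) = f 0 + (\<Sum>k<N. f (int (Suc k))) + (\<Sum>k<N. f (- int (Suc k)))"
proof (induction N)
  case (Suc N)
  have "{- int (Suc N)..int (Suc N)} = insert (int (Suc N)) (insert (- int (Suc N)) {- int N..int N})" by auto
  then have "(\<Sum>n\<in>{- int (Suc N)..int (Suc N)}. f n) = f (int (Suc N)) + (f (- int (Suc N)) + (\<Sum>n\<in>{- int N..int N}. f n))"
    by (simp del: of_nat_Suc)
  then show ?case using Suc by (simp del: of_nat_Suc)
qed auto

lemma finite_int_subset_symmetric:
  assumes "finite (G :: int set)"
  obtains N where "G \<subseteq> {- int N..int N}"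
proof -
  obtain B where B: "\<forall>n\<in>G. \<bar>n\<bar> \<le> B" using assms by (metis finite_int_iff_bounded_le subsetD atMost_iff image_eqI)
  have "G \<subseteq> {- int (nat B)..int (nat B)}" using B by fastforce
  then show ?thesis using that by blast
qed

text \<open>With a nonzero limit the partial sums would grow linearly.\<close>

lemma bounded_partial_sums_limit_zero:
  fixes x :: "nat \<Rightarrow> real"
  assumes x: "x \<longlonglongrightarrow> d" and bd: "\<And>M. \<bar>\<Sum>k<M. x k\<bar> \<le> C"
  shows "d = 0"
proof (rule ccontr)
  assume "d \<noteq> 0"
  define s where "s = sgn d"
  have sd: "s * d = \<bar>d\<bar>" "\<bar>s\<bar> = 1" using \<open>d \<noteq> 0\<close> by (auto simp: s_def sgn_if)
  have "(\<lambda>k. s * x k) \<longlonglongrightarrow> \<bar>d\<bar>" unfolding sd(1)[symmetric] by (intro tendsto_intros x)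
  then have "\<forall>\<^sub>F k in sequentially. s * x k > \<bar>d\<bar> / 2" using \<open>d \<noteq> 0\<close> by (intro order_tendstoD) auto
  then obtain k0 where k0: "\<And>k. k \<ge> k0 \<Longrightarrow> s * x k > \<bar>d\<bar> / 2" by (auto simp: eventually_sequentially)
  have low: "s * (\<Sum>k<k0 + j. x k) \<ge> s * (\<Sum>k<k0. x k) + real j * (\<bar>d\<bar> / 2)" for j
  proof (induction j)
    case (Suc j)
    have "s * (\<Sum>k<k0 + Suc j. x k) = s * (\<Sum>k<k0 + j. x k) + s * x (k0 + j)" by (simp add: distrib_left)
    moreover have "real (Suc j) * (\<bar>d\<bar> / 2) = real j * (\<bar>d\<bar> / 2) + \<bar>d\<bar> / 2" by (simp add: field_simps)
    ultimately show ?case using Suc k0[of "k0 + j"] by linarith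
  qed auto
  obtain j :: nat where j: "2 * C < real j * (\<bar>d\<bar> / 2)"
    using reals_Archimedean3[of "\<bar>d\<bar> / 2"] \<open>d \<noteq> 0\<close> by (metis half_gt_zero zero_less_abs_iff)
  have "\<bar>s * (\<Sum>k<M. x k)\<bar> \<le> C" for M using bd[of M] sd(2) by (simp add: abs_mult)
  from this[of "k0 + j"] this[of k0] low[of j] j show False by linarith
qed

context
  fixes T K :: real and a b :: "real \<Rightarrow> int \<Rightarrow> real"
  assumes toda: "toda_on T a b"
    and bnd: "\<And>t n. t \<in> {0..T} \<Longrightarrow> \<bar>a t n\<bar> \<le> K \<and> \<bar>b t n\<bar> \<le> K"
begin

lemma coeff_bound_nonneg: "0 \<le> K"
  using bnd[of 0 0] toda_onD(1)[OF toda] by auto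

lemma half_rate_bound:
  assumes "t \<in> {0..T}"
  shows "2 * cmod ((l - complex_of_real (b t n)) / 2) \<le> cmod l + K"
    "2 * cmod (- (l - complex_of_real (b t n)) / 2) \<le> cmod l + K"
  using norm_triangle_ineq4[of l "complex_of_real (b t n)"] bnd[OF assms, of n]
  by (simp_all add: norm_divide norm_minus_commute)

text \<open>Here the first form of the flow provides the chain.\<close>

lemma toda_flow_right_bound:
  assumes y: "toda_flow T a b l y" and S: "\<And>N. (\<Sum>k<N. (cmod (y 0 (int (Suc k))))\<^sup>2) \<le> S"
  obtains M where "\<And>t N. t \<in> {0..T} \<Longrightarrow> (\<Sum>k<N. (cmod (y t (int (Suc k))))\<^sup>2) \<le> M"
proof -
  define C where "C = cmod l + K + K + 1"
  have C: "0 \<le> C" using coeff_bound_nonneg by (simp add: C_def)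
  obtain B where B: "\<And>t. t \<in> {0..T} \<Longrightarrow> (cmod (y t 0))\<^sup>2 \<le> B" using toda_flow_bounded[OF y] by metis
  define \<phi> where "\<phi> k t = (cmod (y t (int k)))\<^sup>2" for k t
  define \<phi>' where "\<phi>' k t = 2 * Re (cnj (y t (int k)) * ((l - complex_of_real (b t (int k))) / 2 * y t (int k) - complex_of_real (a t (int k - 1)) * y t (int k - 1)))" for k t
  have main: "(\<Sum>k<N. \<phi> (Suc k) t) \<le> (S + C * B) * exp ((2 * C + 1) * t)" if t: "t \<in> {0..T}" for t N
  proof (rule chain_sum_bound[where \<phi>' = \<phi>' and T = T])
    fix k t assume t: "t \<in> {0..T}"
    show "(\<phi> k has_real_derivative \<phi>' k t) (at t within {0..T})"
      unfolding \<phi>_def[abs_def] \<phi>'_def by (intro norm_power2_has_real_derivative toda_flowD(2)[OF y t])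
    have "\<phi>' (Suc k) t = 2 * Re (cnj (y t (int (Suc k))) * ((l - complex_of_real (b t (int (Suc k)))) / 2 * y t (int (Suc k)) + (- complex_of_real (a t (int k))) * y t (int k) + 0))"
      by (simp add: \<phi>'_def)
    also have "\<dots> \<le> (2 * cmod ((l - complex_of_real (b t (int (Suc k)))) / 2) + cmod (- complex_of_real (a t (int k))) + 1) * ((cmod (y t (int (Suc k))))\<^sup>2 + (cmod (y t (int k)))\<^sup>2) + (cmod 0)\<^sup>2"
      by (rule growth_rate_bound)
    also have "\<dots> \<le> C * (\<phi> (Suc k) t + \<phi> k t)"
      unfolding \<phi>_def C_def using half_rate_bound(1)[OF t, of l "int (Suc k)"] bnd[OF t, of "int k"]
      by (simp del: of_nat_Suc) (intro mult_right_mono, auto)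
    finally show "\<phi>' (Suc k) t \<le> C * (\<phi> (Suc k) t + \<phi> k t)" .
  qed (use C B S t in \<open>auto simp: \<phi>_def\<close>)
  have "(\<Sum>k<N. (cmod (y t (int (Suc k))))\<^sup>2) \<le> (S + C * B) * exp ((2 * C + 1) * T)" if t: "t \<in> {0..T}" for t N
  proof -
    have "0 \<le> S" using S[of 0] by simp
    moreover have "0 \<le> B" using B[OF t] zero_le_power2 order.trans by blast
    ultimately have "(S + C * B) * exp ((2 * C + 1) * t) \<le> (S + C * B) * exp ((2 * C + 1) * T)"
      using t C by (intro mult_left_mono) (auto intro!: mult_left_mono)
    then show ?thesis using main[OF t, of N] unfolding \<phi>_def by linarith
  qed
  then show ?thesis using that by blast
qed

text \<open>The mirror image, with the second form of the flow.\<close>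

lemma toda_flow_left_bound:
  assumes y: "toda_flow T a b l y" and S: "\<And>N. (\<Sum>k<N. (cmod (y 0 (- int (Suc k))))\<^sup>2) \<le> S"
  obtains M where "\<And>t N. t \<in> {0..T} \<Longrightarrow> (\<Sum>k<N. (cmod (y t (- int (Suc k))))\<^sup>2) \<le> M"
proof -
  define C where "C = cmod l + K + K + 1"
  have C: "0 \<le> C" using coeff_bound_nonneg by (simp add: C_def)
  obtain B where B: "\<And>t. t \<in> {0..T} \<Longrightarrow> (cmod (y t 0))\<^sup>2 \<le> B" using toda_flow_bounded[OF y] by metis
  define \<phi> where "\<phi> k t = (cmod (y t (- int k)))\<^sup>2" for k t
  define \<phi>' where "\<phi>' k t = 2 * Re (cnj (y t (- int k)) * (- (l - complex_of_real (b t (- int k))) / 2 * y t (- int k) + complex_of_real (a t (- int k)) * y t (- int k + 1)))" for k t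
  have main: "(\<Sum>k<N. \<phi> (Suc k) t) \<le> (S + C * B) * exp ((2 * C + 1) * t)" if t: "t \<in> {0..T}" for t N
  proof (rule chain_sum_bound[where \<phi>' = \<phi>' and T = T])
    fix k t assume t: "t \<in> {0..T}"
    show "(\<phi> k has_real_derivative \<phi>' k t) (at t within {0..T})"
      unfolding \<phi>_def[abs_def] \<phi>'_def by (intro norm_power2_has_real_derivative toda_flowD(3)[OF y t])
    have "\<phi>' (Suc k) t = 2 * Re (cnj (y t (- int (Suc k))) * (- (l - complex_of_real (b t (- int (Suc k)))) / 2 * y t (- int (Suc k)) + complex_of_real (a t (- int (Suc k))) * y t (- int k) + 0))"
      by (simp add: \<phi>'_def)
    also have "\<dots> \<le> (2 * cmod (- (l - complex_of_real (b t (- int (Suc k)))) / 2) + cmod (complex_of_real (a t (- int (Suc k)))) + 1) * ((cmod (y t (- int (Suc k))))\<^sup>2 + (cmod (y t (- int k)))\<^sup>2) + (cmod 0)\<^sup>2"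
      by (rule growth_rate_bound)
    also have "\<dots> \<le> C * (\<phi> (Suc k) t + \<phi> k t)"
      unfolding \<phi>_def C_def using half_rate_bound(2)[OF t, of l "- int (Suc k)"] bnd[OF t, of "- int (Suc k)"]
      by (simp del: of_nat_Suc) (intro mult_right_mono, auto)
    finally show "\<phi>' (Suc k) t \<le> C * (\<phi> (Suc k) t + \<phi> k t)" .
  qed (use C B S t in \<open>auto simp: \<phi>_def\<close>)
  have "(\<Sum>k<N. (cmod (y t (- int (Suc k))))\<^sup>2) \<le> (S + C * B) * exp ((2 * C + 1) * T)" if t: "t \<in> {0..T}" for t N
  proof -
    have "0 \<le> S" using S[of 0] by simp
    moreover have "0 \<le> B" using B[OF t] zero_le_power2 order.trans by blast
    ultimately have "(S + C * B) * exp ((2 * C + 1) * t) \<le> (S + C * B) * exp ((2 * C + 1) * T)"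
      using t C by (intro mult_left_mono) (auto intro!: mult_left_mono)
    then show ?thesis using main[OF t, of N] unfolding \<phi>_def by linarith
  qed
  then show ?thesis using that by blast
qed

text \<open>Write \<open>y\<^sub>-\<^sub>k z\<^sup>-\<^sup>k = E(t) + v\<^sub>k(t)\<close> with \<open>E(t) = exp (\<theta> t)\<close>. By the second form of the flow \<open>v\<^sub>k\<close> is
  driven by \<open>v\<^sub>k\<^sub>-\<^sub>1\<close>. For \<open>a = 1\<close> and \<open>b = 0\<close> the terms in \<open>E\<close> cancel, because \<open>1/z - l/2 = \<theta>\<close>; in
  general they leave a remainder that tends to 0 uniformly in \<open>t\<close>, which the chain estimate
  tolerates.\<close>

lemma toda_flow_left_asymptotics:
  fixes z :: complex and e :: "nat \<Rightarrow> real"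
  assumes y: "toda_flow T a b (z + inverse z) y" and z: "z \<noteq> 0"
    and e: "e \<longlonglongrightarrow> 0" "\<And>t k. t \<in> {0..T} \<Longrightarrow> \<bar>a t (- int k) - 1\<bar> + \<bar>b t (- int k)\<bar> \<le> e k"
    and init: "(\<lambda>k. y 0 (- int k) * z powi (- int k)) \<longlonglongrightarrow> 1" and t: "t \<in> {0..T}"
  shows "(\<lambda>k. y t (- int k) * z powi (- int k)) \<longlonglongrightarrow> exp ((inverse z - z) / 2 * complex_of_real t)"
proof -
  define l where "l = z + inverse z"
  define \<theta> where "\<theta> = (inverse z - z) / 2"
  define E where "E t = exp (\<theta> * complex_of_real t)" for t
  define v where "v k t = y t (- int k) * z powi (- int k) - E t" for k t
  define v' where "v' k t = - (l - complex_of_real (b t (- int k))) / 2 * v k t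
     + complex_of_real (a t (- int k)) * inverse z * (y t (- int k + 1) * z powi (- int k + 1) - E t)
     + E t * (complex_of_real (b t (- int k)) / 2 + complex_of_real (a t (- int k) - 1) * inverse z)" for k t
  define C where "C = cmod l + K + K * cmod (inverse z) + 1"
  define D where "D = exp (cmod \<theta> * T) * (1 + cmod (inverse z))"
  have C: "0 \<le> C" using coeff_bound_nonneg by (simp add: C_def)
  have lth: "\<theta> = inverse z - l / 2" by (simp add: \<theta>_def l_def field_simps)
  have dE: "(E has_vector_derivative \<theta> * E t) (at t within {0..T})" for t
  proof -
    have 1: "((\<lambda>s. \<theta> * complex_of_real s) has_vector_derivative \<theta>) (at t within {0..T})"
      by (auto intro!: derivative_eq_intros)
    show ?thesis unfolding E_def
      using field_vector_diff_chain_within[OF 1 DERIV_subset[OF DERIV_exp subset_UNIV]]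
      by (simp add: o_def mult.commute)
  qed
  have dv: "(v k has_vector_derivative v' k t) (at t within {0..T})" if t: "t \<in> {0..T}" for k t
  proof -
    define \<zeta> where "\<zeta> = z powi (- int k)"
    have zz: "\<zeta> = inverse z * z powi (- int k + 1)"
      unfolding \<zeta>_def using power_int_add_1[of z "- int k"] z by (simp add: field_simps)
    have "((\<lambda>s. y s (- int k) * \<zeta> - E s) has_vector_derivative
       (- (l - complex_of_real (b t (- int k))) / 2 * y t (- int k) + complex_of_real (a t (- int k)) * y t (- int k + 1)) * \<zeta> - \<theta> * E t) (at t within {0..T})"
      by (intro has_vector_derivative_diff dE has_vector_derivative_mult_left toda_flowD(3)[OF y t, folded l_def])
    moreover have "(- (l - complex_of_real (b t (- int k))) / 2 * y t (- int k) + complex_of_real (a t (- int k)) * y t (- int k + 1)) * \<zeta> - \<theta> * E t = v' k t"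
    proof -
      have "complex_of_real (a t (- int k)) * y t (- int k + 1) * \<zeta>
          = complex_of_real (a t (- int k)) * inverse z * (y t (- int k + 1) * z powi (- int k + 1))"
        by (subst zz) (simp only: mult_ac)
      then have "(- (l - complex_of_real (b t (- int k))) / 2 * y t (- int k) + complex_of_real (a t (- int k)) * y t (- int k + 1)) * \<zeta> - \<theta> * E t
        = - (l - complex_of_real (b t (- int k))) / 2 * (y t (- int k) * \<zeta>) + complex_of_real (a t (- int k)) * inverse z * (y t (- int k + 1) * z powi (- int k + 1)) - \<theta> * E t"
        by (simp only: distrib_right mult.assoc)
      also have "\<dots> = v' k t" unfolding v'_def v_def \<zeta>_def[symmetric] lth by (simp add: algebra_simps diff_divide_distrib add_divide_distrib)
      finally show ?thesis .
    qed
    ultimately show ?thesis unfolding v_def \<zeta>_def[symmetric] by simp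
  qed
  define \<phi> where "\<phi> k t = (cmod (v k t))\<^sup>2" for k t
  define \<phi>' where "\<phi>' k t = 2 * Re (cnj (v k t) * v' k t)" for k t
  have main: "(\<lambda>k. \<phi> k t) \<longlonglongrightarrow> 0"
  proof (rule chain_tendsto_zero[where \<phi>' = \<phi>' and T = T and s = "\<lambda>k. (D * e (Suc k))\<^sup>2" and C = C])
    fix k t assume t: "t \<in> {0..T}"
    show "(\<phi> k has_real_derivative \<phi>' k t) (at t within {0..T})"
      unfolding \<phi>_def[abs_def] \<phi>'_def by (intro norm_power2_has_real_derivative dv t)
    define r where "r = E t * (complex_of_real (b t (- int (Suc k))) / 2 + complex_of_real (a t (- int (Suc k)) - 1) * inverse z)"
    have En: "cmod (E t) \<le> exp (cmod \<theta> * T)"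
    proof -
      have "cmod (E t) \<le> exp (cmod (\<theta> * complex_of_real t))" unfolding E_def by (rule norm_exp)
      also have "\<dots> \<le> exp (cmod \<theta> * T)" using t by (auto simp: norm_mult intro!: mult_left_mono)
      finally show ?thesis .
    qed
    have r: "cmod r \<le> D * e (Suc k)"
    proof -
      define \<epsilon> where "\<epsilon> = e (Suc k)"
      have ee: "\<bar>a t (- int (Suc k)) - 1\<bar> + \<bar>b t (- int (Suc k))\<bar> \<le> \<epsilon>" unfolding \<epsilon>_def by (rule e(2)[OF t])
      have "cmod (complex_of_real (b t (- int (Suc k))) / 2 + complex_of_real (a t (- int (Suc k)) - 1) * inverse z)
         \<le> \<bar>b t (- int (Suc k))\<bar> / 2 + \<bar>a t (- int (Suc k)) - 1\<bar> * cmod (inverse z)"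
        by (intro order.trans[OF norm_triangle_ineq] add_mono) (simp_all add: norm_mult norm_divide del: of_nat_Suc of_real_diff)
      also have "\<dots> \<le> \<epsilon> + \<epsilon> * cmod (inverse z)"
        using ee by (intro add_mono mult_right_mono) auto
      finally have q: "cmod (complex_of_real (b t (- int (Suc k))) / 2 + complex_of_real (a t (- int (Suc k)) - 1) * inverse z)
         \<le> (1 + cmod (inverse z)) * \<epsilon>" by (simp add: algebra_simps)
      have "cmod r \<le> exp (cmod \<theta> * T) * ((1 + cmod (inverse z)) * \<epsilon>)"
        unfolding r_def norm_mult by (intro mult_mono En q) auto
      then show ?thesis by (simp add: D_def \<epsilon>_def mult_ac)
    qed
    have "\<phi>' (Suc k) t = 2 * Re (cnj (v (Suc k) t) * (- (l - complex_of_real (b t (- int (Suc k)))) / 2 * v (Suc k) t + (complex_of_real (a t (- int (Suc k))) * inverse z) * v k t + r))"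
      by (simp add: \<phi>'_def v'_def v_def r_def)
    also have "\<dots> \<le> (2 * cmod (- (l - complex_of_real (b t (- int (Suc k)))) / 2) + cmod (complex_of_real (a t (- int (Suc k))) * inverse z) + 1) * ((cmod (v (Suc k) t))\<^sup>2 + (cmod (v k t))\<^sup>2) + (cmod r)\<^sup>2"
      by (rule growth_rate_bound)
    also have "\<dots> \<le> C * (\<phi> (Suc k) t + \<phi> k t) + (D * e (Suc k))\<^sup>2"
    proof (intro add_mono power_mono r)
      have "cmod (complex_of_real (a t (- int (Suc k))) * inverse z) \<le> K * cmod (inverse z)"
        unfolding norm_mult using bnd[OF t, of "- int (Suc k)"] by (intro mult_right_mono) auto
      then show "(2 * cmod (- (l - complex_of_real (b t (- int (Suc k)))) / 2) + cmod (complex_of_real (a t (- int (Suc k))) * inverse z) + 1) * ((cmod (v (Suc k) t))\<^sup>2 + (cmod (v k t))\<^sup>2)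
         \<le> C * (\<phi> (Suc k) t + \<phi> k t)"
        unfolding \<phi>_def C_def using half_rate_bound(2)[OF t, of l "- int (Suc k)"]
        by (intro mult_right_mono) auto
    qed auto
    finally show "\<phi>' (Suc k) t \<le> C * (\<phi> (Suc k) t + \<phi> k t) + (D * e (Suc k))\<^sup>2" .
  next
    have "(\<lambda>k. (D * e (Suc k))\<^sup>2) \<longlonglongrightarrow> (D * 0)\<^sup>2" by (intro tendsto_intros LIMSEQ_Suc e(1))
    then show "(\<lambda>k. (D * e (Suc k))\<^sup>2) \<longlonglongrightarrow> 0" by simp
    have "(\<lambda>k. (cmod (y 0 (- int k) * z powi (- int k) - 1))\<^sup>2) \<longlonglongrightarrow> (cmod (1 - 1))\<^sup>2" by (intro tendsto_intros init)
    then show "(\<lambda>k. \<phi> k 0) \<longlonglongrightarrow> 0" by (simp add: \<phi>_def v_def E_def)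
  qed (use C t in \<open>auto simp: \<phi>_def\<close>)
  have "(\<lambda>k. sqrt ((cmod (v k t))\<^sup>2)) \<longlonglongrightarrow> sqrt 0" using main unfolding \<phi>_def by (intro tendsto_intros)
  then have "(\<lambda>k. v k t) \<longlonglongrightarrow> 0" by (simp add: tendsto_norm_zero_iff)
  then have "(\<lambda>k. v k t + E t) \<longlonglongrightarrow> 0 + E t" by (intro tendsto_intros)
  then show ?thesis by (simp add: v_def E_def \<theta>_def)
qed

text \<open>The sites \<open>-1\<close> and \<open>0\<close> form a closed system, so continuous dependence on the spectral parameter
  and on the initial values is Gronwall's inequality for the difference of two flows there.\<close>

lemma toda_flow_tendsto:
  fixes y :: "nat \<Rightarrow> real \<Rightarrow> int \<Rightarrow> complex"
  assumes y: "\<And>i. toda_flow T a b (l i) (y i)" and x: "toda_flow T a b l0 x"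
    and l: "l \<longlonglongrightarrow> l0" and init: "(\<lambda>i. y i 0 (-1)) \<longlonglongrightarrow> x 0 (-1)" "(\<lambda>i. y i 0 0) \<longlonglongrightarrow> x 0 0"
    and t: "t \<in> {0..T}"
  shows "(\<lambda>i. y i t (-1)) \<longlonglongrightarrow> x t (-1)" "(\<lambda>i. y i t 0) \<longlonglongrightarrow> x t 0"
proof -
  obtain L where L: "\<And>i. cmod (l i) \<le> L"
    using convergent_imp_Bseq[OF convergentI[OF l]] by (auto simp: Bseq_def)
  have L0: "0 \<le> L" using L[of 0] norm_ge_zero order.trans by blast
  obtain B1 where B1: "\<And>t. t \<in> {0..T} \<Longrightarrow> (cmod (x t (-1)))\<^sup>2 \<le> B1" using toda_flow_bounded[OF x] by metis
  obtain B2 where B2: "\<And>t. t \<in> {0..T} \<Longrightarrow> (cmod (x t 0))\<^sup>2 \<le> B2" using toda_flow_bounded[OF x] by metis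
  define B where "B = B1 + B2"
  define C where "C = 2 * (L + K + K + 1)"
  define p where "p i t = y i t (-1) - x t (-1)" for i t
  define q where "q i t = y i t 0 - x t 0" for i t
  define p' where "p' i t = - (l i - complex_of_real (b t (-1))) / 2 * p i t + complex_of_real (a t (-1)) * q i t + (- (l i - l0) / 2 * x t (-1))" for i t
  define q' where "q' i t = (l i - complex_of_real (b t 0)) / 2 * q i t + (- complex_of_real (a t (-1))) * p i t + (l i - l0) / 2 * x t 0" for i t
  define \<phi> where "\<phi> i t = (cmod (p i t))\<^sup>2 + (cmod (q i t))\<^sup>2" for i t
  define \<phi>' where "\<phi>' i t = 2 * Re (cnj (p i t) * p' i t) + 2 * Re (cnj (q i t) * q' i t)" for i t
  define M where "M i = \<phi> i 0 + (cmod (l i - l0))\<^sup>2 * B" for i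
  have B0: "0 \<le> B" using B1[OF t] B2[OF t] unfolding B_def by (meson add_nonneg_nonneg order.trans zero_le_power2)
  have bound: "\<phi> i t \<le> M i * exp ((C + 1) * t)" for i
  proof (rule differential_inequality[where \<phi>' = "\<phi>' i" and T = T and C = C and N = "(cmod (l i - l0))\<^sup>2 * B"])
    show "\<phi> i 0 \<le> M i" unfolding M_def using B0 by simp
    show "(cmod (l i - l0))\<^sup>2 * B \<le> (C + 1 - C) * M i" by (simp add: M_def \<phi>_def)
    show "t \<in> {0..T}" by fact
    fix t assume t: "t \<in> {0..T}"
    have dp: "(p i has_vector_derivative p' i t) (at t within {0..T})"
    proof -
      have "- (l i - complex_of_real (b t (-1))) / 2 * y i t (-1) + complex_of_real (a t (-1)) * y i t (-1 + 1)
          - (- (l0 - complex_of_real (b t (-1))) / 2 * x t (-1) + complex_of_real (a t (-1)) * x t (-1 + 1)) = p' i t"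
        by (simp add: p'_def p_def q_def field_simps)
      then show ?thesis unfolding p_def
        using has_vector_derivative_diff[OF toda_flowD(3)[OF y[of i] t, of "-1"] toda_flowD(3)[OF x t, of "-1"]] by simp
    qed
    have dq: "(q i has_vector_derivative q' i t) (at t within {0..T})"
    proof -
      have "(l i - complex_of_real (b t 0)) / 2 * y i t 0 - complex_of_real (a t (0 - 1)) * y i t (0 - 1)
          - ((l0 - complex_of_real (b t 0)) / 2 * x t 0 - complex_of_real (a t (0 - 1)) * x t (0 - 1)) = q' i t"
        by (simp add: q'_def p_def q_def field_simps)
      then show ?thesis unfolding q_def
        using has_vector_derivative_diff[OF toda_flowD(2)[OF y[of i] t, of "0"] toda_flowD(2)[OF x t, of "0"]] by simp
    qed
    show "(\<phi> i has_real_derivative \<phi>' i t) (at t within {0..T})"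
      unfolding \<phi>_def[abs_def] \<phi>'_def by (intro DERIV_add norm_power2_has_real_derivative dp dq)
    have P: "2 * Re (cnj (p i t) * p' i t) \<le> (L + K + K + 1) * \<phi> i t + (cmod (- (l i - l0) / 2 * x t (-1)))\<^sup>2"
    proof -
      have "2 * Re (cnj (p i t) * p' i t) \<le> (2 * cmod (- (l i - complex_of_real (b t (-1))) / 2) + cmod (complex_of_real (a t (-1))) + 1) * ((cmod (p i t))\<^sup>2 + (cmod (q i t))\<^sup>2) + (cmod (- (l i - l0) / 2 * x t (-1)))\<^sup>2"
        unfolding p'_def by (rule growth_rate_bound)
      also have "\<dots> \<le> (L + K + K + 1) * \<phi> i t + (cmod (- (l i - l0) / 2 * x t (-1)))\<^sup>2"
        unfolding \<phi>_def using half_rate_bound(2)[OF t, of "l i" "-1"] bnd[OF t, of "-1"] L[of i]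
        by (intro add_mono mult_right_mono) auto
      finally show ?thesis .
    qed
    have Q: "2 * Re (cnj (q i t) * q' i t) \<le> (L + K + K + 1) * \<phi> i t + (cmod ((l i - l0) / 2 * x t 0))\<^sup>2"
    proof -
      have "2 * Re (cnj (q i t) * q' i t) \<le> (2 * cmod ((l i - complex_of_real (b t 0)) / 2) + cmod (- complex_of_real (a t (-1))) + 1) * ((cmod (q i t))\<^sup>2 + (cmod (p i t))\<^sup>2) + (cmod ((l i - l0) / 2 * x t 0))\<^sup>2"
        unfolding q'_def by (rule growth_rate_bound)
      also have "\<dots> \<le> (L + K + K + 1) * \<phi> i t + (cmod ((l i - l0) / 2 * x t 0))\<^sup>2"
        unfolding \<phi>_def add.commute[of "(cmod (q i t))\<^sup>2"] using half_rate_bound(1)[OF t, of "l i" "0"] bnd[OF t, of "-1"] L[of i]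
        by (intro add_mono mult_right_mono) auto
      finally show ?thesis .
    qed
    have "(cmod (- (l i - l0) / 2 * x t (-1)))\<^sup>2 + (cmod ((l i - l0) / 2 * x t 0))\<^sup>2
      = (cmod (l i - l0))\<^sup>2 * (((cmod (x t (-1)))\<^sup>2 + (cmod (x t 0))\<^sup>2) / 4)"
      by (simp only: norm_mult norm_divide norm_minus_cancel norm_numeral power_mult_distrib power_divide)
         (simp add: algebra_simps add_divide_distrib)
    also have "\<dots> \<le> (cmod (l i - l0))\<^sup>2 * B"
    proof (rule mult_left_mono)
      have "(cmod (x t (-1)))\<^sup>2 + (cmod (x t 0))\<^sup>2 \<le> B" using B1[OF t] B2[OF t] unfolding B_def by linarith
      then show "((cmod (x t (-1)))\<^sup>2 + (cmod (x t 0))\<^sup>2) / 4 \<le> B"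
        using zero_le_power2[of "cmod (x t (-1))"] zero_le_power2[of "cmod (x t 0)"] B0 by (simp add: field_simps)
    qed auto
    finally have E: "(cmod (- (l i - l0) / 2 * x t (-1)))\<^sup>2 + (cmod ((l i - l0) / 2 * x t 0))\<^sup>2 \<le> (cmod (l i - l0))\<^sup>2 * B" .
    have "1 \<le> exp ((C + 1) * t)" using t L0 coeff_bound_nonneg by (auto simp: C_def)
    then have "(cmod (l i - l0))\<^sup>2 * B * 1 \<le> (cmod (l i - l0))\<^sup>2 * B * exp ((C + 1) * t)"
      using B0 by (intro mult_left_mono) auto
    moreover have "C * \<phi> i t = (L + K + K + 1) * \<phi> i t + (L + K + K + 1) * \<phi> i t" by (simp add: C_def)
    ultimately show "\<phi>' i t \<le> C * \<phi> i t + (cmod (l i - l0))\<^sup>2 * B * exp ((C + 1) * t)"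
      using P Q E unfolding \<phi>'_def by linarith
  qed
  have "(\<lambda>i. ((cmod (y i 0 (-1) - x 0 (-1)))\<^sup>2 + (cmod (y i 0 0 - x 0 0))\<^sup>2 + (cmod (l i - l0))\<^sup>2 * B) * exp ((C + 1) * t))
     \<longlonglongrightarrow> ((cmod (x 0 (-1) - x 0 (-1)))\<^sup>2 + (cmod (x 0 0 - x 0 0))\<^sup>2 + (cmod (l0 - l0))\<^sup>2 * B) * exp ((C + 1) * t)"
    by (intro tendsto_intros init l)
  then have Mlim: "(\<lambda>i. M i * exp ((C + 1) * t)) \<longlonglongrightarrow> 0" by (simp add: M_def \<phi>_def p_def q_def)
  have sq: "(\<lambda>i. w i) \<longlonglongrightarrow> w0" if "\<And>i. (cmod (w i - w0))\<^sup>2 \<le> \<phi> i t" for w :: "nat \<Rightarrow> complex" and w0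
  proof -
    have "(\<lambda>i. (cmod (w i - w0))\<^sup>2) \<longlonglongrightarrow> 0"
      by (rule tendsto_sandwich[OF _ _ tendsto_const Mlim]; intro always_eventually allI)
         (simp, rule order.trans[OF that bound])
    then have "(\<lambda>i. sqrt ((cmod (w i - w0))\<^sup>2)) \<longlonglongrightarrow> sqrt 0" by (intro tendsto_intros)
    then show ?thesis by (simp add: tendsto_norm_zero_iff LIM_zero_iff)
  qed
  show "(\<lambda>i. y i t (-1)) \<longlonglongrightarrow> x t (-1)" by (rule sq) (simp add: \<phi>_def p_def)
  show "(\<lambda>i. y i t 0) \<longlonglongrightarrow> x t 0" by (rule sq) (simp add: \<phi>_def q_def)
qed

text \<open>The bound is uniform in \<open>t\<close>, which is what the comparison of the times \<open>0\<close> and \<open>t\<close> in the proof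
  of norm conservation needs.\<close>

lemma toda_flow_summable:
  assumes y: "toda_flow T a b l y" and init: "(\<lambda>n. (cmod (y 0 n))\<^sup>2) summable_on UNIV"
  obtains B where "\<And>t G. t \<in> {0..T} \<Longrightarrow> finite G \<Longrightarrow> (\<Sum>n\<in>G. (cmod (y t n))\<^sup>2) \<le> B"
proof -
  define S where "S = infsum (\<lambda>n. (cmod (y 0 n))\<^sup>2) UNIV"
  have "(\<Sum>k<N. (cmod (y 0 (int (Suc k))))\<^sup>2) \<le> S" for N
  proof -
    have "(\<Sum>k<N. (cmod (y 0 (int (Suc k))))\<^sup>2) = (\<Sum>n\<in>(\<lambda>k. int (Suc k)) ` {..<N}. (cmod (y 0 n))\<^sup>2)"
      by (subst sum.reindex) (auto simp: inj_on_def)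
    also have "\<dots> \<le> S" unfolding S_def by (intro finite_sum_le_infsum init) auto
    finally show ?thesis .
  qed
  then obtain M1 where M1: "\<And>t N. t \<in> {0..T} \<Longrightarrow> (\<Sum>k<N. (cmod (y t (int (Suc k))))\<^sup>2) \<le> M1"
    using toda_flow_right_bound[OF y] by metis
  have "(\<Sum>k<N. (cmod (y 0 (- int (Suc k))))\<^sup>2) \<le> S" for N
  proof -
    have "(\<Sum>k<N. (cmod (y 0 (- int (Suc k))))\<^sup>2) = (\<Sum>n\<in>(\<lambda>k. - int (Suc k)) ` {..<N}. (cmod (y 0 n))\<^sup>2)"
      by (subst sum.reindex) (auto simp: inj_on_def)
    also have "\<dots> \<le> S" unfolding S_def by (intro finite_sum_le_infsum init) auto
    finally show ?thesis .
  qed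
  then obtain M2 where M2: "\<And>t N. t \<in> {0..T} \<Longrightarrow> (\<Sum>k<N. (cmod (y t (- int (Suc k))))\<^sup>2) \<le> M2"
    using toda_flow_left_bound[OF y] by metis
  obtain B0 where B0: "\<And>t. t \<in> {0..T} \<Longrightarrow> (cmod (y t 0))\<^sup>2 \<le> B0" using toda_flow_bounded[OF y] by metis
  have "(\<Sum>n\<in>G. (cmod (y t n))\<^sup>2) \<le> B0 + M1 + M2" if t: "t \<in> {0..T}" and G: "finite G" for t G
  proof -
    obtain N where "G \<subseteq> {- int N..int N}" using finite_int_subset_symmetric[OF G] by blast
    then have "(\<Sum>n\<in>G. (cmod (y t n))\<^sup>2) \<le> (\<Sum>n\<in>{- int N..int N}. (cmod (y t n))\<^sup>2)"
      by (intro sum_mono2) auto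
    also have "\<dots> \<le> B0 + M1 + M2" unfolding sum_symmetric_interval
      by (intro add_mono B0 M1 M2 t)
    finally show ?thesis .
  qed
  then show ?thesis using that by blast
qed

text \<open>As \<open>A\<close> is skew-symmetric, the sum of squares over \<open>{-N..N}\<close> changes only by the currents \<open>J\<close>
  through the two ends. These are not known to be small uniformly in \<open>t\<close> for a given \<open>N\<close>, but their
  sum over all \<open>N\<close> is bounded by a multiple of the total sum of squares. So the differences
  \<open>S N t - S N 0\<close> have bounded partial sums, which forces their limit to be 0.\<close>

lemma toda_flow_norm:
  assumes y: "toda_flow T a b l y" and init: "(\<lambda>n. (cmod (y 0 n))\<^sup>2) summable_on UNIV" and t: "t \<in> {0..T}"
  shows "(\<lambda>n. (cmod (y t n))\<^sup>2) summable_on UNIV"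
    "infsum (\<lambda>n. (cmod (y t n))\<^sup>2) UNIV = infsum (\<lambda>n. (cmod (y 0 n))\<^sup>2) UNIV"
proof -
  obtain B where B: "\<And>t G. t \<in> {0..T} \<Longrightarrow> finite G \<Longrightarrow> (\<Sum>n\<in>G. (cmod (y t n))\<^sup>2) \<le> B"
    using toda_flow_summable[OF y init] by metis
  show sm: "(\<lambda>n. (cmod (y t n))\<^sup>2) summable_on UNIV"
    by (rule nonneg_bdd_above_summable_on) (use B[OF t] in \<open>auto intro!: bdd_aboveI\<close>)
  define J where "J n s = a s n * Re (cnj (y s n) * y s (n + 1))" for n s
  define S where "S N s = (\<Sum>n\<in>{- int N..int N}. (cmod (y s n))\<^sup>2)" for N s
  have dS: "(S N has_real_derivative J (int N) s - J (- int N - 1) s) (at s within {0..T})" if s: "s \<in> {0..T}" for N s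
  proof -
    have "(S N has_real_derivative (\<Sum>n\<in>{- int N..int N}. 2 * Re (cnj (y s n) *
       ((complex_of_real (a s n) * y s (n + 1) - complex_of_real (a s (n - 1)) * y s (n - 1)) / 2)))) (at s within {0..T})"
      unfolding S_def[abs_def] by (intro DERIV_sum norm_power2_has_real_derivative toda_flowD(4)[OF y s])
    moreover have "2 * Re (cnj (y s n) * ((complex_of_real (a s n) * y s (n + 1) - complex_of_real (a s (n - 1)) * y s (n - 1)) / 2))
        = J n s - J (n - 1) s" for n
      by (simp add: J_def field_simps)
    moreover have "(\<Sum>n\<in>{- int N..int N}. J n s - J (n - 1) s) = J (int N) s - J (- int N - 1) s"
    proof (induction N)
      case (Suc N)
      have "{- int (Suc N)..int (Suc N)} = insert (int (Suc N)) (insert (- int (Suc N)) {- int N..int N})" by auto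
      then have "(\<Sum>n\<in>{- int (Suc N)..int (Suc N)}. J n s - J (n - 1) s) = J (int (Suc N)) s - J (int (Suc N) - 1) s + (J (- int (Suc N)) s - J (- int (Suc N) - 1) s + (\<Sum>n\<in>{- int N..int N}. J n s - J (n - 1) s))"
        by (simp del: of_nat_Suc)
      moreover have "- int N - 1 = - int (Suc N)" by simp
      ultimately show ?case using Suc by simp
    qed auto
    ultimately show ?thesis by (simp only:)
  qed
  have Jb: "\<bar>J n s\<bar> \<le> K * ((cmod (y s n))\<^sup>2 + (cmod (y s (n + 1)))\<^sup>2)" if s: "s \<in> {0..T}" for n s
  proof -
    have "\<bar>Re (cnj (y s n) * y s (n + 1))\<bar> \<le> cmod (y s n) * cmod (y s (n + 1))"
      using abs_Re_le_cmod[of "cnj (y s n) * y s (n + 1)"] by (simp add: norm_mult)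
    also have "\<dots> \<le> (cmod (y s n))\<^sup>2 + (cmod (y s (n + 1)))\<^sup>2"
      using two_mult_le_squares[of "cmod (y s n)" "cmod (y s (n + 1))"]
        mult_nonneg_nonneg[OF norm_ge_zero[of "y s n"] norm_ge_zero[of "y s (n + 1)"]] by linarith
    finally show ?thesis unfolding J_def abs_mult using bnd[OF s, of n] by (intro mult_mono) auto
  qed
  define F where "F M s = (\<Sum>N<M. S N s)" for M s
  have dF: "(F M has_real_derivative (\<Sum>N<M. J (int N) s - J (- int N - 1) s)) (at s within {0..T})" if s: "s \<in> {0..T}" for M s
    unfolding F_def[abs_def] by (intro DERIV_sum dS s)
  \<comment> \<open>Each current is bounded by two neighbouring squares, so four sums of distinct squares occur.\<close>
  have dFb: "\<bar>\<Sum>N<M. J (int N) s - J (- int N - 1) s\<bar> \<le> 4 * K * B" if s: "s \<in> {0..T}" for M s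
  proof -
    define g where "g n = (cmod (y s n))\<^sup>2" for n
    have gs: "(\<Sum>N<M. g (h N)) \<le> B" if "inj h" for h :: "nat \<Rightarrow> int"
    proof -
      have "(\<Sum>N<M. g (h N)) = sum g (h ` {..<M})" using that by (subst sum.reindex) (auto simp: inj_on_def)
      also have "\<dots> \<le> B" unfolding g_def by (intro B s) auto
      finally show ?thesis .
    qed
    have "\<bar>\<Sum>N<M. J (int N) s - J (- int N - 1) s\<bar> \<le> (\<Sum>N<M. \<bar>J (int N) s - J (- int N - 1) s\<bar>)" by (rule sum_abs)
    also have "\<dots> \<le> (\<Sum>N<M. K * (g (int N) + g (int N + 1)) + K * (g (- int N - 1) + g (- int N - 1 + 1)))"
      unfolding g_def by (intro sum_mono order.trans[OF abs_triangle_ineq4] add_mono Jb s)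
    also have "\<dots> = K * (((\<Sum>N<M. g (int N)) + (\<Sum>N<M. g (int N + 1))) + ((\<Sum>N<M. g (- int N - 1)) + (\<Sum>N<M. g (- int N - 1 + 1))))"
      by (simp add: sum.distrib sum_distrib_left distrib_left)
    also have "\<dots> \<le> K * ((B + B) + (B + B))"
      using coeff_bound_nonneg by (intro mult_left_mono add_mono gs) (auto simp: inj_def)
    finally show ?thesis by simp
  qed
  have Fb: "\<bar>\<Sum>N<M. S N t - S N 0\<bar> \<le> 4 * K * B * T" for M
  proof -
    have "norm (F M t - F M 0) \<le> (4 * K * B) * norm (t - 0)"
    proof (rule field_differentiable_bound[of "{0..T}"])
      show "(F M has_real_derivative (\<Sum>N<M. J (int N) s - J (- int N - 1) s)) (at s within {0..T})" if "s \<in> {0..T}" for s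
        using that by (rule dF)
      show "norm (\<Sum>N<M. J (int N) s - J (- int N - 1) s) \<le> 4 * K * B" if "s \<in> {0..T}" for s
        using dFb[OF that] by simp
    qed (use t in auto)
    also have "\<dots> \<le> 4 * K * B * T"
    proof (rule mult_left_mono)
      have "0 \<le> B" using B[OF t, of "{}"] by simp
      then show "0 \<le> 4 * K * B" using coeff_bound_nonneg by simp
    qed (use t in auto)
    finally show ?thesis by (simp add: F_def sum_subtractf)
  qed
  have lim: "(\<lambda>N. S N s) \<longlonglongrightarrow> infsum (\<lambda>n. (cmod (y s n))\<^sup>2) UNIV" if "(\<lambda>n. (cmod (y s n))\<^sup>2) summable_on UNIV" for s
  proof -
    have fl: "filterlim (\<lambda>N. {- int N..int N}) (finite_subsets_at_top UNIV) sequentially"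
      unfolding filterlim_finite_subsets_at_top
    proof (intro allI impI)
      fix X :: "int set" assume "finite X \<and> X \<subseteq> UNIV"
      then obtain N where N: "X \<subseteq> {- int N..int N}" using finite_int_subset_symmetric by blast
      show "\<forall>\<^sub>F N in sequentially. finite {- int N..int N} \<and> X \<subseteq> {- int N..int N} \<and> {- int N..int N} \<subseteq> UNIV"
        using eventually_ge_at_top[of N] by eventually_elim (use N in auto)
    qed
    show ?thesis unfolding S_def
      using filterlim_compose[OF has_sum_infsum[OF that, unfolded has_sum_def] fl] .
  qed
  have "(\<lambda>N. S N t - S N 0) \<longlonglongrightarrow> infsum (\<lambda>n. (cmod (y t n))\<^sup>2) UNIV - infsum (\<lambda>n. (cmod (y 0 n))\<^sup>2) UNIV"
    by (intro tendsto_diff lim sm init)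
  from bounded_partial_sums_limit_zero[OF this Fb]
  show "infsum (\<lambda>n. (cmod (y t n))\<^sup>2) UNIV = infsum (\<lambda>n. (cmod (y 0 n))\<^sup>2) UNIV" by simp
qed

end

section \<open>Jost solutions\<close>

lemma tendsto_at_bot_int_iff:
  fixes h :: "int \<Rightarrow> 'a::topological_space"
  shows "(h \<longlongrightarrow> L) at_bot \<longleftrightarrow> (\<lambda>k. h (- int k)) \<longlonglongrightarrow> L"
proof
  assume "(h \<longlongrightarrow> L) at_bot"
  moreover have "filterlim (\<lambda>k. - int k) at_bot sequentially"
    unfolding filterlim_at_bot
  proof
    fix Z :: int
    show "\<forall>\<^sub>F k in sequentially. - int k \<le> Z"
      using eventually_ge_at_top[of "nat (- Z)"] by eventually_elim auto
  qed
  ultimately show "(\<lambda>k. h (- int k)) \<longlonglongrightarrow> L" by (rule filterlim_compose)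
next
  assume *: "(\<lambda>k. h (- int k)) \<longlonglongrightarrow> L"
  have "filterlim (\<lambda>n::int. nat (- n)) sequentially at_bot"
    unfolding filterlim_at_top
  proof
    fix Z :: nat
    show "\<forall>\<^sub>F n in at_bot. Z \<le> nat (- n)"
      using eventually_le_at_bot[of "- int Z"] by eventually_elim auto
  qed
  from filterlim_compose[OF * this] have "((\<lambda>n. h (- int (nat (- n)))) \<longlongrightarrow> L) at_bot" .
  then show "(h \<longlongrightarrow> L) at_bot"
  proof (rule Lim_transform_eventually)
    show "\<forall>\<^sub>F n in at_bot. h (- int (nat (- n))) = h n"
      using eventually_le_at_bot[of 0] by eventually_elim auto
  qed
qed

definition left_summable :: "(int \<Rightarrow> real) \<Rightarrow> (int \<Rightarrow> real) \<Rightarrow> bool" where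
  "left_summable a b \<longleftrightarrow> summable (\<lambda>k. \<bar>a (- int k) - 1\<bar> + \<bar>b (- int k)\<bar>)"

text \<open>The relative size of the perturbation at the site \<open>n\<close>: for \<open>\<bar>l\<bar> \<le> \<Lambda>\<close> the dressed solution
  \<open>u\<^sub>n = y\<^sub>n z\<^sup>n\<close> satisfies the recurrence \<open>u\<^sub>n\<^sub>+\<^sub>1 = (1 + z\<^sup>2) u\<^sub>n - z\<^sup>2 u\<^sub>n\<^sub>-\<^sub>1\<close> of the case \<open>a = 1\<close>,
  \<open>b = 0\<close> up to this multiple of its size.\<close>

definition rec_error :: "(int \<Rightarrow> real) \<Rightarrow> (int \<Rightarrow> real) \<Rightarrow> real \<Rightarrow> int \<Rightarrow> real" where
  "rec_error a b \<Lambda> n = \<bar>1 / a n - 1\<bar> * \<Lambda> + \<bar>b n / a n\<bar> + \<bar>a (n - 1) / a n - 1\<bar>"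

lemma rec_error_nonneg: "0 \<le> \<Lambda> \<Longrightarrow> 0 \<le> rec_error a b \<Lambda> n"
  by (simp add: rec_error_def)

lemma left_summable_tendsto:
  assumes "left_summable a b"
  shows "(\<lambda>k. a (- int k)) \<longlonglongrightarrow> 1"
proof -
  have "(\<lambda>k. \<bar>a (- int k) - 1\<bar> + \<bar>b (- int k)\<bar>) \<longlonglongrightarrow> 0"
    using assms unfolding left_summable_def by (rule summable_LIMSEQ_zero)
  then have "(\<lambda>k. \<bar>a (- int k) - 1\<bar>) \<longlonglongrightarrow> 0"
    by (rule Lim_null_comparison[rotated]) (auto intro!: always_eventually)
  then show ?thesis by (simp add: tendsto_rabs_zero_iff LIM_zero_iff)
qed

lemma rec_error_summable:
  assumes pos: "\<forall>n. a n > 0" and ls: "left_summable a b"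
  shows "summable (\<lambda>k. rec_error a b \<Lambda> (- int k))"
proof -
  define \<epsilon> where "\<epsilon> k = \<bar>a (- int k) - 1\<bar> + \<bar>b (- int k)\<bar>" for k
  have se: "summable \<epsilon>" using ls unfolding left_summable_def \<epsilon>_def .
  have "(\<lambda>k. inverse (a (- int k))) \<longlonglongrightarrow> inverse 1"
    by (intro tendsto_inverse left_summable_tendsto[OF ls]) auto
  from convergent_imp_Bseq[OF convergentI[OF this]]
  obtain A where "\<forall>k. norm (inverse (a (- int k))) \<le> A" unfolding Bseq_def by blast
  then have A: "\<And>k. \<bar>inverse (a (- int k))\<bar> \<le> A" by simp
  have "summable (\<lambda>k. A * (\<epsilon> k * \<bar>\<Lambda>\<bar> + 2 * \<epsilon> k + \<epsilon> (Suc k)))"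
    by (intro summable_mult summable_add summable_mult2 se) (use se summable_Suc_iff in auto)
  then show ?thesis
  proof (rule summable_comparison_test'[where N = 0])
    fix k :: nat
    define n where "n = - int k"
    have an: "a n > 0" using pos by blast
    have iA: "inverse (a n) \<le> A" using A[of k] an by (simp add: n_def)
    have A0: "0 \<le> A" using A[of 0] abs_ge_zero order.trans by blast
    have e1: "\<bar>a n - 1\<bar> \<le> \<epsilon> k" "\<bar>b n\<bar> \<le> \<epsilon> k" by (auto simp: \<epsilon>_def n_def)
    have "n - 1 = - int (Suc k)" by (simp add: n_def)
    then have e2: "\<bar>a (n - 1) - 1\<bar> \<le> \<epsilon> (Suc k)" unfolding \<epsilon>_def by (simp only: le_add_same_cancel1 abs_ge_zero)
    have "\<bar>1 / a n - 1\<bar> = inverse (a n) * \<bar>a n - 1\<bar>"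
      using an by (simp add: field_simps abs_minus_commute flip: abs_mult_pos)
    also have "\<dots> \<le> A * \<epsilon> k" using iA e1 A0 by (intro mult_mono) auto
    finally have 1: "\<bar>1 / a n - 1\<bar> * \<bar>\<Lambda>\<bar> \<le> A * \<epsilon> k * \<bar>\<Lambda>\<bar>" by (intro mult_right_mono) auto
    have "\<bar>b n / a n\<bar> = inverse (a n) * \<bar>b n\<bar>" using an by (simp add: field_simps)
    also have "\<dots> \<le> A * \<epsilon> k" using iA e1 A0 by (intro mult_mono) auto
    finally have 2: "\<bar>b n / a n\<bar> \<le> A * \<epsilon> k" .
    have "\<bar>a (n - 1) / a n - 1\<bar> = inverse (a n) * \<bar>a (n - 1) - a n\<bar>"
      using an by (simp add: field_simps flip: abs_mult_pos)
    also have "\<dots> \<le> A * (\<epsilon> (Suc k) + \<epsilon> k)" using iA e1 e2 A0 by (intro mult_mono) auto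
    finally have 3: "\<bar>a (n - 1) / a n - 1\<bar> \<le> A * (\<epsilon> (Suc k) + \<epsilon> k)" .
    have "norm (rec_error a b \<Lambda> n) \<le> \<bar>1 / a n - 1\<bar> * \<bar>\<Lambda>\<bar> + \<bar>b n / a n\<bar> + \<bar>a (n - 1) / a n - 1\<bar>"
      unfolding rec_error_def real_norm_def
      by (intro order.trans[OF abs_triangle_ineq] add_mono order.trans[OF abs_triangle_ineq]) (auto simp: abs_mult)
    also have "\<dots> \<le> A * (\<epsilon> k * \<bar>\<Lambda>\<bar> + 2 * \<epsilon> k + \<epsilon> (Suc k))"
      using 1 2 3 by (simp add: algebra_simps)
    finally show "norm (rec_error a b \<Lambda> (- int k)) \<le> A * (\<epsilon> k * \<bar>\<Lambda>\<bar> + 2 * \<epsilon> k + \<epsilon> (Suc k))" by (simp add: n_def)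
  qed
qed

lemma dressed_recurrence:
  assumes y: "jacobi_solution a b (z + inverse z) y" and pos: "\<forall>n. a n > 0" and z: "z \<noteq> 0" "cmod z \<le> 1"
    and \<Lambda>: "cmod (z + inverse z) \<le> \<Lambda>"
    and M: "cmod (y n * z powi n) \<le> M" "cmod (y (n - 1) * z powi (n - 1)) \<le> M"
  shows "cmod (y (n + 1) * z powi (n + 1) - ((1 + z\<^sup>2) * (y n * z powi n) - z\<^sup>2 * (y (n - 1) * z powi (n - 1))))
    \<le> rec_error a b \<Lambda> n * M"
proof -
  define l where "l = z + inverse z"
  define u where "u n = y n * z powi n" for n
  define p where "p = complex_of_real (1 / a n - 1) * l - complex_of_real (b n / a n)"
  define q where "q = complex_of_real (a (n - 1) / a n - 1)"
  have an: "a n > 0" using pos by blast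
  have y1: "y (n + 1) = (l + p) * y n - (1 + q) * y (n - 1)"
    unfolding jacobi_up[OF y[folded l_def] an] p_def q_def using an by (simp add: field_simps)
  have pw: "z powi (n + 1) = z * z powi n" "z powi n = z * z powi (n - 1)"
    using z power_int_add_1[of z n] power_int_add_1[of z "n - 1"] by (simp_all add: mult.commute)
  have zl: "z * l = 1 + z\<^sup>2" using z by (simp add: l_def power2_eq_square distrib_left)
  have "y (n + 1) * z powi (n + 1) = (z * l + z * p) * u n - z\<^sup>2 * (1 + q) * u (n - 1)"
    unfolding y1 u_def pw by (simp add: algebra_simps power2_eq_square)
  then have e: "y (n + 1) * z powi (n + 1) - ((1 + z\<^sup>2) * u n - z\<^sup>2 * u (n - 1)) = z * p * u n - z\<^sup>2 * q * u (n - 1)"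
    unfolding zl by (simp add: algebra_simps)
  have M0: "0 \<le> M" using M(1) norm_ge_zero order.trans by blast
  have "cmod (z * p * u n - z\<^sup>2 * q * u (n - 1)) \<le> cmod (z * p * u n) + cmod (z\<^sup>2 * q * u (n - 1))" by (rule norm_triangle_ineq4)
  also have "\<dots> \<le> cmod p * M + cmod q * M"
  proof (rule add_mono)
    have "cmod (z * p) \<le> 1 * cmod p" unfolding norm_mult using z by (intro mult_right_mono) auto
    then show "cmod (z * p * u n) \<le> cmod p * M" using M(1) by (intro cmod_mult_le) (auto simp: u_def)
    have "cmod (z\<^sup>2) \<le> 1" using z by (simp add: norm_power power_le_one)
    then have "cmod (z\<^sup>2 * q) \<le> 1 * cmod q" unfolding norm_mult[of "z\<^sup>2"] by (intro mult_right_mono) auto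
    then show "cmod (z\<^sup>2 * q * u (n - 1)) \<le> cmod q * M" using M(2) by (intro cmod_mult_le) (auto simp: u_def)
  qed
  also have "\<dots> \<le> rec_error a b \<Lambda> n * M"
  proof -
    have "cmod p \<le> \<bar>1 / a n - 1\<bar> * \<Lambda> + \<bar>b n / a n\<bar>"
      unfolding p_def
      by (intro order.trans[OF norm_triangle_ineq4] add_mono cmod_mult_le)
         (use \<Lambda> in \<open>simp_all only: norm_of_real l_def order.refl\<close>)
    moreover have "cmod q = \<bar>a (n - 1) / a n - 1\<bar>" unfolding q_def by (rule norm_of_real)
    ultimately have "cmod p + cmod q \<le> rec_error a b \<Lambda> n" unfolding rec_error_def by linarith
    then have "(cmod p + cmod q) * M \<le> rec_error a b \<Lambda> n * M" using M0 by (rule mult_right_mono)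
    then show ?thesis by (simp add: distrib_right)
  qed
  finally have fin: "cmod (z * p * u n - z\<^sup>2 * q * u (n - 1)) \<le> rec_error a b \<Lambda> n * M" .
  show ?thesis using fin unfolding e[symmetric] unfolding u_def .
qed

text \<open>The unperturbed recurrence conserves \<open>g\<^sub>n = u\<^sub>n - z\<^sup>2 u\<^sub>n\<^sub>-\<^sub>1\<close> and multiplies \<open>d\<^sub>n = u\<^sub>n - u\<^sub>n\<^sub>-\<^sub>1\<close> by \<open>z\<^sup>2\<close>;
  both together determine \<open>u\<close> as long as \<open>z\<^sup>2 \<noteq> 1\<close>. A discrete Gronwall argument for \<open>g\<close> and \<open>d\<close>
  bounds \<open>u\<close> with constants that depend on \<open>z\<close> only through \<open>\<Lambda>\<close> and \<open>\<delta>\<close>, hence locally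
  uniformly.\<close>

lemma dressed_growth:
  assumes y: "jacobi_solution a b (z + inverse z) y" and pos: "\<forall>n. a n > 0" and z: "z \<noteq> 0" "cmod z \<le> 1"
    and \<Lambda>: "cmod (z + inverse z) \<le> \<Lambda>" and \<delta>: "\<delta> > 0" "\<delta> \<le> cmod (1 - z\<^sup>2)"
    and r: "cmod (y m * z powi m - z\<^sup>2 * (y (m - 1) * z powi (m - 1))) \<le> r"
      "cmod (y m * z powi m - y (m - 1) * z powi (m - 1)) \<le> r" and mn: "m \<le> n"
  shows "cmod (y n * z powi n) \<le> 2 / \<delta> * (r * exp (2 / \<delta> * (\<Sum>i\<in>{m..<n}. rec_error a b \<Lambda> i)))"
proof -
  define u where "u n = y n * z powi n" for n
  define g where "g n = u n - z\<^sup>2 * u (n - 1)" for n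
  define d where "d n = u n - u (n - 1)" for n
  define R where "R n = r * exp (2 / \<delta> * (\<Sum>i\<in>{m..<n}. rec_error a b \<Lambda> i))" for n
  have z2: "cmod (z\<^sup>2) \<le> 1" using z by (simp add: norm_power power_le_one)
  have D0: "1 - z\<^sup>2 \<noteq> 0" using \<delta> by auto
  have uM: "cmod (u n) \<le> 2 / \<delta> * M \<and> cmod (u (n - 1)) \<le> 2 / \<delta> * M" if "cmod (g n) \<le> M" "cmod (d n) \<le> M" for n M
  proof -
    have M0: "0 \<le> M" using that(1) norm_ge_zero order.trans by blast
    have "(1 - z\<^sup>2) * u n = g n - z\<^sup>2 * d n" "(1 - z\<^sup>2) * u (n - 1) = g n - d n"
      by (simp_all add: g_def d_def algebra_simps)
    then have "u n = (g n - z\<^sup>2 * d n) / (1 - z\<^sup>2)" "u (n - 1) = (g n - d n) / (1 - z\<^sup>2)"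
      using D0 by (metis nonzero_mult_div_cancel_left)+
    moreover have "cmod (g n - z\<^sup>2 * d n) \<le> M + 1 * M"
      by (intro order.trans[OF norm_triangle_ineq4] add_mono cmod_mult_le that z2)
    moreover have "cmod (g n - d n) \<le> M + M"
      by (intro order.trans[OF norm_triangle_ineq4] add_mono that)
    ultimately have "cmod (u n) \<le> (M + M) / cmod (1 - z\<^sup>2)" "cmod (u (n - 1)) \<le> (M + M) / cmod (1 - z\<^sup>2)"
      by (simp_all add: norm_divide divide_right_mono)
    moreover have "(M + M) / cmod (1 - z\<^sup>2) \<le> (M + M) / \<delta>"
      using M0 \<delta> by (intro divide_left_mono mult_pos_pos) (linarith | simp)+
    ultimately show ?thesis by (auto simp: field_simps)
  qed
  have L0: "0 \<le> \<Lambda>" using \<Lambda> norm_ge_zero order.trans by blast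
  have r0: "0 \<le> r" using r(1) norm_ge_zero order.trans by blast
  have "cmod (g n) \<le> R n \<and> cmod (d n) \<le> R n"
    using mn
  proof (induction n rule: int_ge_induct)
    case base
    then show ?case using r by (simp add: g_def d_def u_def R_def)
  next
    case (step n)
    define e where "e = rec_error a b \<Lambda> n"
    define V where "V = u (n + 1) - ((1 + z\<^sup>2) * u n - z\<^sup>2 * u (n - 1))"
    have "cmod V \<le> e * (2 / \<delta> * R n)"
      unfolding V_def u_def e_def
      by (rule dressed_recurrence[OF y pos z \<Lambda>]) (use uM[of n "R n"] step.IH in \<open>auto simp: u_def\<close>)
    moreover have "g (n + 1) = g n + V" "d (n + 1) = z\<^sup>2 * d n + V"
      by (simp_all add: g_def d_def V_def algebra_simps)
    moreover have "cmod (z\<^sup>2 * d n) \<le> 1 * R n" using step.IH z2 by (intro cmod_mult_le) auto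
    ultimately have "cmod (g (n + 1)) \<le> R n + e * (2 / \<delta> * R n)" "cmod (d (n + 1)) \<le> R n + e * (2 / \<delta> * R n)"
      using step.IH norm_triangle_ineq[of "g n" V] norm_triangle_ineq[of "z\<^sup>2 * d n" V] by auto
    moreover have "R n + e * (2 / \<delta> * R n) \<le> R (n + 1)"
    proof -
      have "{m..<n + 1} = insert n {m..<n}" using step.hyps by auto
      then have "R (n + 1) = R n * exp (2 / \<delta> * e)"
        by (simp add: R_def e_def distrib_left exp_add mult_ac)
      moreover have "R n * (1 + 2 / \<delta> * e) \<le> R n * exp (2 / \<delta> * e)"
        using r0 by (intro mult_left_mono exp_ge_add_one_self) (auto simp: R_def)
      ultimately show ?thesis by (simp add: algebra_simps)
    qed
    ultimately show ?case by linarith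
  qed
  then show ?thesis using uM[of n "R n"] unfolding u_def R_def by blast
qed

text \<open>The solution that agrees with the unperturbed Jost solution \<open>z\<^sup>-\<^sup>n\<close> at \<open>-k - 1\<close> and \<open>-k\<close>. For
  growing \<open>k\<close> it approaches the Jost solution.\<close>

definition shoot :: "(int \<Rightarrow> real) \<Rightarrow> (int \<Rightarrow> real) \<Rightarrow> complex \<Rightarrow> nat \<Rightarrow> int \<Rightarrow> complex" where
  "shoot a b z k = (SOME y. jacobi_solution a b (z + inverse z) y \<and>
     y (- int k - 1) = z powi (int k + 1) \<and> y (- int k) = z powi int k)"

lemma shoot:
  assumes pos: "\<forall>n. a n > 0"
  shows "jacobi_solution a b (z + inverse z) (shoot a b z k)"
    "shoot a b z k (- int k - 1) = z powi (int k + 1)" "shoot a b z k (- int k) = z powi int k"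
proof -
  obtain y where "jacobi_solution a b (z + inverse z) y" "y (- int k - 1) = z powi (int k + 1)"
     "y (- int k - 1 + 1) = z powi int k"
    using jacobi_solution_exists[OF pos] by metis
  then have "\<exists>y. jacobi_solution a b (z + inverse z) y \<and>
     y (- int k - 1) = z powi (int k + 1) \<and> y (- int k) = z powi int k" by auto
  from someI_ex[OF this] show "jacobi_solution a b (z + inverse z) (shoot a b z k)"
    "shoot a b z k (- int k - 1) = z powi (int k + 1)" "shoot a b z k (- int k) = z powi int k"
    unfolding shoot_def by auto
qed

text \<open>An upper bound for the distance from \<open>shoot a b z k\<close> to the Jost solution. It depends on \<open>z\<close> only
  through \<open>\<Lambda>\<close> and \<open>\<delta>\<close>, which yields continuity in \<open>z\<close>.\<close>

definition shoot_tail :: "(int \<Rightarrow> real) \<Rightarrow> (int \<Rightarrow> real) \<Rightarrow> real \<Rightarrow> real \<Rightarrow> nat \<Rightarrow> real" where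
  "shoot_tail a b \<Lambda> \<delta> k = 2 / \<delta> * exp (2 / \<delta> * (\<Sum>k. rec_error a b \<Lambda> (- int k))) *
      (\<Sum>j. rec_error a b \<Lambda> (- int (Suc (j + k))))"

lemma shoot_tail_tendsto:
  assumes pos: "\<forall>n. a n > 0" and ls: "left_summable a b"
  shows "shoot_tail a b \<Lambda> \<delta> \<longlonglongrightarrow> 0"
proof -
  have "summable (\<lambda>j. rec_error a b \<Lambda> (- int (Suc j)))"
    using rec_error_summable[OF pos ls] summable_Suc_iff[of "\<lambda>k. rec_error a b \<Lambda> (- int k)"] by blast
  from suminf_exist_split2[OF this]
  have "(\<lambda>k. \<Sum>j. rec_error a b \<Lambda> (- int (Suc (j + k)))) \<longlonglongrightarrow> 0" .
  then show ?thesis unfolding shoot_tail_def[abs_def] by (rule tendsto_mult_right_zero)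
qed

text \<open>Both approximations take the unperturbed value at \<open>-k - 1\<close>, and at \<open>-k\<close> they differ by the
  error of one step of the recurrence; the growth estimate carries this to the right.\<close>

lemma shoot_difference:
  assumes pos: "\<forall>n. a n > 0" and ls: "left_summable a b" and z: "z \<noteq> 0" "cmod z \<le> 1"
    and \<Lambda>: "cmod (z + inverse z) \<le> \<Lambda>" and \<delta>: "\<delta> > 0" "\<delta> \<le> cmod (1 - z\<^sup>2)"
    and n: "- int k \<le> n" "n \<le> 0"
  shows "cmod ((shoot a b z (Suc k) n - shoot a b z k n) * z powi n)
    \<le> 2 / \<delta> * exp (2 / \<delta> * (\<Sum>k. rec_error a b \<Lambda> (- int k))) * rec_error a b \<Lambda> (- int (Suc k))"
proof -
  define y where "y = shoot a b z (Suc k)"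
  define x where "x = shoot a b z k"
  define E where "E = (\<Sum>k. rec_error a b \<Lambda> (- int k))"
  define r where "r = rec_error a b \<Lambda> (- int (Suc k))"
  define m where "m = - int k"
  have L0: "0 \<le> \<Lambda>" using \<Lambda> norm_ge_zero order.trans by blast
  have y: "jacobi_solution a b (z + inverse z) y" and x: "jacobi_solution a b (z + inverse z) x"
    unfolding y_def x_def by (intro shoot[OF pos])+
  have m1: "m - 1 = - int (Suc k)" "m - 1 - 1 = - int (Suc k) - 1" by (simp_all add: m_def)
  have inv: "z powi i * z powi (- i) = 1" for i using z by (simp add: power_int_minus)
  have m2: "m - 1 = - (int k + 1)" "m - 1 - 1 = - (int (Suc k) + 1)" by (simp_all add: m_def)
  have y1: "y (m - 1) * z powi (m - 1) = 1" "y (m - 1 - 1) * z powi (m - 1 - 1) = 1"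
  proof -
    have "y (m - 1) = z powi int (Suc k)" "y (m - 1 - 1) = z powi (int (Suc k) + 1)"
      using shoot(2,3)[OF pos, of b z "Suc k"] by (simp_all only: m1 y_def)
    moreover have "z powi (m - 1) = z powi (- int (Suc k))" by (simp only: m1(1))
    moreover have "z powi (m - 1 - 1) = z powi (- (int (Suc k) + 1))" by (simp only: m2(2))
    ultimately show "y (m - 1) * z powi (m - 1) = 1" "y (m - 1 - 1) * z powi (m - 1 - 1) = 1"
      using inv[of "int (Suc k)"] inv[of "int (Suc k) + 1"] by (simp_all only:)
  qed
  have x1: "x m * z powi m = 1" "x (m - 1) * z powi (m - 1) = 1"
  proof -
    have "m - 1 = - int k - 1" by (simp add: m_def)
    then have "x m = z powi int k" "x (m - 1) = z powi (int k + 1)"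
      using shoot(2,3)[OF pos, of b z k] by (simp_all only: m_def x_def)
    then show "x m * z powi m = 1" "x (m - 1) * z powi (m - 1) = 1"
      using inv[of "int k"] inv[of "int k + 1"] by (simp_all only: m_def[symmetric] m2(1))
  qed
  have "cmod (y (m - 1 + 1) * z powi (m - 1 + 1) - ((1 + z\<^sup>2) * (y (m - 1) * z powi (m - 1)) - z\<^sup>2 * (y (m - 1 - 1) * z powi (m - 1 - 1))))
    \<le> rec_error a b \<Lambda> (m - 1) * 1"
    by (rule dressed_recurrence[OF y pos z \<Lambda>]) (simp_all only: y1 norm_one order_refl)
  then have V: "cmod (y m * z powi m - 1) \<le> r" unfolding y1 diff_add_cancel by (simp add: r_def m1)
  define w where "w n = y n - x n" for n
  have w: "jacobi_solution a b (z + inverse z) w"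
    using jacobi_solution_lincomb[OF y x, of 1 "-1"] by (simp add: w_def[abs_def])
  have w1: "w (m - 1) * z powi (m - 1) = 0" "w m * z powi m = y m * z powi m - 1"
    using y1 x1 by (simp_all add: w_def left_diff_distrib)
  have "cmod (w n * z powi n) \<le> 2 / \<delta> * (r * exp (2 / \<delta> * (\<Sum>i\<in>{m..<n}. rec_error a b \<Lambda> i)))"
  proof (rule dressed_growth[OF w pos z \<Lambda> \<delta>])
    show "cmod (w m * z powi m - z\<^sup>2 * (w (m - 1) * z powi (m - 1))) \<le> r"
      "cmod (w m * z powi m - w (m - 1) * z powi (m - 1)) \<le> r"
      unfolding w1 using V by simp_all
    show "m \<le> n" using n by (simp add: m_def)
  qed
  also have "\<dots> \<le> 2 / \<delta> * (r * exp (2 / \<delta> * E))"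
  proof -
    have "(\<Sum>i\<in>{m..<n}. rec_error a b \<Lambda> i) = (\<Sum>j\<in>(\<lambda>i. nat (- i)) ` {m..<n}. rec_error a b \<Lambda> (- int j))"
      using n by (subst sum.reindex) (auto simp: inj_on_def intro!: sum.cong)
    also have "\<dots> \<le> E" unfolding E_def
      by (intro sum_le_suminf rec_error_summable[OF pos ls]) (auto intro: rec_error_nonneg[OF L0])
    finally show ?thesis using \<delta> rec_error_nonneg[OF L0]
      by (intro mult_left_mono) (auto simp: r_def intro!: divide_right_mono)
  qed
  finally show ?thesis by (simp add: w_def y_def x_def E_def r_def mult_ac)
qed

text \<open>The differences of successive approximations are summable with a bound that is uniform on
  \<open>{-k..0}\<close>. They converge therefore, and the limit inherits the normalisation at \<open>-\<infinity>\<close>.\<close>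

lemma jost_solution_exists:
  assumes pos: "\<forall>n. a n > 0" and ls: "left_summable a b" and z: "z \<noteq> 0" "cmod z \<le> 1"
    and \<Lambda>: "cmod (z + inverse z) \<le> \<Lambda>" and \<delta>: "\<delta> > 0" "\<delta> \<le> cmod (1 - z\<^sup>2)"
  obtains f where "jacobi_solution a b (z + inverse z) f" "((\<lambda>n. f n * z powi n) \<longlongrightarrow> 1) at_bot"
    "\<And>k n. - int k \<le> n \<Longrightarrow> n \<le> 0 \<Longrightarrow> cmod ((f n - shoot a b z k n) * z powi n) \<le> shoot_tail a b \<Lambda> \<delta> k"
proof -
  define c where "c = 2 / \<delta> * exp (2 / \<delta> * (\<Sum>k. rec_error a b \<Lambda> (- int k)))"
  define \<epsilon> where "\<epsilon> k = c * rec_error a b \<Lambda> (- int (Suc k))" for k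
  define Y where "Y = shoot a b z"
  have L0: "0 \<le> \<Lambda>" using \<Lambda> norm_ge_zero order.trans by blast
  have c0: "0 \<le> c" using \<delta> by (simp add: c_def)
  have se: "summable \<epsilon>" unfolding \<epsilon>_def[abs_def]
    using rec_error_summable[OF pos ls] summable_Suc_iff[of "\<lambda>k. rec_error a b \<Lambda> (- int k)"]
    by (intro summable_mult) blast
  have e0: "0 \<le> \<epsilon> k" for k using c0 rec_error_nonneg[OF L0] by (simp add: \<epsilon>_def)
  have tail: "shoot_tail a b \<Lambda> \<delta> k = (\<Sum>j. \<epsilon> (j + k))" for k
  proof -
    have "summable (\<lambda>j. rec_error a b \<Lambda> (- int (Suc (j + k))))"
      using rec_error_summable[OF pos ls] summable_iff_shift[of "\<lambda>k. rec_error a b \<Lambda> (- int k)" "Suc k"] by simp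
    then show ?thesis unfolding shoot_tail_def \<epsilon>_def c_def by (rule suminf_mult[symmetric])
  qed
  have step: "cmod ((Y (Suc k) n - Y k n) * z powi n) \<le> \<epsilon> k" if "- int k \<le> n" "n \<le> 0" for k n
    using shoot_difference[OF pos ls z \<Lambda> \<delta> that] by (simp add: \<epsilon>_def c_def Y_def)
  have far: "cmod ((Y (k + j) n - Y k n) * z powi n) \<le> shoot_tail a b \<Lambda> \<delta> k" if n: "- int k \<le> n" "n \<le> 0" for k n j
  proof -
    have "cmod ((Y (k + j) n - Y k n) * z powi n) \<le> (\<Sum>i<j. \<epsilon> (i + k))"
    proof (induction j)
      case (Suc j)
      have "(Y (k + Suc j) n - Y k n) * z powi n = (Y (k + j) n - Y k n) * z powi n + (Y (Suc (k + j)) n - Y (k + j) n) * z powi n"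
        by (simp add: algebra_simps)
      also have "cmod \<dots> \<le> (\<Sum>i<j. \<epsilon> (i + k)) + \<epsilon> (k + j)"
        by (intro order.trans[OF norm_triangle_ineq] add_mono Suc step) (use n in auto)
      finally show ?case by (simp add: add.commute)
    qed auto
    also have "\<dots> \<le> (\<Sum>i. \<epsilon> (i + k))"
      using se e0 by (intro sum_le_suminf) (auto simp: summable_iff_shift)
    finally show ?thesis unfolding tail .
  qed
  have conv: "convergent (\<lambda>k. Y k n)" if n: "n \<in> {-1, 0}" for n
  proof -
    have "summable (\<lambda>k. (Y (Suc k) n - Y k n) * z powi n)"
    proof (rule summable_comparison_test'[OF se, of 1])
      fix k :: nat assume "1 \<le> k"
      then show "norm ((Y (Suc k) n - Y k n) * z powi n) \<le> \<epsilon> k" using n by (intro step) auto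
    qed
    then have "summable (\<lambda>k. (Y (Suc k) n - Y k n) * z powi n * z powi (- n))" by (rule summable_mult2)
    moreover have "(Y (Suc k) n - Y k n) * z powi n * z powi (- n) = Y (Suc k) n - Y k n" for k
      using z by (simp add: power_int_minus)
    ultimately have "summable (\<lambda>k. Y (Suc k) n - Y k n)" by simp
    then have "convergent (\<lambda>N. \<Sum>k<N. Y (Suc k) n - Y k n)" by (simp add: summable_iff_convergent)
    then have "convergent (\<lambda>N. Y N n - Y 0 n)" by (simp only: sum_lessThan_telescope[of "\<lambda>k. Y k n"])
    from convergent_add[OF this convergent_const[of "Y 0 n"]] show ?thesis by simp
  qed
  obtain f1 f0 where lim: "(\<lambda>k. Y k (-1)) \<longlonglongrightarrow> f1" "(\<lambda>k. Y k 0) \<longlonglongrightarrow> f0"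
    using conv[of "-1"] conv[of 0] unfolding convergent_def by auto
  obtain f where f: "jacobi_solution a b (z + inverse z) f" "f (-1) = f1" "f (-1 + 1) = f0"
    using jacobi_solution_exists[OF pos] by metis
  have lim: "(\<lambda>k. Y k n) \<longlonglongrightarrow> f n" for n
    by (rule jacobi_solution_tendsto[where m = "-1" and l = "\<lambda>k. z + inverse z", OF _ f(1) pos])
       (use lim f in \<open>auto simp: Y_def intro!: always_eventually shoot(1)[OF pos]\<close>)
  have bound: "cmod ((f n - Y k n) * z powi n) \<le> shoot_tail a b \<Lambda> \<delta> k" if n: "- int k \<le> n" "n \<le> 0" for k n
  proof (rule LIMSEQ_le_const2)
    show "(\<lambda>j. cmod ((Y j n - Y k n) * z powi n)) \<longlonglongrightarrow> cmod ((f n - Y k n) * z powi n)" by (intro tendsto_intros lim)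
    show "\<exists>N. \<forall>j\<ge>N. cmod ((Y j n - Y k n) * z powi n) \<le> shoot_tail a b \<Lambda> \<delta> k"
    proof (intro exI allI impI)
      fix j assume "k \<le> j"
      then show "cmod ((Y j n - Y k n) * z powi n) \<le> shoot_tail a b \<Lambda> \<delta> k" using far[OF n, of "j - k"] by simp
    qed
  qed
  have "(\<lambda>k. f (- int k) * z powi (- int k) - 1) \<longlonglongrightarrow> 0"
  proof (rule Lim_null_comparison[OF always_eventually shoot_tail_tendsto[OF pos ls]], rule allI)
    fix k
    have "Y k (- int k) * z powi (- int k) = 1"
      unfolding Y_def shoot[OF pos] using z by (simp add: power_int_minus)
    then show "norm (f (- int k) * z powi (- int k) - 1) \<le> shoot_tail a b \<Lambda> \<delta> k"
      using bound[of k "- int k"] by (simp add: left_diff_distrib)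
  qed
  then have "((\<lambda>n. f n * z powi n) \<longlongrightarrow> 1) at_bot"
    unfolding tendsto_at_bot_int_iff by (simp add: LIM_zero_iff)
  then show ?thesis using that[OF f(1)] bound unfolding Y_def by blast
qed

text \<open>The Wronskian of two such solutions tends to 0 at \<open>-\<infinity>\<close>, so they are proportional, and the
  normalisation fixes the factor. For \<open>\<bar>z\<bar> = 1\<close>, where the powers of \<open>z\<close> do not decay, this rests on
  the convergence of both dressed solutions to the same limit.\<close>

lemma jost_solution_unique:
  assumes pos: "\<forall>n. a n > 0" and ls: "left_summable a b" and z: "z \<noteq> 0" "cmod z \<le> 1"
    and f: "jacobi_solution a b l f" "((\<lambda>n. f n * z powi n) \<longlongrightarrow> 1) at_bot"
    and g: "jacobi_solution a b l g" "((\<lambda>n. g n * z powi n) \<longlongrightarrow> 1) at_bot"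
  shows "f = g"
proof -
  define F where "F k = f (- int k) * z powi (- int k)" for k
  define G where "G k = g (- int k) * z powi (- int k)" for k
  have F: "F \<longlonglongrightarrow> 1" and G: "G \<longlonglongrightarrow> 1" using f(2) g(2) unfolding tendsto_at_bot_int_iff F_def G_def .
  have fF: "f (- int k) = F k * z ^ k" and gG: "g (- int k) = G k * z ^ k" for k
    using z by (simp_all add: F_def G_def power_int_minus power_int_of_nat)
  have W: "wronskian a f g (- int (Suc k)) = complex_of_real (a (- int (Suc k))) * ((F (Suc k) * G k - F k * G (Suc k)) * (z ^ k * z ^ Suc k))" for k
  proof -
    have "- int (Suc k) + 1 = - int k" by simp
    then show ?thesis unfolding wronskian_def by (simp only: fF gG) (simp add: algebra_simps)
  qed
  have "(\<lambda>k. complex_of_real (a (- int (Suc k))) * ((F (Suc k) * G k - F k * G (Suc k)) * (z ^ k * z ^ Suc k))) \<longlonglongrightarrow> 0"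
  proof (rule Lim_null_comparison)
    have "(\<lambda>k. \<bar>a (- int (Suc k))\<bar> * cmod (F (Suc k) * G k - F k * G (Suc k))) \<longlonglongrightarrow> \<bar>1\<bar> * cmod (1 * 1 - 1 * 1)"
      by (intro tendsto_intros F G LIMSEQ_Suc[OF F] LIMSEQ_Suc[OF G] LIMSEQ_Suc[OF left_summable_tendsto[OF ls]])
    then show "(\<lambda>k. \<bar>a (- int (Suc k))\<bar> * cmod (F (Suc k) * G k - F k * G (Suc k))) \<longlonglongrightarrow> 0" by simp
    show "\<forall>\<^sub>F k in sequentially. norm (complex_of_real (a (- int (Suc k))) * ((F (Suc k) * G k - F k * G (Suc k)) * (z ^ k * z ^ Suc k)))
        \<le> \<bar>a (- int (Suc k))\<bar> * cmod (F (Suc k) * G k - F k * G (Suc k))"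
    proof (intro always_eventually allI)
      fix k
      have "cmod (z ^ k * z ^ Suc k) \<le> 1"
        unfolding norm_mult norm_power using z by (intro mult_le_one power_le_one zero_le_power) auto
      then show "norm (complex_of_real (a (- int (Suc k))) * ((F (Suc k) * G k - F k * G (Suc k)) * (z ^ k * z ^ Suc k)))
        \<le> \<bar>a (- int (Suc k))\<bar> * cmod (F (Suc k) * G k - F k * G (Suc k))"
        unfolding norm_mult norm_of_real by (intro mult_left_mono mult_right_le_one_le) (auto simp: norm_mult)
    qed
  qed
  moreover have "wronskian a f g (- int (Suc k)) = wronskian a f g 0" for k by (rule wronskian_const[OF f(1) g(1)])
  ultimately have "(\<lambda>k::nat. wronskian a f g 0) \<longlonglongrightarrow> 0" unfolding W[symmetric] by simp
  then have W0: "wronskian a f g 0 = 0" by (simp add: LIMSEQ_const_iff)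
  have "\<exists>k. f k \<noteq> 0"
  proof (rule ccontr)
    assume "\<nexists>k. f k \<noteq> 0"
    then have "F = (\<lambda>k. 0)" by (simp add: F_def fun_eq_iff)
    then show False using F by (simp add: LIMSEQ_const_iff)
  qed
  then obtain c where c: "g = (\<lambda>n. c * f n)" using wronskian_zero_proportional[OF f(1) g(1) pos W0] by blast
  have "(\<lambda>k. c * F k) \<longlonglongrightarrow> c * 1" by (intro tendsto_intros F)
  moreover have "G = (\<lambda>k. c * F k)" by (simp add: G_def F_def c fun_eq_iff)
  ultimately have "c = 1" using LIMSEQ_unique[OF G] by simp
  then show ?thesis using c by simp
qed

lemma jostI:
  assumes pos: "\<forall>n. a n > 0" and ls: "left_summable a b" and z: "z \<noteq> 0" "cmod z \<le> 1"
    and f: "jacobi_solution a b l f" "((\<lambda>n. f n * z powi n) \<longlongrightarrow> 1) at_bot"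
  shows "jost a b l z = f"
  unfolding jost_def
  by (rule the_equality) (use f jost_solution_unique[OF pos ls z] in auto)

lemma jost_solution:
  assumes pos: "\<forall>n. a n > 0" and ls: "left_summable a b" and z: "z \<noteq> 0" "cmod z \<le> 1" "z\<^sup>2 \<noteq> 1"
    and l: "l = z + inverse z"
  shows "jacobi_solution a b l (jost a b l z)" "((\<lambda>n. jost a b l z n * z powi n) \<longlongrightarrow> 1) at_bot"
proof -
  obtain f where f: "jacobi_solution a b l f" "((\<lambda>n. f n * z powi n) \<longlongrightarrow> 1) at_bot"
    by (rule jost_solution_exists[OF pos ls z(1,2), of "cmod l" "cmod (1 - z\<^sup>2)"]) (use z l in auto)
  then show "jacobi_solution a b l (jost a b l z)" "((\<lambda>n. jost a b l z n * z powi n) \<longlongrightarrow> 1) at_bot"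
    using jostI[OF pos ls z(1,2) f] by auto
qed

text \<open>The approximations depend continuously on \<open>z\<close>, and near \<open>z0\<close> they approximate uniformly,
  because \<open>\<bar>1 - z\<^sup>2\<bar>\<close> stays away from 0 there.\<close>

lemma jost_tendsto:
  fixes z :: "'c \<Rightarrow> complex"
  assumes pos: "\<forall>n. a n > 0" and ls: "left_summable a b"
    and z: "\<forall>\<^sub>F s in F. cmod (z s) = 1" and z0: "cmod z0 = 1" "z0\<^sup>2 \<noteq> 1" and lim: "(z \<longlongrightarrow> z0) F"
  shows "((\<lambda>s. jost a b (z s + inverse (z s)) (z s) n) \<longlongrightarrow> jost a b (z0 + inverse z0) z0 n) F"
proof -
  define \<delta> where "\<delta> = cmod (1 - z0\<^sup>2) / 2"
  have \<delta>: "\<delta> > 0" using z0 by (simp add: \<delta>_def)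
  have z00: "z0 \<noteq> 0" using z0 by auto
  define good where "good w \<longleftrightarrow> cmod w = 1 \<and> \<delta> \<le> cmod (1 - w\<^sup>2)" for w
  have "((\<lambda>s. cmod (1 - (z s)\<^sup>2)) \<longlongrightarrow> cmod (1 - z0\<^sup>2)) F" by (intro tendsto_intros lim)
  then have "\<forall>\<^sub>F s in F. \<delta> < cmod (1 - (z s)\<^sup>2)" using z0 by (intro order_tendstoD) (auto simp: \<delta>_def)
  then have gz: "\<forall>\<^sub>F s in F. good (z s)" using z by eventually_elim (auto simp: good_def)
  have g0: "good z0" using z0 by (auto simp: good_def \<delta>_def)
  have close: "cmod (jost a b (w + inverse w) w n - shoot a b w k n) \<le> shoot_tail a b 2 \<delta> k"
    if w: "good w" and n: "- int k \<le> n" "n \<le> 0" for w k n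
  proof -
    have w0: "w \<noteq> 0" "cmod w \<le> 1" using w by (auto simp: good_def)
    have "cmod (w + inverse w) \<le> cmod w + cmod (inverse w)" by (rule norm_triangle_ineq)
    then have w2: "cmod (w + inverse w) \<le> 2" using w by (simp add: good_def norm_inverse)
    obtain f where f: "jacobi_solution a b (w + inverse w) f" "((\<lambda>n. f n * w powi n) \<longlongrightarrow> 1) at_bot"
      "\<And>k n. - int k \<le> n \<Longrightarrow> n \<le> 0 \<Longrightarrow> cmod ((f n - shoot a b w k n) * w powi n) \<le> shoot_tail a b 2 \<delta> k"
      using jost_solution_exists[OF pos ls w0 w2 \<delta>] w unfolding good_def by metis
    have "cmod (w powi n) = 1" using w by (simp add: good_def norm_power_int)
    then show ?thesis using f(3)[OF n] unfolding jostI[OF pos ls w0 f(1,2)] by (simp add: norm_mult)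
  qed
  have shoot_lim: "((\<lambda>s. shoot a b (z s) k n) \<longlongrightarrow> shoot a b z0 k n) F" for k n
  proof (rule jacobi_solution_tendsto[where m = "- int k - 1" and l = "\<lambda>s. z s + inverse (z s)"])
    show "\<forall>\<^sub>F s in F. jacobi_solution a b (z s + inverse (z s)) (shoot a b (z s) k)"
      by (intro always_eventually allI shoot[OF pos])
    show "jacobi_solution a b (z0 + inverse z0) (shoot a b z0 k)" by (rule shoot[OF pos])
    show "((\<lambda>s. z s + inverse (z s)) \<longlongrightarrow> z0 + inverse z0) F" by (intro tendsto_intros lim z00)
    show "((\<lambda>s. shoot a b (z s) k (- int k - 1)) \<longlongrightarrow> shoot a b z0 k (- int k - 1)) F"
      unfolding shoot[OF pos] by (intro tendsto_intros lim) (use z00 in auto)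
    have "((\<lambda>s. shoot a b (z s) k (- int k)) \<longlongrightarrow> shoot a b z0 k (- int k)) F"
      unfolding shoot[OF pos] by (intro tendsto_intros lim) (use z00 in auto)
    then show "((\<lambda>s. shoot a b (z s) k (- int k - 1 + 1)) \<longlongrightarrow> shoot a b z0 k (- int k - 1 + 1)) F" by simp
  qed (rule pos)
  have base: "((\<lambda>s. jost a b (z s + inverse (z s)) (z s) n) \<longlongrightarrow> jost a b (z0 + inverse z0) z0 n) F" if n: "n \<le> 0" for n
  proof (rule tendstoI)
    fix e :: real assume e: "e > 0"
    have "\<forall>\<^sub>F k in sequentially. shoot_tail a b 2 \<delta> k < e / 3"
      using shoot_tail_tendsto[OF pos ls] e by (intro order_tendstoD) auto
    moreover have "\<forall>\<^sub>F k in sequentially. - int k \<le> n"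
      using eventually_ge_at_top[of "nat (- n)"] by eventually_elim auto
    ultimately have "\<forall>\<^sub>F k in sequentially. shoot_tail a b 2 \<delta> k < e / 3 \<and> - int k \<le> n" by eventually_elim auto
    then obtain k where k: "shoot_tail a b 2 \<delta> k < e / 3" "- int k \<le> n" using eventually_happens by fastforce
    have "\<forall>\<^sub>F s in F. dist (shoot a b (z s) k n) (shoot a b z0 k n) < e / 3"
      using e by (intro tendstoD[OF shoot_lim]) auto
    then show "\<forall>\<^sub>F s in F. dist (jost a b (z s + inverse (z s)) (z s) n) (jost a b (z0 + inverse z0) z0 n) < e"
      using gz
    proof eventually_elim
      case (elim s)
      define A where "A = jost a b (z s + inverse (z s)) (z s) n"
      define B where "B = shoot a b (z s) k n"
      define C where "C = shoot a b z0 k n"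
      define D where "D = jost a b (z0 + inverse z0) z0 n"
      have "dist A B < e / 3" "dist B C < e / 3" "dist C D < e / 3"
        using close[OF elim(2) k(2) n] close[OF g0 k(2) n] elim(1) k(1)
        by (auto simp: A_def B_def C_def D_def dist_norm norm_minus_commute)
      then show ?case
        using dist_triangle[of A D B] dist_triangle[of B D C] by (simp add: A_def D_def)
    qed
  qed
  show ?thesis
  proof (rule jacobi_solution_tendsto[where m = "-1" and l = "\<lambda>s. z s + inverse (z s)"])
    show "\<forall>\<^sub>F s in F. jacobi_solution a b (z s + inverse (z s)) (jost a b (z s + inverse (z s)) (z s))"
      using gz by eventually_elim (use \<delta> in \<open>auto simp: good_def intro!: jost_solution(1)[OF pos ls]\<close>)
    show "jacobi_solution a b (z0 + inverse z0) (jost a b (z0 + inverse z0) z0)"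
      using z0 z00 by (intro jost_solution(1)[OF pos ls]) auto
    show "((\<lambda>s. z s + inverse (z s)) \<longlongrightarrow> z0 + inverse z0) F" by (intro tendsto_intros lim z00)
  qed (use base pos in auto)
qed

section \<open>Square summable sequences\<close>

text \<open>Sequences on a half-line are treated as sequences over the integers that vanish elsewhere, so
  that one notion serves the operators on the line and on the half-line.\<close>

definition ell2 :: "(int \<Rightarrow> real) \<Rightarrow> bool" where
  "ell2 x \<longleftrightarrow> (\<lambda>n. (x n)\<^sup>2) summable_on UNIV"

definition ip :: "(int \<Rightarrow> real) \<Rightarrow> (int \<Rightarrow> real) \<Rightarrow> real" where
  "ip x y = (\<Sum>\<^sub>\<infinity>n. x n * y n)"

definition jac :: "(int \<Rightarrow> real) \<Rightarrow> (int \<Rightarrow> real) \<Rightarrow> (int \<Rightarrow> real) \<Rightarrow> int \<Rightarrow> real" where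
  "jac a b x n = a (n - 1) * x (n - 1) + b n * x n + a n * x (n + 1)"

lemma abs_mult_le_squares: "\<bar>x * y\<bar> \<le> x\<^sup>2 + (y::real)\<^sup>2"
  using two_mult_le_squares[of x y] two_mult_le_squares[of "-x" y] zero_le_power2[of x] zero_le_power2[of y]
  by (simp add: abs_if)

lemma summable_on_bounded_by:
  fixes f g :: "'a \<Rightarrow> real"
  assumes "g summable_on A" "\<And>x. x \<in> A \<Longrightarrow> \<bar>f x\<bar> \<le> g x"
  shows "f summable_on A"
proof -
  have "(\<lambda>x. \<bar>f x\<bar>) summable_on A" by (rule summable_on_comparison_test[OF assms]) auto
  then show ?thesis using summable_on_iff_abs_summable_on_real by (metis (no_types, lifting) real_norm_def summable_on_cong)
qed

lemma ell2_mult_summable: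
  assumes "ell2 x" "ell2 y"
  shows "(\<lambda>n. x n * y n) summable_on UNIV"
proof (rule summable_on_bounded_by)
  show "(\<lambda>n. (x n)\<^sup>2 + (y n)\<^sup>2) summable_on UNIV"
    using assms unfolding ell2_def by (rule summable_on_add)
qed (rule abs_mult_le_squares)

lemma ell2_bounded_mult:
  assumes x: "ell2 x" and c: "\<And>n. \<bar>c n\<bar> \<le> K"
  shows "ell2 (\<lambda>n. c n * x n)"
  unfolding ell2_def
proof (rule summable_on_bounded_by)
  show "(\<lambda>n. K\<^sup>2 * (x n)\<^sup>2) summable_on UNIV" using x unfolding ell2_def by (rule summable_on_cmult_right)
  fix n
  have "(c n)\<^sup>2 \<le> K\<^sup>2" using power_mono[OF c[of n], of 2] by simp
  then show "\<bar>(c n * x n)\<^sup>2\<bar> \<le> K\<^sup>2 * (x n)\<^sup>2" by (auto simp: power_mult_distrib intro: mult_right_mono)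
qed

lemma ell2_scale: "ell2 x \<Longrightarrow> ell2 (\<lambda>n. c * x n)"
  by (rule ell2_bounded_mult[where K = "\<bar>c\<bar>"]) auto

lemma ell2_zero [simp]: "ell2 (\<lambda>n. 0)"
  by (simp add: ell2_def)

lemma ell2_add:
  assumes "ell2 x" "ell2 y"
  shows "ell2 (\<lambda>n. x n + y n)"
  unfolding ell2_def
proof (rule summable_on_bounded_by)
  show "(\<lambda>n. 2 * (x n)\<^sup>2 + 2 * (y n)\<^sup>2) summable_on UNIV"
    using assms unfolding ell2_def by (intro summable_on_add summable_on_cmult_right)
  fix n
  show "\<bar>(x n + y n)\<^sup>2\<bar> \<le> 2 * (x n)\<^sup>2 + 2 * (y n)\<^sup>2"
    using two_mult_le_squares[of "x n" "y n"] zero_le_power2[of "x n + y n"] unfolding power2_sum mult.assoc by linarith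
qed

lemma ell2_diff: "ell2 x \<Longrightarrow> ell2 y \<Longrightarrow> ell2 (\<lambda>n. x n - y n)"
  using ell2_add[OF _ ell2_scale[of y "-1"]] by simp

lemma ell2_sum:
  assumes "\<And>i. i \<in> I \<Longrightarrow> ell2 (x i)"
  shows "ell2 (\<lambda>n. \<Sum>i\<in>I. c i * x i n)"
  using assms
proof (induction I rule: infinite_finite_induct)
  case (insert i I)
  then have "ell2 (\<lambda>n. c i * x i n + (\<Sum>i\<in>I. c i * x i n))" by (intro ell2_add ell2_scale) auto
  then show ?case using insert by simp
qed auto

lemma bij_int_shift: "bij_betw (\<lambda>n::int. n + k) UNIV UNIV"
  by (rule bij_betwI[where g = "\<lambda>n. n - k"]) auto

lemma ell2_shift: "ell2 x \<Longrightarrow> ell2 (\<lambda>n. x (n + k))"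
  unfolding ell2_def
  using summable_on_reindex_bij_betw[OF bij_int_shift[of k], of "\<lambda>n. (x n)\<^sup>2"] by simp

lemma infsum_int_shift: "(\<Sum>\<^sub>\<infinity>n. f (n + k :: int)) = (\<Sum>\<^sub>\<infinity>n. f n)" for f :: "int \<Rightarrow> real"
  using infsum_reindex_bij_betw[OF bij_int_shift[of k], of f] .

lemma ell2_jac:
  assumes x: "ell2 x" and K: "\<And>n. \<bar>a n\<bar> \<le> K" "\<And>n. \<bar>b n\<bar> \<le> K"
  shows "ell2 (jac a b x)"
proof -
  have "ell2 (\<lambda>n. a (n + (-1)) * x (n + (-1)) + b n * x n + a n * x (n + 1))"
    by (intro ell2_add ell2_bounded_mult[where K = K] ell2_shift x K)
  then show ?thesis by (simp add: jac_def[abs_def])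
qed

lemma ip_commute: "ip x y = ip y x"
  by (simp add: ip_def mult.commute)

lemma ip_scale: "ip (\<lambda>n. c * x n) y = c * ip x y"
  unfolding ip_def mult.assoc by (rule infsum_cmult_right') 

lemma ip_add: "ell2 x \<Longrightarrow> ell2 y \<Longrightarrow> ell2 z \<Longrightarrow> ip (\<lambda>n. x n + y n) z = ip x z + ip y z"
  unfolding ip_def distrib_right by (intro infsum_add ell2_mult_summable)

lemma ip_diff: "ell2 x \<Longrightarrow> ell2 y \<Longrightarrow> ell2 z \<Longrightarrow> ip (\<lambda>n. x n - y n) z = ip x z - ip y z"
  using ip_add[OF _ ell2_scale[of y "-1"], of x z] ip_scale[of "-1" y z] by simp

lemma ip_zero [simp]: "ip (\<lambda>n. 0) y = 0"
  by (simp add: ip_def)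

lemma ip_sum:
  assumes "\<And>i. i \<in> I \<Longrightarrow> ell2 (x i)" "ell2 y"
  shows "ip (\<lambda>n. \<Sum>i\<in>I. c i * x i n) y = (\<Sum>i\<in>I. c i * ip (x i) y)"
  using assms
  by (induction I rule: infinite_finite_induct)
     (auto simp: ip_add ip_scale ell2_scale ell2_sum)

lemma ip_self_nonneg: "0 \<le> ip x x"
  unfolding ip_def by (rule infsum_nonneg) simp

lemma sum_squares_le_ip:
  assumes "ell2 x" "finite G"
  shows "(\<Sum>n\<in>G. (x n)\<^sup>2) \<le> ip x x"
  unfolding ip_def power2_eq_square using assms unfolding ell2_def power2_eq_square
  by (intro finite_sum_le_infsum) auto

lemma ip_self_eq_0: "ell2 x \<Longrightarrow> ip x x = 0 \<Longrightarrow> x = (\<lambda>n. 0)"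
  using sum_squares_le_ip[of x "{n}" for n] by (fastforce simp: fun_eq_iff)

lemma ip_self_pos: "ell2 x \<Longrightarrow> x n \<noteq> 0 \<Longrightarrow> 0 < ip x x"
  using ip_self_eq_0[of x] ip_self_nonneg[of x] by (metis order_le_less)

lemma ell2I:
  assumes "\<And>G. finite G \<Longrightarrow> (\<Sum>n\<in>G. (x n)\<^sup>2) \<le> B"
  shows "ell2 x" "ip x x \<le> B"
proof -
  show *: "ell2 x" unfolding ell2_def
    by (rule nonneg_bdd_above_summable_on) (use assms in \<open>auto intro!: bdd_aboveI\<close>)
  show "ip x x \<le> B" unfolding ip_def
    by (rule infsum_le_finite_sums) (use * assms in \<open>auto simp: ell2_def power2_eq_square\<close>)
qed

lemma ip_cauchy_schwarz:
  assumes x: "ell2 x" and y: "ell2 y"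
  shows "(ip x y)\<^sup>2 \<le> ip x x * ip y y"
proof (cases "ip y y = 0")
  case True
  then have "y = (\<lambda>n. 0)" using ip_self_eq_0 y by blast
  then show ?thesis by (simp add: ip_def)
next
  case False
  then have pos: "ip y y > 0" using ip_self_nonneg[of y] by simp
  define t where "t = ip x y / ip y y"
  define d where "d n = x n + (- t) * y n" for n
  have d: "ell2 d" unfolding d_def by (intro ell2_add ell2_scale x y)
  have "ip d d = ip x d + (- t) * ip y d"
    unfolding d_def[abs_def] using ip_add[OF x ell2_scale[OF y, of "- t"] d] ip_scale[of "-t" y d] by (simp add: d_def[abs_def])
  moreover have "ip x d = ip x x + (- t) * ip x y" "ip y d = ip y x + (- t) * ip y y"
    unfolding ip_commute[of x d] ip_commute[of y d]
    using ip_add[OF x ell2_scale[OF y, of "- t"]] ip_scale[of "-t" y] x y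
    by (auto simp: d_def[abs_def] ip_commute[of y x])
  ultimately have "ip d d = ip x x - 2 * t * ip x y + t\<^sup>2 * ip y y"
    by (simp add: ip_commute[of y x] algebra_simps power2_eq_square)
  also have "\<dots> = ip x x - (ip x y)\<^sup>2 / ip y y"
    using pos by (simp add: t_def field_simps power2_eq_square)
  finally have "0 \<le> ip x x - (ip x y)\<^sup>2 / ip y y" using ip_self_nonneg[of d] by simp
  then show ?thesis using pos by (simp add: field_simps)
qed

lemma jac_selfadjoint:
  assumes x: "ell2 x" and y: "ell2 y" and K: "\<And>n. \<bar>a n\<bar> \<le> K" "\<And>n. \<bar>b n\<bar> \<le> K"
  shows "ip (jac a b x) y = ip x (jac a b y)"
proof -
  have s1: "(\<lambda>n. (a n * x (n + 1)) * y n) summable_on UNIV" "(\<lambda>n. (a n * x n) * y (n + 1)) summable_on UNIV"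
    by (intro ell2_mult_summable ell2_bounded_mult[where K = K] ell2_shift x y K)+
  have s2: "(\<lambda>n. (a (n + (-1)) * x (n + (-1))) * y n) summable_on UNIV" "(\<lambda>n. x n * (a (n + (-1)) * y (n + (-1)))) summable_on UNIV"
    by (intro ell2_mult_summable ell2_bounded_mult[where K = K] ell2_shift x y K)+
  have s3: "(\<lambda>n. (b n * x n) * y n) summable_on UNIV"
    by (intro ell2_mult_summable ell2_bounded_mult[where K = K] x y K)
  define A where "A = (\<Sum>\<^sub>\<infinity>n. (a n * x (n + 1)) * y n)"
  define B where "B = (\<Sum>\<^sub>\<infinity>n. (a n * x n) * y (n + 1))"
  define C where "C = (\<Sum>\<^sub>\<infinity>n. (b n * x n) * y n)"
  have e1: "(\<Sum>\<^sub>\<infinity>n. (a (n + (-1)) * x (n + (-1))) * y n) = B"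
    using infsum_int_shift[of "\<lambda>n. (a n * x n) * y (n + 1)" "-1"] by (simp add: B_def)
  have e2: "(\<Sum>\<^sub>\<infinity>n. x n * (a (n + (-1)) * y (n + (-1)))) = A"
    using infsum_int_shift[of "\<lambda>n. (a n * x (n + 1)) * y n" "-1"] by (simp add: A_def mult_ac)
  have "ip (jac a b x) y = (\<Sum>\<^sub>\<infinity>n. ((a (n + (-1)) * x (n + (-1))) * y n + (b n * x n) * y n) + (a n * x (n + 1)) * y n)"
    by (simp add: ip_def jac_def distrib_right)
  also have "\<dots> = (B + C) + A"
    by (subst infsum_add[OF summable_on_add[OF s2(1) s3] s1(1)], subst infsum_add[OF s2(1) s3])
       (simp add: e1[simplified] A_def C_def)
  finally have l: "ip (jac a b x) y = B + C + A" .
  have "ip x (jac a b y) = (\<Sum>\<^sub>\<infinity>n. (x n * (a (n + (-1)) * y (n + (-1))) + (b n * x n) * y n) + (a n * x n) * y (n + 1))"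
    by (simp add: ip_def jac_def distrib_left mult_ac)
  also have "\<dots> = (A + C) + B"
    by (subst infsum_add[OF summable_on_add[OF s2(2) s3] s1(2)], subst infsum_add[OF s2(2) s3])
       (simp add: e2[simplified] B_def C_def)
  finally show ?thesis using l by simp
qed

lemma ip_orthogonal_sums:
  assumes e: "\<And>i. i \<in> I \<Longrightarrow> ell2 (v i)" and orth: "\<And>i j. i \<in> I \<Longrightarrow> j \<in> I \<Longrightarrow> i \<noteq> j \<Longrightarrow> ip (v i) (v j) = 0"
    and I: "finite I"
  shows "ip (\<lambda>n. \<Sum>i\<in>I. c i * v i n) (\<lambda>n. \<Sum>i\<in>I. d i * v i n) = (\<Sum>i\<in>I. c i * d i * ip (v i) (v i))"
proof -
  have "ip (\<lambda>n. \<Sum>i\<in>I. c i * v i n) (\<lambda>n. \<Sum>i\<in>I. d i * v i n) = (\<Sum>i\<in>I. c i * ip (v i) (\<lambda>n. \<Sum>i\<in>I. d i * v i n))"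
    by (intro ip_sum ell2_sum e)
  also have "\<dots> = (\<Sum>i\<in>I. c i * (d i * ip (v i) (v i)))"
  proof (intro sum.cong refl arg_cong2[of _ _ _ _ "(*)"])
    fix i assume i: "i \<in> I"
    have "ip (v i) (\<lambda>n. \<Sum>j\<in>I. d j * v j n) = (\<Sum>j\<in>I. d j * ip (v j) (v i))"
      using ip_sum[of I v "v i" d] e i by (simp add: ip_commute)
    also have "\<dots> = (\<Sum>j\<in>I. if j = i then d i * ip (v i) (v i) else 0)"
      using i orth by (intro sum.cong) auto
    finally show "ip (v i) (\<lambda>n. \<Sum>j\<in>I. d j * v j n) = d i * ip (v i) (v i)" using i I by simp
  qed
  finally show ?thesis by (simp add: mult_ac)
qed

lemma jac_sum: "jac a b (\<lambda>n. \<Sum>i\<in>I. c i * v i n) n = (\<Sum>i\<in>I. c i * jac a b (v i) n)"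
  by (simp add: jac_def sum_distrib_left sum.distrib algebra_simps)

lemma jac_eigen_orthogonal:
  assumes "ell2 x" "ell2 y" "\<And>n. \<bar>a n\<bar> \<le> K" "\<And>n. \<bar>b n\<bar> \<le> K"
    and "jac a b x = (\<lambda>n. \<mu> * x n)" "jac a b y = (\<lambda>n. \<nu> * y n)" "\<mu> \<noteq> \<nu>"
  shows "ip x y = 0"
proof -
  have "\<mu> * ip x y = ip (jac a b x) y" using assms(5) by (simp add: ip_scale)
  also have "\<dots> = ip x (jac a b y)" by (rule jac_selfadjoint) fact+
  also have "\<dots> = \<nu> * ip x y" using assms(6) by (simp add: ip_scale ip_commute[of x])
  finally show ?thesis using assms(7) by simp
qed

section \<open>Finiteness of the discrete spectrum\<close>

text \<open>By elimination of one unknown, and induction on the number of equations.\<close>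

lemma underdetermined_system:
  fixes F :: "'i \<Rightarrow> 'j \<Rightarrow> real"
  assumes "finite I" "finite J" "card I < card J"
  obtains c where "\<exists>j\<in>J. c j \<noteq> 0" "\<And>i. i \<in> I \<Longrightarrow> (\<Sum>j\<in>J. c j * F i j) = 0"
proof -
  have "\<exists>c. (\<exists>j\<in>J. c j \<noteq> 0) \<and> (\<forall>i\<in>I. (\<Sum>j\<in>J. c j * F i j) = 0)"
    using assms
  proof (induction I arbitrary: J F rule: finite_induct)
    case empty
    then have "J \<noteq> {}" by auto
    then show ?case by (intro exI[of _ "\<lambda>_. 1"]) auto
  next
    case (insert i I)
    show ?case
    proof (cases "\<forall>j\<in>J. F i j = 0")
      case True
      have "card I < card J" using insert by simp
      from insert.IH[OF insert.prems(1) this, of F] obtain c where "\<exists>j\<in>J. c j \<noteq> 0" "\<forall>i\<in>I. (\<Sum>j\<in>J. c j * F i j) = 0" by blast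
      then show ?thesis using True by (intro exI[of _ c]) auto
    next
      case False
      then obtain j0 where j0: "j0 \<in> J" "F i j0 \<noteq> 0" by blast
      have "card I < card (J - {j0})" using insert j0 by simp
      from insert.IH[OF _ this, of "\<lambda>i' j. F i' j - F i j / F i j0 * F i' j0"] insert.prems(1)
      obtain c where c: "\<exists>j\<in>J - {j0}. c j \<noteq> 0"
        "\<forall>i'\<in>I. (\<Sum>j\<in>J - {j0}. c j * (F i' j - F i j / F i j0 * F i' j0)) = 0" by auto
      define s where "s = (\<Sum>j\<in>J - {j0}. c j * F i j)"
      define c' where "c' j = (if j = j0 then - s / F i j0 else c j)" for j
      have split: "(\<Sum>j\<in>J. c' j * G j) = - s / F i j0 * G j0 + (\<Sum>j\<in>J - {j0}. c j * G j)" for G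
        using sum.remove[OF insert.prems(1) j0(1), of "\<lambda>j. c' j * G j"] by (simp add: c'_def)
      have "(\<Sum>j\<in>J. c' j * F i j) = 0" unfolding split using j0 by (simp add: s_def)
      moreover have "(\<Sum>j\<in>J. c' j * F i' j) = 0" if "i' \<in> I" for i'
      proof -
        have "(\<Sum>j\<in>J - {j0}. c j * (F i j / F i j0 * F i' j0)) = (\<Sum>j\<in>J - {j0}. c j * F i j) / F i j0 * F i' j0"
          by (simp add: sum_distrib_right sum_divide_distrib mult.assoc)
        then have "0 = (\<Sum>j\<in>J - {j0}. c j * F i' j) - (\<Sum>j\<in>J - {j0}. c j * F i j) / F i j0 * F i' j0"
          using c(2)[rule_format, OF that] unfolding right_diff_distrib sum_subtractf by simp
        then show ?thesis unfolding split s_def by simp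
      qed
      moreover have "\<exists>j\<in>J. c' j \<noteq> 0" using c(1) by (auto simp: c'_def)
      ultimately show ?thesis by (intro exI[of _ c']) auto
    qed
  qed
  then show ?thesis using that by blast
qed

text \<open>The form of \<open>2 - L\<close> is that of the case \<open>a = 1\<close>, \<open>b = 0\<close>, a sum of squared differences, plus
  the perturbation.\<close>

lemma quadratic_form_identity:
  assumes x: "ell2 x" and K: "\<And>n. \<bar>a n\<bar> \<le> K" "\<And>n. \<bar>b n\<bar> \<le> K"
  shows "(\<lambda>n. (x n - x (n + 1))\<^sup>2 - b n * (x n)\<^sup>2 - 2 * (a n - 1) * (x n * x (n + 1))) summable_on UNIV"
    "2 * ip x x - ip (jac a b x) x
       = (\<Sum>\<^sub>\<infinity>n. (x n - x (n + 1))\<^sup>2 - b n * (x n)\<^sup>2 - 2 * (a n - 1) * (x n * x (n + 1)))"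
proof -
  have s0: "(\<lambda>n. x n * x n) summable_on UNIV" "(\<lambda>n. x (n + 1) * x (n + 1)) summable_on UNIV"
    by (intro ell2_mult_summable ell2_shift x)+
  have s1: "(\<lambda>n. (a n * x (n + 1)) * x n) summable_on UNIV" "(\<lambda>n. (a (n + (-1)) * x (n + (-1))) * x n) summable_on UNIV"
    "(\<lambda>n. (b n * x n) * x n) summable_on UNIV"
    by (intro ell2_mult_summable ell2_bounded_mult[where K = K] ell2_shift x K)+
  define A where "A = (\<Sum>\<^sub>\<infinity>n. (a n * x (n + 1)) * x n)"
  define C where "C = (\<Sum>\<^sub>\<infinity>n. (b n * x n) * x n)"
  have e1: "(\<Sum>\<^sub>\<infinity>n. (a (n + (-1)) * x (n + (-1))) * x n) = A"
    using infsum_int_shift[of "\<lambda>n. (a n * x (n + 1)) * x n" "-1"] by (simp add: A_def mult_ac)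
  have "ip (jac a b x) x = (\<Sum>\<^sub>\<infinity>n. ((a (n + (-1)) * x (n + (-1))) * x n + (b n * x n) * x n) + (a n * x (n + 1)) * x n)"
    by (simp add: ip_def jac_def distrib_right)
  also have "\<dots> = (A + C) + A"
    by (subst infsum_add[OF summable_on_add[OF s1(2) s1(3)] s1(1)], subst infsum_add[OF s1(2) s1(3)])
       (simp add: e1[simplified] A_def C_def)
  finally have l: "ip (jac a b x) x = A + C + A" .
  have i1: "(\<Sum>\<^sub>\<infinity>n. x (n + 1) * x (n + 1)) = ip x x"
    using infsum_int_shift[of "\<lambda>n. x n * x n" 1] by (simp add: ip_def)
  have eq: "(\<lambda>n. (x n - x (n + 1))\<^sup>2 - b n * (x n)\<^sup>2 - 2 * (a n - 1) * (x n * x (n + 1)))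
     = (\<lambda>n. ((x n * x n + x (n + 1) * x (n + 1)) + (- 1) * ((b n * x n) * x n)) + (- 2) * ((a n * x (n + 1)) * x n))"
    by (simp add: fun_eq_iff power2_eq_square algebra_simps)
  note sa = summable_on_add[OF s0] and sb = summable_on_cmult_right[OF s1(3), of "-1"] and sc = summable_on_cmult_right[OF s1(1), of "-2"]
  show "(\<lambda>n. (x n - x (n + 1))\<^sup>2 - b n * (x n)\<^sup>2 - 2 * (a n - 1) * (x n * x (n + 1))) summable_on UNIV"
    unfolding eq by (intro summable_on_add[OF summable_on_add[OF sa sb] sc])
  have "(\<Sum>\<^sub>\<infinity>n. ((x n * x n + x (n + 1) * x (n + 1)) + (- 1) * ((b n * x n) * x n)) + (- 2) * ((a n * x (n + 1)) * x n))
     = (ip x x + ip x x) + (- 1) * C + (- 2) * A"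
    by (subst infsum_add[OF summable_on_add[OF sa sb] sc], subst infsum_add[OF sa sb], subst infsum_add[OF s0])
       (simp only: infsum_cmult_right[OF s1(3)] infsum_cmult_right[OF s1(1)] i1 ip_def[symmetric] C_def A_def infsum_cmult_right')
  then show "2 * ip x x - ip (jac a b x) x
       = (\<Sum>\<^sub>\<infinity>n. (x n - x (n + 1))\<^sup>2 - b n * (x n)\<^sup>2 - 2 * (a n - 1) * (x n * x (n + 1)))"
    unfolding eq l by simp
qed

text \<open>A discrete Hardy argument. Let \<open>D\<close> be the sum of the squared differences on the left. As \<open>x\<close>
  vanishes at \<open>-N\<close>, the Cauchy-Schwarz inequality gives \<open>\<bar>x\<^sub>n\<bar>\<^sup>2 \<le> \<bar>n\<bar> D\<close> for \<open>n \<le> - N\<close>, and a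
  perturbation with first moment at most 1 cannot outweigh \<open>D\<close>. On the right, where the
  coefficients are small, every summand is nonnegative by itself.\<close>

lemma quadratic_form_nonneg:
  fixes N :: nat
  assumes x: "ell2 x" and K: "\<And>n. \<bar>a n\<bar> \<le> K" "\<And>n. \<bar>b n\<bar> \<le> K"
    and right: "\<And>n. n \<ge> int N \<Longrightarrow> \<bar>a n\<bar> \<le> 1/2 \<and> \<bar>b n\<bar> \<le> 1/2"
    and left: "\<And>G. finite G \<Longrightarrow> G \<subseteq> {..< - int N} \<Longrightarrow> (\<Sum>n\<in>G. \<bar>of_int n\<bar> * (\<bar>b n\<bar> + 2 * \<bar>a n - 1\<bar>)) \<le> 1"
    and zero: "\<And>n. n \<in> {- int N..int N} \<Longrightarrow> x n = 0"
  shows "ip (jac a b x) x \<le> 2 * ip x x"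
proof -
  define q where "q n = (x n - x (n + 1))\<^sup>2 - b n * (x n)\<^sup>2 - 2 * (a n - 1) * (x n * x (n + 1))" for n
  define d where "d n = (x n - x (n + 1))\<^sup>2" for n
  define e where "e n = b n * (x n)\<^sup>2 + 2 * (a n - 1) * (x n * x (n + 1))" for n
  define L where "L = {..< - int N}"
  define D where "D = infsum d L"
  have qs: "q summable_on UNIV" unfolding q_def by (rule quadratic_form_identity(1)[OF x K])
  have ds: "d summable_on UNIV"
    using ell2_diff[OF x ell2_shift[OF x, of 1]] unfolding ell2_def d_def[abs_def] .
  have dsL: "d summable_on L" by (rule summable_on_subset_banach[OF ds]) auto
  have qsL: "q summable_on L" "q summable_on - L" by (rule summable_on_subset_banach[OF qs], simp)+
  have q_de: "q n = d n - e n" for n by (simp add: q_def d_def e_def)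
  have esL: "e summable_on L"
  proof -
    have "(\<lambda>n. d n + (- 1) * q n) summable_on L" by (intro summable_on_add summable_on_cmult_right dsL qsL)
    then show ?thesis by (simp add: q_de)
  qed
  have D0: "0 \<le> D" unfolding D_def by (rule infsum_nonneg) (simp add: d_def)
  have xb: "(x n)\<^sup>2 \<le> real_of_int (- int N - n) * D" if n: "n \<le> - int N" for n
  proof -
    have tel: "(\<Sum>m\<in>{n..< - int N}. x m - x (m + 1)) = x n - x (- int N)"
      using n
    proof (induction n rule: int_le_induct)
      case (step i)
      have "{i - 1..< - int N} = insert (i - 1) {i..< - int N}" using step.hyps by auto
      then show ?case using step.IH by simp
    qed simp
    have "(x n)\<^sup>2 = (\<Sum>m\<in>{n..< - int N}. x m - x (m + 1))\<^sup>2" unfolding tel using zero[of "- int N"] by simp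
    also have "\<dots> \<le> real (card {n..< - int N}) * (\<Sum>m\<in>{n..< - int N}. (x m - x (m + 1))\<^sup>2)"
      using sum_squared_le_sum_of_squares[of "\<lambda>m. x m - x (m + 1)" "{n..< - int N}"] by (simp add: mult.commute)
    also have "\<dots> \<le> real (card {n..< - int N}) * D"
      unfolding D_def d_def[symmetric]
      by (intro mult_left_mono finite_sum_le_infsum dsL) (auto simp: L_def d_def)
    finally show ?thesis using n by simp
  qed
  have "infsum e L \<le> D"
  proof (rule infsum_le_finite_sums[OF esL])
    fix G assume G: "finite G" "G \<subseteq> L"
    have "sum e G \<le> (\<Sum>n\<in>G. (\<bar>of_int n\<bar> * (\<bar>b n\<bar> + 2 * \<bar>a n - 1\<bar>)) * D)"
    proof (rule sum_mono)
      fix n assume "n \<in> G"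
      then have n: "n < - int N" using G by (auto simp: L_def)
      then have n0: "real_of_int n < 0" by simp
      have "(x n)\<^sup>2 \<le> real_of_int (- int N - n) * D" "(x (n + 1))\<^sup>2 \<le> real_of_int (- int N - (n + 1)) * D"
        using n xb[of n] xb[of "n + 1"] by simp_all
      moreover have "real_of_int (- int N - n) * D \<le> \<bar>of_int n\<bar> * D" "real_of_int (- int N - (n + 1)) * D \<le> \<bar>of_int n\<bar> * D"
        using n0 D0 by (intro mult_right_mono; simp)+
      ultimately have x2: "(x n)\<^sup>2 \<le> \<bar>of_int n\<bar> * D" "(x (n + 1))\<^sup>2 \<le> \<bar>of_int n\<bar> * D" by linarith+
      have xx: "\<bar>x n * x (n + 1)\<bar> \<le> \<bar>of_int n\<bar> * D"
        using two_mult_le_squares[of "x n" "x (n + 1)"] two_mult_le_squares[of "- x n" "x (n + 1)"] x2 by (simp add: abs_if)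
      have "e n \<le> \<bar>b n\<bar> * (x n)\<^sup>2 + 2 * \<bar>a n - 1\<bar> * \<bar>x n * x (n + 1)\<bar>"
      proof -
        have "b n * (x n)\<^sup>2 \<le> \<bar>b n\<bar> * (x n)\<^sup>2" by (intro mult_right_mono) auto
        moreover have "(a n - 1) * (x n * x (n + 1)) \<le> \<bar>a n - 1\<bar> * \<bar>x n * x (n + 1)\<bar>"
          by (metis abs_ge_self abs_mult)
        ultimately show ?thesis unfolding e_def mult.assoc by linarith
      qed
      also have "\<dots> \<le> \<bar>b n\<bar> * (\<bar>of_int n\<bar> * D) + 2 * \<bar>a n - 1\<bar> * (\<bar>of_int n\<bar> * D)"
        using x2 xx by (intro add_mono mult_left_mono) auto
      finally show "e n \<le> (\<bar>of_int n\<bar> * (\<bar>b n\<bar> + 2 * \<bar>a n - 1\<bar>)) * D" by (simp add: algebra_simps)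
    qed
    also have "\<dots> = (\<Sum>n\<in>G. \<bar>of_int n\<bar> * (\<bar>b n\<bar> + 2 * \<bar>a n - 1\<bar>)) * D" by (simp add: sum_distrib_right)
    also have "\<dots> \<le> 1 * D" using left[OF G[unfolded L_def]] D0 by (rule mult_right_mono)
    finally show "sum e G \<le> D" by simp
  qed
  then have QL: "0 \<le> infsum q L"
    unfolding q_de using infsum_add[OF dsL summable_on_cmult_right[OF esL, of "-1"]] infsum_cmult_right[OF esL, of "-1"] by (simp add: D_def)
  have QR: "0 \<le> infsum q (- L)"
  proof (rule infsum_nonneg)
    fix n assume "n \<in> - L"
    then consider "n \<in> {- int N..<int N}" | "n \<ge> int N" by (cases "n < int N") (auto simp: L_def)
    then show "0 \<le> q n"
    proof cases
      case 1
      then have "x n = 0" "x (n + 1) = 0" by (auto intro!: zero)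
      then show ?thesis by (simp add: q_def)
    next
      case 2
      have ab: "\<bar>a n\<bar> \<le> 1/2" "\<bar>b n\<bar> \<le> 1/2" using right[OF 2] by auto
      have "q n = (x n)\<^sup>2 + (x (n + 1))\<^sup>2 - b n * (x n)\<^sup>2 - a n * (2 * (x n * x (n + 1)))"
        by (simp add: q_def power2_diff algebra_simps)
      moreover have "b n * (x n)\<^sup>2 \<le> 1/2 * (x n)\<^sup>2" using ab by (intro mult_right_mono) auto
      moreover have "a n * (2 * (x n * x (n + 1))) \<le> 1/2 * ((x n)\<^sup>2 + (x (n + 1))\<^sup>2)"
      proof -
        have "a n * (2 * (x n * x (n + 1))) \<le> \<bar>a n\<bar> * \<bar>2 * (x n * x (n + 1))\<bar>" by (metis abs_ge_self abs_mult)
        also have "\<dots> \<le> 1/2 * ((x n)\<^sup>2 + (x (n + 1))\<^sup>2)"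
          using ab two_mult_le_squares[of "x n" "x (n + 1)"] two_mult_le_squares[of "- x n" "x (n + 1)"]
          by (intro mult_mono) (auto simp: abs_if)
        finally show ?thesis .
      qed
      ultimately have "q n \<ge> (x (n + 1))\<^sup>2 / 2" by (simp add: field_simps)
      moreover have "0 \<le> (x (n + 1))\<^sup>2 / 2" by simp
      ultimately show ?thesis by (rule order.trans[rotated])
    qed
  qed
  have "infsum q UNIV = infsum q L + infsum q (- L)"
    using infsum_Un_disjoint[OF qsL] by simp
  moreover have "2 * ip x x - ip (jac a b x) x = infsum q UNIV"
    unfolding q_def by (rule quadratic_form_identity(2)[OF x, of a K b]) (rule K)+
  ultimately show ?thesis using QL QR by simp
qed

text \<open>If there were more eigenvalues above 2 than sites in \<open>{-N..N}\<close>, some nonzero combination of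
  their eigenvectors would vanish at all these sites. By orthogonality the form of \<open>L\<close> exceeds that
  of 2 on it, contrary to \<open>quadratic_form_nonneg\<close>.\<close>

lemma finite_eigenvalues_above_2:
  fixes N :: nat
  assumes K: "\<And>n. \<bar>a n\<bar> \<le> K" "\<And>n. \<bar>b n\<bar> \<le> K"
    and right: "\<And>n. n \<ge> int N \<Longrightarrow> \<bar>a n\<bar> \<le> 1/2 \<and> \<bar>b n\<bar> \<le> 1/2"
    and left: "\<And>G. finite G \<Longrightarrow> G \<subseteq> {..< - int N} \<Longrightarrow> (\<Sum>n\<in>G. \<bar>of_int n\<bar> * (\<bar>b n\<bar> + 2 * \<bar>a n - 1\<bar>)) \<le> 1"
  shows "finite {\<mu>. \<mu> > 2 \<and> (\<exists>x. ell2 x \<and> x \<noteq> (\<lambda>n. 0) \<and> jac a b x = (\<lambda>n. \<mu> * x n))}"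
    (is "finite ?E")
proof (rule ccontr)
  assume "infinite ?E"
  then obtain J where J: "J \<subseteq> ?E" "finite J" "card J = Suc (card {- int N..int N})"
    using infinite_arbitrarily_large by blast
  define v where "v \<mu> = (SOME x. ell2 x \<and> x \<noteq> (\<lambda>n. 0) \<and> jac a b x = (\<lambda>n. \<mu> * x n))" for \<mu>
  have v: "ell2 (v \<mu>)" "v \<mu> \<noteq> (\<lambda>n. 0)" "jac a b (v \<mu>) = (\<lambda>n. \<mu> * v \<mu> n)" "\<mu> > 2" if "\<mu> \<in> J" for \<mu>
  proof -
    have "\<exists>x. ell2 x \<and> x \<noteq> (\<lambda>n. 0) \<and> jac a b x = (\<lambda>n. \<mu> * x n)" using J that by blast
    from someI_ex[OF this] show "ell2 (v \<mu>)" "v \<mu> \<noteq> (\<lambda>n. 0)" "jac a b (v \<mu>) = (\<lambda>n. \<mu> * v \<mu> n)"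
      unfolding v_def by auto
    show "\<mu> > 2" using J that by blast
  qed
  have "card {- int N..int N} < card J" using J by simp
  then obtain c where c: "\<exists>\<mu>\<in>J. c \<mu> \<noteq> 0" "\<And>n. n \<in> {- int N..int N} \<Longrightarrow> (\<Sum>\<mu>\<in>J. c \<mu> * v \<mu> n) = 0"
    using underdetermined_system[of "{- int N..int N}" J "\<lambda>n \<mu>. v \<mu> n"] J(2) by blast
  define x where "x n = (\<Sum>\<mu>\<in>J. c \<mu> * v \<mu> n)" for n
  have x: "ell2 x" unfolding x_def using v(1) by (rule ell2_sum)
  have orth: "ip (v \<mu>) (v \<nu>) = 0" if "\<mu> \<in> J" "\<nu> \<in> J" "\<mu> \<noteq> \<nu>" for \<mu> \<nu>
    using jac_eigen_orthogonal[OF v(1)[OF that(1)] v(1)[OF that(2)] K v(3)[OF that(1)] v(3)[OF that(2)] that(3)] .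
  have jx: "jac a b x = (\<lambda>n. \<Sum>\<mu>\<in>J. (c \<mu> * \<mu>) * v \<mu> n)"
    unfolding x_def[abs_def] fun_eq_iff jac_sum using v(3) by (auto intro!: sum.cong simp: mult_ac)
  have "ip (jac a b x) x - 2 * ip x x = (\<Sum>\<mu>\<in>J. (c \<mu>)\<^sup>2 * ((\<mu> - 2) * ip (v \<mu>) (v \<mu>)))"
    unfolding jx unfolding x_def[abs_def]
    using ip_orthogonal_sums[of J v, OF v(1) orth J(2), of "\<lambda>\<mu>. c \<mu> * \<mu>" c] ip_orthogonal_sums[of J v, OF v(1) orth J(2), of c c]
    by (simp add: sum_distrib_left sum_subtractf[symmetric] algebra_simps power2_eq_square)
  also have "\<dots> > 0"
  proof -
    obtain \<mu> where \<mu>: "\<mu> \<in> J" "c \<mu> \<noteq> 0" using c(1) by blast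
    have nn: "0 \<le> (c \<nu>)\<^sup>2 * ((\<nu> - 2) * ip (v \<nu>) (v \<nu>))" if "\<nu> \<in> J" for \<nu>
      using v(4)[OF that] ip_self_nonneg[of "v \<nu>"] by simp
    obtain n where "v \<mu> n \<noteq> 0" using v(2)[OF \<mu>(1)] by blast
    then have "0 < ip (v \<mu>) (v \<mu>)" using ip_self_pos v(1)[OF \<mu>(1)] by blast
    then have "0 < (c \<mu>)\<^sup>2 * ((\<mu> - 2) * ip (v \<mu>) (v \<mu>))" using \<mu>(2) v(4)[OF \<mu>(1)] by simp
    then show ?thesis using \<mu>(1) nn J(2) by (intro sum_pos2) auto
  qed
  finally have "ip (jac a b x) x > 2 * ip x x" by simp
  moreover have "ip (jac a b x) x \<le> 2 * ip x x"
    by (rule quadratic_form_nonneg[OF x K right left]) (use c(2) in \<open>auto simp: x_def\<close>)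
  ultimately show False by simp
qed

lemma discrete_eigenvalue_real_eigenvector:
  assumes "\<mu> \<in> discrete_eigenvalues a b"
  obtains x where "ell2 x" "x \<noteq> (\<lambda>n. 0)" "jac a b x = (\<lambda>n. \<mu> * x n)"
proof -
  obtain y n0 where y: "square_summable_on y UNIV" "y n0 \<noteq> 0" "jacobi_solution a b (complex_of_real \<mu>) y"
    using assms unfolding discrete_eigenvalues_def by blast
  have eq: "complex_of_real (a (n - 1)) * y (n - 1) + complex_of_real (b n) * y n + complex_of_real (a n) * y (n + 1) = complex_of_real \<mu> * y n" for n
    using y(3) unfolding jacobi_solution_def jacobi_def by blast
  have re: "jac a b (\<lambda>n. Re (y n)) = (\<lambda>n. \<mu> * Re (y n))" and im: "jac a b (\<lambda>n. Im (y n)) = (\<lambda>n. \<mu> * Im (y n))"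
    using arg_cong[OF eq, of Re] arg_cong[OF eq, of Im] by (auto simp: jac_def fun_eq_iff)
  have s: "(\<lambda>n. (cmod (y n))\<^sup>2) summable_on UNIV" using y(1) by (simp add: square_summable_on_def)
  have "ell2 (\<lambda>n. Re (y n))" "ell2 (\<lambda>n. Im (y n))"
    unfolding ell2_def by (rule summable_on_bounded_by[OF s]; simp add: cmod_power2)+
  moreover have "(\<lambda>n. Re (y n)) \<noteq> (\<lambda>n. 0) \<or> (\<lambda>n. Im (y n)) \<noteq> (\<lambda>n. 0)"
    using y(2) by (metis complex_eqI zero_complex.sel)
  ultimately show ?thesis using that re im by blast
qed

text \<open>Multiplication by \<open>(-1)\<^sup>n\<close> turns \<open>L\<close> into the negative of the operator with \<open>- b\<close> for \<open>b\<close>.\<close>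

lemma discrete_eigenvalues_neg:
  assumes "\<mu> \<in> discrete_eigenvalues a b"
  shows "- \<mu> \<in> discrete_eigenvalues a (\<lambda>n. - b n)"
proof -
  obtain y where y: "square_summable_on y UNIV" "\<exists>n. y n \<noteq> 0" "jacobi_solution a b (complex_of_real \<mu>) y"
    and \<mu>: "\<mu> \<notin> {-2..2}"
    using assms unfolding discrete_eigenvalues_def by blast
  define w where "w n = (if even n then y n else - y n)" for n :: int
  have "jacobi_solution a (\<lambda>n. - b n) (complex_of_real (- \<mu>)) w"
    unfolding jacobi_solution_def jacobi_def
  proof
    fix n
    have "complex_of_real (a (n - 1)) * y (n - 1) + complex_of_real (b n) * y n + complex_of_real (a n) * y (n + 1) = complex_of_real \<mu> * y n"
      using y(3) unfolding jacobi_solution_def jacobi_def by blast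
    then show "complex_of_real (a (n - 1)) * w (n - 1) + complex_of_real (- b n) * w n + complex_of_real (a n) * w (n + 1) = complex_of_real (- \<mu>) * w n"
      by (auto simp: w_def algebra_simps add_eq_0_iff)
  qed
  moreover have "cmod (w n) = cmod (y n)" for n by (simp add: w_def)
  moreover have "\<exists>n. w n \<noteq> 0" using y(2) by (auto simp: w_def)
  ultimately show ?thesis using y(1) \<mu> unfolding discrete_eigenvalues_def square_summable_on_def
    by (intro CollectI conjI exI[of _ w]) auto
qed

section \<open>The decay conditions\<close>

lemma left_moment_term_nonneg: "0 \<le> left_moment_term a b n"
  by (simp add: left_moment_term_def)

lemma initial_class_left_tail:
  assumes "initial_class a b" "\<epsilon> > 0"
  obtains N :: nat where "\<And>G. finite G \<Longrightarrow> G \<subseteq> {..< - int N} \<Longrightarrow> (\<Sum>n\<in>G. left_moment_term a b n) \<le> \<epsilon>"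
proof -
  define h where "h = left_moment_term a b"
  have s: "h summable_on {..<0}" using assms by (simp add: initial_class_def h_def)
  have h0: "0 \<le> h n" for n by (simp add: h_def left_moment_term_nonneg)
  have "((\<lambda>F. sum h F) \<longlongrightarrow> infsum h {..<0}) (finite_subsets_at_top {..<0})"
    using has_sum_infsum[OF s] by (simp add: has_sum_def)
  then have "\<forall>\<^sub>F F in finite_subsets_at_top {..<0}. dist (sum h F) (infsum h {..<0}) < \<epsilon>"
    using assms(2) by (rule tendstoD)
  then obtain F where F: "finite F" "F \<subseteq> {..<0}" "dist (sum h F) (infsum h {..<0}) < \<epsilon>"
    unfolding eventually_finite_subsets_at_top by blast
  obtain N where N: "F \<subseteq> {- int N..int N}" using finite_int_subset_symmetric[OF F(1)] by blast
  have "(\<Sum>n\<in>G. left_moment_term a b n) \<le> \<epsilon>" if G: "finite G" "G \<subseteq> {..< - int N}" for G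
  proof -
    have "F \<inter> G = {}" using N G by fastforce
    then have "sum h F + sum h G = sum h (F \<union> G)" using F G by (simp add: sum.union_disjoint)
    also have "\<dots> \<le> infsum h {..<0}" using F G by (intro finite_sum_le_infsum s h0) auto
    finally show ?thesis using F(3) by (simp add: dist_real_def h_def)
  qed
  then show ?thesis using that by blast
qed

lemma initial_class_bounded:
  assumes "initial_class a b"
  obtains K where "\<And>n. \<bar>a n\<bar> \<le> K" "\<And>n. \<bar>b n\<bar> \<le> K"
proof -
  have "\<forall>\<^sub>F n in at_top. \<bar>a n\<bar> < 1" "\<forall>\<^sub>F n in at_top. \<bar>b n\<bar> < 1"
    using assms unfolding initial_class_def
    by (auto intro!: order_tendstoD(2)[OF tendsto_rabs_zero])
  then have "\<forall>\<^sub>F n in at_top. \<bar>a n\<bar> < 1 \<and> \<bar>b n\<bar> < 1" by eventually_elim auto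
  then obtain R where R: "\<And>n. n \<ge> R \<Longrightarrow> \<bar>a n\<bar> < 1 \<and> \<bar>b n\<bar> < 1" by (auto simp: eventually_at_top_linorder)
  define S where "S = infsum (left_moment_term a b) {..<0}"
  have left: "\<bar>a n\<bar> \<le> S + 1 \<and> \<bar>b n\<bar> \<le> S + 1" if n: "n < 0" for n
  proof -
    have "left_moment_term a b n = sum (left_moment_term a b) {n}" by simp
    also have "\<dots> \<le> S" unfolding S_def using assms n
      by (intro finite_sum_le_infsum left_moment_term_nonneg) (auto simp: initial_class_def)
    finally have h: "left_moment_term a b n \<le> S" .
    have "1 * (\<bar>a n - 1\<bar> + \<bar>b n\<bar>) \<le> left_moment_term a b n"
      unfolding left_moment_term_def using n by (intro mult_right_mono) auto
    then have ab: "\<bar>a n - 1\<bar> + \<bar>b n\<bar> \<le> S" using h by simp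
    have "\<bar>a n\<bar> \<le> \<bar>a n - 1\<bar> + 1" by simp
    then show ?thesis using ab abs_ge_zero[of "b n"] abs_ge_zero[of "a n - 1"] by (intro conjI; linarith)
  qed
  define M where "M = Max ((\<lambda>n. max \<bar>a n\<bar> \<bar>b n\<bar>) ` {0..max R 0})"
  have mid: "\<bar>a n\<bar> \<le> M \<and> \<bar>b n\<bar> \<le> M" if "n \<in> {0..max R 0}" for n
  proof -
    have "max \<bar>a n\<bar> \<bar>b n\<bar> \<le> M" unfolding M_def using that by (intro Max_ge) auto
    then show ?thesis by simp
  qed
  have "\<bar>a n\<bar> \<le> max (max 1 (S + 1)) M \<and> \<bar>b n\<bar> \<le> max (max 1 (S + 1)) M" for n
  proof -
    consider "n < 0" | "n \<in> {0..max R 0}" | "n \<ge> R" by fastforce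
    then show ?thesis using left[of n] mid[of n] R[of n] by cases auto
  qed
  then show ?thesis using that by blast
qed

lemma initial_class_left_summable:
  assumes "initial_class a b"
  shows "left_summable a b"
proof -
  define h where "h = left_moment_term a b"
  have s: "h summable_on {..<0}" using assms by (simp add: initial_class_def h_def)
  have h0: "0 \<le> h n" for n by (simp add: h_def left_moment_term_nonneg)
  have "summable (\<lambda>k. \<bar>a (- int (Suc k)) - 1\<bar> + \<bar>b (- int (Suc k))\<bar>)"
  proof (rule bounded_imp_summable)
    fix n
    have "(\<Sum>k\<le>n. \<bar>a (- int (Suc k)) - 1\<bar> + \<bar>b (- int (Suc k))\<bar>) \<le> (\<Sum>k\<le>n. h (- int (Suc k)))"
    proof (rule sum_mono)
      fix k
      have "1 * (\<bar>a (- int (Suc k)) - 1\<bar> + \<bar>b (- int (Suc k))\<bar>) \<le> h (- int (Suc k))"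
        unfolding h_def left_moment_term_def by (intro mult_right_mono) auto
      then show "\<bar>a (- int (Suc k)) - 1\<bar> + \<bar>b (- int (Suc k))\<bar> \<le> h (- int (Suc k))" by simp
    qed
    also have "\<dots> = sum h ((\<lambda>k. - int (Suc k)) ` {..n})"
      by (subst sum.reindex) (auto simp: inj_on_def)
    also have "\<dots> \<le> infsum h {..<0}" by (intro finite_sum_le_infsum s h0) auto
    finally show "(\<Sum>k\<le>n. \<bar>a (- int (Suc k)) - 1\<bar> + \<bar>b (- int (Suc k))\<bar>) \<le> infsum h {..<0}" .
  qed auto
  then show ?thesis unfolding left_summable_def using summable_Suc_iff[of "\<lambda>k. \<bar>a (- int k) - 1\<bar> + \<bar>b (- int k)\<bar>"] by simp
qed

lemma initial_class_neg: "initial_class a b \<Longrightarrow> initial_class a (\<lambda>n. - b n)"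
  by (auto simp: initial_class_def left_moment_term_def[abs_def] tendsto_minus_cancel_left[symmetric])

lemma finite_discrete_eigenvalues_above_2:
  assumes "initial_class a b"
  shows "finite {\<mu> \<in> discrete_eigenvalues a b. \<mu> > 2}"
proof -
  obtain K where K: "\<And>n. \<bar>a n\<bar> \<le> K" "\<And>n. \<bar>b n\<bar> \<le> K" using initial_class_bounded[OF assms] by blast
  obtain N1 where N1: "\<And>G. finite G \<Longrightarrow> G \<subseteq> {..< - int N1} \<Longrightarrow> (\<Sum>n\<in>G. left_moment_term a b n) \<le> 1/2"
    using initial_class_left_tail[OF assms, of "1/2"] by auto
  have "(a \<longlongrightarrow> 0) at_top" "(b \<longlongrightarrow> 0) at_top" using assms unfolding initial_class_def by auto
  then have "\<forall>\<^sub>F n in at_top. \<bar>a n\<bar> < 1/2" "\<forall>\<^sub>F n in at_top. \<bar>b n\<bar> < 1/2"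
    by (intro order_tendstoD(2)[OF tendsto_rabs_zero]; simp)+
  then have "\<forall>\<^sub>F n in at_top. \<bar>a n\<bar> < 1/2 \<and> \<bar>b n\<bar> < 1/2" by eventually_elim auto
  then obtain R where R: "\<And>n. n \<ge> R \<Longrightarrow> \<bar>a n\<bar> < 1/2 \<and> \<bar>b n\<bar> < 1/2" by (auto simp: eventually_at_top_linorder)
  define N where "N = max N1 (nat R)"
  have "finite {\<mu>. \<mu> > 2 \<and> (\<exists>x. ell2 x \<and> x \<noteq> (\<lambda>n. 0) \<and> jac a b x = (\<lambda>n. \<mu> * x n))}"
  proof (rule finite_eigenvalues_above_2[OF K, of N])
    fix n assume "int N \<le> n"
    then have "n \<ge> R" by (auto simp: N_def)
    then show "\<bar>a n\<bar> \<le> 1/2 \<and> \<bar>b n\<bar> \<le> 1/2" using R[of n] by auto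
  next
    fix G assume G: "finite G" "G \<subseteq> {..< - int N}"
    have "(\<Sum>n\<in>G. \<bar>of_int n\<bar> * (\<bar>b n\<bar> + 2 * \<bar>a n - 1\<bar>)) \<le> (\<Sum>n\<in>G. 2 * left_moment_term a b n)"
      unfolding left_moment_term_def by (intro sum_mono) (auto simp: algebra_simps intro: mult_right_mono)
    also have "\<dots> = 2 * (\<Sum>n\<in>G. left_moment_term a b n)" by (simp add: sum_distrib_left)
    also have "\<dots> \<le> 2 * (1/2)" using G by (intro mult_left_mono N1) (auto simp: N_def)
    finally show "(\<Sum>n\<in>G. \<bar>of_int n\<bar> * (\<bar>b n\<bar> + 2 * \<bar>a n - 1\<bar>)) \<le> 1" by simp
  qed
  then show ?thesis
  proof (rule finite_subset[rotated], intro subsetI CollectI)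
    fix \<mu> assume "\<mu> \<in> {\<mu> \<in> discrete_eigenvalues a b. \<mu> > 2}"
    then show "\<mu> > 2 \<and> (\<exists>x. ell2 x \<and> x \<noteq> (\<lambda>n. 0) \<and> jac a b x = (\<lambda>n. \<mu> * x n))"
      using discrete_eigenvalue_real_eigenvector[of \<mu> a b] by blast
  qed
qed

lemma finite_discrete_eigenvalues:
  assumes "initial_class a b"
  shows "finite (discrete_eigenvalues a b)"
proof -
  have "discrete_eigenvalues a b \<subseteq> {\<mu> \<in> discrete_eigenvalues a b. \<mu> > 2}
     \<union> uminus ` {\<mu> \<in> discrete_eigenvalues a (\<lambda>n. - b n). \<mu> > 2}"
  proof
    fix \<mu> assume \<mu>: "\<mu> \<in> discrete_eigenvalues a b"
    then have "\<mu> > 2 \<or> - \<mu> > 2" by (auto simp: discrete_eigenvalues_def)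
    then show "\<mu> \<in> {\<mu> \<in> discrete_eigenvalues a b. \<mu> > 2} \<union> uminus ` {\<mu> \<in> discrete_eigenvalues a (\<lambda>n. - b n). \<mu> > 2}"
      using \<mu> discrete_eigenvalues_neg[OF \<mu>] by (auto intro!: image_eqI[of \<mu> uminus "- \<mu>"])
  qed
  moreover have "finite \<dots>"
    using finite_discrete_eigenvalues_above_2[OF assms] finite_discrete_eigenvalues_above_2[OF initial_class_neg[OF assms]] by auto
  ultimately show ?thesis by (rule finite_subset)
qed

section \<open>Compact self-adjoint Jacobi operators on the half-line\<close>

text \<open>The tail of \<open>p\<close> contributes little, uniformly on bounded sets, and finitely many coordinates
  converge.\<close>

lemma weak_tendsto:
  assumes x: "\<forall>\<^sub>F i in F. ell2 (x i) \<and> ip (x i) (x i) \<le> B" and y: "ell2 y" and p: "ell2 p"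
    and lim: "\<And>n. ((\<lambda>i. x i n) \<longlongrightarrow> y n) F" and B: "0 \<le> B" "ip y y \<le> B"
  shows "((\<lambda>i. ip (x i) p) \<longlongrightarrow> ip y p) F"
proof (rule tendstoI)
  fix e :: real assume e: "e > 0"
  define M where "M = 4 * B + 1"
  have M: "M > 0" using B by (simp add: M_def)
  define \<eta> where "\<eta> = e / (2 * sqrt M)"
  have \<eta>: "\<eta> > 0" using e M by (simp add: \<eta>_def)
  have ps: "(\<lambda>n. (p n)\<^sup>2) summable_on UNIV" using p by (simp add: ell2_def)
  have "((\<lambda>G. \<Sum>n\<in>G. (p n)\<^sup>2) \<longlongrightarrow> ip p p) (finite_subsets_at_top UNIV)"
    using has_sum_infsum[OF ps] by (simp add: has_sum_def ip_def power2_eq_square)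
  from tendstoD[OF this, of "\<eta>\<^sup>2"] \<eta>
  obtain G where G: "finite G" "dist (\<Sum>n\<in>G. (p n)\<^sup>2) (ip p p) < \<eta>\<^sup>2"
    unfolding eventually_finite_subsets_at_top by auto
  define q where "q n = (if n \<in> G then 0 else p n)" for n
  have q: "ell2 q"
  proof -
    have "ell2 (\<lambda>n. (if n \<in> G then 0 else 1) * p n)" by (rule ell2_bounded_mult[OF p, where K = 1]) auto
    moreover have "(\<lambda>n. (if n \<in> G then 0 else 1) * p n) = q" by (auto simp: q_def)
    ultimately show ?thesis by simp
  qed
  have pq: "ip u p = (\<Sum>n\<in>G. u n * p n) + ip u q" if u: "ell2 u" for u
  proof -
    have "ip u p = (\<Sum>\<^sub>\<infinity>n. u n * (if n \<in> G then p n else 0) + u n * q n)"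
      unfolding ip_def q_def by (intro infsum_cong) auto
    also have "\<dots> = (\<Sum>\<^sub>\<infinity>n. u n * (if n \<in> G then p n else 0)) + ip u q"
      unfolding ip_def
    proof (rule infsum_add)
      have "ell2 (\<lambda>n. (if n \<in> G then 1 else 0) * p n)" by (rule ell2_bounded_mult[OF p, where K = 1]) auto
      moreover have "(\<lambda>n. (if n \<in> G then 1 else 0) * p n) = (\<lambda>n. if n \<in> G then p n else 0)" by auto
      ultimately have "ell2 (\<lambda>n. if n \<in> G then p n else 0)" by simp
      then show "(\<lambda>n. u n * (if n \<in> G then p n else 0)) summable_on UNIV" by (rule ell2_mult_summable[OF u])
    qed (rule ell2_mult_summable[OF u q])
    also have "(\<Sum>\<^sub>\<infinity>n. u n * (if n \<in> G then p n else 0)) = (\<Sum>\<^sub>\<infinity>n\<in>G. u n * p n)"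
      by (rule infsum_cong_neutral) auto
    finally show ?thesis using G(1) by simp
  qed
  have qq: "ip q q < \<eta>\<^sup>2"
  proof -
    have "ip p p = (\<Sum>n\<in>G. (p n)\<^sup>2) + ip p q" using pq[OF p] by (simp add: power2_eq_square)
    moreover have "ip p q = ip q q" unfolding ip_def q_def by (intro infsum_cong) auto
    ultimately show ?thesis using G(2) by (simp add: dist_real_def)
  qed
  have "((\<lambda>i. \<Sum>n\<in>G. x i n * p n) \<longlongrightarrow> (\<Sum>n\<in>G. y n * p n)) F" by (intro tendsto_intros lim)
  then have "\<forall>\<^sub>F i in F. dist (\<Sum>n\<in>G. x i n * p n) (\<Sum>n\<in>G. y n * p n) < e / 2"
    using e by (intro tendstoD) auto
  with x show "\<forall>\<^sub>F i in F. dist (ip (x i) p) (ip y p) < e"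
  proof eventually_elim
    case (elim i)
    define d where "d n = x i n - y n" for n
    have d: "ell2 d" unfolding d_def using elim y by (intro ell2_diff) auto
    have "ip d d \<le> 4 * B"
    proof (rule ell2I(2))
      fix H :: "int set" assume H: "finite H"
      have "(\<Sum>n\<in>H. (d n)\<^sup>2) \<le> (\<Sum>n\<in>H. 2 * (x i n)\<^sup>2 + 2 * (y n)\<^sup>2)"
      proof (rule sum_mono)
        fix n show "(d n)\<^sup>2 \<le> 2 * (x i n)\<^sup>2 + 2 * (y n)\<^sup>2"
          using zero_le_power2[of "x i n + y n"] by (simp add: d_def power2_sum power2_diff)
      qed
      also have "\<dots> = 2 * (\<Sum>n\<in>H. (x i n)\<^sup>2) + 2 * (\<Sum>n\<in>H. (y n)\<^sup>2)" by (simp add: sum.distrib sum_distrib_left)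
      also have "\<dots> \<le> 2 * B + 2 * B"
        using sum_squares_le_ip[OF conjunct1[OF elim(1)] H] sum_squares_le_ip[OF y H] elim(1) B by simp
      finally show "(\<Sum>n\<in>H. (d n)\<^sup>2) \<le> 4 * B" by simp
    qed
    then have dd: "ip d d \<le> M" by (simp add: M_def)
    have "(ip d q)\<^sup>2 \<le> ip d d * ip q q" by (rule ip_cauchy_schwarz[OF d q])
    also have "\<dots> \<le> M * \<eta>\<^sup>2" using dd qq M ip_self_nonneg by (intro mult_mono) auto
    also have "\<dots> = (e / 2)\<^sup>2" using M by (simp add: \<eta>_def power_divide power_mult_distrib)
    finally have dq: "\<bar>ip d q\<bar> \<le> e / 2" using e by (simp add: abs_le_square_iff[symmetric])
    have "ip (x i) p - ip y p = ((\<Sum>n\<in>G. x i n * p n) - (\<Sum>n\<in>G. y n * p n)) + ip d q"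
      using pq[of "x i"] pq[OF y] elim(1) ip_diff[of "x i" y q] y q by (simp add: d_def[abs_def])
    then show ?case using dq elim(2) abs_triangle_ineq[of "(\<Sum>n\<in>G. x i n * p n) - (\<Sum>n\<in>G. y n * p n)" "ip d q"]
      by (simp add: dist_real_def)
  qed
qed

lemma half_line_solution_unique:
  assumes pos: "\<forall>n. a n > 0" and y: "y (-1) = 0" "\<forall>n\<ge>0. jacobi a b y n = l * y n" and n: "n \<ge> -1"
  shows "y n = y 0 * P_sol a b l n"
proof -
  note P = P_sol[OF pos, of b l]
  have "n \<ge> 0 \<Longrightarrow> y n = y 0 * P_sol a b l n \<and> y (n - 1) = y 0 * P_sol a b l (n - 1)" for n
  proof (induction n rule: int_ge_induct)
    case base
    then show ?case using y P by simp
  next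
    case (step n)
    have an: "complex_of_real (a n) \<noteq> 0" using pos by (metis less_irrefl of_real_eq_0_iff)
    have "complex_of_real (a n) * y (n + 1) = l * y n - complex_of_real (b n) * y n - complex_of_real (a (n - 1)) * y (n - 1)"
      using y(2)[rule_format, OF step.hyps] by (simp add: jacobi_def algebra_simps)
    also have "\<dots> = y 0 * (l * P_sol a b l n - complex_of_real (b n) * P_sol a b l n - complex_of_real (a (n - 1)) * P_sol a b l (n - 1))"
      using step.IH by (simp add: algebra_simps)
    also have "l * P_sol a b l n - complex_of_real (b n) * P_sol a b l n - complex_of_real (a (n - 1)) * P_sol a b l (n - 1)
        = complex_of_real (a n) * P_sol a b l (n + 1)"
      using P(1) unfolding jacobi_solution_def jacobi_def by (metis add_diff_cancel_left' diff_diff_eq add.commute)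
    finally have "y (n + 1) = y 0 * P_sol a b l (n + 1)" using an by simp
    then show ?case using step.IH by simp
  qed
  from this[of n] this[of 0] n y P show ?thesis by (cases "n = -1") auto
qed

locale half_line_jacobi =
  fixes a b :: "int \<Rightarrow> real" and K :: real
  assumes pos: "\<forall>n. a n > 0" and K: "\<And>n. \<bar>a n\<bar> \<le> K" "\<And>n. \<bar>b n\<bar> \<le> K"
    and lima: "(a \<longlongrightarrow> 0) at_top" and limb: "(b \<longlongrightarrow> 0) at_top"
begin

text \<open>The operator \<open>L\<^sub>0\<close> on sequences over the integers: cutting both coefficients to \<open>n \<ge> 0\<close> decouples
  it from the negative sites, where it acts as 0. Results on \<open>jac\<close> thus apply to it.\<close>

definition half_op :: "(int \<Rightarrow> real) \<Rightarrow> int \<Rightarrow> real" where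
  "half_op = jac (\<lambda>n. if n \<ge> 0 then a n else 0) (\<lambda>n. if n \<ge> 0 then b n else 0)"

definition half_poly :: "real \<Rightarrow> int \<Rightarrow> real" where
  "half_poly \<nu> n = (if n \<ge> 0 then Re (P_sol a b (complex_of_real \<nu>) n) else 0)"

lemma P_sol_real: "P_sol a b (complex_of_real \<nu>) n \<in> \<real>"
  by (rule sol_real[OF P_sol(1)[OF pos] pos, of _ _ "-1"]) (simp_all add: P_sol[OF pos])

lemma half_poly_eq: "n \<ge> 0 \<Longrightarrow> P_sol a b (complex_of_real \<nu>) n = complex_of_real (half_poly \<nu> n)"
  using P_sol_real by (simp add: half_poly_def)

lemma half_poly_0 [simp]: "half_poly \<nu> 0 = 1"
  by (simp add: half_poly_def P_sol[OF pos])

lemma half_poly_neg [simp]: "n < 0 \<Longrightarrow> half_poly \<nu> n = 0"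
  by (simp add: half_poly_def)

lemma half_op_neg: "n < 0 \<Longrightarrow> half_op x n = 0"
  by (simp add: half_op_def jac_def)

lemma half_op_pos: "n > 0 \<Longrightarrow> half_op x n = jac a b x n"
  by (simp add: half_op_def jac_def)

lemma half_op_0: "half_op x 0 = b 0 * x 0 + a 0 * x 1"
  by (simp add: half_op_def jac_def)

lemma half_op_jac: "n \<ge> 0 \<Longrightarrow> x (-1) = 0 \<Longrightarrow> half_op x n = jac a b x n"
  by (cases "n = 0") (auto simp: half_op_pos half_op_0 jac_def)

lemma half_op_half_poly: "half_op (half_poly \<nu>) n = \<nu> * half_poly \<nu> n"
proof (cases "n \<ge> 0")
  case True
  have "jacobi a b (P_sol a b (complex_of_real \<nu>)) n = complex_of_real \<nu> * P_sol a b (complex_of_real \<nu>) n"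
    using P_sol(1)[OF pos] unfolding jacobi_solution_def by blast
  moreover have "P_sol a b (complex_of_real \<nu>) (n - 1) = complex_of_real (half_poly \<nu> (n - 1))"
    using True half_poly_eq[of "n - 1"] P_sol(2)[OF pos] by (cases "n = 0") auto
  ultimately have "complex_of_real (jac a b (half_poly \<nu>) n) = complex_of_real (\<nu> * half_poly \<nu> n)"
    using True by (simp add: jacobi_def jac_def half_poly_eq)
  then have "jac a b (half_poly \<nu>) n = \<nu> * half_poly \<nu> n" by (simp only: of_real_eq_iff)
  then show ?thesis using True by (simp add: half_op_jac)
qed (simp add: half_op_neg)

lemma half_infsum_cmod:
  "(\<lambda>n. (cmod (P_sol a b (complex_of_real \<nu>) n))\<^sup>2) summable_on {0..} \<longleftrightarrow> ell2 (half_poly \<nu>)"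
  "(\<Sum>\<^sub>\<infinity>n\<in>{0..}. (cmod (P_sol a b (complex_of_real \<nu>) n))\<^sup>2) = ip (half_poly \<nu>) (half_poly \<nu>)"
proof -
  have e: "n \<ge> 0 \<Longrightarrow> (cmod (P_sol a b (complex_of_real \<nu>) n))\<^sup>2 = (half_poly \<nu> n)\<^sup>2" for n by (simp add: half_poly_eq)
  show "(\<lambda>n. (cmod (P_sol a b (complex_of_real \<nu>) n))\<^sup>2) summable_on {0..} \<longleftrightarrow> ell2 (half_poly \<nu>)"
    unfolding ell2_def by (rule summable_on_cong_neutral) (auto simp: e)
  show "(\<Sum>\<^sub>\<infinity>n\<in>{0..}. (cmod (P_sol a b (complex_of_real \<nu>) n))\<^sup>2) = ip (half_poly \<nu>) (half_poly \<nu>)"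
    unfolding ip_def power2_eq_square[symmetric] by (rule infsum_cong_neutral) (auto simp: e)
qed

abbreviation "H \<equiv> half_eigenvalues a b"

text \<open>The mass of the spectral function at an eigenvalue.\<close>

definition weight :: "real \<Rightarrow> real" where
  "weight \<nu> = 1 / ip (half_poly \<nu>) (half_poly \<nu>)"

lemma weight_half_norm: "1 / (half_norm a b \<nu>)\<^sup>2 = weight \<nu>"
  unfolding half_norm_def weight_def half_infsum_cmod(2) by (simp add: ip_self_nonneg)

lemma half_eigenvalue_iff: "\<nu> \<in> H \<longleftrightarrow> ell2 (half_poly \<nu>)"
proof
  assume "\<nu> \<in> H"
  then obtain y where y: "square_summable_on y {0..}" "\<exists>n\<ge>0. y n \<noteq> 0" "y (-1) = 0"
    "\<forall>n\<ge>0. jacobi a b y n = complex_of_real \<nu> * y n"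
    unfolding half_eigenvalues_def by blast
  have yP: "y n = y 0 * P_sol a b (complex_of_real \<nu>) n" if "n \<ge> 0" for n
    using half_line_solution_unique[OF pos y(3,4), of n] that by simp
  obtain m where m: "m \<ge> 0" "y m \<noteq> 0" using y(2) by blast
  have y0: "y 0 \<noteq> 0"
  proof
    assume "y 0 = 0"
    then have "y 0 * P_sol a b (complex_of_real \<nu>) m = 0" by simp
    then show False using yP[OF m(1)] m(2) by simp
  qed
  have "(\<lambda>n. (1 / (cmod (y 0))\<^sup>2) * (cmod (y n))\<^sup>2) summable_on {0..}"
    using y(1) unfolding square_summable_on_def by (rule summable_on_cmult_right)
  also have "?this \<longleftrightarrow> (\<lambda>n. (cmod (P_sol a b (complex_of_real \<nu>) n))\<^sup>2) summable_on {0..}"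
  proof (rule summable_on_cong)
    fix n :: int assume "n \<in> {0..}"
    then have "n \<ge> 0" by simp
    from arg_cong[OF yP[OF this], of cmod]
    have "cmod (y n) = cmod (y 0) * cmod (P_sol a b (complex_of_real \<nu>) n)" unfolding norm_mult .
    then show "(1 / (cmod (y 0))\<^sup>2) * (cmod (y n))\<^sup>2 = (cmod (P_sol a b (complex_of_real \<nu>) n))\<^sup>2"
      using y0 by (simp add: power_mult_distrib)
  qed
  finally have "(\<lambda>n. (cmod (P_sol a b (complex_of_real \<nu>) n))\<^sup>2) summable_on {0..}" .
  then show "ell2 (half_poly \<nu>)" by (simp add: half_infsum_cmod)
next
  assume "ell2 (half_poly \<nu>)"
  then have "square_summable_on (P_sol a b (complex_of_real \<nu>)) {0..}"
    unfolding square_summable_on_def half_infsum_cmod .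
  moreover have "P_sol a b (complex_of_real \<nu>) 0 \<noteq> 0" by (simp add: P_sol[OF pos])
  ultimately show "\<nu> \<in> H" using P_sol[OF pos, of b "complex_of_real \<nu>"]
    unfolding half_eigenvalues_def jacobi_solution_def by blast
qed

lemma half_eigenvector:
  assumes x: "ell2 x" "\<And>n. n < 0 \<Longrightarrow> x n = 0" "half_op x = (\<lambda>n. \<nu> * x n)" "x \<noteq> (\<lambda>n. 0)"
  shows "\<nu> \<in> H" "x = (\<lambda>n. x 0 * half_poly \<nu> n)"
proof -
  define y where "y n = complex_of_real (x n)" for n
  have "jacobi a b y n = complex_of_real \<nu> * y n" if "n \<ge> 0" for n
  proof -
    have "jac a b x n = \<nu> * x n" using half_op_jac[OF that, of x] x(2,3) by simp
    then have "complex_of_real (jac a b x n) = complex_of_real (\<nu> * x n)" by simp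
    then show ?thesis by (simp add: jacobi_def jac_def y_def)
  qed
  then have yP: "y n = y 0 * P_sol a b (complex_of_real \<nu>) n" if "n \<ge> 0" for n
    using half_line_solution_unique[OF pos, of y b "complex_of_real \<nu>" n] that x(2) by (simp add: y_def)
  have "complex_of_real (x n) = complex_of_real (x 0 * half_poly \<nu> n)" if "n \<ge> 0" for n
    using yP[OF that] by (simp only: y_def half_poly_eq[OF that] of_real_mult)
  then have xe1: "x n = x 0 * half_poly \<nu> n" if "n \<ge> 0" for n using that of_real_eq_iff by blast
  have xe: "x n = x 0 * half_poly \<nu> n" for n
  proof (cases "n \<ge> 0")
    case False
    then show ?thesis using x(2)[of n] half_poly_neg[of n] by simp
  qed (rule xe1)
  then show "x = (\<lambda>n. x 0 * half_poly \<nu> n)" by blast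
  have x0: "x 0 \<noteq> 0" using xe x(4) by (metis (no_types, opaque_lifting) ext mult_zero_left)
  have "half_poly \<nu> n = (1 / x 0) * x n" for n using xe[of n] x0 by (simp add: field_simps)
  then have "half_poly \<nu> = (\<lambda>n. (1 / x 0) * x n)" by blast
  then show "\<nu> \<in> H" unfolding half_eigenvalue_iff using ell2_scale[OF x(1), of "1 / x 0"] by simp
qed

lemma half_coeff_bounds: "\<bar>if n \<ge> 0 then a n else 0\<bar> \<le> K" "\<bar>if n \<ge> 0 then b n else 0\<bar> \<le> K"
  using K[of n] by auto

lemma ell2_half_op: "ell2 x \<Longrightarrow> ell2 (half_op x)"
  unfolding half_op_def by (rule ell2_jac[where K = K]) (assumption | rule half_coeff_bounds)+

lemma half_op_selfadjoint: "ell2 x \<Longrightarrow> ell2 y \<Longrightarrow> ip (half_op x) y = ip x (half_op y)"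
  unfolding half_op_def by (rule jac_selfadjoint[where K = K]) (assumption | rule half_coeff_bounds)+

lemma half_poly_orthogonal:
  assumes "\<mu> \<in> H" "\<nu> \<in> H" "\<mu> \<noteq> \<nu>"
  shows "ip (half_poly \<mu>) (half_poly \<nu>) = 0"
proof (rule jac_eigen_orthogonal[where a = "\<lambda>n. if n \<ge> 0 then a n else 0" and b = "\<lambda>n. if n \<ge> 0 then b n else 0" and K = K and \<mu> = \<mu> and \<nu> = \<nu>])
  show "jac (\<lambda>n. if 0 \<le> n then a n else 0) (\<lambda>n. if 0 \<le> n then b n else 0) (half_poly \<mu>) = (\<lambda>n. \<mu> * half_poly \<mu> n)"
    "jac (\<lambda>n. if 0 \<le> n then a n else 0) (\<lambda>n. if 0 \<le> n then b n else 0) (half_poly \<nu>) = (\<lambda>n. \<nu> * half_poly \<nu> n)"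
    using half_op_half_poly unfolding half_op_def by auto
qed (use assms half_coeff_bounds in \<open>auto simp: half_eigenvalue_iff\<close>)

lemma half_poly_ip_pos: "\<nu> \<in> H \<Longrightarrow> 0 < ip (half_poly \<nu>) (half_poly \<nu>)"
  using ip_self_pos[of "half_poly \<nu>" 0] by (simp add: half_eigenvalue_iff)

lemma weight_pos: "\<nu> \<in> H \<Longrightarrow> 0 < weight \<nu>"
  by (simp add: weight_def half_poly_ip_pos)

lemma weight_ip: "\<nu> \<in> H \<Longrightarrow> weight \<nu> * ip (half_poly \<nu>) (half_poly \<nu>) = 1"
  using half_poly_ip_pos[of \<nu>] by (simp add: weight_def)

lemma ip_basis: "ip (\<lambda>m. if m = n then 1 else 0) x = x n"
proof -
  have "ip (\<lambda>m. if m = n then 1 else 0) x = (\<Sum>\<^sub>\<infinity>m\<in>{n}. x m)"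
    unfolding ip_def by (rule infsum_cong_neutral) auto
  then show ?thesis by simp
qed

lemma ell2_basis: "ell2 (\<lambda>m. if m = n then 1 else 0)"
proof (rule ell2I(1))
  fix G :: "int set" assume "finite G"
  then show "(\<Sum>m\<in>G. (if m = n then 1 else 0)\<^sup>2) \<le> (1::real)"
    by (simp add: if_distrib[of "\<lambda>c. c\<^sup>2"] cong: if_cong)
qed

lemma bessel:
  assumes F: "finite F" "F \<subseteq> H" and u: "ell2 u"
  shows "(\<Sum>\<nu>\<in>F. weight \<nu> * (ip u (half_poly \<nu>))\<^sup>2) \<le> ip u u"
proof -
  define c where "c \<nu> = weight \<nu> * ip u (half_poly \<nu>)" for \<nu>
  define s where "s n = (\<Sum>\<nu>\<in>F. c \<nu> * half_poly \<nu> n)" for n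
  have hp: "\<And>\<nu>. \<nu> \<in> F \<Longrightarrow> ell2 (half_poly \<nu>)" using F half_eigenvalue_iff by blast
  have orth: "\<And>\<mu> \<nu>. \<mu> \<in> F \<Longrightarrow> \<nu> \<in> F \<Longrightarrow> \<mu> \<noteq> \<nu> \<Longrightarrow> ip (half_poly \<mu>) (half_poly \<nu>) = 0"
    using F half_poly_orthogonal by blast
  have s: "ell2 s" unfolding s_def by (rule ell2_sum[OF hp])
  define S where "S = (\<Sum>\<nu>\<in>F. weight \<nu> * (ip u (half_poly \<nu>))\<^sup>2)"
  have su: "ip s u = S"
  proof -
    have "ip s u = (\<Sum>\<nu>\<in>F. c \<nu> * ip (half_poly \<nu>) u)" unfolding s_def[abs_def] by (rule ip_sum) (use hp u in auto)
    then show ?thesis by (simp add: S_def c_def ip_commute[of _ u] power2_eq_square mult.assoc)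
  qed
  have ss: "ip s s = S"
  proof -
    have "ip s s = (\<Sum>\<nu>\<in>F. c \<nu> * c \<nu> * ip (half_poly \<nu>) (half_poly \<nu>))"
      unfolding s_def[abs_def] by (rule ip_orthogonal_sums) (simp_all add: hp orth F(1))
    also have "\<dots> = S" unfolding S_def
    proof (rule sum.cong)
      fix \<nu> assume "\<nu> \<in> F"
      then have "weight \<nu> * ip (half_poly \<nu>) (half_poly \<nu>) = 1" using weight_ip F by blast
      moreover have "c \<nu> * c \<nu> * ip (half_poly \<nu>) (half_poly \<nu>) = weight \<nu> * (ip u (half_poly \<nu>))\<^sup>2 * (weight \<nu> * ip (half_poly \<nu>) (half_poly \<nu>))"
        by (simp add: c_def power2_eq_square)
      ultimately show "c \<nu> * c \<nu> * ip (half_poly \<nu>) (half_poly \<nu>) = weight \<nu> * (ip u (half_poly \<nu>))\<^sup>2" by simp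
    qed simp
    finally show ?thesis .
  qed
  define d where "d n = u n - s n" for n
  have d: "ell2 d" unfolding d_def by (rule ell2_diff[OF u s])
  have "ip d d = ip u d - ip s d" unfolding d_def[abs_def] by (rule ip_diff[OF u s d[unfolded d_def[abs_def]]])
  also have "\<dots> = (ip u u - ip s u) - (ip u s - ip s s)"
    using ip_diff[OF u s u] ip_diff[OF u s s] unfolding ip_commute[of u d] ip_commute[of s d] by (simp add: d_def[abs_def])
  finally have "ip d d = ip u u - S" by (simp add: su ss ip_commute[of u s])
  then show ?thesis using ip_self_nonneg[of d] by (simp add: S_def)
qed

text \<open>Bessel's inequality for the unit vector at \<open>n\<close>. For \<open>n = 0\<close> it bounds the total mass, as
  \<open>half_poly \<nu> 0 = 1\<close>.\<close>

lemma bessel_coordinate: "finite F \<Longrightarrow> F \<subseteq> H \<Longrightarrow> (\<Sum>\<nu>\<in>F. weight \<nu> * (half_poly \<nu> n)\<^sup>2) \<le> 1"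
  using bessel[of F "\<lambda>m. if m = n then 1 else 0"] ell2_basis[of n] ip_basis[of n] by simp

text \<open>The form in which compactness enters: up to \<open>\<eta> \<bar>x\<bar>\<^sup>2\<close>, the norm of \<open>L\<^sub>0 x\<close> is carried by finitely
  many coordinates, because the coefficients are small at all other sites.\<close>

lemma half_op_tail:
  assumes "\<eta> > 0"
  obtains S where "finite S" "\<And>x. ell2 x \<Longrightarrow> ip (half_op x) (half_op x) \<le> (\<Sum>n\<in>S. (half_op x n)\<^sup>2) + \<eta> * ip x x"
proof -
  \<comment> \<open>One factor 3 comes from squaring a sum of three terms, the other from the three shifted sums.\<close>
  define \<epsilon> where "\<epsilon> = sqrt (\<eta> / 9)"
  have \<epsilon>: "\<epsilon> > 0" "\<epsilon>\<^sup>2 = \<eta> / 9" using assms by (auto simp: \<epsilon>_def)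
  have "\<forall>\<^sub>F n in at_top. \<bar>a n\<bar> < \<epsilon>" "\<forall>\<^sub>F n in at_top. \<bar>b n\<bar> < \<epsilon>"
    using \<epsilon> lima limb by (intro order_tendstoD(2)[OF tendsto_rabs_zero]; simp)+
  then have "\<forall>\<^sub>F n in at_top. \<bar>a n\<bar> < \<epsilon> \<and> \<bar>b n\<bar> < \<epsilon>" by eventually_elim auto
  then obtain R where R: "\<And>n. n \<ge> R \<Longrightarrow> \<bar>a n\<bar> < \<epsilon> \<and> \<bar>b n\<bar> < \<epsilon>" by (auto simp: eventually_at_top_linorder)
  define S where "S = {0..R}"
  have "ip (half_op x) (half_op x) \<le> (\<Sum>n\<in>S. (half_op x n)\<^sup>2) + \<eta> * ip x x" if x: "ell2 x" for x
  proof -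
    define q where "q n = (half_op x n)\<^sup>2" for n
    have qs: "q summable_on UNIV" using ell2_half_op[OF x] unfolding ell2_def q_def[abs_def] .
    have qs': "q summable_on S" "q summable_on - S" by (rule summable_on_subset_banach[OF qs], simp)+
    have split: "ip (half_op x) (half_op x) = sum q S + infsum q (- S)"
      using infsum_Un_disjoint[OF qs'] by (simp add: ip_def q_def[abs_def] power2_eq_square S_def)
    have "infsum q (- S) \<le> \<eta> * ip x x"
    proof (rule infsum_le_finite_sums[OF qs'(2)])
      fix G assume G: "finite G" "G \<subseteq> - S"
      have "sum q G \<le> (\<Sum>n\<in>G. (\<eta> / 3) * ((x (n + (-1)))\<^sup>2 + (x n)\<^sup>2 + (x (n + 1))\<^sup>2))"
      proof (rule sum_mono)
        fix n assume "n \<in> G"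
        then consider "n < 0" | "n > R" "n \<ge> 0" using G by (fastforce simp: S_def)
        then show "q n \<le> (\<eta> / 3) * ((x (n + (-1)))\<^sup>2 + (x n)\<^sup>2 + (x (n + 1))\<^sup>2)"
        proof cases
          case 1
          then show ?thesis using assms by (simp add: q_def half_op_neg)
        next
          case 2
          define A where "A = (if n - 1 \<ge> 0 then a (n - 1) else 0)"
          have ab: "\<bar>A\<bar> \<le> \<epsilon>" "\<bar>b n\<bar> \<le> \<epsilon>" "\<bar>a n\<bar> \<le> \<epsilon>"
            using R[of "n - 1"] R[of n] 2 \<epsilon> by (auto simp: A_def)
          have "\<bar>half_op x n\<bar> \<le> \<epsilon> * (\<bar>x (n - 1)\<bar> + \<bar>x n\<bar> + \<bar>x (n + 1)\<bar>)"
          proof -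
            have "half_op x n = A * x (n - 1) + b n * x n + a n * x (n + 1)"
              using 2 by (simp add: half_op_def jac_def A_def)
            also have "\<bar>\<dots>\<bar> \<le> \<bar>A * x (n - 1)\<bar> + \<bar>b n * x n\<bar> + \<bar>a n * x (n + 1)\<bar>" by linarith
            also have "\<dots> \<le> \<epsilon> * \<bar>x (n - 1)\<bar> + \<epsilon> * \<bar>x n\<bar> + \<epsilon> * \<bar>x (n + 1)\<bar>"
              unfolding abs_mult using ab by (intro add_mono mult_right_mono) auto
            finally show ?thesis by (simp add: distrib_left)
          qed
          then have "\<bar>half_op x n\<bar>\<^sup>2 \<le> (\<epsilon> * (\<bar>x (n - 1)\<bar> + \<bar>x n\<bar> + \<bar>x (n + 1)\<bar>))\<^sup>2" by (intro power_mono) auto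
          also have "\<dots> = \<eta> / 9 * (\<bar>x (n - 1)\<bar> + \<bar>x n\<bar> + \<bar>x (n + 1)\<bar>)\<^sup>2" by (simp add: power_mult_distrib \<epsilon>)
          also have "\<dots> \<le> \<eta> / 9 * (3 * ((x (n - 1))\<^sup>2 + (x n)\<^sup>2 + (x (n + 1))\<^sup>2))"
          proof (rule mult_left_mono)
            have "(p + q + r)\<^sup>2 \<le> 3 * (p\<^sup>2 + q\<^sup>2 + r\<^sup>2)" for p q r :: real
              using two_mult_le_squares[of p q] two_mult_le_squares[of p r] two_mult_le_squares[of q r]
              by (simp add: power2_eq_square algebra_simps)
            from this[of "\<bar>x (n - 1)\<bar>" "\<bar>x n\<bar>" "\<bar>x (n + 1)\<bar>"]
            show "(\<bar>x (n - 1)\<bar> + \<bar>x n\<bar> + \<bar>x (n + 1)\<bar>)\<^sup>2 \<le> 3 * ((x (n - 1))\<^sup>2 + (x n)\<^sup>2 + (x (n + 1))\<^sup>2)" by simp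
          qed (use assms in auto)
          also have "\<dots> = (\<eta> / 3) * ((x (n - 1))\<^sup>2 + (x n)\<^sup>2 + (x (n + 1))\<^sup>2)" by (simp only: mult.assoc[symmetric])
          finally show ?thesis unfolding q_def power2_abs by simp
        qed
      qed
      also have "\<dots> = (\<eta> / 3) * ((\<Sum>n\<in>G. (x (n + (-1)))\<^sup>2) + (\<Sum>n\<in>G. (x n)\<^sup>2) + (\<Sum>n\<in>G. (x (n + 1))\<^sup>2))"
        by (simp only: sum_distrib_left[symmetric] sum.distrib)
      also have "\<dots> \<le> (\<eta> / 3) * (ip x x + ip x x + ip x x)"
      proof (intro mult_left_mono add_mono)
        have sh: "ip (\<lambda>n. x (n + k)) (\<lambda>n. x (n + k)) = ip x x" for k
          using infsum_int_shift[of "\<lambda>n. x n * x n" k] by (simp add: ip_def)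
        show "(\<Sum>n\<in>G. (x (n + (-1)))\<^sup>2) \<le> ip x x" "(\<Sum>n\<in>G. (x (n + 1))\<^sup>2) \<le> ip x x"
          using sum_squares_le_ip[OF ell2_shift[OF x, of "-1"] G(1)] sum_squares_le_ip[OF ell2_shift[OF x, of 1] G(1)]
          unfolding sh by auto
        show "(\<Sum>n\<in>G. (x n)\<^sup>2) \<le> ip x x" by (rule sum_squares_le_ip[OF x G(1)])
      qed (use assms in auto)
      finally show "sum q G \<le> \<eta> * ip x x" by simp
    qed
    then show ?thesis unfolding split by (simp add: q_def)
  qed
  then show ?thesis using that[of S] by (auto simp: S_def)
qed

lemma half_op_bounded:
  obtains C where "C \<ge> 0" "\<And>x. ell2 x \<Longrightarrow> ip (half_op x) (half_op x) \<le> C * ip x x"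
proof -
  obtain S where S: "finite S" "\<And>x. ell2 x \<Longrightarrow> ip (half_op x) (half_op x) \<le> (\<Sum>n\<in>S. (half_op x n)\<^sup>2) + 1 * ip x x"
    using half_op_tail[of 1] by auto
  define C where "C = real (card S) * (3 * K)\<^sup>2 + 1"
  have K0: "0 \<le> K" using K(1)[of 0] by linarith
  have "ip (half_op x) (half_op x) \<le> C * ip x x" if x: "ell2 x" for x
  proof -
    have xb: "\<bar>x n\<bar> \<le> sqrt (ip x x)" for n
      using sum_squares_le_ip[OF x, of "{n}"] by (simp add: real_le_rsqrt)
    have "(half_op x n)\<^sup>2 \<le> (3 * K)\<^sup>2 * ip x x" for n
    proof -
      have "\<bar>half_op x n\<bar> \<le> \<bar>(if n - 1 \<ge> 0 then a (n - 1) else 0) * x (n - 1)\<bar> + \<bar>(if n \<ge> 0 then b n else 0) * x n\<bar> + \<bar>(if n \<ge> 0 then a n else 0) * x (n + 1)\<bar>"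
        unfolding half_op_def jac_def by linarith
      also have "\<dots> \<le> K * sqrt (ip x x) + K * sqrt (ip x x) + K * sqrt (ip x x)"
        unfolding abs_mult by (intro add_mono mult_mono half_coeff_bounds xb) (use K0 in auto)
      finally have "\<bar>half_op x n\<bar> \<le> 3 * K * sqrt (ip x x)" by simp
      then have "\<bar>half_op x n\<bar>\<^sup>2 \<le> (3 * K * sqrt (ip x x))\<^sup>2" by (intro power_mono) auto
      then show ?thesis by (simp add: power_mult_distrib ip_self_nonneg)
    qed
    then have "(\<Sum>n\<in>S. (half_op x n)\<^sup>2) \<le> (\<Sum>n\<in>S. (3 * K)\<^sup>2 * ip x x)" by (intro sum_mono)
    then show ?thesis using S(2)[OF x] by (simp add: C_def algebra_simps)
  qed
  moreover have "C \<ge> 0" by (simp add: C_def)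
  ultimately show ?thesis using that by blast
qed

text \<open>By compactness a normalised eigenvector with \<open>\<bar>\<nu>\<bar> \<ge> \<delta>\<close> has at least half of its mass on a finite
  set \<open>S\<close> of coordinates, and by Bessel's inequality all eigenvectors together have mass at most 1
  on each coordinate. So at most \<open>2 \<bar>S\<bar>\<close> such eigenvalues fit in.\<close>

lemma finite_half_eigenvalues_away_from_0:
  assumes "\<delta> > 0"
  shows "finite {\<nu> \<in> H. \<bar>\<nu>\<bar> \<ge> \<delta>}"
proof -
  obtain S where S: "finite S" "\<And>x. ell2 x \<Longrightarrow> ip (half_op x) (half_op x) \<le> (\<Sum>n\<in>S. (half_op x n)\<^sup>2) + (\<delta>\<^sup>2 / 2) * ip x x"
    using half_op_tail[of "\<delta>\<^sup>2 / 2"] assms by auto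
  have half: "1 / 2 \<le> (\<Sum>n\<in>S. weight \<nu> * (half_poly \<nu> n)\<^sup>2)" if \<nu>: "\<nu> \<in> H" "\<bar>\<nu>\<bar> \<ge> \<delta>" for \<nu>
  proof -
    define I where "I = ip (half_poly \<nu>) (half_poly \<nu>)"
    define s where "s = (\<Sum>n\<in>S. (half_poly \<nu> n)\<^sup>2)"
    have e: "half_op (half_poly \<nu>) = (\<lambda>n. \<nu> * half_poly \<nu> n)" using half_op_half_poly by blast
    have "ip (\<lambda>n. \<nu> * half_poly \<nu> n) (\<lambda>n. \<nu> * half_poly \<nu> n) = \<nu>\<^sup>2 * I"
      unfolding ip_scale ip_commute[of "half_poly \<nu>" "\<lambda>n. \<nu> * half_poly \<nu> n"] by (simp add: I_def power2_eq_square)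
    then have "\<nu>\<^sup>2 * I \<le> \<nu>\<^sup>2 * s + (\<delta>\<^sup>2 / 2) * I"
      using S(2)[of "half_poly \<nu>"] \<nu>(1) unfolding e half_eigenvalue_iff by (simp add: I_def s_def power_mult_distrib sum_distrib_left)
    moreover have "(\<delta>\<^sup>2 / 2) * I \<le> (\<nu>\<^sup>2 / 2) * I"
    proof (rule mult_right_mono)
      have "\<delta>\<^sup>2 \<le> \<bar>\<nu>\<bar>\<^sup>2" using \<nu>(2) assms by (intro power_mono) auto
      then show "\<delta>\<^sup>2 / 2 \<le> \<nu>\<^sup>2 / 2" by simp
    qed (simp add: I_def ip_self_nonneg)
    ultimately have "\<nu>\<^sup>2 * (I / 2) \<le> \<nu>\<^sup>2 * s" by (simp add: algebra_simps)
    moreover have "0 < \<nu>\<^sup>2" using \<nu>(2) assms by auto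
    ultimately have "I / 2 \<le> s" by simp
    then have "weight \<nu> * (I / 2) \<le> weight \<nu> * s" using weight_pos[OF \<nu>(1)] by (intro mult_left_mono) auto
    then show ?thesis using weight_ip[OF \<nu>(1)] by (simp add: I_def s_def sum_distrib_left)
  qed
  have "card F \<le> 2 * card S" if F: "F \<subseteq> {\<nu> \<in> H. \<bar>\<nu>\<bar> \<ge> \<delta>}" "finite F" for F
  proof -
    have "real (card F) * (1/2) \<le> (\<Sum>\<nu>\<in>F. \<Sum>n\<in>S. weight \<nu> * (half_poly \<nu> n)\<^sup>2)"
      using F half by (intro sum_bounded_below) auto
    also have "\<dots> = (\<Sum>n\<in>S. \<Sum>\<nu>\<in>F. weight \<nu> * (half_poly \<nu> n)\<^sup>2)" by (rule sum.swap)
    also have "\<dots> \<le> (\<Sum>n\<in>S. 1)" using F by (intro sum_mono bessel_coordinate) auto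
    finally show ?thesis by simp
  qed
  then show ?thesis by (meson finite_if_finite_subsets_card_bdd)
qed

text \<open>The orthogonal complement of the eigenvectors of \<open>L\<^sub>0\<close>.\<close>

definition residual :: "(int \<Rightarrow> real) \<Rightarrow> bool" where
  "residual x \<longleftrightarrow> ell2 x \<and> (\<forall>n<0. x n = 0) \<and> (\<forall>\<nu>\<in>H. ip x (half_poly \<nu>) = 0)"

lemma residual_lincomb: "residual x \<Longrightarrow> residual y \<Longrightarrow> residual (\<lambda>n. x n + c * y n)"
  unfolding residual_def by (auto simp: ell2_add ell2_scale ip_add ip_scale half_eigenvalue_iff)

lemma residual_scale: "residual x \<Longrightarrow> residual (\<lambda>n. c * x n)"
  unfolding residual_def by (auto simp: ell2_scale ip_scale)

lemma residual_half_op: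
  assumes "residual x"
  shows "residual (half_op x)"
  unfolding residual_def
proof (intro conjI ballI allI impI)
  fix \<nu> assume \<nu>: "\<nu> \<in> H"
  have "ip (half_op x) (half_poly \<nu>) = ip x (half_op (half_poly \<nu>))"
    using assms \<nu> by (intro half_op_selfadjoint) (auto simp: residual_def half_eigenvalue_iff)
  also have "half_op (half_poly \<nu>) = (\<lambda>n. \<nu> * half_poly \<nu> n)" by (rule ext) (rule half_op_half_poly)
  also have "ip x (\<lambda>n. \<nu> * half_poly \<nu> n) = \<nu> * ip x (half_poly \<nu>)"
    unfolding ip_commute[of x] by (rule ip_scale)
  finally show "ip (half_op x) (half_poly \<nu>) = 0" using assms \<nu> by (simp add: residual_def)
qed (use assms ell2_half_op half_op_neg in \<open>auto simp: residual_def\<close>)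

lemma residual_no_eigenvector:
  assumes x: "residual x" and e: "half_op x = (\<lambda>n. \<nu> * x n)"
  shows "x = (\<lambda>n. 0)"
proof (rule ccontr)
  assume nz: "x \<noteq> (\<lambda>n. 0)"
  have "ell2 x" "\<And>n. n < 0 \<Longrightarrow> x n = 0" using x by (auto simp: residual_def)
  from half_eigenvector[OF this e nz] have \<nu>: "\<nu> \<in> H" and xe: "x = (\<lambda>n. x 0 * half_poly \<nu> n)" by auto
  have "ip x x = x 0 * ip (half_poly \<nu>) x" by (subst (1) xe) (simp add: ip_scale)
  also have "\<dots> = 0" using x \<nu> by (simp add: residual_def ip_commute[of _ x])
  finally show False using nz ip_self_eq_0[OF \<open>ell2 x\<close>] by blast
qed

lemma half_op_add: "half_op (\<lambda>n. x n + c * y n) n = half_op x n + c * half_op y n"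
  by (simp add: half_op_def jac_def algebra_simps)

text \<open>Completeness of the eigenvectors. The complement is invariant under \<open>L\<^sub>0\<close> and contains no
  eigenvector. If it were not 0, then by compactness \<open>\<bar>L\<^sub>0 x\<bar>\<^sup>2\<close> would attain its maximum \<open>c\<close> over the
  unit ball of the complement at some \<open>x\<close>. Extremality gives \<open>L\<^sub>0\<^sup>2 x = c x\<close>, and from
  \<open>(L\<^sub>0 - s) (L\<^sub>0 + s) x = 0\<close> with \<open>s\<^sup>2 = c\<close> one of \<open>(L\<^sub>0 + s) x\<close> and \<open>x\<close> is an eigenvector;
  for \<open>c = 0\<close> the whole complement consists of eigenvectors for 0.\<close>

lemma residual_trivial:
  assumes u: "residual u"
  shows "u = (\<lambda>n. 0)"
proof (rule ccontr)
  assume nz: "u \<noteq> (\<lambda>n. 0)"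
  define V where "V = {ip (half_op x) (half_op x) | x. residual x \<and> ip x x \<le> 1}"
  obtain C where C: "C \<ge> 0" "\<And>x. ell2 x \<Longrightarrow> ip (half_op x) (half_op x) \<le> C * ip x x" using half_op_bounded by blast
  have bdd: "bdd_above V"
  proof (rule bdd_aboveI)
    fix v assume "v \<in> V"
    then obtain x where x: "v = ip (half_op x) (half_op x)" "residual x" "ip x x \<le> 1" unfolding V_def by blast
    have "v \<le> C * ip x x" using C x by (simp add: residual_def)
    also have "\<dots> \<le> C" using x(3) C(1) by (metis mult_left_mono mult.right_neutral)
    finally show "v \<le> C" .
  qed
  have "residual (\<lambda>n. 0)" using residual_scale[OF u, of 0] by simp
  then have Vne: "V \<noteq> {}" unfolding V_def by (force intro: exI[of _ "\<lambda>n. 0"])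
  define c where "c = Sup V"
  have Vle: "ip (half_op x) (half_op x) \<le> c" if "residual x" "ip x x \<le> 1" for x
    unfolding c_def by (rule cSup_upper[OF _ bdd]) (use that in \<open>auto simp: V_def\<close>)
  have hom: "ip (half_op x) (half_op x) \<le> c * ip x x" if x: "residual x" for x
  proof (cases "ip x x = 0")
    case True
    then have "x = (\<lambda>n. 0)" using x ip_self_eq_0 by (auto simp: residual_def)
    then show ?thesis using True by (simp add: half_op_def jac_def[abs_def])
  next
    case False
    then have p: "ip x x > 0" using ip_self_nonneg[of x] by simp
    define r where "r = 1 / sqrt (ip x x)"
    have r2: "r * r = 1 / ip x x" using p by (simp add: r_def)
    have ipr: "ip (\<lambda>n. r * w n) (\<lambda>n. r * w n) = (r * r) * ip w w" for w
      unfolding ip_scale ip_commute[of w "\<lambda>n. r * w n"] by simp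
    have e: "half_op (\<lambda>n. r * x n) = (\<lambda>n. r * half_op x n)" by (simp add: half_op_def jac_def fun_eq_iff algebra_simps)
    have "ip (\<lambda>n. r * x n) (\<lambda>n. r * x n) \<le> 1" unfolding ipr r2 using p by simp
    from Vle[OF residual_scale[OF x] this]
    have "(r * r) * ip (half_op x) (half_op x) \<le> c" unfolding e ipr .
    then show ?thesis unfolding r2 using p by (simp add: field_simps)
  qed
  have c0: "0 \<le> c" using Vle[OF \<open>residual (\<lambda>n. 0)\<close>] by (simp add: half_op_def jac_def[abs_def])
  show False
  proof (cases "c = 0")
    case True
    then have "ip (half_op u) (half_op u) = 0" using hom[OF u] ip_self_nonneg[of "half_op u"] by simp
    then have "half_op u = (\<lambda>n. 0 * u n)" using ip_self_eq_0[OF ell2_half_op] u by (auto simp: residual_def)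
    from residual_no_eigenvector[OF u this] nz show False by blast
  next
    case False
    have "\<exists>x. residual x \<and> ip x x \<le> 1 \<and> ip (half_op x) (half_op x) > c - inverse (real (Suc k))" for k
    proof -
      have "c - inverse (real (Suc k)) < Sup V" by (simp add: c_def)
      then obtain v where "v \<in> V" "v > c - inverse (real (Suc k))" using less_cSup_iff[OF Vne bdd] by blast
      then show ?thesis by (auto simp: V_def)
    qed
    then obtain X where X: "\<And>k. residual (X k)" "\<And>k. ip (X k) (X k) \<le> 1"
      "\<And>k. ip (half_op (X k)) (half_op (X k)) > c - inverse (real (Suc k))" by metis
    have Xe: "ell2 (X k)" for k using X(1) by (simp add: residual_def)
    have Xb: "norm (X k n) \<le> 1" for k n
    proof -
      have "(X k n)\<^sup>2 \<le> 1" using sum_squares_le_ip[OF Xe, of "{n}" k] X(2)[of k] by simp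
      then show ?thesis by (simp add: abs_square_le_1)
    qed
    \<comment> \<open>A diagonal subsequence of the maximising sequence converges at every site; compactness then
      shows that no part of the maximum is lost in the limit.\<close>
    obtain r where r: "strict_mono (r :: nat \<Rightarrow> nat)" "\<And>n. n \<in> UNIV \<Longrightarrow> \<exists>l. (\<lambda>k. X (r k) n) \<longlonglongrightarrow> l"
      using function_convergent_subsequence[of "UNIV :: int set" X 1] Xb by auto
    then obtain x where x: "\<And>n. (\<lambda>k. X (r k) n) \<longlonglongrightarrow> x n" by (metis UNIV_I)
    have xs: "(\<Sum>n\<in>G. (x n)\<^sup>2) \<le> 1" if G: "finite G" for G
    proof (rule LIMSEQ_le_const2)
      show "(\<lambda>k. \<Sum>n\<in>G. (X (r k) n)\<^sup>2) \<longlonglongrightarrow> (\<Sum>n\<in>G. (x n)\<^sup>2)" by (intro tendsto_intros x)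
      show "\<exists>N. \<forall>k\<ge>N. (\<Sum>n\<in>G. (X (r k) n)\<^sup>2) \<le> 1"
        using order.trans[OF sum_squares_le_ip[OF Xe G] X(2)] by blast
    qed
    have xe: "ell2 x" and x1: "ip x x \<le> 1" using ell2I[OF xs] by auto
    have xres: "residual x" unfolding residual_def
    proof (intro conjI allI impI ballI)
      show "ell2 x" by fact
      fix n :: int assume "n < 0"
      then have "(\<lambda>k. X (r k) n) = (\<lambda>k. 0)" using X(1) by (auto simp: residual_def)
      then show "x n = 0" using x[of n] LIMSEQ_unique by (metis tendsto_const)
    next
      fix \<nu> assume \<nu>: "\<nu> \<in> H"
      have "(\<lambda>k. ip (X (r k)) (half_poly \<nu>)) \<longlonglongrightarrow> ip x (half_poly \<nu>)"
        by (rule weak_tendsto[where B = 1]) (use \<nu> Xe X(2) xe x x1 in \<open>auto simp: half_eigenvalue_iff\<close>)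
      moreover have "(\<lambda>k. ip (X (r k)) (half_poly \<nu>)) = (\<lambda>k. 0)" using X(1) \<nu> by (auto simp: residual_def)
      ultimately show "ip x (half_poly \<nu>) = 0" using LIMSEQ_unique tendsto_const by metis
    qed
    have "c \<le> ip (half_op x) (half_op x)"
    proof (rule field_le_epsilon)
      fix e :: real assume e: "e > 0"
      obtain S where S: "finite S" "\<And>x. ell2 x \<Longrightarrow> ip (half_op x) (half_op x) \<le> (\<Sum>n\<in>S. (half_op x n)\<^sup>2) + e * ip x x"
        using half_op_tail[OF e] by blast
      have "(\<lambda>k. half_op (X (r k)) n) \<longlonglongrightarrow> half_op x n" for n
        unfolding half_op_def jac_def by (intro tendsto_intros x)
      then have R: "(\<lambda>k. (\<Sum>n\<in>S. (half_op (X (r k)) n)\<^sup>2) + e) \<longlonglongrightarrow> (\<Sum>n\<in>S. (half_op x n)\<^sup>2) + e"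
        by (intro tendsto_intros)
      have "(\<lambda>k. c - inverse (real (Suc (r k)))) \<longlonglongrightarrow> c - 0"
        using LIMSEQ_subseq_LIMSEQ[OF LIMSEQ_inverse_real_of_nat r(1)] by (intro tendsto_intros) (simp add: o_def)
      then have L: "(\<lambda>k. c - inverse (real (Suc (r k)))) \<longlonglongrightarrow> c" by simp
      have "c \<le> (\<Sum>n\<in>S. (half_op x n)\<^sup>2) + e"
      proof (rule LIMSEQ_le[OF L R], intro exI allI impI)
        fix k
        have "c - inverse (real (Suc (r k))) < ip (half_op (X (r k))) (half_op (X (r k)))" by (rule X(3))
        also have "\<dots> \<le> (\<Sum>n\<in>S. (half_op (X (r k)) n)\<^sup>2) + e * ip (X (r k)) (X (r k))" by (rule S(2)[OF Xe])
        also have "e * ip (X (r k)) (X (r k)) \<le> e * 1" using e X(2) by (intro mult_left_mono) auto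
        finally show "c - inverse (real (Suc (r k))) \<le> (\<Sum>n\<in>S. (half_op (X (r k)) n)\<^sup>2) + e" by simp
      qed
      also have "(\<Sum>n\<in>S. (half_op x n)\<^sup>2) \<le> ip (half_op x) (half_op x)"
        by (rule sum_squares_le_ip[OF ell2_half_op[OF xe] S(1)])
      finally show "c \<le> ip (half_op x) (half_op x) + e" by simp
    qed
    then have xc: "ip (half_op x) (half_op x) = c" using Vle[OF xres x1] by simp
    \<comment> \<open>Expanding the square shows that T2 - c x has nonpositive norm, as the norm of T2 is at most c.\<close>
    define T2 where "T2 = half_op (half_op x)"
    have T2: "ell2 T2" unfolding T2_def by (intro ell2_half_op xe)
    define z where "z n = T2 n - c * x n" for n
    have z: "ell2 z" unfolding z_def by (intro ell2_diff T2 ell2_scale xe)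
    have T2x: "ip T2 x = c" unfolding T2_def using half_op_selfadjoint[OF ell2_half_op[OF xe] xe] xc by simp
    have "ip T2 T2 \<le> c * c" unfolding T2_def using hom[OF residual_half_op[OF xres]] xc by simp
    moreover have "ip z z = ip T2 T2 - 2 * c * ip T2 x + c * c * ip x x"
    proof -
      have "ip z w = ip T2 w - c * ip x w" if "ell2 w" for w
        unfolding z_def[abs_def] using ip_diff[OF T2 ell2_scale[OF xe, of c] that] by (simp add: ip_scale)
      from this[OF z] this[OF T2] this[OF xe]
      show ?thesis by (simp add: ip_commute[of T2 z] ip_commute[of x z] ip_commute[of x T2] algebra_simps)
    qed
    moreover have "c * c * ip x x \<le> c * c" using x1 c0 by (metis mult_left_mono mult.right_neutral mult_nonneg_nonneg)
    ultimately have "ip z z \<le> 0" unfolding T2x by simp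
    then have "z = (\<lambda>n. 0)" using ip_self_eq_0[OF z] ip_self_nonneg[of z] by simp
    then have T2e: "half_op (half_op x) n = c * x n" for n
      unfolding z_def T2_def by (metis eq_iff_diff_eq_0)
    define s where "s = sqrt c"
    have s2: "s * s = c" using c0 by (simp add: s_def)
    define y where "y n = half_op x n + s * x n" for n
    have y: "residual y" unfolding y_def by (intro residual_lincomb residual_half_op xres)
    have "half_op y = (\<lambda>n. s * y n)"
      unfolding y_def half_op_add fun_eq_iff T2e by (simp add: s2[symmetric] algebra_simps)
    from residual_no_eigenvector[OF y this] have "half_op x n + s * x n = 0" for n
      unfolding y_def by metis
    then have "half_op x = (\<lambda>n. (- s) * x n)" by (simp add: fun_eq_iff add_eq_0_iff)
    from residual_no_eigenvector[OF xres this] have "x = (\<lambda>n. 0)" .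
    then have "half_op x = (\<lambda>n. 0)" by (simp add: half_op_def jac_def fun_eq_iff)
    then show False using xc False by simp
  qed
qed

lemma weight_summable: "weight summable_on H"
proof (rule nonneg_bdd_above_summable_on)
  show "bdd_above (sum weight ` {F. F \<subseteq> H \<and> finite F})"
    using bessel_coordinate[of _ 0] by (intro bdd_aboveI[of _ 1]) auto
qed (simp add: weight_pos less_imp_le)

lemma weight_half_poly_summable:
  assumes k: "\<And>\<nu>. \<nu> \<in> H \<Longrightarrow> \<bar>k \<nu>\<bar> \<le> B"
  shows "(\<lambda>\<nu>. weight \<nu> * k \<nu> * half_poly \<nu> n) summable_on H"
proof (rule summable_on_bounded_by)
  have sq: "(\<lambda>\<nu>. weight \<nu> * (half_poly \<nu> n)\<^sup>2) summable_on H"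
  proof (rule nonneg_bdd_above_summable_on)
    show "bdd_above (sum (\<lambda>\<nu>. weight \<nu> * (half_poly \<nu> n)\<^sup>2) ` {F. F \<subseteq> H \<and> finite F})"
      using bessel_coordinate by (intro bdd_aboveI[of _ 1]) auto
  qed (simp add: weight_pos less_imp_le)
  show "(\<lambda>\<nu>. B * (weight \<nu> + weight \<nu> * (half_poly \<nu> n)\<^sup>2)) summable_on H"
    by (intro summable_on_cmult_right summable_on_add weight_summable sq)
  fix \<nu> assume \<nu>: "\<nu> \<in> H"
  have w: "0 \<le> weight \<nu>" using weight_pos[OF \<nu>] by simp
  have "\<bar>half_poly \<nu> n\<bar> \<le> 1 + (half_poly \<nu> n)\<^sup>2" using abs_mult_le_squares[of 1 "half_poly \<nu> n"] by simp
  then have "\<bar>k \<nu>\<bar> * \<bar>half_poly \<nu> n\<bar> \<le> B * (1 + (half_poly \<nu> n)\<^sup>2)"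
    using k[OF \<nu>] by (intro mult_mono) auto
  then have "weight \<nu> * (\<bar>k \<nu>\<bar> * \<bar>half_poly \<nu> n\<bar>) \<le> weight \<nu> * (B * (1 + (half_poly \<nu> n)\<^sup>2))" using w by (rule mult_left_mono)
  then show "\<bar>weight \<nu> * k \<nu> * half_poly \<nu> n\<bar> \<le> B * (weight \<nu> + weight \<nu> * (half_poly \<nu> n)\<^sup>2)"
    using w by (simp add: abs_mult algebra_simps)
qed

text \<open>The inverse spectral transform: the sequence whose inner products with the eigenvectors are
  the values of \<open>k\<close>.\<close>

definition synth :: "(real \<Rightarrow> real) \<Rightarrow> int \<Rightarrow> real" where
  "synth k n = (\<Sum>\<^sub>\<infinity>\<nu>\<in>H. weight \<nu> * k \<nu> * half_poly \<nu> n)"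

lemma synth_ell2:
  assumes k: "\<And>\<nu>. \<nu> \<in> H \<Longrightarrow> \<bar>k \<nu>\<bar> \<le> B"
  shows "ell2 (synth k)" "ip (synth k) (synth k) \<le> B\<^sup>2" "\<And>\<nu>. \<nu> \<in> H \<Longrightarrow> ip (synth k) (half_poly \<nu>) = k \<nu>"
proof -
  define s where "s F n = (\<Sum>\<nu>\<in>F. weight \<nu> * k \<nu> * half_poly \<nu> n)" for F n
  have lim: "((\<lambda>F. s F n) \<longlongrightarrow> synth k n) (finite_subsets_at_top H)" for n
    using has_sum_infsum[OF weight_half_poly_summable[OF k, where n = n]] by (simp add: has_sum_def s_def synth_def)
  have sF: "ell2 (s F) \<and> ip (s F) (s F) \<le> B\<^sup>2" if F: "finite F" "F \<subseteq> H" for F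
  proof
    have hp: "\<And>\<nu>. \<nu> \<in> F \<Longrightarrow> ell2 (half_poly \<nu>)" using F half_eigenvalue_iff by blast
    have orth: "\<And>\<mu> \<nu>. \<mu> \<in> F \<Longrightarrow> \<nu> \<in> F \<Longrightarrow> \<mu> \<noteq> \<nu> \<Longrightarrow> ip (half_poly \<mu>) (half_poly \<nu>) = 0"
      using F half_poly_orthogonal by blast
    show "ell2 (s F)" unfolding s_def by (rule ell2_sum[OF hp])
    have "ip (s F) (s F) = (\<Sum>\<nu>\<in>F. (weight \<nu> * k \<nu>) * (weight \<nu> * k \<nu>) * ip (half_poly \<nu>) (half_poly \<nu>))"
      unfolding s_def[abs_def] by (rule ip_orthogonal_sums) (simp_all add: hp orth F(1))
    also have "\<dots> \<le> (\<Sum>\<nu>\<in>F. B\<^sup>2 * (weight \<nu> * (half_poly \<nu> 0)\<^sup>2))"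
    proof (rule sum_mono)
      fix \<nu> assume "\<nu> \<in> F"
      then have \<nu>: "\<nu> \<in> H" using F by blast
      have "(weight \<nu> * k \<nu>) * (weight \<nu> * k \<nu>) * ip (half_poly \<nu>) (half_poly \<nu>)
          = (k \<nu>)\<^sup>2 * (weight \<nu> * (weight \<nu> * ip (half_poly \<nu>) (half_poly \<nu>)))" by (simp add: power2_eq_square)
      also have "\<dots> = (k \<nu>)\<^sup>2 * weight \<nu>" unfolding weight_ip[OF \<nu>] by simp
      also have "\<dots> \<le> B\<^sup>2 * weight \<nu>"
        using weight_pos[OF \<nu>] power_mono[OF k[OF \<nu>], of 2] by (intro mult_right_mono) auto
      finally show "(weight \<nu> * k \<nu>) * (weight \<nu> * k \<nu>) * ip (half_poly \<nu>) (half_poly \<nu>) \<le> B\<^sup>2 * (weight \<nu> * (half_poly \<nu> 0)\<^sup>2)" by simp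
    qed
    also have "\<dots> \<le> B\<^sup>2 * 1" unfolding sum_distrib_left[symmetric] using F by (intro mult_left_mono bessel_coordinate) auto
    finally show "ip (s F) (s F) \<le> B\<^sup>2" by simp
  qed
  have ev: "\<forall>\<^sub>F F in finite_subsets_at_top H. ell2 (s F) \<and> ip (s F) (s F) \<le> B\<^sup>2"
    by (rule eventually_finite_subsets_at_top_weakI) (rule sF)
  have bd: "(\<Sum>n\<in>G. (synth k n)\<^sup>2) \<le> B\<^sup>2" if G: "finite G" for G
  proof (rule tendsto_upperbound)
    show "((\<lambda>F. \<Sum>n\<in>G. (s F n)\<^sup>2) \<longlongrightarrow> (\<Sum>n\<in>G. (synth k n)\<^sup>2)) (finite_subsets_at_top H)" by (intro tendsto_intros lim)
    show "\<forall>\<^sub>F F in finite_subsets_at_top H. (\<Sum>n\<in>G. (s F n)\<^sup>2) \<le> B\<^sup>2"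
      using ev by eventually_elim (use sum_squares_le_ip G order.trans in blast)
  qed simp
  show e: "ell2 (synth k)" and i: "ip (synth k) (synth k) \<le> B\<^sup>2" using ell2I[OF bd] by auto
  fix \<nu> assume \<nu>: "\<nu> \<in> H"
  have "((\<lambda>F. ip (s F) (half_poly \<nu>)) \<longlongrightarrow> ip (synth k) (half_poly \<nu>)) (finite_subsets_at_top H)"
    by (rule weak_tendsto[OF ev e _ lim _ i]) (use \<nu> in \<open>auto simp: half_eigenvalue_iff\<close>)
  moreover have "\<forall>\<^sub>F F in finite_subsets_at_top H. ip (s F) (half_poly \<nu>) = k \<nu>"
    unfolding eventually_finite_subsets_at_top
  proof (intro exI[of _ "{\<nu>}"] conjI allI impI)
    fix F assume F: "finite F \<and> {\<nu>} \<subseteq> F \<and> F \<subseteq> H"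
    then have hp: "\<And>\<nu>. \<nu> \<in> F \<Longrightarrow> ell2 (half_poly \<nu>)" using half_eigenvalue_iff by blast
    have "ip (s F) (half_poly \<nu>) = (\<Sum>\<mu>\<in>F. weight \<mu> * k \<mu> * ip (half_poly \<mu>) (half_poly \<nu>))"
      unfolding s_def[abs_def] by (rule ip_sum[OF hp]) (use \<nu> in \<open>auto simp: half_eigenvalue_iff\<close>)
    also have "\<dots> = (\<Sum>\<mu>\<in>F. if \<mu> = \<nu> then k \<nu> else 0)"
    proof (rule sum.cong)
      fix \<mu> assume "\<mu> \<in> F"
      then show "weight \<mu> * k \<mu> * ip (half_poly \<mu>) (half_poly \<nu>) = (if \<mu> = \<nu> then k \<nu> else 0)"
        using weight_ip[OF \<nu>] half_poly_orthogonal[of \<mu> \<nu>] F \<nu> by (auto simp: mult_ac)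
    qed simp
    finally show "ip (s F) (half_poly \<nu>) = k \<nu>" using F by simp
  qed (use \<nu> in auto)
  ultimately have "((\<lambda>F. k \<nu>) \<longlongrightarrow> ip (synth k) (half_poly \<nu>)) (finite_subsets_at_top H)"
    by (rule Lim_transform_eventually)
  then show "ip (synth k) (half_poly \<nu>) = k \<nu>" by (simp add: tendsto_const_iff)
qed

text \<open>The expansion of the unit vector at 0: since \<open>half_poly \<nu> 0 = 1\<close>, all its coefficients are 1, and
  by completeness nothing is missing.\<close>

lemma synth_one: "synth (\<lambda>_. 1) n = (if n = 0 then 1 else 0)"
proof -
  define u where "u n = (if n = 0 then 1 else 0) - synth (\<lambda>_. 1) n" for n
  have s: "ell2 (synth (\<lambda>_. 1))" by (rule synth_ell2(1)[where B = 1]) simp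
  have "residual u" unfolding residual_def
  proof (intro conjI allI impI ballI)
    show "ell2 u" unfolding u_def by (intro ell2_diff ell2_basis s)
    show "u n = 0" if "n < 0" for n using that by (simp add: u_def synth_def)
    show "ip u (half_poly \<nu>) = 0" if \<nu>: "\<nu> \<in> H" for \<nu>
    proof -
      have "ip u (half_poly \<nu>) = ip (\<lambda>m. if m = 0 then 1 else 0) (half_poly \<nu>) - ip (synth (\<lambda>_. 1)) (half_poly \<nu>)"
        unfolding u_def[abs_def] by (rule ip_diff[OF ell2_basis s]) (use \<nu> in \<open>simp add: half_eigenvalue_iff\<close>)
      then show ?thesis using synth_ell2(3)[of "\<lambda>_. 1" 1, OF _ \<nu>] by (simp add: ip_basis)
    qed
  qed
  from fun_cong[OF residual_trivial[OF this], of n] show ?thesis by (simp add: u_def)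
qed

text \<open>This makes the spectral measure a probability measure, so that its distribution function
  determines it.\<close>

lemma weight_sum: "(\<Sum>\<^sub>\<infinity>\<nu>\<in>H. weight \<nu>) = 1"
  using synth_one[of 0] by (simp add: synth_def)

lemma synth_half_op:
  assumes k: "\<And>\<nu>. \<nu> \<in> H \<Longrightarrow> \<bar>k \<nu>\<bar> \<le> B" and k': "\<And>\<nu>. \<nu> \<in> H \<Longrightarrow> \<bar>\<nu> * k \<nu>\<bar> \<le> B'"
  shows "half_op (synth k) n = synth (\<lambda>\<nu>. \<nu> * k \<nu>) n"
proof -
  define p where "p = (if n - 1 \<ge> 0 then a (n - 1) else 0)"
  define q where "q = (if n \<ge> 0 then b n else 0)"
  define r where "r = (if n \<ge> 0 then a n else 0)"
  define f where "f m \<nu> = weight \<nu> * k \<nu> * half_poly \<nu> m" for m \<nu>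
  have fs: "f m summable_on H" for m unfolding f_def using weight_half_poly_summable[OF k] .
  have "half_op (synth k) n = p * infsum (f (n - 1)) H + q * infsum (f n) H + r * infsum (f (n + 1)) H"
    by (simp add: half_op_def jac_def p_def q_def r_def synth_def f_def[abs_def])
  also have "\<dots> = (\<Sum>\<^sub>\<infinity>\<nu>\<in>H. p * f (n - 1) \<nu> + q * f n \<nu> + r * f (n + 1) \<nu>)"
    by (subst infsum_add[OF summable_on_add[OF summable_on_cmult_right[OF fs] summable_on_cmult_right[OF fs]] summable_on_cmult_right[OF fs]],
        subst infsum_add[OF summable_on_cmult_right[OF fs] summable_on_cmult_right[OF fs]])
       (simp add: infsum_cmult_right')
  also have "\<dots> = (\<Sum>\<^sub>\<infinity>\<nu>\<in>H. weight \<nu> * (\<nu> * k \<nu>) * half_poly \<nu> n)"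
  proof (rule infsum_cong)
    fix \<nu>
    have "p * half_poly \<nu> (n - 1) + q * half_poly \<nu> n + r * half_poly \<nu> (n + 1) = \<nu> * half_poly \<nu> n"
      using half_op_half_poly[of \<nu> n] by (simp add: half_op_def jac_def p_def q_def r_def)
    then have "weight \<nu> * k \<nu> * (p * half_poly \<nu> (n - 1) + q * half_poly \<nu> n + r * half_poly \<nu> (n + 1)) = weight \<nu> * k \<nu> * (\<nu> * half_poly \<nu> n)" by simp
    then show "p * f (n - 1) \<nu> + q * f n \<nu> + r * f (n + 1) \<nu> = weight \<nu> * (\<nu> * k \<nu>) * half_poly \<nu> n"
      by (simp add: f_def algebra_simps)
  qed
  finally show ?thesis by (simp add: synth_def)
qed

end

section \<open>The spectral measure and the Weyl function\<close>

lemma integrable_count_space_iff: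
  fixes f :: "'a \<Rightarrow> 'b::{banach, second_countable_topology}"
  shows "integrable (count_space A) f \<longleftrightarrow> (\<lambda>x. norm (f x)) summable_on A"
  using abs_summable_equivalent[of f A] unfolding Infinite_Set_Sum.abs_summable_on_def by blast

lemma integral_count_space_infsum:
  fixes f :: "'a \<Rightarrow> 'b::{banach, second_countable_topology}"
  assumes "(\<lambda>x. norm (f x)) summable_on A"
  shows "integral\<^sup>L (count_space A) f = infsum f A"
  using infsetsum_infsum[of f A] assms integrable_count_space_iff[of A f]
  unfolding Infinite_Set_Sum.abs_summable_on_def infsetsum_def by blast

context half_line_jacobi
begin

definition atomic_measure :: "real measure" where
  "atomic_measure = distr (density (count_space H) (\<lambda>\<nu>. ennreal (weight \<nu>))) borel (\<lambda>\<nu>. \<nu>)"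

lemma weight_nonneg: "\<nu> \<in> H \<Longrightarrow> 0 \<le> weight \<nu>"
  using weight_pos[of \<nu>] by simp

lemma id_measurable: "(\<lambda>\<nu>. \<nu>) \<in> measurable (density (count_space H) (\<lambda>\<nu>. ennreal (weight \<nu>))) borel"
  by simp

lemma emeasure_atomic:
  assumes A: "A \<in> sets borel"
  shows "emeasure atomic_measure A = ennreal (infsum weight (H \<inter> A))"
proof -
  define f where "f \<nu> = weight \<nu> * indicator A \<nu>" for \<nu>
  have fn: "0 \<le> f \<nu>" if "\<nu> \<in> H" for \<nu> using weight_nonneg[OF that] by (simp add: f_def indicator_def)
  have fs: "(\<lambda>\<nu>. norm (f \<nu>)) summable_on H"
    by (rule summable_on_bounded_by[OF weight_summable]) (use weight_nonneg in \<open>auto simp: f_def indicator_def\<close>)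
  have "emeasure atomic_measure A = emeasure (density (count_space H) (\<lambda>\<nu>. ennreal (weight \<nu>))) (A \<inter> H)"
    unfolding atomic_measure_def using A by (subst emeasure_distr[OF id_measurable]) (auto simp: vimage_def Int_def)
  also have "\<dots> = (\<integral>\<^sup>+ \<nu>. ennreal (weight \<nu>) * indicator (A \<inter> H) \<nu> \<partial>count_space H)"
    by (subst emeasure_density) auto
  also have "\<dots> = (\<integral>\<^sup>+ \<nu>. ennreal (f \<nu>) \<partial>count_space H)"
    by (intro nn_integral_cong) (auto simp: f_def indicator_def)
  also have "\<dots> = ennreal (integral\<^sup>L (count_space H) f)"
    using fs fn by (intro nn_integral_eq_integral) (auto simp: integrable_count_space_iff AE_count_space)
  also have "integral\<^sup>L (count_space H) f = infsum f H" using fs by (rule integral_count_space_infsum)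
  also have "\<dots> = infsum weight (H \<inter> A)"
    by (rule infsum_cong_neutral) (auto simp: f_def indicator_def)
  finally show ?thesis .
qed

lemma measure_atomic: "A \<in> sets borel \<Longrightarrow> measure atomic_measure A = infsum weight (H \<inter> A)"
proof -
  have "0 \<le> infsum weight (H \<inter> A)" by (rule infsum_nonneg) (simp add: weight_nonneg)
  then show "A \<in> sets borel \<Longrightarrow> measure atomic_measure A = infsum weight (H \<inter> A)"
    unfolding measure_def by (simp add: emeasure_atomic)
qed

lemma real_distribution_atomic: "real_distribution atomic_measure"
proof -
  have "emeasure atomic_measure UNIV = 1" using emeasure_atomic[of UNIV] by (simp add: weight_sum)
  then interpret prob_space atomic_measure
    by (intro prob_spaceI) (simp add: atomic_measure_def)
  show ?thesis by unfold_locales (simp add: atomic_measure_def)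
qed

lemma spectral_function_eq: "spectral_function a b x = measure atomic_measure {..<x}"
proof -
  have "{\<nu> \<in> H. \<nu> < x} = H \<inter> {..<x}" by auto
  then show ?thesis unfolding spectral_function_def weight_half_norm by (simp add: measure_atomic)
qed

text \<open>Taking right limits turns the spectral function, the measure of open half-lines, into the
  distribution function of the point masses.\<close>

lemma spectral_measure_eq: "spectral_measure a b = atomic_measure"
proof -
  interpret real_distribution atomic_measure by (rule real_distribution_atomic)
  have "Lim (at_right x) (spectral_function a b) = cdf atomic_measure x" for x
  proof (rule tendsto_Lim)
    show "(spectral_function a b \<longlongrightarrow> cdf atomic_measure x) (at_right x)"
    proof (rule tendsto_sandwich[OF _ _ tendsto_const])
      show "(cdf atomic_measure \<longlongrightarrow> cdf atomic_measure x) (at_right x)"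
        using cdf_is_right_cont[of x] by (simp add: continuous_within)
      show "\<forall>\<^sub>F y in at_right x. cdf atomic_measure x \<le> spectral_function a b y"
        unfolding eventually_at_right_field spectral_function_eq cdf_def
        by (intro exI[of _ "x + 1"]) (auto intro!: finite_measure_mono)
      show "\<forall>\<^sub>F y in at_right x. spectral_function a b y \<le> cdf atomic_measure y"
        unfolding spectral_function_eq cdf_def
        by (intro always_eventually allI finite_measure_mono) auto
    qed
  qed simp
  then have e: "spectral_measure a b = interval_measure (cdf atomic_measure)"
    unfolding spectral_measure_def by simp
  have "real_distribution (interval_measure (cdf atomic_measure))"
    by (rule real_distribution_interval_measure[OF cdf_nondecreasing cdf_is_right_cont cdf_lim_at_bot cdf_lim_at_top_prob])
  moreover have "cdf (interval_measure (cdf atomic_measure)) = cdf atomic_measure"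
    by (rule cdf_interval_measure[OF cdf_nondecreasing cdf_is_right_cont cdf_lim_at_bot])
  ultimately show ?thesis unfolding e using cdf_unique real_distribution_atomic by blast
qed

lemma integral_atomic:
  fixes g :: "real \<Rightarrow> complex"
  assumes [measurable]: "g \<in> borel_measurable borel"
  shows "integral\<^sup>L atomic_measure g = (\<integral>\<nu>. weight \<nu> *\<^sub>R g \<nu> \<partial>count_space H)"
    "integrable atomic_measure g \<longleftrightarrow> (\<lambda>\<nu>. norm (weight \<nu> *\<^sub>R g \<nu>)) summable_on H"
proof -
  have nn: "AE \<nu> in count_space H. 0 \<le> weight \<nu>" by (simp add: AE_count_space weight_nonneg)
  show "integral\<^sup>L atomic_measure g = (\<integral>\<nu>. weight \<nu> *\<^sub>R g \<nu> \<partial>count_space H)"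
    unfolding atomic_measure_def
    by (subst integral_distr[OF id_measurable assms], rule integral_density) (auto simp: nn)
  show "integrable atomic_measure g \<longleftrightarrow> (\<lambda>\<nu>. norm (weight \<nu> *\<^sub>R g \<nu>)) summable_on H"
    unfolding atomic_measure_def integrable_distr_eq[OF id_measurable assms]
    by (subst integrable_density) (auto simp: nn integrable_count_space_iff)
qed

lemma weyl_m_integral:
  "weyl_m a b l = (\<integral>\<nu>. weight \<nu> *\<^sub>R (1 / (complex_of_real \<nu> - l)) \<partial>count_space H)"
  unfolding weyl_m_def spectral_measure_eq by (rule integral_atomic(1)) measurable

lemma spectral_integrable_iff:
  "integrable (spectral_measure a b) (\<lambda>\<tau>. 1 / complex_of_real \<tau>) \<longleftrightarrow> (\<lambda>\<nu>. weight \<nu> / \<bar>\<nu>\<bar>) summable_on H"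
proof -
  have "(\<lambda>\<nu>. norm (weight \<nu> *\<^sub>R (1 / complex_of_real \<nu>))) summable_on H \<longleftrightarrow> (\<lambda>\<nu>. weight \<nu> / \<bar>\<nu>\<bar>) summable_on H"
    by (rule summable_on_cong) (simp add: norm_divide weight_nonneg)
  then show ?thesis unfolding spectral_measure_eq by (subst integral_atomic(2)) auto
qed

lemma weyl_m_infsum:
  assumes "(\<lambda>\<nu>. weight \<nu> * cmod (1 / (complex_of_real \<nu> - l))) summable_on H"
  shows "weyl_m a b l = (\<Sum>\<^sub>\<infinity>\<nu>\<in>H. complex_of_real (weight \<nu>) * (1 / (complex_of_real \<nu> - l)))"
proof -
  have "(\<lambda>\<nu>. norm (weight \<nu> *\<^sub>R (1 / (complex_of_real \<nu> - l)))) summable_on H"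
    using assms by (rule summable_on_cong[THEN iffD1, rotated]) (simp add: weight_nonneg norm_divide)
  from integral_count_space_infsum[OF this] show ?thesis
    unfolding weyl_m_integral by (simp add: scaleR_conv_of_real)
qed

lemma weyl_m_real: "weyl_m a b (complex_of_real x) = complex_of_real (\<integral>\<nu>. weight \<nu> / (\<nu> - x) \<partial>count_space H)"
proof -
  have "weyl_m a b (complex_of_real x) = (\<integral>\<nu>. complex_of_real (weight \<nu> / (\<nu> - x)) \<partial>count_space H)"
    unfolding weyl_m_integral by (intro Bochner_Integration.integral_cong) (simp_all add: scaleR_conv_of_real)
  also have "\<dots> = complex_of_real (\<integral>\<nu>. weight \<nu> / (\<nu> - x) \<partial>count_space H)" by (rule integral_complex_of_real)
  finally show ?thesis .
qed

text \<open>Dominated convergence: leaving the real axis vertically only increases \<open>\<bar>\<nu> - l\<bar>\<close>.\<close>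

lemma weyl_m_vertical_limit:
  assumes x: "x \<notin> H" and s: "(\<lambda>\<nu>. weight \<nu> / \<bar>\<nu> - x\<bar>) summable_on H"
  shows "(\<lambda>j. weyl_m a b (Complex x (inverse (real (Suc j))))) \<longlonglongrightarrow> weyl_m a b (complex_of_real x)"
  unfolding weyl_m_integral
proof (rule integral_dominated_convergence)
  have "(\<lambda>\<nu>. norm (weight \<nu> / \<bar>\<nu> - x\<bar>)) summable_on H"
    using s by (rule summable_on_cong[THEN iffD1, rotated]) (simp add: weight_nonneg)
  then show "integrable (count_space H) (\<lambda>\<nu>. weight \<nu> / \<bar>\<nu> - x\<bar>)" by (simp add: integrable_count_space_iff)
  show "AE \<nu> in count_space H. (\<lambda>j. weight \<nu> *\<^sub>R (1 / (complex_of_real \<nu> - Complex x (inverse (real (Suc j))))))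
      \<longlonglongrightarrow> weight \<nu> *\<^sub>R (1 / (complex_of_real \<nu> - complex_of_real x))"
    unfolding AE_count_space
  proof
    fix \<nu> assume "\<nu> \<in> H"
    then have ne: "complex_of_real \<nu> - complex_of_real x \<noteq> 0" using x by auto
    have "(\<lambda>j. Complex x (inverse (real (Suc j)))) \<longlonglongrightarrow> Complex x 0"
      by (intro tendsto_Complex tendsto_const LIMSEQ_inverse_real_of_nat)
    then have "(\<lambda>j. Complex x (inverse (real (Suc j)))) \<longlonglongrightarrow> complex_of_real x" by (simp add: complex_of_real_def)
    then show "(\<lambda>j. weight \<nu> *\<^sub>R (1 / (complex_of_real \<nu> - Complex x (inverse (real (Suc j))))))
      \<longlonglongrightarrow> weight \<nu> *\<^sub>R (1 / (complex_of_real \<nu> - complex_of_real x))"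
      by (intro tendsto_intros ne)
  qed
  fix j
  show "AE \<nu> in count_space H. norm (weight \<nu> *\<^sub>R (1 / (complex_of_real \<nu> - Complex x (inverse (real (Suc j)))))) \<le> weight \<nu> / \<bar>\<nu> - x\<bar>"
    unfolding AE_count_space
  proof
    fix \<nu> assume \<nu>: "\<nu> \<in> H"
    then have p: "0 < \<bar>\<nu> - x\<bar>" using x by auto
    have "\<bar>\<nu> - x\<bar> \<le> cmod (complex_of_real \<nu> - Complex x (inverse (real (Suc j))))"
      using abs_Re_le_cmod[of "complex_of_real \<nu> - Complex x (inverse (real (Suc j)))"] by simp
    then have "weight \<nu> / cmod (complex_of_real \<nu> - Complex x (inverse (real (Suc j)))) \<le> weight \<nu> / \<bar>\<nu> - x\<bar>"
      using p weight_nonneg[OF \<nu>] by (intro divide_left_mono mult_pos_pos) auto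
    then show "norm (weight \<nu> *\<^sub>R (1 / (complex_of_real \<nu> - Complex x (inverse (real (Suc j)))))) \<le> weight \<nu> / \<bar>\<nu> - x\<bar>"
      using weight_nonneg[OF \<nu>] by (simp add: norm_divide)
  qed
qed auto

lemma half_eigenvalues_isolated:
  assumes "x \<noteq> 0"
  obtains \<delta> where "\<delta> > 0" "\<forall>\<nu>\<in>H. \<nu> \<noteq> x \<longrightarrow> \<delta> \<le> \<bar>\<nu> - x\<bar>"
proof -
  have "finite {\<nu> \<in> H. \<bar>\<nu>\<bar> \<ge> \<bar>x\<bar> / 2}" using assms by (intro finite_half_eigenvalues_away_from_0) auto
  then obtain d where d: "d > 0" "\<forall>\<nu>\<in>{\<nu> \<in> H. \<bar>\<nu>\<bar> \<ge> \<bar>x\<bar> / 2}. \<nu> \<noteq> x \<longrightarrow> d \<le> dist x \<nu>"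
    using finite_set_avoid by blast
  have "min d (\<bar>x\<bar> / 2) \<le> \<bar>\<nu> - x\<bar>" if "\<nu> \<in> H" "\<nu> \<noteq> x" for \<nu>
  proof (cases "\<bar>\<nu>\<bar> \<ge> \<bar>x\<bar> / 2")
    case True
    then show ?thesis using d(2) that by (auto simp: dist_real_def abs_minus_commute)
  next
    case False
    then show ?thesis by (auto simp: min_def abs_if split: if_splits)
  qed
  then show ?thesis using that[of "min d (\<bar>x\<bar> / 2)"] d(1) assms by auto
qed

text \<open>Near \<open>x\<close> the Weyl function splits into a possible pole at \<open>x\<close> and a part that is bounded, because
  all other eigenvalues stay at distance \<open>\<delta> / 2\<close> from \<open>y\<close>.\<close>

lemma weyl_m_infsum_off_x:
  assumes \<delta>: "\<delta> > 0" "\<forall>\<nu>\<in>H. \<nu> \<noteq> x \<longrightarrow> \<delta> \<le> \<bar>\<nu> - x\<bar>" and y: "\<bar>y - x\<bar> < \<delta> / 2"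
  shows "(\<lambda>\<nu>. weight \<nu> / (\<nu> - y)) summable_on (H - {x})"
    "\<bar>\<Sum>\<^sub>\<infinity>\<nu>\<in>H - {x}. weight \<nu> / (\<nu> - y)\<bar> \<le> 2 / \<delta>"
    "y \<noteq> x \<or> x \<notin> H \<Longrightarrow> weyl_m a b (complex_of_real y) =
       complex_of_real ((if x \<in> H then weight x / (x - y) else 0) + (\<Sum>\<^sub>\<infinity>\<nu>\<in>H - {x}. weight \<nu> / (\<nu> - y)))"
proof -
  have ws: "weight summable_on (H - {x})" by (rule summable_on_subset_banach[OF weight_summable]) auto
  have far: "\<delta> / 2 \<le> \<bar>\<nu> - y\<bar>" if "\<nu> \<in> H - {x}" for \<nu> using \<delta>(2) that y by (fastforce simp: abs_if split: if_splits)
  have b: "\<bar>weight \<nu> / (\<nu> - y)\<bar> \<le> 2 / \<delta> * weight \<nu>" if "\<nu> \<in> H - {x}" for \<nu>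
  proof -
    have "weight \<nu> / \<bar>\<nu> - y\<bar> \<le> weight \<nu> / (\<delta> / 2)"
      using far[OF that] \<delta>(1) weight_nonneg[of \<nu>] that by (intro divide_left_mono mult_pos_pos) auto
    then show ?thesis using weight_nonneg[of \<nu>] that by (simp add: abs_divide mult.commute)
  qed
  have w2: "(\<lambda>\<nu>. 2 / \<delta> * weight \<nu>) summable_on (H - {x})" by (intro summable_on_cmult_right ws)
  show s: "(\<lambda>\<nu>. weight \<nu> / (\<nu> - y)) summable_on (H - {x})" by (rule summable_on_bounded_by[OF w2 b])
  have le1: "(\<Sum>\<^sub>\<infinity>\<nu>\<in>H - {x}. weight \<nu>) \<le> 1"
    unfolding weight_sum[symmetric]
    by (rule infsum_mono_neutral[OF ws weight_summable]) (auto simp: weight_nonneg)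
  have "norm (\<Sum>\<^sub>\<infinity>\<nu>\<in>H - {x}. weight \<nu> / (\<nu> - y)) \<le> (\<Sum>\<^sub>\<infinity>\<nu>\<in>H - {x}. 2 / \<delta> * weight \<nu>)"
    by (rule norm_infsum_le[OF has_sum_infsum[OF s] has_sum_infsum[OF w2]]) (use b in auto)
  also have "\<dots> = 2 / \<delta> * (\<Sum>\<^sub>\<infinity>\<nu>\<in>H - {x}. weight \<nu>)" by (rule infsum_cmult_right')
  also have "\<dots> \<le> 2 / \<delta> * 1" using le1 \<delta>(1) by (intro mult_left_mono) auto
  finally show "\<bar>\<Sum>\<^sub>\<infinity>\<nu>\<in>H - {x}. weight \<nu> / (\<nu> - y)\<bar> \<le> 2 / \<delta>" by simp
  assume y': "y \<noteq> x \<or> x \<notin> H"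
  have "(\<lambda>\<nu>. weight \<nu> / (\<nu> - y)) summable_on insert x (H - {x})" using s by (simp only: summable_on_insert_iff)
  then have sH: "(\<lambda>\<nu>. weight \<nu> / (\<nu> - y)) summable_on H" by (rule summable_on_subset_banach) auto
  have "(\<integral>\<nu>. weight \<nu> / (\<nu> - y) \<partial>count_space H) = (\<Sum>\<^sub>\<infinity>\<nu>\<in>H. weight \<nu> / (\<nu> - y))"
    by (rule integral_count_space_infsum) (rule summable_on_iff_abs_summable_on_real[THEN iffD1, OF sH])
  also have "\<dots> = (if x \<in> H then weight x / (x - y) else 0) + (\<Sum>\<^sub>\<infinity>\<nu>\<in>H - {x}. weight \<nu> / (\<nu> - y))"
  proof (cases "x \<in> H")
    case True
    have "(\<Sum>\<^sub>\<infinity>\<nu>\<in>insert x (H - {x}). weight \<nu> / (\<nu> - y)) = weight x / (x - y) + (\<Sum>\<^sub>\<infinity>\<nu>\<in>H - {x}. weight \<nu> / (\<nu> - y))"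
      by (rule infsum_insert[OF s]) simp
    then show ?thesis using True by (simp add: insert_absorb)
  qed simp
  finally show "weyl_m a b (complex_of_real y) =
       complex_of_real ((if x \<in> H then weight x / (x - y) else 0) + (\<Sum>\<^sub>\<infinity>\<nu>\<in>H - {x}. weight \<nu> / (\<nu> - y)))"
    unfolding weyl_m_real by simp
qed

lemma weyl_m_tendsto:
  assumes "x \<noteq> 0" "x \<notin> H"
  shows "((\<lambda>y. weyl_m a b (complex_of_real y)) \<longlongrightarrow> weyl_m a b (complex_of_real x)) (at x)"
proof -
  obtain \<delta> where \<delta>: "\<delta> > 0" "\<forall>\<nu>\<in>H. \<nu> \<noteq> x \<longrightarrow> \<delta> \<le> \<bar>\<nu> - x\<bar>" using half_eigenvalues_isolated[OF assms(1)] by blast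
  note F = weyl_m_infsum_off_x[OF \<delta>]
  have Hx: "H - {x} = H" using assms by auto
  define g where "g y = (\<Sum>\<^sub>\<infinity>\<nu>\<in>H. weight \<nu> / (\<nu> - y))" for y
  have mg: "weyl_m a b (complex_of_real y) = complex_of_real (g y)" if "\<bar>y - x\<bar> < \<delta> / 2" for y
    using F(3)[OF that] assms(2) by (simp add: g_def Hx)
  have gx: "\<bar>g y - g x\<bar> \<le> \<bar>y - x\<bar> * (2 / (\<delta> * \<delta>))" if y: "\<bar>y - x\<bar> < \<delta> / 2" for y
  proof -
    have x0: "\<bar>x - x\<bar> < \<delta> / 2" using \<delta> by simp
    note sy = F(1)[OF y, unfolded Hx] and sx = F(1)[OF x0, unfolded Hx]
    have "((\<lambda>\<nu>. weight \<nu> / (\<nu> - y) + - (weight \<nu> / (\<nu> - x))) has_sum (g y + - g x)) H"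
      unfolding g_def by (intro has_sum_add has_sum_infsum sy has_sum_uminusI sx)
    moreover have w2: "((\<lambda>\<nu>. \<bar>y - x\<bar> * (2 / (\<delta> * \<delta>)) * weight \<nu>) has_sum (\<bar>y - x\<bar> * (2 / (\<delta> * \<delta>)) * infsum weight H)) H"
      by (intro has_sum_cmult_right has_sum_infsum weight_summable)
    ultimately have "norm (g y + - g x) \<le> \<bar>y - x\<bar> * (2 / (\<delta> * \<delta>)) * infsum weight H"
    proof (rule norm_infsum_le)
      fix \<nu> assume \<nu>: "\<nu> \<in> H"
      then have "\<nu> \<noteq> x" using assms(2) by auto
      then have 1: "\<delta> \<le> \<bar>\<nu> - x\<bar>" using \<delta>(2) \<nu> by blast
      then have 2: "\<delta> / 2 \<le> \<bar>\<nu> - y\<bar>" using y by (auto simp: abs_if split: if_splits)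
      have ne: "\<nu> - x \<noteq> 0" "\<nu> - y \<noteq> 0" using 1 2 \<delta>(1) by auto
      have "weight \<nu> / (\<nu> - y) + - (weight \<nu> / (\<nu> - x)) = weight \<nu> * (y - x) / ((\<nu> - y) * (\<nu> - x))"
        using ne by (simp add: field_simps)
      also have "norm \<dots> = (weight \<nu> * \<bar>y - x\<bar>) / (\<bar>\<nu> - y\<bar> * \<bar>\<nu> - x\<bar>)"
        using weight_nonneg[OF \<nu>] by (simp add: abs_mult)
      also have "\<dots> \<le> (weight \<nu> * \<bar>y - x\<bar>) / ((\<delta> / 2) * \<delta>)"
        using 1 2 \<delta>(1) weight_nonneg[OF \<nu>] ne by (intro divide_left_mono mult_mono mult_pos_pos mult_nonneg_nonneg) auto
      finally show "norm (weight \<nu> / (\<nu> - y) + - (weight \<nu> / (\<nu> - x))) \<le> \<bar>y - x\<bar> * (2 / (\<delta> * \<delta>)) * weight \<nu>"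
        by (simp add: field_simps)
    qed
    then show ?thesis by (simp add: weight_sum)
  qed
  have near: "\<forall>\<^sub>F y in at x. \<bar>y - x\<bar> < \<delta> / 2"
    using \<delta>(1) by (auto simp: eventually_at dist_real_def intro!: exI[of _ "\<delta> / 2"])
  have "((\<lambda>y. \<bar>y - x\<bar> * (2 / (\<delta> * \<delta>))) \<longlongrightarrow> \<bar>x - x\<bar> * (2 / (\<delta> * \<delta>))) (at x)" by (intro tendsto_intros)
  then have "((\<lambda>y. \<bar>y - x\<bar> * (2 / (\<delta> * \<delta>))) \<longlongrightarrow> 0) (at x)" by simp
  then have "((\<lambda>y. g y - g x) \<longlongrightarrow> 0) (at x)"
    by (rule Lim_null_comparison[rotated]) (use near gx in \<open>auto elim!: eventually_mono\<close>)
  then have "(g \<longlongrightarrow> g x) (at x)" by (simp add: LIM_zero_iff)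
  then have "((\<lambda>y. complex_of_real (g y)) \<longlongrightarrow> complex_of_real (g x)) (at x)" by (intro tendsto_intros)
  then show ?thesis
    unfolding mg[of x, simplified, OF \<delta>(1)]
    by (rule Lim_transform_eventually) (use near mg in \<open>auto elim!: eventually_mono\<close>)
qed

lemma weyl_m_pole:
  assumes "x \<noteq> 0" "x \<in> H"
  shows "((\<lambda>y. complex_of_real (x - y) * weyl_m a b (complex_of_real y)) \<longlongrightarrow> complex_of_real (weight x)) (at x)"
proof -
  obtain \<delta> where \<delta>: "\<delta> > 0" "\<forall>\<nu>\<in>H. \<nu> \<noteq> x \<longrightarrow> \<delta> \<le> \<bar>\<nu> - x\<bar>" using half_eigenvalues_isolated[OF assms(1)] by blast
  note F = weyl_m_infsum_off_x[OF \<delta>]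
  define g where "g y = (\<Sum>\<^sub>\<infinity>\<nu>\<in>H - {x}. weight \<nu> / (\<nu> - y))" for y
  have near: "\<forall>\<^sub>F y in at x. \<bar>y - x\<bar> < \<delta> / 2 \<and> y \<noteq> x"
    using \<delta>(1) by (auto simp: eventually_at dist_real_def intro!: exI[of _ "\<delta> / 2"])
  have "((\<lambda>y. (x - y) * g y) \<longlongrightarrow> 0) (at x)"
  proof (rule Lim_null_comparison)
    have "((\<lambda>y. \<bar>x - y\<bar> * (2 / \<delta>)) \<longlongrightarrow> \<bar>x - x\<bar> * (2 / \<delta>)) (at x)" by (intro tendsto_intros)
    then show "((\<lambda>y. \<bar>x - y\<bar> * (2 / \<delta>)) \<longlongrightarrow> 0) (at x)" by simp
    show "\<forall>\<^sub>F y in at x. norm ((x - y) * g y) \<le> \<bar>x - y\<bar> * (2 / \<delta>)"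
      using near
    proof eventually_elim
      case (elim y)
      then have "\<bar>g y\<bar> \<le> 2 / \<delta>" using F(2)[of y] by (simp add: g_def)
      then show ?case unfolding real_norm_def abs_mult by (rule mult_left_mono) simp
    qed
  qed
  then have "((\<lambda>y. complex_of_real (weight x + (x - y) * g y)) \<longlongrightarrow> complex_of_real (weight x + 0)) (at x)"
    by (intro tendsto_intros)
  then have "((\<lambda>y. complex_of_real (weight x + (x - y) * g y)) \<longlongrightarrow> complex_of_real (weight x)) (at x)" by simp
  then show ?thesis
  proof (rule Lim_transform_eventually)
    show "\<forall>\<^sub>F y in at x. complex_of_real (weight x + (x - y) * g y) = complex_of_real (x - y) * weyl_m a b (complex_of_real y)"
      using near
    proof eventually_elim
      case (elim y)
      have "(x - y) * (weight x / (x - y) + g y) = weight x + (x - y) * g y" using elim by (simp add: field_simps)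
      moreover have "weyl_m a b (complex_of_real y) = complex_of_real (weight x / (x - y) + g y)"
        using F(3)[of y] elim assms(2) by (simp add: g_def)
      ultimately show ?case by (simp only: of_real_mult[symmetric])
    qed
  qed
qed

lemma synth_lincomb:
  assumes "\<And>\<nu>. \<nu> \<in> H \<Longrightarrow> \<bar>k1 \<nu>\<bar> \<le> B1" "\<And>\<nu>. \<nu> \<in> H \<Longrightarrow> \<bar>k2 \<nu>\<bar> \<le> B2"
  shows "synth (\<lambda>\<nu>. k1 \<nu> + c * k2 \<nu>) n = synth k1 n + c * synth k2 n"
proof -
  note s1 = weight_half_poly_summable[of k1 B1 n, OF assms(1)] and s2 = weight_half_poly_summable[of k2 B2 n, OF assms(2)]
  have "synth (\<lambda>\<nu>. k1 \<nu> + c * k2 \<nu>) n = (\<Sum>\<^sub>\<infinity>\<nu>\<in>H. weight \<nu> * k1 \<nu> * half_poly \<nu> n + c * (weight \<nu> * k2 \<nu> * half_poly \<nu> n))"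
    unfolding synth_def by (intro infsum_cong) (simp add: algebra_simps)
  also have "\<dots> = synth k1 n + c * synth k2 n"
    unfolding synth_def
    by (subst infsum_add[OF s1 summable_on_cmult_right[OF s2]]) (simp_all add: infsum_cmult_right')
  finally show ?thesis .
qed

text \<open>Put \<open>g(\<nu>) = 1 / (\<nu> - l)\<close> and let \<open>s\<close> be its inverse spectral transform, in real and imaginary
  parts. From \<open>\<nu> g(\<nu>) = 1 + l g(\<nu>)\<close> and the expansion of the unit vector \<open>\<delta>\<^sub>0\<close> it follows that
  \<open>L\<^sub>0 s = \<delta>\<^sub>0 + l s\<close>, and \<open>s\<^sub>0\<close> is the Weyl function. The Weyl solution satisfies the same equation
  for \<open>n \<ge> 0\<close>, because \<open>a\<^sub>-\<^sub>1 \<psi>\<^sub>-\<^sub>1 = -1\<close>, with the same value at 0; so it equals \<open>s\<close> there. Finally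
  \<open>\<bar>g\<bar> \<le> 1 / \<bar>Im l\<bar>\<close> bounds the norm of \<open>s\<close>.\<close>

lemma weyl_sol_right_l2:
  assumes l: "Im l \<noteq> 0"
  obtains S where "\<And>N. (\<Sum>k<N. (cmod (weyl_sol a b l (int (Suc k))))\<^sup>2) \<le> S"
proof -
  define g where "g \<nu> = 1 / (complex_of_real \<nu> - l)" for \<nu>
  define B where "B = 1 / \<bar>Im l\<bar>"
  define kr where "kr \<nu> = Re (g \<nu>)" for \<nu>
  define ki where "ki \<nu> = Im (g \<nu>)" for \<nu>
  have ne: "complex_of_real \<nu> - l \<noteq> 0" for \<nu> using l by (auto simp: complex_eq_iff)
  have gB: "cmod (g \<nu>) \<le> B" for \<nu>
  proof -
    have "\<bar>Im l\<bar> \<le> cmod (complex_of_real \<nu> - l)" using abs_Im_le_cmod[of "complex_of_real \<nu> - l"] by simp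
    then show ?thesis unfolding g_def B_def norm_divide using l by (simp add: frac_le)
  qed
  have B0: "0 \<le> B" by (simp add: B_def)
  have krB: "\<bar>kr \<nu>\<bar> \<le> B" and kiB: "\<bar>ki \<nu>\<bar> \<le> B" for \<nu>
    using abs_Re_le_cmod[of "g \<nu>"] abs_Im_le_cmod[of "g \<nu>"] gB[of \<nu>] by (auto simp: kr_def ki_def)
  have g1: "complex_of_real \<nu> * g \<nu> = 1 + l * g \<nu>" for \<nu> using ne[of \<nu>] by (simp add: g_def field_simps)
  have nkr: "\<nu> * kr \<nu> = (1 + Re l * kr \<nu>) + (- Im l) * ki \<nu>" and nki: "\<nu> * ki \<nu> = Re l * ki \<nu> + Im l * kr \<nu>" for \<nu>
    using arg_cong[OF g1[of \<nu>], of Re] arg_cong[OF g1[of \<nu>], of Im] by (auto simp: kr_def ki_def)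
  have b1: "\<bar>Re l * kr \<nu>\<bar> \<le> \<bar>Re l\<bar> * B" "\<bar>Im l * ki \<nu>\<bar> \<le> \<bar>Im l\<bar> * B" "\<bar>Re l * ki \<nu>\<bar> \<le> \<bar>Re l\<bar> * B" "\<bar>Im l * kr \<nu>\<bar> \<le> \<bar>Im l\<bar> * B" for \<nu>
    unfolding abs_mult by (intro mult_left_mono krB kiB abs_ge_zero)+
  define sr where "sr = synth kr"
  define si where "si = synth ki"
  have hr: "half_op sr n = (if n = 0 then 1 else 0) + Re l * sr n - Im l * si n" for n
  proof -
    have "half_op sr n = synth (\<lambda>\<nu>. \<nu> * kr \<nu>) n"
      unfolding sr_def
    proof (rule synth_half_op[where B = B and B' = "1 + \<bar>Re l\<bar> * B + \<bar>Im l\<bar> * B"])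
      fix \<nu> show "\<bar>\<nu> * kr \<nu>\<bar> \<le> 1 + \<bar>Re l\<bar> * B + \<bar>Im l\<bar> * B"
      proof -
        have "\<bar>(- Im l) * ki \<nu>\<bar> = \<bar>Im l * ki \<nu>\<bar>" by simp
        then show ?thesis unfolding nkr
          using b1[of \<nu>] abs_triangle_ineq[of "1 + Re l * kr \<nu>" "(- Im l) * ki \<nu>"] abs_triangle_ineq[of 1 "Re l * kr \<nu>"]
          by linarith
      qed
    qed (rule krB)
    also have "\<dots> = synth (\<lambda>\<nu>. (1 + Re l * kr \<nu>) + (- Im l) * ki \<nu>) n" unfolding nkr ..
    also have "\<dots> = synth (\<lambda>\<nu>. 1 + Re l * kr \<nu>) n + (- Im l) * si n"
      unfolding si_def
    proof (rule synth_lincomb[where ?B1.0 = "1 + \<bar>Re l\<bar> * B" and ?B2.0 = B])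
      fix \<nu> show "\<bar>1 + Re l * kr \<nu>\<bar> \<le> 1 + \<bar>Re l\<bar> * B" using b1(1)[of \<nu>] abs_triangle_ineq[of 1 "Re l * kr \<nu>"] by linarith
    qed (rule kiB)
    also have "synth (\<lambda>\<nu>. 1 + Re l * kr \<nu>) n = synth (\<lambda>_. 1) n + Re l * sr n"
      unfolding sr_def by (rule synth_lincomb[where ?B1.0 = 1 and ?B2.0 = B]) (auto simp: krB)
    finally show ?thesis by (simp add: synth_one)
  qed
  have hi: "half_op si n = Re l * si n + Im l * sr n" for n
  proof -
    have "half_op si n = synth (\<lambda>\<nu>. \<nu> * ki \<nu>) n"
      unfolding si_def
    proof (rule synth_half_op[where B = B and B' = "\<bar>Re l\<bar> * B + \<bar>Im l\<bar> * B"])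
      fix \<nu> show "\<bar>\<nu> * ki \<nu>\<bar> \<le> \<bar>Re l\<bar> * B + \<bar>Im l\<bar> * B"
        unfolding nki using b1[of \<nu>] abs_triangle_ineq[of "Re l * ki \<nu>" "Im l * kr \<nu>"] by linarith
    qed (rule kiB)
    also have "\<dots> = synth (\<lambda>\<nu>. (0 + Re l * ki \<nu>) + Im l * kr \<nu>) n" unfolding nki by simp
    also have "\<dots> = synth (\<lambda>\<nu>. 0 + Re l * ki \<nu>) n + Im l * sr n"
      unfolding sr_def by (rule synth_lincomb[where ?B1.0 = "\<bar>Re l\<bar> * B" and ?B2.0 = B]) (use b1 krB in auto)
    also have "synth (\<lambda>\<nu>. 0 + Re l * ki \<nu>) n = synth (\<lambda>_. 0) n + Re l * si n"
      unfolding si_def by (rule synth_lincomb[where ?B1.0 = 0 and ?B2.0 = B]) (auto simp: kiB)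
    also have "synth (\<lambda>_. 0) n = 0" by (simp add: synth_def)
    finally show ?thesis by simp
  qed
  define s where "s n = Complex (sr n) (si n)" for n
  have wr: "(\<lambda>\<nu>. weight \<nu> * kr \<nu>) summable_on H" "(\<lambda>\<nu>. weight \<nu> * ki \<nu>) summable_on H"
    using weight_half_poly_summable[of kr B 0, OF krB] weight_half_poly_summable[of ki B 0, OF kiB] by simp_all
  have m0: "weyl_m a b l = s 0"
  proof -
    have "weyl_m a b l = (\<Sum>\<^sub>\<infinity>\<nu>\<in>H. complex_of_real (weight \<nu>) * g \<nu>)"
      unfolding g_def
    proof (rule weyl_m_infsum, rule summable_on_bounded_by)
      show "(\<lambda>\<nu>. B * weight \<nu>) summable_on H" by (intro summable_on_cmult_right weight_summable)
      fix \<nu> assume "\<nu> \<in> H"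
      then show "\<bar>weight \<nu> * cmod (1 / (complex_of_real \<nu> - l))\<bar> \<le> B * weight \<nu>"
        using mult_left_mono[OF gB[of \<nu>] weight_nonneg[of \<nu>]] weight_nonneg[of \<nu>] by (simp add: g_def abs_mult mult.commute)
    qed
    also have "\<dots> = (\<Sum>\<^sub>\<infinity>\<nu>\<in>H. complex_of_real (weight \<nu> * kr \<nu>) + \<i> * complex_of_real (weight \<nu> * ki \<nu>))"
      by (intro infsum_cong) (simp add: complex_eq_iff kr_def ki_def)
    also have "\<dots> = complex_of_real (\<Sum>\<^sub>\<infinity>\<nu>\<in>H. weight \<nu> * kr \<nu>) + \<i> * complex_of_real (\<Sum>\<^sub>\<infinity>\<nu>\<in>H. weight \<nu> * ki \<nu>)"
      by (intro infsumI has_sum_add has_sum_cmult_right has_sum_of_real has_sum_infsum wr)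
    also have "\<dots> = s 0" by (simp add: s_def sr_def si_def synth_def complex_eq_iff)
    finally show ?thesis .
  qed
  note W = weyl_sol[OF pos, of b l]
  have Wrec: "complex_of_real (a (n - 1)) * weyl_sol a b l (n - 1) + complex_of_real (b n) * weyl_sol a b l n + complex_of_real (a n) * weyl_sol a b l (n + 1) = l * weyl_sol a b l n" for n
    using W(1) unfolding jacobi_solution_def jacobi_def by blast
  have anz: "complex_of_real (a n) \<noteq> 0" for n using pos by (metis less_irrefl of_real_eq_0_iff)
  have ws: "weyl_sol a b l n = s n \<and> weyl_sol a b l (n + 1) = s (n + 1)" if "n \<ge> 0" for n
    using that
  proof (induction n rule: int_ge_induct)
    case base
    have "Complex (half_op sr 0) (half_op si 0) = 1 + l * s 0"
      unfolding hr hi by (simp add: s_def complex_eq_iff)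
    then have "complex_of_real (b 0) * s 0 + complex_of_real (a 0) * s 1 = 1 + l * s 0"
      unfolding half_op_0 by (simp add: s_def complex_eq_iff)
    moreover have "complex_of_real (b 0) * s 0 + complex_of_real (a 0) * weyl_sol a b l 1 = 1 + l * s 0"
      using Wrec[of 0] W(2,3) m0 anz[of "-1"] by (simp add: algebra_simps)
    ultimately have "complex_of_real (a 0) * weyl_sol a b l 1 = complex_of_real (a 0) * s 1" by (metis add_left_cancel)
    then show ?case using anz[of 0] W(3) m0 by simp
  next
    case (step n)
    have n1: "n + 1 > 0" using step.hyps by simp
    have "Complex (half_op sr (n + 1)) (half_op si (n + 1)) = l * s (n + 1)"
      unfolding hr hi using step.hyps by (simp add: s_def complex_eq_iff)
    then have "complex_of_real (a n) * s n + complex_of_real (b (n + 1)) * s (n + 1) + complex_of_real (a (n + 1)) * s (n + 1 + 1) = l * s (n + 1)"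
      unfolding half_op_pos[OF n1] jac_def by (simp add: s_def complex_eq_iff)
    moreover have "complex_of_real (a n) * s n + complex_of_real (b (n + 1)) * s (n + 1) + complex_of_real (a (n + 1)) * weyl_sol a b l (n + 1 + 1) = l * s (n + 1)"
      using Wrec[of "n + 1"] step.IH by simp
    ultimately have "complex_of_real (a (n + 1)) * weyl_sol a b l (n + 1 + 1) = complex_of_real (a (n + 1)) * s (n + 1 + 1)" by (metis add_left_cancel)
    then show ?case using anz[of "n + 1"] step.IH by simp
  qed
  have er: "ell2 sr" and ir: "ip sr sr \<le> B\<^sup>2" unfolding sr_def using synth_ell2(1,2)[of kr B] krB by auto
  have ei: "ell2 si" and ii: "ip si si \<le> B\<^sup>2" unfolding si_def using synth_ell2(1,2)[of ki B] kiB by auto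
  have "(\<Sum>k<N. (cmod (weyl_sol a b l (int (Suc k))))\<^sup>2) \<le> 2 * B\<^sup>2" for N
  proof -
    define G where "G = (\<lambda>k. int (Suc k)) ` {..<N}"
    have "(\<Sum>k<N. (cmod (weyl_sol a b l (int (Suc k))))\<^sup>2) = (\<Sum>n\<in>G. (cmod (weyl_sol a b l n))\<^sup>2)"
      unfolding G_def by (subst sum.reindex) (auto simp: inj_on_def)
    also have "\<dots> = (\<Sum>n\<in>G. (sr n)\<^sup>2 + (si n)\<^sup>2)"
    proof (rule sum.cong)
      fix n assume "n \<in> G"
      then have "n \<ge> 0" by (auto simp: G_def)
      then show "(cmod (weyl_sol a b l n))\<^sup>2 = (sr n)\<^sup>2 + (si n)\<^sup>2" using ws by (simp add: cmod_power2 s_def)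
    qed simp
    also have "\<dots> \<le> B\<^sup>2 + B\<^sup>2"
      unfolding sum.distrib using sum_squares_le_ip[OF er, of G] sum_squares_le_ip[OF ei, of G] ir ii by (simp add: G_def)
    finally show ?thesis by simp
  qed
  then show ?thesis using that by blast
qed

end

lemma half_line_jacobi_intro:
  assumes "\<forall>n. a n > 0" "initial_class a b"
  obtains K where "half_line_jacobi a b K"
proof -
  obtain K where K: "\<And>n. \<bar>a n\<bar> \<le> K" "\<And>n. \<bar>b n\<bar> \<le> K" using initial_class_bounded[OF assms(2)] by blast
  have "half_line_jacobi a b K"
    by unfold_locales (use assms K in \<open>auto simp: initial_class_def\<close>)
  then show ?thesis using that by blast
qed

text \<open>Away from 0 the half-line eigenvalues are isolated, which gives the dominating function. They
  may accumulate at 0, where its summability is the integrability hypothesis.\<close>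

lemma weyl_m_vertical:
  assumes "\<forall>n. a n > 0" "initial_class a b" and x: "x \<notin> half_eigenvalues a b"
    and x0: "x = 0 \<Longrightarrow> integrable (spectral_measure a b) (\<lambda>\<tau>. 1 / complex_of_real \<tau>)"
  shows "(\<lambda>j. weyl_m a b (Complex x (inverse (real (Suc j))))) \<longlonglongrightarrow> weyl_m a b (complex_of_real x)"
proof -
  obtain K where "half_line_jacobi a b K" using half_line_jacobi_intro[OF assms(1,2)] by blast
  then interpret h: half_line_jacobi a b K .
  show ?thesis
  proof (rule h.weyl_m_vertical_limit[OF x])
    show "(\<lambda>\<nu>. h.weight \<nu> / \<bar>\<nu> - x\<bar>) summable_on h.H"
    proof (cases "x = 0")
      case True
      then show ?thesis using x0 h.spectral_integrable_iff by simp
    next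
      case False
      obtain \<delta> where \<delta>: "\<delta> > 0" "\<forall>\<nu>\<in>h.H. \<nu> \<noteq> x \<longrightarrow> \<delta> \<le> \<bar>\<nu> - x\<bar>" using h.half_eigenvalues_isolated[OF False] by blast
      show ?thesis
      proof (rule summable_on_bounded_by)
        show "(\<lambda>\<nu>. (1 / \<delta>) * h.weight \<nu>) summable_on h.H" by (intro summable_on_cmult_right h.weight_summable)
        fix \<nu> assume \<nu>: "\<nu> \<in> h.H"
        then have "\<nu> \<noteq> x" using x by auto
        then have d: "\<delta> \<le> \<bar>\<nu> - x\<bar>" using \<delta>(2) \<nu> by blast
        then have "h.weight \<nu> / \<bar>\<nu> - x\<bar> \<le> h.weight \<nu> / \<delta>"
          using \<delta>(1) h.weight_nonneg[OF \<nu>] by (intro divide_left_mono mult_pos_pos) auto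
        then show "\<bar>h.weight \<nu> / \<bar>\<nu> - x\<bar>\<bar> \<le> (1 / \<delta>) * h.weight \<nu>"
          using h.weight_nonneg[OF \<nu>] by simp
      qed
    qed
  qed
qed

lemma initial_class_half_eigenvalues_isolated:
  assumes "\<forall>n. a n > 0" "initial_class a b" and "x \<noteq> 0"
  obtains \<delta> where "\<delta> > 0" "\<forall>\<nu>\<in>half_eigenvalues a b. \<nu> \<noteq> x \<longrightarrow> \<delta> \<le> \<bar>\<nu> - x\<bar>"
proof -
  obtain K where "half_line_jacobi a b K" using half_line_jacobi_intro[OF assms(1,2)] by blast
  then interpret h: half_line_jacobi a b K .
  show ?thesis using h.half_eigenvalues_isolated[OF assms(3)] that by blast
qed

section \<open>The reflection coefficient as a quotient of Wronskians\<close>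

definition boundary_jost :: "(int \<Rightarrow> real) \<Rightarrow> (int \<Rightarrow> real) \<Rightarrow> side \<Rightarrow> real \<Rightarrow> int \<Rightarrow> complex" where
  "boundary_jost a b s x = jost a b (complex_of_real x) (z_bdry (s, x))"

text \<open>The Wronskian of \<open>\<psi>\<close> and \<open>f\<close> at \<open>-1\<close>, up to the factor \<open>a\<^sub>-\<^sub>1\<close>; this is real and cancels in the
  reflection coefficient.\<close>

definition weyl_jost :: "(int \<Rightarrow> real) \<Rightarrow> (int \<Rightarrow> real) \<Rightarrow> side \<Rightarrow> real \<Rightarrow> complex" where
  "weyl_jost a b s x = weyl_sol a b (complex_of_real x) (-1) * boundary_jost a b s x 0
     - weyl_sol a b (complex_of_real x) 0 * boundary_jost a b s x (-1)"

lemma boundary_jost: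
  assumes pos: "\<forall>n. a n > 0" and init: "initial_class a b" and x: "x \<in> {-2..2}" "x\<^sup>2 \<noteq> 4"
  shows "jacobi_solution a b (complex_of_real x) (boundary_jost a b s x)"
    "((\<lambda>n. boundary_jost a b s x n * z_bdry (s, x) powi n) \<longlongrightarrow> 1) at_bot"
proof -
  note z = z_bdry_facts[OF x(1), of s]
  show "jacobi_solution a b (complex_of_real x) (boundary_jost a b s x)"
    "((\<lambda>n. boundary_jost a b s x n * z_bdry (s, x) powi n) \<longlongrightarrow> 1) at_bot"
    unfolding boundary_jost_def
    using jost_solution[OF pos initial_class_left_summable[OF init] z(2) _ z(5)[OF x(2)] z(4)[symmetric]] z(1) by auto
qed

text \<open>At \<open>-\<infinity>\<close> the Wronskian of \<open>cnj f\<close> and \<open>f\<close> tends to \<open>cnj z - z\<close>, which vanishes only for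
  \<open>z\<^sup>2 = 1\<close>.\<close>

lemma boundary_jost_independent:
  assumes pos: "\<forall>n. a n > 0" and init: "initial_class a b" and x: "x \<in> {-2..2}" "x\<^sup>2 \<noteq> 4"
  shows "cnj (boundary_jost a b s x (-1)) * boundary_jost a b s x 0
      - cnj (boundary_jost a b s x 0) * boundary_jost a b s x (-1) \<noteq> 0"
proof
  define f where "f = boundary_jost a b s x"
  define z where "z = z_bdry (s, x)"
  define g where "g n = cnj (f n)" for n
  have ls: "left_summable a b" by (rule initial_class_left_summable[OF init])
  note zf = z_bdry_facts[OF x(1), of s, folded z_def]
  have f: "jacobi_solution a b (complex_of_real x) f" "((\<lambda>n. f n * z powi n) \<longlongrightarrow> 1) at_bot"
    using boundary_jost[OF pos init x] unfolding f_def z_def by auto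
  have g: "jacobi_solution a b (complex_of_real x) g"
    using jacobi_solution_cnj[OF f(1)] by (simp add: g_def[abs_def])
  assume "cnj (boundary_jost a b s x (-1)) * boundary_jost a b s x 0
      - cnj (boundary_jost a b s x 0) * boundary_jost a b s x (-1) = 0"
  then have "wronskian a g f (-1) = 0" by (simp add: wronskian_def g_def f_def)
  then have W0: "wronskian a g f n = 0" for n using wronskian_const[OF g f(1), of n "-1"] by simp
  define F where "F k = f (- int k) * z powi (- int k)" for k
  have F: "F \<longlonglongrightarrow> 1" using f(2) unfolding tendsto_at_bot_int_iff F_def .
  have fF: "f (- int k) = F k * z ^ k" for k
    using zf(2) by (simp add: F_def power_int_minus power_int_of_nat)
  have zz: "cnj z * z = 1" using zf(1) complex_norm_square[of z] by (simp add: mult.commute)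
  have zzk: "cnj z ^ k * z ^ k = 1" for k using zz by (simp add: power_mult_distrib[symmetric])
  have "wronskian a g f (- int (Suc k)) = complex_of_real (a (- int (Suc k))) * (cnj (F (Suc k)) * F k * cnj z - cnj (F k) * F (Suc k) * z)" for k
  proof -
    have i: "- int (Suc k) + 1 = - int k" by simp
    have "wronskian a g f (- int (Suc k)) = complex_of_real (a (- int (Suc k))) * (cnj (F (Suc k)) * F k * cnj z * (cnj z ^ k * z ^ k) - cnj (F k) * F (Suc k) * z * (cnj z ^ k * z ^ k))"
      unfolding wronskian_def g_def i by (simp only: fF) (simp add: algebra_simps)
    then show ?thesis by (simp add: zzk)
  qed
  then have e: "complex_of_real (a (- int (Suc k))) * (cnj (F (Suc k)) * F k * cnj z - cnj (F k) * F (Suc k) * z) = 0" for k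
    using W0 by simp
  have "(\<lambda>k. complex_of_real (a (- int (Suc k))) * (cnj (F (Suc k)) * F k * cnj z - cnj (F k) * F (Suc k) * z))
      \<longlonglongrightarrow> complex_of_real 1 * (cnj 1 * 1 * cnj z - cnj 1 * 1 * z)"
    by (intro tendsto_intros F LIMSEQ_Suc[OF F] LIMSEQ_Suc[OF left_summable_tendsto[OF ls]])
  then have "cnj z - z = 0" unfolding e by (simp add: LIMSEQ_const_iff)
  then have "z * z = 1" using zz by simp
  then show False using zf(5)[OF x(2)] by (simp add: power2_eq_square)
qed

lemma regular_pointsD:
  assumes "x \<in> regular_points a b"
  shows "x \<in> {-2..2}" "x\<^sup>2 \<noteq> 4" "x \<notin> half_eigenvalues a b"
  using assms by (auto simp: regular_points_def)

lemma initial_class_weyl_m_real: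
  assumes "\<forall>n. a n > 0" "initial_class a b"
  shows "weyl_m a b (complex_of_real x) \<in> \<real>"
proof -
  obtain K where "half_line_jacobi a b K" using half_line_jacobi_intro[OF assms] by blast
  then interpret h: half_line_jacobi a b K .
  show ?thesis by (simp add: h.weyl_m_real)
qed

lemma cnj_weyl_sol:
  assumes "\<forall>n. a n > 0" "initial_class a b"
  shows "cnj (weyl_sol a b (complex_of_real x) n) = weyl_sol a b (complex_of_real x) n"
proof -
  have "weyl_sol a b (complex_of_real x) n \<in> \<real>"
    by (rule sol_real[OF weyl_sol(1)[OF assms(1)] assms(1), of _ _ "-1"])
       (simp_all add: weyl_sol[OF assms(1)] initial_class_weyl_m_real[OF assms])
  then show ?thesis by (simp add: Reals_cnj_iff)
qed

text \<open>The Wronskian of \<open>\<psi> = c cnj f + (cnj c) f\<close> with \<open>f\<close> isolates \<open>c = D / w\<close>, where \<open>w\<close> is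
  the Wronskian of \<open>cnj f\<close> and \<open>f\<close>. It is purely imaginary, so \<open>cnj c / c = - cnj D / D\<close>.\<close>

lemma reflection_quotient:
  assumes pos: "\<forall>n. a n > 0" and init: "initial_class a b" and x: "x \<in> {-2..2}" "x\<^sup>2 \<noteq> 4"
  shows "cnj (a_coeff a b (s, x)) / a_coeff a b (s, x) = - cnj (weyl_jost a b s x) / weyl_jost a b s x"
    "weyl_jost a b s x \<noteq> 0"
proof -
  define f where "f = boundary_jost a b s x"
  define \<psi> where "\<psi> = weyl_sol a b (complex_of_real x)"
  define D where "D = weyl_jost a b s x"
  define w where "w = cnj (f (-1)) * f 0 - cnj (f 0) * f (-1)"
  have w: "w \<noteq> 0" using boundary_jost_independent[OF pos init x] by (simp add: w_def f_def)
  have f: "jacobi_solution a b (complex_of_real x) f" using boundary_jost[OF pos init x] by (simp add: f_def)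
  have D: "D = \<psi> (-1) * f 0 - \<psi> 0 * f (-1)" by (simp add: D_def weyl_jost_def \<psi>_def f_def)
  have \<psi>: "jacobi_solution a b (complex_of_real x) \<psi>" unfolding \<psi>_def by (rule weyl_sol(1)[OF pos])
  have \<psi>r: "cnj (\<psi> n) = \<psi> n" for n unfolding \<psi>_def by (rule cnj_weyl_sol[OF pos init])
  have cw: "cnj w = - w" by (simp add: w_def)
  define c where "c = D / w"
  have cc: "cnj c = - cnj D / w" by (simp add: c_def cw)
  have g: "jacobi_solution a b (complex_of_real x) (\<lambda>n. cnj (f n))"
    using jacobi_solution_cnj[OF f] by simp
  have at: "\<psi> (-1) = c * cnj (f (-1)) + cnj c * f (-1)" "\<psi> 0 = c * cnj (f 0) + cnj c * f 0"
  proof -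
    have cD: "cnj D = \<psi> (-1) * cnj (f 0) - \<psi> 0 * cnj (f (-1))" by (simp add: D \<psi>r)
    have "w * (c * cnj (f (-1)) + cnj c * f (-1)) = D * cnj (f (-1)) - cnj D * f (-1)"
      "w * (c * cnj (f 0) + cnj c * f 0) = D * cnj (f 0) - cnj D * f 0"
      unfolding cc unfolding c_def using w by (simp_all add: field_simps)
    moreover have "D * cnj (f (-1)) - cnj D * f (-1) = w * \<psi> (-1)" "D * cnj (f 0) - cnj D * f 0 = w * \<psi> 0"
      unfolding cD unfolding D w_def by (simp_all add: algebra_simps)
    ultimately show "\<psi> (-1) = c * cnj (f (-1)) + cnj c * f (-1)" "\<psi> 0 = c * cnj (f 0) + cnj c * f 0"
      using w by (metis mult_left_cancel)+
  qed
  have "\<psi> = (\<lambda>n. c * cnj (f n) + cnj c * f n)"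
    by (rule jacobi_solution_unique[OF \<psi> jacobi_solution_lincomb[OF g f] pos, of "-1"]) (use at in auto)
  then have ex: "\<forall>n. \<psi> n = c * cnj (f n) + cnj c * f n" by metis
  have uq: "c' = c" if c': "\<forall>n. \<psi> n = c' * cnj (f n) + cnj c' * f n" for c'
  proof -
    have "D = c' * w" unfolding D w_def c'[rule_format, of "-1"] c'[rule_format, of 0] by (simp add: algebra_simps)
    then show ?thesis using w by (simp add: c_def)
  qed
  have ac: "a_coeff a b (s, x) = c"
    unfolding a_coeff_def by (simp add: Let_def f_def[symmetric, unfolded boundary_jost_def] \<psi>_def[symmetric])
       (rule the_equality, rule ex, erule uq)
  have "\<psi> (-1) \<noteq> 0"
  proof -
    have "a (-1) \<noteq> 0" using pos by (metis less_irrefl)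
    then show ?thesis by (simp add: \<psi>_def weyl_sol[OF pos])
  qed
  then have c0: "c \<noteq> 0" using at(1) by auto
  then show "weyl_jost a b s x \<noteq> 0" by (auto simp: c_def D_def)
  have "cnj c / c = - cnj D / D" unfolding cc unfolding c_def using w by simp
  then show "cnj (a_coeff a b (s, x)) / a_coeff a b (s, x) = - cnj (weyl_jost a b s x) / weyl_jost a b s x"
    unfolding ac D_def .
qed

section \<open>Continuity of the reflection coefficient in the interior of the cut\<close>

lemma boundary_jost_tendsto:
  assumes pos: "\<forall>n. a n > 0" and init: "initial_class a b" and x: "x \<in> {-2..2}" "x\<^sup>2 \<noteq> 4" and S: "S \<subseteq> {-2..2}"
  shows "((\<lambda>y. boundary_jost a b s y n) \<longlongrightarrow> boundary_jost a b s x n) (at x within S)"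
proof -
  have "((\<lambda>y. jost a b (z_bdry (s, y) + inverse (z_bdry (s, y))) (z_bdry (s, y)) n) \<longlongrightarrow>
      jost a b (z_bdry (s, x) + inverse (z_bdry (s, x))) (z_bdry (s, x)) n) (at x within S)"
  proof (rule jost_tendsto[OF pos initial_class_left_summable[OF init]])
    show "\<forall>\<^sub>F y in at x within S. cmod (z_bdry (s, y)) = 1"
      using S by (auto simp: eventually_at_filter subset_iff z_bdry_facts)
    show "(z_bdry (s, x))\<^sup>2 \<noteq> 1" by (rule z_bdry_facts(5)[OF x])
    show "cmod (z_bdry (s, x)) = 1" by (rule z_bdry_facts(1)[OF x(1)])
    show "((\<lambda>y. z_bdry (s, y)) \<longlongrightarrow> z_bdry (s, x)) (at x within S)" by (rule z_bdry_tendsto[OF x(1) S])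
  qed
  then show ?thesis
    unfolding boundary_jost_def z_bdry_facts(4)[OF x(1)]
  proof (rule Lim_transform_eventually)
    show "\<forall>\<^sub>F y in at x within S. jost a b (z_bdry (s, y) + inverse (z_bdry (s, y))) (z_bdry (s, y)) n = jost a b (complex_of_real y) (z_bdry (s, y)) n"
      unfolding eventually_at_filter
      by (intro always_eventually allI impI) (use S in \<open>simp only: subset_iff z_bdry_facts(4)\<close>)
  qed
qed

text \<open>At an eigenvalue \<open>x\<close> of the half-line operator \<open>D\<close> has a simple pole. Multiplication of \<open>D(y)\<close> by
  the real number \<open>x - y\<close> removes it and leaves \<open>cnj D / D\<close> unchanged.\<close>

lemma reflection_interior_limit:
  assumes pos: "\<forall>n. a n > 0" and init: "initial_class a b" and x: "x \<in> {-2..2}" "x\<^sup>2 \<noteq> 4" "x \<noteq> 0"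
  obtains L where "((\<lambda>y. cnj (a_coeff a b (s, y)) / a_coeff a b (s, y)) \<longlongrightarrow> L) (at x within regular_points a b)"
    "x \<in> regular_points a b \<Longrightarrow> L = cnj (a_coeff a b (s, x)) / a_coeff a b (s, x)"
proof -
  define S where "S = regular_points a b"
  define D where "D = weyl_jost a b s"
  have S: "S \<subseteq> {-2..2}" by (auto simp: S_def regular_points_def)
  obtain K where "half_line_jacobi a b K" using half_line_jacobi_intro[OF pos init] by blast
  then interpret h: half_line_jacobi a b K .
  have jl: "((\<lambda>y. boundary_jost a b s y n) \<longlongrightarrow> boundary_jost a b s x n) (at x within S)" for n
    by (rule boundary_jost_tendsto[OF pos init x(1,2) S])
  have De: "D y = - 1 / complex_of_real (a (-1)) * boundary_jost a b s y 0 - weyl_m a b (complex_of_real y) * boundary_jost a b s y (-1)" for y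
    by (simp add: D_def weyl_jost_def weyl_sol[OF pos])
  \<comment> \<open>The real factor g is x - y at an eigenvalue of the half-line operator and 1 elsewhere.\<close>
  have lim: "\<exists>g D0. (\<forall>y. cnj (g y) = g y) \<and> (\<forall>y\<in>S. y \<noteq> x \<longrightarrow> g y \<noteq> 0) \<and> D0 \<noteq> 0 \<and>
     ((\<lambda>y. g y * D y) \<longlongrightarrow> D0) (at x within S) \<and> (x \<in> S \<longrightarrow> D0 = D x)"
  proof (cases "x \<in> half_eigenvalues a b")
    case True
    define D0 where "D0 = complex_of_real 0 * (- 1 / complex_of_real (a (-1)) * boundary_jost a b s x 0) - complex_of_real (h.weight x) * boundary_jost a b s x (-1)"
    have m: "((\<lambda>y. complex_of_real (x - y) * weyl_m a b (complex_of_real y)) \<longlongrightarrow> complex_of_real (h.weight x)) (at x within S)"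
      by (rule tendsto_within_subset[OF h.weyl_m_pole[OF x(3) True]]) auto
    have g0: "((\<lambda>y. x - y) \<longlongrightarrow> 0) (at x within S)"
    proof -
      have "((\<lambda>y. x - y) \<longlongrightarrow> x - x) (at x within S)" by (intro tendsto_intros)
      then show ?thesis by simp
    qed
    have "((\<lambda>y. complex_of_real (x - y) * (- 1 / complex_of_real (a (-1)) * boundary_jost a b s y 0) - (complex_of_real (x - y) * weyl_m a b (complex_of_real y)) * boundary_jost a b s y (-1)) \<longlongrightarrow> D0) (at x within S)"
      unfolding D0_def by (intro tendsto_diff tendsto_mult jl m tendsto_const tendsto_of_real g0)
    then have l: "((\<lambda>y. complex_of_real (x - y) * D y) \<longlongrightarrow> D0) (at x within S)"
      unfolding De by (simp add: algebra_simps)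
    have "boundary_jost a b s x (-1) \<noteq> 0"
      using boundary_jost_independent[OF pos init x(1,2), of s] by auto
    then have "D0 \<noteq> 0" using h.weight_pos[OF True] by (simp add: D0_def)
    moreover have "x \<notin> S" using True by (simp add: S_def regular_points_def)
    ultimately show ?thesis using l by (intro exI[of _ "\<lambda>y. complex_of_real (x - y)"] exI[of _ D0]) auto
  next
    case False
    have m: "((\<lambda>y. weyl_m a b (complex_of_real y)) \<longlongrightarrow> weyl_m a b (complex_of_real x)) (at x within S)"
      by (rule tendsto_within_subset[OF h.weyl_m_tendsto[OF x(3) False]]) auto
    have "(D \<longlongrightarrow> D x) (at x within S)"
      unfolding De by (intro tendsto_diff tendsto_mult jl m tendsto_const)
    moreover have "D x \<noteq> 0" unfolding D_def by (rule reflection_quotient(2)[OF pos init x(1,2)])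
    ultimately show ?thesis by (intro exI[of _ "\<lambda>y. 1"] exI[of _ "D x"]) auto
  qed
  then obtain g D0 where g: "\<And>y. cnj (g y) = g y" "\<And>y. y \<in> S \<Longrightarrow> y \<noteq> x \<Longrightarrow> g y \<noteq> 0" "D0 \<noteq> 0"
    "((\<lambda>y. g y * D y) \<longlongrightarrow> D0) (at x within S)" "x \<in> S \<longrightarrow> D0 = D x" by blast
  have "((\<lambda>y. - cnj (g y * D y) / (g y * D y)) \<longlongrightarrow> - cnj D0 / D0) (at x within S)"
    by (intro tendsto_intros g(3,4))
  then have "((\<lambda>y. cnj (a_coeff a b (s, y)) / a_coeff a b (s, y)) \<longlongrightarrow> - cnj D0 / D0) (at x within S)"
  proof (rule Lim_transform_eventually)
    show "\<forall>\<^sub>F y in at x within S. - cnj (g y * D y) / (g y * D y) = cnj (a_coeff a b (s, y)) / a_coeff a b (s, y)"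
      unfolding eventually_at_filter
    proof (intro always_eventually allI impI)
      fix y assume y: "y \<noteq> x" "y \<in> S"
      then have r: "y \<in> {-2..2}" "y\<^sup>2 \<noteq> 4" using regular_pointsD[of y a b] by (auto simp: S_def)
      have "g y \<noteq> 0" using g(2) y by blast
      then show "- cnj (g y * D y) / (g y * D y) = cnj (a_coeff a b (s, y)) / a_coeff a b (s, y)"
        unfolding reflection_quotient(1)[OF pos init r] D_def[symmetric] by (simp add: g(1))
    qed
  qed
  moreover have "- cnj D0 / D0 = cnj (a_coeff a b (s, x)) / a_coeff a b (s, x)" if "x \<in> S"
    unfolding reflection_quotient(1)[OF pos init x(1,2)] using g(5) that by (simp add: D_def)
  ultimately show ?thesis using that unfolding S_def by blast
qed

section \<open>Time evolution: uniform bounds\<close>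

lemma toda_on_of_solution:
  assumes pos: "\<forall>t\<ge>0. \<forall>n. a t n > 0" and toda: "toda_solution a b" and T: "0 \<le> T"
  shows "toda_on T a b"
proof -
  have sub: "{0..T} \<subseteq> {0..}" by auto
  show ?thesis unfolding toda_on_def using T pos toda unfolding toda_solution_def
    by (auto intro: DERIV_subset[OF _ sub])
qed

lemma solution_class_pointwise:
  assumes toda: "toda_on T a b" and T: "T > 0" and cls: "solution_class a b" and \<epsilon>: "\<epsilon> > 0"
  obtains R where "\<And>n t. n \<ge> R \<Longrightarrow> t \<in> {0..T} \<Longrightarrow> \<bar>a t n\<bar> < \<epsilon> \<and> \<bar>b t n\<bar> < \<epsilon>"
proof -
  have ba: "bdd_above ((\<lambda>t. \<bar>a t n\<bar>) ` {0..T})" and bb: "bdd_above ((\<lambda>t. \<bar>b t n\<bar>) ` {0..T})" for n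
  proof -
    obtain K where "\<And>t. t \<in> {0..T} \<Longrightarrow> \<bar>a t n\<bar> \<le> K \<and> \<bar>b t n\<bar> \<le> K" using toda_on_bounded[OF toda] by blast
    then show "bdd_above ((\<lambda>t. \<bar>a t n\<bar>) ` {0..T})" "bdd_above ((\<lambda>t. \<bar>b t n\<bar>) ` {0..T})"
      by (auto intro!: bdd_aboveI[of _ K])
  qed
  have "((\<lambda>n. SUP t\<in>{0..T}. \<bar>a t n\<bar>) \<longlongrightarrow> 0) at_top" "((\<lambda>n. SUP t\<in>{0..T}. \<bar>b t n\<bar>) \<longlongrightarrow> 0) at_top"
    using cls T unfolding solution_class_def by blast+
  then have "\<forall>\<^sub>F n in at_top. (SUP t\<in>{0..T}. \<bar>a t n\<bar>) < \<epsilon>" "\<forall>\<^sub>F n in at_top. (SUP t\<in>{0..T}. \<bar>b t n\<bar>) < \<epsilon>"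
    using \<epsilon> by (auto intro: order_tendstoD)
  then have "\<forall>\<^sub>F n in at_top. (SUP t\<in>{0..T}. \<bar>a t n\<bar>) < \<epsilon> \<and> (SUP t\<in>{0..T}. \<bar>b t n\<bar>) < \<epsilon>" by eventually_elim auto
  then obtain R where R: "\<And>n. n \<ge> R \<Longrightarrow> (SUP t\<in>{0..T}. \<bar>a t n\<bar>) < \<epsilon> \<and> (SUP t\<in>{0..T}. \<bar>b t n\<bar>) < \<epsilon>"
    by (auto simp: eventually_at_top_linorder)
  have "\<bar>a t n\<bar> < \<epsilon> \<and> \<bar>b t n\<bar> < \<epsilon>" if "n \<ge> R" "t \<in> {0..T}" for n t
    using R[OF that(1)] cSUP_upper[OF that(2) ba[of n]] cSUP_upper[OF that(2) bb[of n]] by linarith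
  then show ?thesis using that by blast
qed

lemma solution_class_initial_class:
  assumes toda: "toda_on T a b" and T: "T > 0" and cls: "solution_class a b" and t: "t \<in> {0..T}"
  shows "initial_class (a t) (b t)"
  unfolding initial_class_def
proof (intro conjI)
  show "(a t \<longlongrightarrow> 0) at_top"
  proof (rule tendstoI)
    fix e :: real assume "e > 0"
    then obtain R where "\<And>n t. n \<ge> R \<Longrightarrow> t \<in> {0..T} \<Longrightarrow> \<bar>a t n\<bar> < e \<and> \<bar>b t n\<bar> < e"
      using solution_class_pointwise[OF toda T cls] by blast
    then show "\<forall>\<^sub>F n in at_top. dist (a t n) 0 < e" using t by (auto simp: eventually_at_top_linorder intro!: exI[of _ R])
  qed
  show "(b t \<longlongrightarrow> 0) at_top"
  proof (rule tendstoI)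
    fix e :: real assume "e > 0"
    then obtain R where "\<And>n t. n \<ge> R \<Longrightarrow> t \<in> {0..T} \<Longrightarrow> \<bar>a t n\<bar> < e \<and> \<bar>b t n\<bar> < e"
      using solution_class_pointwise[OF toda T cls] by blast
    then show "\<forall>\<^sub>F n in at_top. dist (b t n) 0 < e" using t by (auto simp: eventually_at_top_linorder intro!: exI[of _ R])
  qed
  show "left_moment_term (a t) (b t) summable_on {..<0}" using cls T t unfolding solution_class_def by blast
qed

text \<open>On the left the bound \<open>Q\<close> for the first moments gives \<open>Q / k\<close> at the site \<open>-k\<close>; on the right the
  suprema over \<open>{0..T}\<close> are small; continuity in \<open>t\<close> covers the finitely many sites in between.\<close>

lemma solution_class_uniform:
  assumes toda: "toda_on T a b" and T: "T > 0" and cls: "solution_class a b"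
  obtains K e where "\<And>t n. t \<in> {0..T} \<Longrightarrow> \<bar>a t n\<bar> \<le> K \<and> \<bar>b t n\<bar> \<le> K"
    "e \<longlonglongrightarrow> 0" "\<And>t k. t \<in> {0..T} \<Longrightarrow> \<bar>a t (- int k) - 1\<bar> + \<bar>b t (- int k)\<bar> \<le> e k"
proof -
  obtain R where R: "\<And>n t. n \<ge> R \<Longrightarrow> t \<in> {0..T} \<Longrightarrow> \<bar>a t n\<bar> < 1 \<and> \<bar>b t n\<bar> < 1"
    using solution_class_pointwise[OF toda T cls, of 1] by auto
  have "bdd_above ((\<lambda>t. left_moment (a t) (b t)) ` {0..T})" using cls T unfolding solution_class_def by simp
  then obtain Q where "\<forall>x\<in>(\<lambda>t. left_moment (a t) (b t)) ` {0..T}. x \<le> Q" unfolding bdd_above_def by blast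
  then have Q: "\<And>t. t \<in> {0..T} \<Longrightarrow> left_moment (a t) (b t) \<le> Q" by auto
  have left: "real k * (\<bar>a t (- int k) - 1\<bar> + \<bar>b t (- int k)\<bar>) \<le> Q" if t: "t \<in> {0..T}" and k: "k > 0" for t k
  proof -
    have s: "left_moment_term (a t) (b t) summable_on {..<0}" using cls T t unfolding solution_class_def by blast
    have "sum (left_moment_term (a t) (b t)) {- int k} \<le> left_moment (a t) (b t)"
      unfolding left_moment_def using k by (intro finite_sum_le_infsum s left_moment_term_nonneg) auto
    then show ?thesis using Q[OF t] by (simp add: left_moment_term_def)
  qed
  have Q0: "0 \<le> Q"
  proof -
    have "0 \<le> left_moment (a 0) (b 0)" unfolding left_moment_def by (rule infsum_nonneg) (rule left_moment_term_nonneg)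
    then show ?thesis using Q[of 0] T by simp
  qed
  have left1: "\<bar>a t (- int k) - 1\<bar> + \<bar>b t (- int k)\<bar> \<le> Q / real k" if "t \<in> {0..T}" "k > 0" for t k
    using left[OF that] that(2) by (simp add: field_simps)
  have "\<exists>K. \<forall>t\<in>{0..T}. \<bar>a t n\<bar> \<le> K \<and> \<bar>b t n\<bar> \<le> K" for n
    by (rule toda_on_bounded[OF toda, of n]) blast
  then obtain Kn where Kn: "\<And>n t. t \<in> {0..T} \<Longrightarrow> \<bar>a t n\<bar> \<le> Kn n \<and> \<bar>b t n\<bar> \<le> Kn n" by metis
  define M where "M = Max (Kn ` {0..max R 0})"
  define K where "K = max (max 1 (Q + 1)) M"
  have K: "\<bar>a t n\<bar> \<le> K \<and> \<bar>b t n\<bar> \<le> K" if t: "t \<in> {0..T}" for t n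
  proof -
    consider "n < 0" | "n \<in> {0..max R 0}" | "n \<ge> R" by fastforce
    then show ?thesis
    proof cases
      case 1
      define k where "k = nat (- n)"
      have k: "k > 0" "n = - int k" using 1 by (auto simp: k_def)
      have "Q / real k \<le> Q / 1" using k(1) Q0 by (intro divide_left_mono) auto
      then have "Q / real k \<le> Q" by simp
      then have *: "\<bar>a t n - 1\<bar> + \<bar>b t n\<bar> \<le> Q" using left1[OF t k(1)] k(2) by simp
      have "\<bar>a t n\<bar> \<le> \<bar>a t n - 1\<bar> + 1" by simp
      then have "\<bar>a t n\<bar> \<le> Q + 1" "\<bar>b t n\<bar> \<le> Q + 1" using * abs_ge_zero[of "a t n - 1"] abs_ge_zero[of "b t n"] by linarith+
      then show ?thesis by (auto simp: K_def le_max_iff_disj)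
    next
      case 2
      then have "Kn n \<le> M" unfolding M_def by (intro Max_ge) auto
      then show ?thesis using Kn[OF t, of n] unfolding K_def by (auto simp: le_max_iff_disj)
    next
      case 3
      then show ?thesis using R[OF 3 t] unfolding K_def by (auto simp: le_max_iff_disj)
    qed
  qed
  \<comment> \<open>The moment carries no information about the site 0.\<close>
  define e where "e k = (if k = 0 then 2 * K + 1 else Q / real k)" for k
  have "(\<lambda>k. Q / real k) \<longlonglongrightarrow> 0" by (rule lim_const_over_n)
  then have e0: "e \<longlonglongrightarrow> 0"
  proof (rule Lim_transform_eventually)
    show "\<forall>\<^sub>F k in sequentially. Q / real k = e k" using eventually_gt_at_top[of 0] by eventually_elim (simp add: e_def)
  qed
  have "\<bar>a t (- int k) - 1\<bar> + \<bar>b t (- int k)\<bar> \<le> e k" if t: "t \<in> {0..T}" for t k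
  proof (cases "k = 0")
    case True
    then show ?thesis using K[OF t, of 0] by (simp add: e_def abs_if split: if_splits)
  next
    case False
    then show ?thesis using left1[OF t, of k] by (simp add: e_def)
  qed
  then show ?thesis using that K e0 by blast
qed

section \<open>Conservation of the discrete spectrum\<close>

text \<open>The flow transports an eigenvector and keeps its norm, hence also keeps it from vanishing.\<close>

lemma discrete_eigenvalues_forward:
  assumes toda: "toda_on T a b" and bnd: "\<And>t n. t \<in> {0..T} \<Longrightarrow> \<bar>a t n\<bar> \<le> K \<and> \<bar>b t n\<bar> \<le> K" and t: "t \<in> {0..T}"
  shows "discrete_eigenvalues (a 0) (b 0) \<subseteq> discrete_eigenvalues (a t) (b t)"
proof
  fix \<mu> assume \<mu>: "\<mu> \<in> discrete_eigenvalues (a 0) (b 0)"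
  then obtain y0 m where y0: "square_summable_on y0 UNIV" "y0 m \<noteq> 0" "jacobi_solution (a 0) (b 0) (complex_of_real \<mu>) y0"
    unfolding discrete_eigenvalues_def by blast
  obtain y where y: "toda_flow T a b (complex_of_real \<mu>) y" "y 0 = y0" using toda_flow_exists[OF toda y0(3)] by blast
  have init: "(\<lambda>n. (cmod (y 0 n))\<^sup>2) summable_on UNIV" using y0(1) y(2) by (simp add: square_summable_on_def)
  note nrm = toda_flow_norm[OF toda bnd y(1) init t]
  have "(\<Sum>n\<in>{m}. (cmod (y 0 n))\<^sup>2) \<le> (\<Sum>\<^sub>\<infinity>n. (cmod (y 0 n))\<^sup>2)" by (intro finite_sum_le_infsum init) auto
  moreover have "0 < (\<Sum>n\<in>{m}. (cmod (y 0 n))\<^sup>2)" using y0(2) y(2) by simp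
  ultimately have "0 < (\<Sum>\<^sub>\<infinity>n. (cmod (y 0 n))\<^sup>2)" by linarith
  then have "(\<Sum>\<^sub>\<infinity>n. (cmod (y t n))\<^sup>2) \<noteq> 0" using nrm(2) by simp
  then have "\<exists>n. y t n \<noteq> 0" by (metis (no_types, lifting) infsum_0 norm_zero zero_power2)
  moreover have "square_summable_on (y t) UNIV" using nrm(1) by (simp add: square_summable_on_def)
  moreover have "jacobi_solution (a t) (b t) (complex_of_real \<mu>) (y t)" by (rule toda_flowD(1)[OF y(1) t])
  ultimately show "\<mu> \<in> discrete_eigenvalues (a t) (b t)" using \<mu> unfolding discrete_eigenvalues_def by blast
qed

text \<open>Time reversal changes the sign of both equations, and replacing \<open>b\<close> by \<open>- b\<close> restores them.\<close>

lemma toda_on_reverse: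
  assumes "toda_on T a b"
  shows "toda_on T (\<lambda>s. a (T - s)) (\<lambda>s n. - b (T - s) n)"
proof -
  have rev: "((\<lambda>s. f (T - s)) has_real_derivative - f') (at t within {0..T})"
    if f: "(f has_real_derivative f') (at (T - t) within {0..T})" and t: "t \<in> {0..T}" for f f' t
  proof -
    have im: "(\<lambda>s. T - s) ` {0..T} = {0..T}" by (auto intro: image_eqI[of _ _ "T - _"])
    have "((\<lambda>s. T - s) has_real_derivative - 1) (at t within {0..T})" by (auto intro!: derivative_eq_intros)
    from DERIV_image_chain[of f f' "\<lambda>s. T - s" t "{0..T}", unfolded im, OF f this]
    show ?thesis by (simp add: o_def)
  qed
  show ?thesis unfolding toda_on_def
  proof (intro conjI ballI allI)
    show "0 \<le> T" by (rule toda_onD(1)[OF assms])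
    fix t n assume t: "t \<in> {0..T}"
    then have t': "T - t \<in> {0..T}" by simp
    show "0 < a (T - t) n" by (rule toda_onD(2)[OF assms t'])
    show "((\<lambda>s. a (T - s) n) has_real_derivative a (T - t) n / 2 * (- b (T - t) (n + 1) - - b (T - t) n)) (at t within {0..T})"
      using rev[OF toda_onD(3)[OF assms t', of n] t] by (simp add: algebra_simps)
    have "((\<lambda>s. b (T - s) n) has_real_derivative - ((a (T - t) n)\<^sup>2 - (a (T - t) (n - 1))\<^sup>2)) (at t within {0..T})"
      using rev[OF toda_onD(4)[OF assms t', of n] t] .
    from DERIV_minus[OF this]
    show "((\<lambda>s. - b (T - s) n) has_real_derivative (a (T - t) n)\<^sup>2 - (a (T - t) (n - 1))\<^sup>2) (at t within {0..T})" by simp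
  qed
qed

text \<open>The reverse inclusion comes from the reversed lattice, whose operator with \<open>- b\<close> has the
  negatives of the eigenvalues.\<close>

lemma discrete_eigenvalues_const:
  assumes toda: "toda_on T a b" and bnd: "\<And>t n. t \<in> {0..T} \<Longrightarrow> \<bar>a t n\<bar> \<le> K \<and> \<bar>b t n\<bar> \<le> K"
  shows "discrete_eigenvalues (a T) (b T) = discrete_eigenvalues (a 0) (b 0)"
proof
  have T: "T \<in> {0..T}" using toda_onD(1)[OF toda] by simp
  show "discrete_eigenvalues (a 0) (b 0) \<subseteq> discrete_eigenvalues (a T) (b T)"
    by (rule discrete_eigenvalues_forward[OF toda bnd T])
  have bnd': "\<bar>a (T - s) n\<bar> \<le> K \<and> \<bar>- b (T - s) n\<bar> \<le> K" if "s \<in> {0..T}" for s n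
    using bnd[of "T - s" n] that by simp
  have "discrete_eigenvalues (a (T - 0)) (\<lambda>n. - b (T - 0) n) \<subseteq> discrete_eigenvalues (a (T - T)) (\<lambda>n. - b (T - T) n)"
    by (rule discrete_eigenvalues_forward[OF toda_on_reverse[OF toda] bnd' T])
  then show "discrete_eigenvalues (a T) (b T) \<subseteq> discrete_eigenvalues (a 0) (b 0)"
    using discrete_eigenvalues_neg[of _ "a T" "b T"] discrete_eigenvalues_neg[of _ "a 0" "\<lambda>n. - b 0 n"] by fastforce
qed

section \<open>Norming constants\<close>

text \<open>Both the Jost solution and an eigenvector tend to 0 at \<open>-\<infinity>\<close>, so their Wronskian vanishes and
  they are proportional. The Jost solution is real because \<open>z\<close> is real and the conjugate has the
  same normalisation.\<close>

lemma jost_at_eigenvalue: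
  assumes pos: "\<forall>n. a n > 0" and init: "initial_class a b" and \<mu>: "\<mu> \<in> discrete_eigenvalues a b"
    and z: "z = z_fun (complex_of_real \<mu>)"
  shows "(\<lambda>n. (cmod (jost a b (complex_of_real \<mu>) z n))\<^sup>2) summable_on UNIV"
    "cnj (jost a b (complex_of_real \<mu>) z n) = jost a b (complex_of_real \<mu>) z n"
    "0 < (\<Sum>\<^sub>\<infinity>n. (cmod (jost a b (complex_of_real \<mu>) z n))\<^sup>2)"
proof -
  define f where "f = jost a b (complex_of_real \<mu>) z"
  have ls: "left_summable a b" by (rule initial_class_left_summable[OF init])
  have "\<mu> \<notin> {-2..2}" using \<mu> by (simp add: discrete_eigenvalues_def)
  then obtain \<zeta> where \<zeta>: "z_fun (complex_of_real \<mu>) = complex_of_real \<zeta>" "\<zeta> \<noteq> 0" "\<bar>\<zeta>\<bar> < 1" "\<zeta> + 1 / \<zeta> = \<mu>"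
    using z_fun_real by blast
  have z\<zeta>: "z = complex_of_real \<zeta>" using z \<zeta>(1) by simp
  have z0: "z \<noteq> 0" "cmod z < 1" "cnj z = z" using \<zeta> z by auto
  have z2: "z\<^sup>2 \<noteq> 1" using z0(2) by (metis norm_one norm_power less_irrefl norm_ge_zero power_less_one_iff zero_less_numeral pos2)
  have zl: "complex_of_real \<mu> = z + inverse z"
    unfolding z\<zeta> \<zeta>(4)[symmetric] by (simp add: divide_inverse)
  have f: "jacobi_solution a b (complex_of_real \<mu>) f" "((\<lambda>n. f n * z powi n) \<longlongrightarrow> 1) at_bot"
    using jost_solution[OF pos ls z0(1) less_imp_le[OF z0(2)] z2 zl] by (auto simp: f_def)
  have g: "jacobi_solution a b (complex_of_real \<mu>) (\<lambda>n. cnj (f n))" "((\<lambda>n. cnj (f n) * z powi n) \<longlongrightarrow> 1) at_bot"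
  proof -
    show "jacobi_solution a b (complex_of_real \<mu>) (\<lambda>n. cnj (f n))" using jacobi_solution_cnj[OF f(1)] by simp
    have "cnj (z powi n) = z powi n" for n unfolding z \<zeta>(1) by (simp flip: of_real_power_int)
    then show "((\<lambda>n. cnj (f n) * z powi n) \<longlongrightarrow> 1) at_bot" using tendsto_cnj[OF f(2)] by simp
  qed
  have "(\<lambda>n. cnj (f n)) = f" by (rule jost_solution_unique[OF pos ls z0(1) less_imp_le[OF z0(2)] g f])
  then show "cnj (jost a b (complex_of_real \<mu>) z n) = jost a b (complex_of_real \<mu>) z n" unfolding f_def by metis
  obtain y m where y: "square_summable_on y UNIV" "y m \<noteq> 0" "jacobi_solution a b (complex_of_real \<mu>) y"
    using \<mu> unfolding discrete_eigenvalues_def by blast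
  have ys: "(\<lambda>n. (cmod (y n))\<^sup>2) summable_on UNIV" using y(1) by (simp add: square_summable_on_def)
  define F where "F k = f (- int k) * z powi (- int k)" for k
  have F: "F \<longlonglongrightarrow> 1" using f(2) unfolding tendsto_at_bot_int_iff F_def .
  have fF: "f (- int k) = F k * z ^ k" for k
    using z0(1) by (simp add: F_def power_int_minus power_int_of_nat)
  have flim: "(\<lambda>k. f (- int k)) \<longlonglongrightarrow> 0"
  proof -
    have "(\<lambda>k. F k * z ^ k) \<longlonglongrightarrow> 1 * 0" by (intro tendsto_mult F LIMSEQ_power_zero z0(2))
    then show ?thesis by (simp add: fF)
  qed
  have ylim: "(\<lambda>k. y (- int k)) \<longlonglongrightarrow> 0"
  proof -
    have "(\<lambda>n. (cmod (y n))\<^sup>2) summable_on range (\<lambda>k. - int k)" by (rule summable_on_subset_banach[OF ys]) simp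
    then have "((\<lambda>n. (cmod (y n))\<^sup>2) \<circ> (\<lambda>k. - int k)) summable_on UNIV"
      by (subst (asm) summable_on_reindex) (auto simp: inj_on_def)
    then have "summable (\<lambda>k. (cmod (y (- int k)))\<^sup>2)" by (simp add: o_def summable_on_imp_summable)
    then have "(\<lambda>k. (cmod (y (- int k)))\<^sup>2) \<longlonglongrightarrow> 0" by (rule summable_LIMSEQ_zero)
    then have "(\<lambda>k. sqrt ((cmod (y (- int k)))\<^sup>2)) \<longlonglongrightarrow> sqrt 0" by (intro tendsto_intros)
    then show ?thesis by (simp add: tendsto_norm_zero_iff)
  qed
  have W: "wronskian a f y (- int (Suc k)) = complex_of_real (a (- int (Suc k))) * (f (- int (Suc k)) * y (- int k) - f (- int k) * y (- int (Suc k)))" for k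
  proof -
    have "- int (Suc k) + 1 = - int k" by simp
    then show ?thesis unfolding wronskian_def by (simp only:)
  qed
  have "(\<lambda>k. wronskian a f y (- int (Suc k))) \<longlonglongrightarrow> complex_of_real 1 * (0 * 0 - 0 * 0)"
    unfolding W by (intro tendsto_intros LIMSEQ_Suc[OF left_summable_tendsto[OF ls]] LIMSEQ_Suc[OF flim] LIMSEQ_Suc[OF ylim] flim ylim)
  moreover have "wronskian a f y (- int (Suc k)) = wronskian a f y 0" for k by (rule wronskian_const[OF f(1) y(3)])
  ultimately have "wronskian a f y 0 = 0" by (simp add: LIMSEQ_const_iff)
  moreover have "wronskian a y f 0 = - wronskian a f y 0" by (simp add: wronskian_def algebra_simps)
  ultimately have W0: "wronskian a y f 0 = 0" by simp
  obtain c where c: "f = (\<lambda>n. c * y n)" using wronskian_zero_proportional[OF y(3) f(1) pos W0 y(2)] by blast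
  have fs: "(\<lambda>n. (cmod (f n))\<^sup>2) summable_on UNIV"
    unfolding c norm_mult power_mult_distrib by (intro summable_on_cmult_right ys)
  then show "(\<lambda>n. (cmod (jost a b (complex_of_real \<mu>) z n))\<^sup>2) summable_on UNIV" by (simp add: f_def)
  have "\<exists>n. f n \<noteq> 0"
  proof (rule ccontr)
    assume "\<nexists>n. f n \<noteq> 0"
    then have "F = (\<lambda>k. 0)" by (simp add: F_def fun_eq_iff)
    then show False using F by (simp add: LIMSEQ_const_iff)
  qed
  then obtain n where n: "f n \<noteq> 0" by blast
  have "(\<Sum>n\<in>{n}. (cmod (f n))\<^sup>2) \<le> (\<Sum>\<^sub>\<infinity>n. (cmod (f n))\<^sup>2)" by (intro finite_sum_le_infsum fs) auto
  then show "0 < (\<Sum>\<^sub>\<infinity>n. (cmod (jost a b (complex_of_real \<mu>) z n))\<^sup>2)" using n unfolding f_def by (auto intro: less_le_trans[rotated])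
qed

lemma norming_const_square:
  assumes pos: "\<forall>n. a n > 0" and init: "initial_class a b" and \<mu>: "\<mu> \<in> discrete_eigenvalues a b"
  shows "norming_const a b \<mu> = sqrt (\<Sum>\<^sub>\<infinity>n. (cmod (jost a b (complex_of_real \<mu>) (z_fun (complex_of_real \<mu>)) n))\<^sup>2)"
proof -
  define f where "f = jost a b (complex_of_real \<mu>) (z_fun (complex_of_real \<mu>))"
  note J = jost_at_eigenvalue[OF pos init \<mu> refl, folded f_def]
  have "(f n)\<^sup>2 = complex_of_real ((cmod (f n))\<^sup>2)" for n
    using complex_norm_square[of "f n"] J(2)[of n] by (simp add: power2_eq_square)
  then have "(\<Sum>\<^sub>\<infinity>n. (f n)\<^sup>2) = (\<Sum>\<^sub>\<infinity>n. complex_of_real ((cmod (f n))\<^sup>2))" by simp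
  also have "\<dots> = complex_of_real (\<Sum>\<^sub>\<infinity>n. (cmod (f n))\<^sup>2)" by (intro infsumI has_sum_of_real has_sum_infsum J(1))
  finally show ?thesis unfolding norming_const_def f_def by simp
qed

text \<open>The solution class on \<open>{0..T}\<close> in terms of bounds that do not depend on \<open>t\<close>: \<open>K\<close> for the
  coefficients and \<open>e\<close> for their approach to 1 and 0 on the left.\<close>

locale toda_evolution =
  fixes T K :: real and a b :: "real \<Rightarrow> int \<Rightarrow> real" and e :: "nat \<Rightarrow> real"
  assumes toda: "toda_on T a b"
    and bnd: "\<And>t n. t \<in> {0..T} \<Longrightarrow> \<bar>a t n\<bar> \<le> K \<and> \<bar>b t n\<bar> \<le> K"
    and e0: "e \<longlonglongrightarrow> 0" and eb: "\<And>t k. t \<in> {0..T} \<Longrightarrow> \<bar>a t (- int k) - 1\<bar> + \<bar>b t (- int k)\<bar> \<le> e k"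
    and init: "\<And>t. t \<in> {0..T} \<Longrightarrow> initial_class (a t) (b t)"
begin

lemma zero_in: "0 \<in> {0..T}"
  using toda_onD(1)[OF toda] by simp

lemma pos: "t \<in> {0..T} \<Longrightarrow> \<forall>n. a t n > 0"
  using toda_onD(2)[OF toda] by blast

text \<open>The transport of \<open>f(0)\<close> solves the equation at time \<open>t\<close> with the asymptotics of
  \<open>exp (\<theta> t) f(t)\<close>, and Jost solutions are determined by their asymptotics.\<close>

lemma jost_flow:
  assumes z: "z \<noteq> 0" "cmod z \<le> 1" "z\<^sup>2 \<noteq> 1" and l: "l = z + inverse z"
    and y: "toda_flow T a b l y" "y 0 = jost (a 0) (b 0) l z" and t: "t \<in> {0..T}"
  shows "y t n = exp ((inverse z - z) / 2 * complex_of_real t) * jost (a t) (b t) l z n"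
proof -
  define E where "E = exp ((inverse z - z) / 2 * complex_of_real t)"
  have E: "E \<noteq> 0" by (simp add: E_def)
  have "((\<lambda>n. y 0 n * z powi n) \<longlongrightarrow> 1) at_bot"
    unfolding y(2) by (rule jost_solution(2)[OF pos[OF zero_in] initial_class_left_summable[OF init[OF zero_in]] z l])
  then have "(\<lambda>k. y t (- int k) * z powi (- int k)) \<longlonglongrightarrow> E"
    unfolding E_def tendsto_at_bot_int_iff
    by (intro toda_flow_left_asymptotics[OF toda bnd y(1)[unfolded l] z(1) e0 eb _ t]) auto
  then have "((\<lambda>n. y t n * z powi n) \<longlongrightarrow> E) at_bot" unfolding tendsto_at_bot_int_iff .
  then have "((\<lambda>n. inverse E * (y t n * z powi n)) \<longlongrightarrow> inverse E * E) at_bot" by (intro tendsto_intros)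
  then have lim: "((\<lambda>n. inverse E * y t n * z powi n) \<longlongrightarrow> 1) at_bot" using E by (simp add: mult.assoc)
  have "jost (a t) (b t) l z = (\<lambda>n. inverse E * y t n)"
    by (rule jostI[OF pos[OF t] initial_class_left_summable[OF init[OF t]] z(1,2) jacobi_solution_scale[OF toda_flowD(1)[OF y(1) t]] lim])
  from fun_cong[OF this, of n] have "y t n = E * jost (a t) (b t) l z n" using E by simp
  then show ?thesis unfolding E_def .
qed

text \<open>The transport of \<open>f(0)\<close> has the norm of \<open>f(0)\<close> and equals \<open>exp (\<theta> t) f(t)\<close>, where \<open>\<theta>\<close> is real
  because \<open>z\<close> is.\<close>

lemma norming_const_evolution:
  assumes \<mu>: "\<mu> \<in> discrete_eigenvalues (a 0) (b 0)" and t: "t \<in> {0..T}" and z: "z = z_fun (complex_of_real \<mu>)"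
  shows "complex_of_real (norming_const (a t) (b t) \<mu> powi (-2)) =
     complex_of_real (norming_const (a 0) (b 0) \<mu> powi (-2)) * exp ((inverse z - z) * complex_of_real t)"
proof -
  have \<mu>t: "\<mu> \<in> discrete_eigenvalues (a t) (b t)" using discrete_eigenvalues_forward[OF toda bnd t] \<mu> by blast
  have "\<mu> \<notin> {-2..2}" using \<mu> by (simp add: discrete_eigenvalues_def)
  then obtain \<zeta> where \<zeta>: "z_fun (complex_of_real \<mu>) = complex_of_real \<zeta>" "\<zeta> \<noteq> 0" "\<bar>\<zeta>\<bar> < 1" "\<zeta> + 1 / \<zeta> = \<mu>"
    using z_fun_real by blast
  have z\<zeta>: "z = complex_of_real \<zeta>" using z \<zeta>(1) by simp
  have z0: "z \<noteq> 0" "cmod z < 1" using \<zeta> z by auto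
  have z2: "z\<^sup>2 \<noteq> 1" using z0(2) by (metis norm_one norm_power less_irrefl norm_ge_zero power_less_one_iff zero_less_numeral pos2)
  have zl: "complex_of_real \<mu> = z + inverse z"
    unfolding z\<zeta> \<zeta>(4)[symmetric] by (simp add: divide_inverse)
  define f where "f t = jost (a t) (b t) (complex_of_real \<mu>) z" for t
  define S where "S t = (\<Sum>\<^sub>\<infinity>n. (cmod (f t n))\<^sup>2)" for t
  note J0 = jost_at_eigenvalue[OF pos[OF zero_in] init[OF zero_in] \<mu> z, folded f_def]
  note Jt = jost_at_eigenvalue[OF pos[OF t] init[OF t] \<mu>t z, folded f_def]
  have "jacobi_solution (a 0) (b 0) (complex_of_real \<mu>) (f 0)"
    unfolding f_def by (rule jost_solution(1)[OF pos[OF zero_in] initial_class_left_summable[OF init[OF zero_in]] z0(1) less_imp_le[OF z0(2)] z2 zl])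
  then obtain y where y: "toda_flow T a b (complex_of_real \<mu>) y" "y 0 = f 0" using toda_flow_exists[OF toda] by blast
  define \<theta> where "\<theta> = (inverse \<zeta> - \<zeta>) / 2"
  have th: "(inverse z - z) / 2 = complex_of_real \<theta>" unfolding z \<zeta>(1) \<theta>_def by simp
  have yt: "y t n = exp (complex_of_real \<theta> * complex_of_real t) * f t n" for n
    using jost_flow[OF z0(1) less_imp_le[OF z0(2)] z2 zl y(1) _ t] y(2) unfolding f_def th by blast
  have "(cmod (y t n))\<^sup>2 = exp (2 * \<theta> * t) * (cmod (f t n))\<^sup>2" for n
  proof -
    have "cmod (y t n) = exp (\<theta> * t) * cmod (f t n)" unfolding yt norm_mult by (simp flip: of_real_mult exp_of_real)
    moreover have "(exp (\<theta> * t))\<^sup>2 = exp (2 * \<theta> * t)" by (simp add: power2_eq_square exp_add[symmetric])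
    ultimately show ?thesis by (simp add: power_mult_distrib)
  qed
  then have "(\<Sum>\<^sub>\<infinity>n. (cmod (y t n))\<^sup>2) = exp (2 * \<theta> * t) * S t" unfolding S_def by (simp add: infsum_cmult_right')
  moreover have "(\<Sum>\<^sub>\<infinity>n. (cmod (y t n))\<^sup>2) = S 0"
    unfolding S_def y(2)[symmetric] by (rule toda_flow_norm(2)[OF toda bnd y(1) _ t]) (use J0(1) y(2) in auto)
  ultimately have SS: "S 0 = exp (2 * \<theta> * t) * S t" by simp
  have S0: "0 < S 0" "0 < S t" using J0(3) Jt(3) by (auto simp: S_def)
  have N: "norming_const (a t) (b t) \<mu> powi (-2) = 1 / S t" "norming_const (a 0) (b 0) \<mu> powi (-2) = 1 / S 0"
    unfolding norming_const_square[OF pos[OF t] init[OF t] \<mu>t] norming_const_square[OF pos[OF zero_in] init[OF zero_in] \<mu>]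
      z[symmetric] f_def[symmetric] S_def[symmetric] using S0
    by (simp_all add: power_int_minus divide_inverse)
  have "norming_const (a t) (b t) \<mu> powi (-2) = norming_const (a 0) (b 0) \<mu> powi (-2) * exp (2 * \<theta> * t)"
    unfolding N SS using S0 by simp
  moreover have e: "(inverse z - z) * complex_of_real t = complex_of_real (2 * \<theta> * t)"
  proof -
    have "inverse z - z = 2 * complex_of_real \<theta>" unfolding th[symmetric] by simp
    then show ?thesis by simp
  qed
  ultimately show ?thesis unfolding e exp_of_real of_real_mult[symmetric] by (simp only:)
qed

section \<open>Evolution of the Weyl solution and of the reflection coefficient\<close>

text \<open>The limit point case at \<open>+\<infinity>\<close>: since the coefficients are bounded, the Wronskian of the two
  solutions tends to 0, and it is constant.\<close>

lemma right_l2_proportional: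
  assumes t: "t \<in> {0..T}" and u: "jacobi_solution (a t) (b t) l u" and v: "jacobi_solution (a t) (b t) l v"
    and su: "\<And>N. (\<Sum>k<N. (cmod (u (int (Suc k))))\<^sup>2) \<le> A" and sv: "\<And>N. (\<Sum>k<N. (cmod (v (int (Suc k))))\<^sup>2) \<le> B"
  shows "u (-1) * v 0 = u 0 * v (-1)"
proof -
  have lim: "(\<lambda>k. w (int (Suc k))) \<longlonglongrightarrow> 0" if "\<And>N. (\<Sum>k<N. (cmod (w (int (Suc k))))\<^sup>2) \<le> C" for w :: "int \<Rightarrow> complex" and C
  proof -
    have "summable (\<lambda>k. (cmod (w (int (Suc k))))\<^sup>2)"
      using that[of "Suc n" for n] by (intro bounded_imp_summable[where B = C]) (auto simp only: lessThan_Suc_atMost zero_le_power2)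
    then have "(\<lambda>k. (cmod (w (int (Suc k))))\<^sup>2) \<longlonglongrightarrow> 0" by (rule summable_LIMSEQ_zero)
    then have "(\<lambda>k. sqrt ((cmod (w (int (Suc k))))\<^sup>2)) \<longlonglongrightarrow> sqrt 0" by (intro tendsto_intros)
    then show ?thesis by (simp add: tendsto_norm_zero_iff)
  qed
  note lu = lim[OF su] and lv = lim[OF sv]
  have W: "wronskian (a t) u v (int (Suc k)) = complex_of_real (a t (int (Suc k))) * (u (int (Suc k)) * v (int (Suc (Suc k))) - u (int (Suc (Suc k))) * v (int (Suc k)))" for k
  proof -
    have "int (Suc k) + 1 = int (Suc (Suc k))" by simp
    then show ?thesis unfolding wronskian_def by (simp only:)
  qed
  have "(\<lambda>k. wronskian (a t) u v (int (Suc k))) \<longlonglongrightarrow> 0"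
  proof (rule Lim_null_comparison)
    have "(\<lambda>k. K * cmod (u (int (Suc k)) * v (int (Suc (Suc k))) - u (int (Suc (Suc k))) * v (int (Suc k)))) \<longlonglongrightarrow> K * cmod (0 * 0 - 0 * 0)"
      by (intro tendsto_intros lu lv LIMSEQ_Suc[OF lu] LIMSEQ_Suc[OF lv])
    then show "(\<lambda>k. K * cmod (u (int (Suc k)) * v (int (Suc (Suc k))) - u (int (Suc (Suc k))) * v (int (Suc k)))) \<longlonglongrightarrow> 0" by simp
    show "\<forall>\<^sub>F k in sequentially. norm (wronskian (a t) u v (int (Suc k))) \<le> K * cmod (u (int (Suc k)) * v (int (Suc (Suc k))) - u (int (Suc (Suc k))) * v (int (Suc k)))"
      unfolding W norm_mult norm_of_real using bnd[OF t] by (intro always_eventually allI mult_right_mono) auto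
  qed
  moreover have "wronskian (a t) u v (int (Suc k)) = wronskian (a t) u v (-1)" for k by (rule wronskian_const[OF u v])
  ultimately have "wronskian (a t) u v (-1) = 0" by (simp add: LIMSEQ_const_iff)
  moreover have "complex_of_real (a t (-1)) \<noteq> 0" using pos[OF t] by (metis less_irrefl of_real_eq_0_iff)
  ultimately show ?thesis by (simp add: wronskian_def)
qed

lemma toda_weyl_sol_right_l2:
  assumes t: "t \<in> {0..T}" and l: "Im l \<noteq> 0"
  obtains S where "\<And>N. (\<Sum>k<N. (cmod (weyl_sol (a t) (b t) l (int (Suc k))))\<^sup>2) \<le> S"
proof -
  obtain K where "half_line_jacobi (a t) (b t) K" using half_line_jacobi_intro[OF pos[OF t] init[OF t]] by blast
  then interpret h: half_line_jacobi "a t" "b t" K .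
  show ?thesis using h.weyl_sol_right_l2[OF l] that by blast
qed

text \<open>Real points at which the Weyl function is the limit of its values at \<open>x + \<i>/j\<close>.\<close>

definition vertical_regular :: "real \<Rightarrow> real \<Rightarrow> bool" where
  "vertical_regular t x \<longleftrightarrow> x \<notin> half_eigenvalues (a t) (b t) \<and>
     (x = 0 \<longrightarrow> integrable (spectral_measure (a t) (b t)) (\<lambda>\<tau>. 1 / complex_of_real \<tau>))"

text \<open>For nonreal \<open>l\<close> the flow keeps the Weyl solution square summable at \<open>+\<infinity>\<close>, which forces it to
  remain proportional to the Weyl solution. Both sides are continuous along \<open>x + \<i>/j\<close>.\<close>

lemma weyl_sol_flow:
  assumes t: "t \<in> {0..T}" and x: "vertical_regular 0 x" "vertical_regular t x"
    and y: "toda_flow T a b (complex_of_real x) y" "y 0 = weyl_sol (a 0) (b 0) (complex_of_real x)"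
  shows "y t (-1) * weyl_sol (a t) (b t) (complex_of_real x) 0 = y t 0 * weyl_sol (a t) (b t) (complex_of_real x) (-1)"
proof -
  define l where "l j = Complex x (inverse (real (Suc j)))" for j
  have l: "l \<longlonglongrightarrow> complex_of_real x"
  proof -
    have "l \<longlonglongrightarrow> Complex x 0" unfolding l_def by (intro tendsto_Complex tendsto_const LIMSEQ_inverse_real_of_nat)
    then show ?thesis by (simp add: complex_of_real_def)
  qed
  have m: "(\<lambda>j. weyl_m (a \<tau>) (b \<tau>) (l j)) \<longlonglongrightarrow> weyl_m (a \<tau>) (b \<tau>) (complex_of_real x)"
    if "\<tau> \<in> {0..T}" "vertical_regular \<tau> x" for \<tau>
    unfolding l_def using that(2) unfolding vertical_regular_def
    by (intro weyl_m_vertical[OF pos[OF that(1)] init[OF that(1)]]) auto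
  have "\<exists>Y. toda_flow T a b (l j) Y \<and> Y 0 = weyl_sol (a 0) (b 0) (l j)" for j
    using toda_flow_exists[OF toda weyl_sol(1)[OF pos[OF zero_in]]] by metis
  then obtain Y where Y: "\<And>j. toda_flow T a b (l j) (Y j)" "\<And>j. Y j 0 = weyl_sol (a 0) (b 0) (l j)" by metis
  have i1: "(\<lambda>j. Y j 0 (-1)) \<longlonglongrightarrow> y 0 (-1)" by (simp add: Y(2) y(2) weyl_sol[OF pos[OF zero_in]])
  have i2: "(\<lambda>j. Y j 0 0) \<longlonglongrightarrow> y 0 0" using m[OF zero_in x(1)] by (simp add: Y(2) y(2) weyl_sol[OF pos[OF zero_in]])
  note Yl = toda_flow_tendsto[OF toda bnd Y(1) y(1) l i1 i2 t]
  have eq: "Y j t (-1) * weyl_sol (a t) (b t) (l j) 0 = Y j t 0 * weyl_sol (a t) (b t) (l j) (-1)" for j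
  proof -
    have Im: "Im (l j) \<noteq> 0" by (simp add: l_def)
    obtain S0 where "\<And>N. (\<Sum>k<N. (cmod (weyl_sol (a 0) (b 0) (l j) (int (Suc k))))\<^sup>2) \<le> S0"
      using toda_weyl_sol_right_l2[OF zero_in Im] by blast
    then obtain M where M: "\<And>t N. t \<in> {0..T} \<Longrightarrow> (\<Sum>k<N. (cmod (Y j t (int (Suc k))))\<^sup>2) \<le> M"
      using toda_flow_right_bound[OF toda bnd Y(1)[of j], of S0] Y(2)[of j] by metis
    obtain S where S: "\<And>N. (\<Sum>k<N. (cmod (weyl_sol (a t) (b t) (l j) (int (Suc k))))\<^sup>2) \<le> S"
      using toda_weyl_sol_right_l2[OF t Im] by blast
    show ?thesis
      by (rule right_l2_proportional[OF t toda_flowD(1)[OF Y(1) t] weyl_sol(1)[OF pos[OF t]] M[OF t] S])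
  qed
  have "(\<lambda>j. Y j t (-1) * weyl_m (a t) (b t) (l j)) \<longlonglongrightarrow> y t (-1) * weyl_m (a t) (b t) (complex_of_real x)"
    by (intro tendsto_intros Yl m t x)
  moreover have "(\<lambda>j. Y j t 0 * (- 1 / complex_of_real (a t (-1)))) \<longlonglongrightarrow> y t 0 * (- 1 / complex_of_real (a t (-1)))"
    by (intro tendsto_mult tendsto_const Yl)
  moreover have "(\<lambda>j. Y j t (-1) * weyl_m (a t) (b t) (l j)) = (\<lambda>j. Y j t 0 * (- 1 / complex_of_real (a t (-1))))"
    using eq unfolding weyl_sol(2,3)[OF pos[OF t]] by (rule ext)
  ultimately show ?thesis unfolding weyl_sol(2,3)[OF pos[OF t]] by (simp only: LIMSEQ_unique)
qed

lemma toda_flow_cnj: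
  assumes "toda_flow T a b l y"
  shows "toda_flow T a b (cnj l) (\<lambda>t n. cnj (y t n))"
  unfolding toda_flow_def
proof (intro ballI conjI allI)
  fix t assume t: "t \<in> {0..T}"
  show "jacobi_solution (a t) (b t) (cnj l) (\<lambda>n. cnj (y t n))" by (rule jacobi_solution_cnj[OF toda_flowD(1)[OF assms t]])
  fix n
  show "((\<lambda>s. cnj (y s n)) has_vector_derivative
      (complex_of_real (a t n) * cnj (y t (n + 1)) - complex_of_real (a t (n - 1)) * cnj (y t (n - 1))) / 2) (at t within {0..T})"
    using has_vector_derivative_cnj[OF toda_flowD(4)[OF assms t, of n]] by simp
qed

text \<open>The flow is determined by its initial values at two sites; this is the constant case of
  continuous dependence, applied to the flow and its conjugate.\<close>

lemma toda_flow_real: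
  assumes y: "toda_flow T a b (complex_of_real x) y" and r: "cnj (y 0 (-1)) = y 0 (-1)" "cnj (y 0 0) = y 0 0" and t: "t \<in> {0..T}"
  shows "cnj (y t (-1)) = y t (-1)" "cnj (y t 0) = y t 0"
proof -
  have c: "toda_flow T a b (complex_of_real x) (\<lambda>t n. cnj (y t n))" using toda_flow_cnj[OF y] by simp
  have "(\<lambda>i::nat. cnj (y t (-1))) \<longlonglongrightarrow> y t (-1)" "(\<lambda>i::nat. cnj (y t 0)) \<longlonglongrightarrow> y t 0"
    by (rule toda_flow_tendsto[OF toda bnd c y tendsto_const _ _ t]; simp add: r)+
  then show "cnj (y t (-1)) = y t (-1)" "cnj (y t 0) = y t 0" by (simp_all add: LIMSEQ_const_iff)
qed

text \<open>The Wronskian of the transported \<open>\<psi>(0)\<close> and \<open>f(0)\<close> is conserved, and these are \<open>\<kappa> \<psi>(t)\<close> with a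
  real \<open>\<kappa>\<close> and \<open>E f(t)\<close> with \<open>\<bar>E\<bar> = 1\<close>. So \<open>D(0) = \<rho> E D(t)\<close> with a real \<open>\<rho>\<close>, and \<open>- cnj D / D\<close>
  acquires the factor \<open>E\<^sup>2\<close>.\<close>

lemma reflection_quotient_evolution:
  assumes t: "t \<in> {0..T}" and x: "x \<in> {-2..2}" "x\<^sup>2 \<noteq> 4" and v: "vertical_regular 0 x" "vertical_regular t x"
    and z: "z = z_bdry (s, x)"
  shows "cnj (a_coeff (a t) (b t) (s, x)) / a_coeff (a t) (b t) (s, x) =
    cnj (a_coeff (a 0) (b 0) (s, x)) / a_coeff (a 0) (b 0) (s, x) * exp ((inverse z - z) * complex_of_real t)"
proof -
  note zf = z_bdry_facts[OF x(1), of s, folded z]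
  define \<theta> where "\<theta> = (inverse z - z) / 2"
  define E where "E = exp (\<theta> * complex_of_real t)"
  define D where "D \<tau> = weyl_jost (a \<tau>) (b \<tau>) s x" for \<tau>
  define f where "f \<tau> = boundary_jost (a \<tau>) (b \<tau>) s x" for \<tau>
  define \<psi> where "\<psi> \<tau> = weyl_sol (a \<tau>) (b \<tau>) (complex_of_real x)" for \<tau>
  have D: "D \<tau> = \<psi> \<tau> (-1) * f \<tau> 0 - \<psi> \<tau> 0 * f \<tau> (-1)" for \<tau> by (simp add: D_def weyl_jost_def \<psi>_def f_def)
  have cth: "cnj \<theta> = - \<theta>" unfolding \<theta>_def zf(3) by (simp add: field_simps)
  have cE: "cnj E = inverse E" unfolding E_def exp_cnj by (simp add: cth exp_minus)
  have E0: "E \<noteq> 0" by (simp add: E_def)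
  have EE: "E * E = exp ((inverse z - z) * complex_of_real t)"
  proof -
    have "\<theta> * complex_of_real t + \<theta> * complex_of_real t = (2 * \<theta>) * complex_of_real t" by simp
    also have "2 * \<theta> = inverse z - z" by (simp add: \<theta>_def)
    finally show ?thesis unfolding E_def by (simp only: exp_add[symmetric])
  qed
  obtain F where F: "toda_flow T a b (complex_of_real x) F" "F 0 = f 0"
    using toda_flow_exists[OF toda, of "complex_of_real x" "f 0"] boundary_jost(1)[OF pos[OF zero_in] init[OF zero_in] x, of s]
    unfolding f_def by blast
  have Ft: "F t n = E * f t n" for n
    using jost_flow[OF zf(2) _ zf(5)[OF x(2)] zf(4)[symmetric] F(1) _ t] F(2) zf(1)
    unfolding f_def boundary_jost_def z[symmetric] E_def \<theta>_def by simp
  obtain Y where Y: "toda_flow T a b (complex_of_real x) Y" "Y 0 = \<psi> 0"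
    using toda_flow_exists[OF toda, of "complex_of_real x" "\<psi> 0"] weyl_sol(1)[OF pos[OF zero_in]]
    unfolding \<psi>_def by blast
  have Yr: "cnj (Y t (-1)) = Y t (-1)" "cnj (Y t 0) = Y t 0"
    by (rule toda_flow_real[OF Y(1) _ _ t]; simp add: Y(2) \<psi>_def cnj_weyl_sol[OF pos[OF zero_in] init[OF zero_in]])+
  have pr: "Y t (-1) * \<psi> t 0 = Y t 0 * \<psi> t (-1)"
    using weyl_sol_flow[OF t v Y(1)] Y(2) unfolding \<psi>_def by blast
  have \<psi>1: "\<psi> t (-1) \<noteq> 0" "cnj (\<psi> t (-1)) = \<psi> t (-1)"
  proof -
    have "a t (-1) \<noteq> 0" using pos[OF t] by (metis less_irrefl)
    then show "\<psi> t (-1) \<noteq> 0" by (simp add: \<psi>_def weyl_sol[OF pos[OF t]])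
    show "cnj (\<psi> t (-1)) = \<psi> t (-1)" unfolding \<psi>_def by (rule cnj_weyl_sol[OF pos[OF t] init[OF t]])
  qed
  define \<kappa> where "\<kappa> = Y t (-1) / \<psi> t (-1)"
  have \<kappa>: "Y t (-1) = \<kappa> * \<psi> t (-1)" "Y t 0 = \<kappa> * \<psi> t 0" "cnj \<kappa> = \<kappa>"
    using pr \<psi>1 Yr by (auto simp: \<kappa>_def field_simps)
  have "wronskian (a t) (Y t) (F t) (-1) = wronskian (a 0) (Y 0) (F 0) (-1)"
    by (rule toda_flow_wronskian[OF toda Y(1) F(1) t])
  then have w: "complex_of_real (a t (-1)) * (\<kappa> * E * D t) = complex_of_real (a 0 (-1)) * D 0"
    unfolding wronskian_def D by (simp add: \<kappa>(1,2) Ft Y(2) F(2) algebra_simps)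
  have a0: "complex_of_real (a 0 (-1)) \<noteq> 0" using pos[OF zero_in] by (metis less_irrefl of_real_eq_0_iff)
  define \<rho> where "\<rho> = complex_of_real (a t (-1)) * \<kappa> / complex_of_real (a 0 (-1))"
  have D0: "D 0 = \<rho> * E * D t" using w a0 by (simp add: \<rho>_def field_simps)
  have r: "cnj \<rho> = \<rho>" by (simp add: \<rho>_def \<kappa>(3))
  have Dn: "D 0 \<noteq> 0" "D t \<noteq> 0"
    unfolding D_def by (rule reflection_quotient(2)[OF pos[OF zero_in] init[OF zero_in] x], rule reflection_quotient(2)[OF pos[OF t] init[OF t] x])
  have \<rho>0: "\<rho> \<noteq> 0" using D0 Dn by auto
  have "- cnj (D t) / D t = - cnj (D 0) / D 0 * (E * E)"
    unfolding D0 using \<rho>0 E0 Dn(2) by (simp add: r cE field_simps)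
  then show ?thesis
    unfolding reflection_quotient(1)[OF pos[OF zero_in] init[OF zero_in] x] reflection_quotient(1)[OF pos[OF t] init[OF t] x] EE D_def .
qed

text \<open>This identifies the filters of the two limits that define the reflection coefficient at the
  times \<open>0\<close> and \<open>t\<close>.\<close>

lemma regular_points_agree_near:
  assumes t: "t \<in> {0..T}" and x: "x \<noteq> 0"
  obtains \<delta> where "\<delta> > 0" "\<And>y. y \<noteq> x \<Longrightarrow> \<bar>y - x\<bar> < \<delta> \<Longrightarrow> y \<noteq> 0 \<and>
     (y \<in> regular_points (a t) (b t) \<longleftrightarrow> y \<in> {-2..2} \<and> y\<^sup>2 \<noteq> 4) \<and> (y \<in> regular_points (a 0) (b 0) \<longleftrightarrow> y \<in> {-2..2} \<and> y\<^sup>2 \<noteq> 4)"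
proof -
  obtain d0 where d0: "d0 > 0" "\<forall>\<nu>\<in>half_eigenvalues (a 0) (b 0). \<nu> \<noteq> x \<longrightarrow> d0 \<le> \<bar>\<nu> - x\<bar>"
    using initial_class_half_eigenvalues_isolated[OF pos[OF zero_in] init[OF zero_in] x] by blast
  obtain d1 where d1: "d1 > 0" "\<forall>\<nu>\<in>half_eigenvalues (a t) (b t). \<nu> \<noteq> x \<longrightarrow> d1 \<le> \<bar>\<nu> - x\<bar>"
    using initial_class_half_eigenvalues_isolated[OF pos[OF t] init[OF t] x] by blast
  define \<delta> where "\<delta> = min (min d0 d1) \<bar>x\<bar>"
  have "y \<noteq> 0 \<and> (y \<in> regular_points (a t) (b t) \<longleftrightarrow> y \<in> {-2..2} \<and> y\<^sup>2 \<noteq> 4) \<and> (y \<in> regular_points (a 0) (b 0) \<longleftrightarrow> y \<in> {-2..2} \<and> y\<^sup>2 \<noteq> 4)"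
    if y: "y \<noteq> x" "\<bar>y - x\<bar> < \<delta>" for y
  proof -
    have "y \<notin> half_eigenvalues (a 0) (b 0)" "y \<notin> half_eigenvalues (a t) (b t)" "y \<noteq> 0"
      using d0(2) d1(2) y by (fastforce simp: \<delta>_def)+
    then show ?thesis by (auto simp: regular_points_def)
  qed
  moreover have "\<delta> > 0" using d0(1) d1(1) x by (simp add: \<delta>_def)
  ultimately show ?thesis using that by blast
qed

text \<open>Away from the ends of the cut and from 0 both values are limits of the quotient, which evolves
  at all nearby points. At 0 the quotient itself is available. At the ends of the cut it is not
  known whether the limits exist; but the factor tends to 1 there because \<open>z = 1/z\<close>, so the two
  functions have the same limits, if any, and \<open>Lim\<close> takes the same value for both.\<close>

lemma reflection_evolution:
  assumes t: "t \<in> {0..T}" and \<xi>: "\<xi> \<in> reflection_domain (a 0) (b 0) \<inter> reflection_domain (a t) (b t)"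
  shows "reflection (a t) (b t) \<xi> = reflection (a 0) (b 0) \<xi> * exp ((inverse (z_bdry \<xi>) - z_bdry \<xi>) * complex_of_real t)"
proof -
  obtain s x where sx: "\<xi> = (s, x)" by (cases \<xi>) auto
  have x: "x \<in> {-2..2}" using \<xi> sx by (auto simp: reflection_domain_def cut_boundary_def)
  define R where "R \<tau> y = cnj (a_coeff (a \<tau>) (b \<tau>) (s, y)) / a_coeff (a \<tau>) (b \<tau>) (s, y)" for \<tau> y
  define E where "E y = exp ((inverse (z_bdry (s, y)) - z_bdry (s, y)) * complex_of_real t)" for y
  define S where "S \<tau> = regular_points (a \<tau>) (b \<tau>)" for \<tau>
  have refl_eq: "reflection (a \<tau>) (b \<tau>) \<xi> = (if x \<in> S \<tau> then R \<tau> x else Lim (at x within S \<tau>) (R \<tau>))" for \<tau>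
    unfolding reflection_def R_def S_def sx by simp
  have RE: "R t y = R 0 y * E y" if "y \<in> {-2..2}" "y\<^sup>2 \<noteq> 4" "vertical_regular 0 y" "vertical_regular t y" for y
    unfolding R_def E_def by (rule reflection_quotient_evolution[OF t that refl])
  have "reflection (a t) (b t) \<xi> = reflection (a 0) (b 0) \<xi> * E x"
  proof (cases "x = 0")
    case True
    then have v: "vertical_regular 0 x" "vertical_regular t x" and S: "x \<in> S 0" "x \<in> S t"
      using \<xi> sx by (auto simp: reflection_domain_def vertical_regular_def S_def regular_points_def)
    have "x\<^sup>2 \<noteq> 4" using True by simp
    then have "R t x = R 0 x * E x" using v by (rule RE[OF x])
    then show ?thesis unfolding refl_eq if_P[OF S(1)] if_P[OF S(2)] .
  next
    case x0: False
    obtain \<delta> where \<delta>: "\<delta> > 0" "\<And>y. y \<noteq> x \<Longrightarrow> \<bar>y - x\<bar> < \<delta> \<Longrightarrow> y \<noteq> 0 \<and>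
       (y \<in> S t \<longleftrightarrow> y \<in> {-2..2} \<and> y\<^sup>2 \<noteq> 4) \<and> (y \<in> S 0 \<longleftrightarrow> y \<in> {-2..2} \<and> y\<^sup>2 \<noteq> 4)"
      using regular_points_agree_near[OF t x0] unfolding S_def by metis
    have filt: "at x within S t = at x within S 0"
      by (rule at_within_nhd[of x "ball x \<delta>"]) (use \<delta> in \<open>auto simp: dist_real_def abs_minus_commute\<close>)
    have near: "\<forall>\<^sub>F y in at x within S 0. R t y = R 0 y * E y"
      unfolding eventually_at
    proof (intro exI[of _ \<delta>] conjI ballI impI)
      fix y assume y: "y \<in> S 0" "y \<noteq> x \<and> dist y x < \<delta>"
      then have "y \<in> S t" "y \<noteq> 0" using \<delta>(2)[of y] by (auto simp: dist_real_def)
      then show "R t y = R 0 y * E y"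
        using y(1) by (intro RE) (auto simp: S_def regular_points_def vertical_regular_def)
    qed (rule \<delta>(1))
    have Elim: "(E \<longlongrightarrow> E x) (at x within S 0)"
      unfolding E_def
      by (intro tendsto_intros z_bdry_tendsto[OF x]) (use z_bdry_facts(2)[OF x] in \<open>auto simp: S_def regular_points_def\<close>)
    show ?thesis
    proof (cases "x\<^sup>2 = 4")
      case True
      have E1: "E x = 1" unfolding E_def z_bdry_facts(6)[OF x True] by simp
      have ns: "x \<notin> S 0" "x \<notin> S t" using True by (auto simp: S_def regular_points_def)
      have "(R t \<longlongrightarrow> L) (at x within S 0) \<longleftrightarrow> (R 0 \<longlongrightarrow> L) (at x within S 0)" for L
      proof
        assume "(R 0 \<longlongrightarrow> L) (at x within S 0)"
        then have "((\<lambda>y. R 0 y * E y) \<longlongrightarrow> L * E x) (at x within S 0)" by (intro tendsto_mult Elim)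
        then show "(R t \<longlongrightarrow> L) (at x within S 0)"
          unfolding E1 mult_1_right by (rule Lim_transform_eventually) (use near in eventually_elim, simp)
      next
        assume "(R t \<longlongrightarrow> L) (at x within S 0)"
        then have "((\<lambda>y. R t y * inverse (E y)) \<longlongrightarrow> L * inverse (E x)) (at x within S 0)"
          by (intro tendsto_mult tendsto_inverse Elim) (simp_all add: E1)
        then show "(R 0 \<longlongrightarrow> L) (at x within S 0)"
          unfolding E1 inverse_1 mult_1_right by (rule Lim_transform_eventually) (use near in eventually_elim, simp add: E_def)
      qed
      then have "Lim (at x within S 0) (R t) = Lim (at x within S 0) (R 0)"
        unfolding Topological_Spaces.Lim_def by simp
      then show ?thesis unfolding refl_eq using ns E1 filt by simp
    next
      case False
      have lim: "\<exists>L. (R \<tau> \<longlongrightarrow> L) (at x within S \<tau>) \<and> (x \<in> S \<tau> \<longrightarrow> L = R \<tau> x)" if "\<tau> \<in> {0..T}" for \<tau>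
        using reflection_interior_limit[OF pos[OF that] init[OF that] x False x0, of s] unfolding R_def S_def by metis
      have xint: "-2 < x" "x < 2" using x False by (auto simp: less_le)
      have "at x within S 0 = at x within UNIV"
        by (rule at_within_nhd[of x "ball x \<delta> \<inter> {-2<..<2}"])
           (use \<delta> xint in \<open>auto simp: dist_real_def abs_minus_commute power2_eq_square square_eq_iff[of _ 2, simplified]\<close>)
      then have nt: "at x within S 0 \<noteq> bot" by simp
      obtain L0 where L0: "(R 0 \<longlongrightarrow> L0) (at x within S 0)" "x \<in> S 0 \<longrightarrow> L0 = R 0 x" using lim[OF zero_in] by blast
      obtain Lt where Lt: "(R t \<longlongrightarrow> Lt) (at x within S 0)" "x \<in> S t \<longrightarrow> Lt = R t x" using lim[OF t] unfolding filt by blast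
      have "((\<lambda>y. R 0 y * E y) \<longlongrightarrow> L0 * E x) (at x within S 0)" by (intro tendsto_mult L0(1) Elim)
      then have "(R t \<longlongrightarrow> L0 * E x) (at x within S 0)"
        by (rule Lim_transform_eventually) (use near in eventually_elim, simp)
      then have "Lt = L0 * E x" using tendsto_unique[OF nt Lt(1)] by blast
      moreover have "reflection (a 0) (b 0) \<xi> = L0" unfolding refl_eq using L0 tendsto_Lim[OF nt L0(1)] by simp
      moreover have "reflection (a t) (b t) \<xi> = Lt" unfolding refl_eq filt using Lt tendsto_Lim[OF nt Lt(1)] by simp
      ultimately show ?thesis by simp
    qed
  qed
  then show ?thesis by (simp add: E_def sx)
qed

end

section \<open>Evolution of the scattering data\<close>

theorem theorem1:
  fixes a b :: "real \<Rightarrow> int \<Rightarrow> real"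
  assumes pos: "\<forall>t\<ge>0. \<forall>n. a t n > 0"
    and toda: "toda_solution a b"
    and init: "initial_class (a 0) (b 0)"
    and cls: "solution_class a b"
  shows "\<forall>t\<ge>0.
    (\<forall>\<xi> \<in> reflection_domain (a 0) (b 0) \<inter> reflection_domain (a t) (b t).
       reflection (a t) (b t) \<xi> =
         reflection (a 0) (b 0) \<xi> *
           exp ((inverse (z_bdry \<xi>) - z_bdry \<xi>) * complex_of_real t)) \<and>
    finite (discrete_eigenvalues (a t) (b t)) \<and>
    num_eigenvalues (a t) (b t) = num_eigenvalues (a 0) (b 0) \<and>
    (\<forall>k \<in> {1..num_eigenvalues (a 0) (b 0)}.
       eigenvalue (a t) (b t) k = eigenvalue (a 0) (b 0) k) \<and>
    (\<forall>k \<in> {1..num_eigenvalues (a 0) (b 0)}.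
       let z = z_fun (complex_of_real (eigenvalue (a 0) (b 0) k)) in
       complex_of_real (norming_const (a t) (b t) (eigenvalue (a t) (b t) k) powi (-2)) =
         complex_of_real (norming_const (a 0) (b 0) (eigenvalue (a 0) (b 0) k) powi (-2)) *
           exp ((inverse z - z) * complex_of_real t))"
proof (intro allI impI)
  fix t :: real assume t: "0 \<le> t"
  \<comment> \<open>The solution class speaks of positive T, while t may be 0.\<close>
  define T where "T = t + 1"
  have T: "0 < T" and tT: "t \<in> {0..T}" using t by (auto simp: T_def)
  have on: "toda_on T a b" by (rule toda_on_of_solution[OF pos toda]) (use T in simp)
  obtain K e where Ke: "\<And>t n. t \<in> {0..T} \<Longrightarrow> \<bar>a t n\<bar> \<le> K \<and> \<bar>b t n\<bar> \<le> K"
    "e \<longlonglongrightarrow> 0" "\<And>t k. t \<in> {0..T} \<Longrightarrow> \<bar>a t (- int k) - 1\<bar> + \<bar>b t (- int k)\<bar> \<le> e k"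
    using solution_class_uniform[OF on T cls] by metis
  interpret ev: toda_evolution T K a b e
    by unfold_locales (use on Ke solution_class_initial_class[OF on T cls] in auto)
  have on_t: "toda_on t a b" by (rule toda_on_of_solution[OF pos toda t])
  have disc: "discrete_eigenvalues (a t) (b t) = discrete_eigenvalues (a 0) (b 0)"
    by (rule discrete_eigenvalues_const[OF on_t, of K]) (use Ke(1) tT in auto)
  have fin: "finite (discrete_eigenvalues (a 0) (b 0))" by (rule finite_discrete_eigenvalues[OF init])
  have num: "num_eigenvalues (a t) (b t) = num_eigenvalues (a 0) (b 0)" by (simp add: num_eigenvalues_def disc)
  have eig: "eigenvalue (a t) (b t) k = eigenvalue (a 0) (b 0) k" for k by (simp add: eigenvalue_def disc)
  have mem: "eigenvalue (a 0) (b 0) k \<in> discrete_eigenvalues (a 0) (b 0)" if "k \<in> {1..num_eigenvalues (a 0) (b 0)}" for k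
  proof -
    have "k - 1 < length (sorted_list_of_set (discrete_eigenvalues (a 0) (b 0)))"
      using that by (auto simp: num_eigenvalues_def)
    then have "eigenvalue (a 0) (b 0) k \<in> set (sorted_list_of_set (discrete_eigenvalues (a 0) (b 0)))"
      unfolding eigenvalue_def by (rule nth_mem)
    then show ?thesis using fin by simp
  qed
  show "(\<forall>\<xi> \<in> reflection_domain (a 0) (b 0) \<inter> reflection_domain (a t) (b t).
       reflection (a t) (b t) \<xi> =
         reflection (a 0) (b 0) \<xi> *
           exp ((inverse (z_bdry \<xi>) - z_bdry \<xi>) * complex_of_real t)) \<and>
    finite (discrete_eigenvalues (a t) (b t)) \<and>
    num_eigenvalues (a t) (b t) = num_eigenvalues (a 0) (b 0) \<and>
    (\<forall>k \<in> {1..num_eigenvalues (a 0) (b 0)}.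
       eigenvalue (a t) (b t) k = eigenvalue (a 0) (b 0) k) \<and>
    (\<forall>k \<in> {1..num_eigenvalues (a 0) (b 0)}.
       let z = z_fun (complex_of_real (eigenvalue (a 0) (b 0) k)) in
       complex_of_real (norming_const (a t) (b t) (eigenvalue (a t) (b t) k) powi (-2)) =
         complex_of_real (norming_const (a 0) (b 0) (eigenvalue (a 0) (b 0) k) powi (-2)) *
           exp ((inverse z - z) * complex_of_real t))"
    unfolding Let_def eig num using fin disc ev.reflection_evolution[OF tT] ev.norming_const_evolution[OF mem tT refl]
    by (intro conjI ballI) auto
qed

end
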